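(* Let $(S_n)$ be the multidimensional elephant random walk with stops on $\mathbb{Z}^d$ with parameters $p,q\in[0,1]$, $r\in(0,1)$, $p+(2d-1)q+r=1$, in the superdiffusive regime $p>p_{d,r}$, where $p_{d,r}=\left(\frac{2d+1}{4d}\right)(1-r)$. Let $\sigma_n^2=\sum_{k=1}^n\|X_k\|^2$, let $$\vartheta^2=\frac{(2d-1)(1-r)}{d\big(4dp-(2d+1)(1-r)\big)},$$ and let $L$ be the almost sure limit of $S_n/n^{p-q}$ as $n\to\infty$. Then, as $n\to\infty$, one has the convergence in distribution $$\frac{S_n-n^{p-q}L}{\sqrt{\sigma_n^2}}\longrightarrow\mathcal{N}\big(0,\vartheta^2I_d\big).$$ Moreover, as $n\to\infty$, one has the convergence in distribution $$\frac{S_n-n^{p-q}L}{\sqrt{n^{1-r}}}\longrightarrow\sqrt{\Sigma'}\,Z,$$ where $Z$ has the Gaussian distribution $\mathcal{N}(0,\vartheta^2I_d)$, $\Sigma'$ has the Mittag-Leffler distribution $\mathcal{ML}(1-r)$, and $\Sigma'$ is independent of $Z$.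
   Context: Multidimensional elephant random walk with stops (MERWS). Let $d\ge1$ be an integer and $p,q\in[0,1]$, $r\in(0,1)$ with $p+(2d-1)q+r=1$. Let $I_d$ be the $d\times d$ identity matrix and $J_d$ the $d\times d$ cyclic permutation matrix with $(J_d)_{i,i+1}=1$ for $1\le i\le d-1$, $(J_d)_{d,1}=1$, and all other entries $0$. Let $(e_1,\dots,e_d)$ be the standard basis of $\mathbb{R}^d$. Set $S_0=0$, let $X_1$ be uniformly distributed on the $2d$ vectors $\pm e_1,\dots,\pm e_d$, and $S_1=X_1$. For all $n\ge1$, $X_{n+1}=A_{n+1}X_{U_{n+1}}$ and $S_{n+1}=S_n+X_{n+1}$, where $U_{n+1}$ is uniformly distributed on $\{1,\dots,n\}$ and $A_{n+1}$ is a random matrix equal to $I_d$ with probability $p$, to $-I_d$ with probability $q$, to each of $J_d^i$ and $-J_d^i$ ($1\le i\le d-1$) with probability $q$, and to the zero matrix with probability $r$; $A_{n+1}$ and $U_{n+1}$ are independent of each other and of $\mathcal{F}_n=\sigma(X_1,\dots,X_n)$. $\|\cdot\|$ is the Euclidean norm. $\sigma_n^2$ is the trace of the Gram matrix $\sum_{k=1}^nX_kX_k^T$. In the superdiffusive regime, the almost sure limit $L=\lim_{n\to\infty}S_n/n^{p-q}$ exists as an $\mathbb{R}^d$-valued random vector. Mittag-Leffler distribution: for $\alpha\in(0,1)$, a positive random variable $X$ has the $\mathcal{ML}(\alpha)$ distribution if $\mathbb{E}[\exp(tX)]=\sum_{n=0}^\infty \frac{t^n}{\Gamma(1+n\alpha)}$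 for all $t\in\mathbb{R}$.
   Formalization: The case q = 0 with d ≥ 2 is excluded: there every step is a.s. X_1 or 0, so S_n and L lie on the random axis of X_1 and neither Gaussian-type limit in R^d can hold; q > 0 or d = 1 is assumed. *)

theory Defs
  imports "HOL-Probability.Probability"
begin

definition sigma_rv :: "'w measure \<Rightarrow> 'b measure \<Rightarrow> ('w \<Rightarrow> 'b) \<Rightarrow> 'w set set" where
  "sigma_rv M N Y = sets (vimage_algebra (space M) Y N)"

text \<open>The library's weak convergence is restricted to laws on the real line; for random vectors
  we use the definition by bounded continuous test functions.\<close>

definition converges_in_distribution ::
  "'w measure \<Rightarrow> (nat \<Rightarrow> 'w \<Rightarrow> 'a::topological_space) \<Rightarrow> 'a measure \<Rightarrow> bool" where
  "converges_in_distribution M Y \<mu> \<longleftrightarrow>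
     (\<forall>f :: 'a \<Rightarrow> real. continuous_on UNIV f \<longrightarrow> bounded (range f) \<longrightarrow>
        (\<lambda>n. \<integral>\<omega>. f (Y n \<omega>) \<partial>M) \<longlonglongrightarrow> (\<integral>x. f x \<partial>\<mu>))"

text \<open>Only meaningful for a positive definite covariance matrix \<open>C\<close>.\<close>

definition gaussian_measure :: "real^'d \<Rightarrow> real^'d^'d \<Rightarrow> (real^'d) measure" where
  "gaussian_measure m C = density lborel (\<lambda>x. ennreal
     (exp (- ((x - m) \<bullet> (matrix_inv C *v (x - m))) / 2) / sqrt ((2 * pi) ^ CARD('d) * det C)))"

text \<open>Integrability is required explicitly because the Bochner integral of a non-integrable
  function is \<open>0\<close>.\<close>

definition (in prob_space) mittag_leffler_distributed :: "real \<Rightarrow> ('a \<Rightarrow> real) \<Rightarrow> bool" where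
  "mittag_leffler_distributed \<alpha> Y \<longleftrightarrow>
     random_variable borel Y \<and> (AE \<omega> in M. 0 < Y \<omega>) \<and>
     (\<forall>t::real. integrable M (\<lambda>\<omega>. exp (t * Y \<omega>)) \<and>
        (\<lambda>n. t ^ n / Gamma (1 + real n * \<alpha>)) sums expectation (\<lambda>\<omega>. exp (t * Y \<omega>)))"

text \<open>The coordinates are indexed by an arbitrary finite type \<open>'d\<close>, so \<open>d = CARD('d)\<close>;
  \<open>b\<close> enumerates them as \<open>b 1, \<dots>, b d\<close>, and the \<open>i\<close>-th standard basis vector is
  \<open>axis (b i) 1\<close>. The enumeration is needed only to say what "cyclic" means.\<close>

definition cyclic_matrix :: "(nat \<Rightarrow> 'd) \<Rightarrow> real^'d^'d" where
  "cyclic_matrix b = (\<chi> i j.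
     if (\<exists>k\<in>{1..<CARD('d)}. i = b k \<and> j = b (k + 1)) \<or> (i = b CARD('d) \<and> j = b 1)
     then 1 else 0)"

definition matrix_power :: "real^'d^'d \<Rightarrow> nat \<Rightarrow> real^'d^'d" where
  "matrix_power J i = (((**) J) ^^ i) (mat 1)"

text \<open>Boundary case: if \<open>q = 0\<close> then every step is almost surely \<open>X 1\<close> or \<open>0\<close>, so the walk stays on
  the random axis of \<open>X 1\<close>. For \<open>d \<ge> 2\<close> a limit law \<open>N(0, \<vartheta>\<^sup>2 I)\<close> is then impossible, so a
  Gaussian limit theorem has to exclude \<open>q = 0\<close> with \<open>d \<ge> 2\<close>, although the model allows it.\<close>

locale merws = prob_space M
  for M :: "'w measure" +
  fixes b :: "nat \<Rightarrow> 'd::finite"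
    and p q r :: real
    and X :: "nat \<Rightarrow> 'w \<Rightarrow> real^'d"
    and U :: "nat \<Rightarrow> 'w \<Rightarrow> nat"
    and A :: "nat \<Rightarrow> 'w \<Rightarrow> real^'d^'d"
  assumes enum: "bij_betw b {1..CARD('d)} UNIV"
    and p_range: "p \<in> {0..1}" and q_range: "q \<in> {0..1}" and r_range: "r \<in> {0<..<1}"
    and total: "p + (2 * real CARD('d) - 1) * q + r = 1"
    and X1_rv: "random_variable borel (X 1)"
    and X1_uniform: "\<And>i. i \<in> {1..CARD('d)} \<Longrightarrow>
          prob {\<omega> \<in> space M. X 1 \<omega> = axis (b i) 1} = 1 / (2 * real CARD('d)) \<and>
          prob {\<omega> \<in> space M. X 1 \<omega> = - axis (b i) 1} = 1 / (2 * real CARD('d))"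
    and U_rv: "\<And>n. n \<ge> 1 \<Longrightarrow> random_variable (count_space {1..n}) (U (n + 1))"
    and U_uniform: "\<And>n k. n \<ge> 1 \<Longrightarrow> k \<in> {1..n} \<Longrightarrow>
          prob {\<omega> \<in> space M. U (n + 1) \<omega> = k} = 1 / real n"
    and A_rv: "\<And>n. n \<ge> 1 \<Longrightarrow> random_variable borel (A (n + 1))"
    and A_id: "\<And>n. n \<ge> 1 \<Longrightarrow>
          prob {\<omega> \<in> space M. A (n + 1) \<omega> = mat 1} = p \<and>
          prob {\<omega> \<in> space M. A (n + 1) \<omega> = - mat 1} = q"
    and A_cyclic: "\<And>n i. n \<ge> 1 \<Longrightarrow> i \<in> {1..<CARD('d)} \<Longrightarrow>
          prob {\<omega> \<in> space M. A (n + 1) \<omega> = matrix_power (cyclic_matrix b) i} = q \<and>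
          prob {\<omega> \<in> space M. A (n + 1) \<omega> = - matrix_power (cyclic_matrix b) i} = q"
    and A_zero: "\<And>n. n \<ge> 1 \<Longrightarrow> prob {\<omega> \<in> space M. A (n + 1) \<omega> = 0} = r"
    and step: "\<And>n \<omega>. n \<ge> 1 \<Longrightarrow> \<omega> \<in> space M \<Longrightarrow>
          X (n + 1) \<omega> = A (n + 1) \<omega> *v X (U (n + 1) \<omega>) \<omega>"
    \<comment> \<open>mutual independence of \<open>\<sigma>(A (n + 1))\<close>, \<open>\<sigma>(U (n + 1))\<close> and \<open>\<sigma>(X 1, \<dots>, X n)\<close>\<close>
    and indep: "\<And>n. n \<ge> 1 \<Longrightarrow> indep_sets
          ((!) [sigma_rv M borel (A (n + 1)),
                sigma_rv M (count_space {1..n}) (U (n + 1)),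
                sigma_sets (space M) (\<Union>k\<in>{1..n}. sigma_rv M borel (X k))]) {..<3}"

definition walk :: "(nat \<Rightarrow> 'w \<Rightarrow> real^'d) \<Rightarrow> nat \<Rightarrow> 'w \<Rightarrow> real^'d" where
  "walk X n \<omega> = (\<Sum>k=1..n. X k \<omega>)"

definition sigma_sq :: "(nat \<Rightarrow> 'w \<Rightarrow> real^'d) \<Rightarrow> nat \<Rightarrow> 'w \<Rightarrow> real" where
  "sigma_sq X n \<omega> = (\<Sum>k=1..n. (norm (X k \<omega>))\<^sup>2)"

end

theory Submission
  imports Defs
begin

text \<open>
  Write \<open>a = p - q\<close> and \<open>\<alpha> = 1 - r\<close>. Given the past, a unit step \<open>y\<close> is taken at time \<open>n + 1\<close> with
  probability \<open>(a C\<^sub>n(y) + q \<sigma>\<^sub>n\<^sup>2) / n\<close>, where \<open>C\<^sub>n(y)\<close> counts the earlier steps equal to \<open>y\<close>, so that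
  \<open>S\<^sub>n / G n\<close> with \<open>G n = \<Gamma>(n + a) / \<Gamma>(n)\<close> is a martingale with limit \<open>L\<close>, and \<open>|n\<^sup>a - G n| \<le> 1\<close>.
  The quantity \<open>S\<^sub>n - G n L\<close> only depends on the increments after time \<open>n\<close>, while both normalisations
  and \<open>\<sigma>\<^sub>n\<^sup>2\<close> are known at time \<open>n\<close>; hence no stable convergence is needed, and it suffices to show that,
  uniformly over \<open>F\<^sub>n\<close>-measurable \<open>w\<close> of order \<open>n\<close> to the power \<open>-\<alpha>/2\<close>, the expectations of
  \<open>exp (i w \<bullet> (S\<^sub>n - G n L))\<close> and \<open>exp (- \<theta> |w|\<^sup>2 \<sigma>\<^sub>n\<^sup>2 / 2)\<close> are close. This follows by replacing the
  increments one at a time. The variance bookkeeping telescopes exactly because, with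
  \<open>H k = \<Gamma>(k + \<alpha>) / \<Gamma>(k)\<close> and \<open>B k = H k / (G k)\<^sup>2\<close>, the difference \<open>B k - B (k + 1)\<close> is
  \<open>H k / (G (k + 1))\<^sup>2\<close> times \<open>(2 a - \<alpha>) / k + a\<^sup>2 / k\<^sup>2\<close>. Second moments control the errors.
  The rising factorial moments of \<open>\<sigma>\<^sub>n\<^sup>2\<close> are explicit and give the Mittag-Leffler law of the limit of
  \<open>\<sigma>\<^sub>n\<^sup>2\<close> divided by \<open>n\<close> to the power \<open>\<alpha>\<close>; a moment of order \<open>-1/2\<close> shows that this limit is positive.
\<close>

section \<open>Quotients of Gamma functions\<close>

text \<open>The limiting variance comes from the steps after time n. Once the Gram matrix is nearly
  sigma_k^2 / d times the identity, step k + 1 contributes about (G n / G k)^2 alpha sigma_k^2 / (d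
  k) in each direction; sigma_k^2 may be replaced by its prediction sigma_n^2 H k / H n, and the sum
  over k >= n is about theta sigma_n^2 with theta = alpha / (d (2 a - alpha)). It converges because
  alpha < 2 a. Isotropy is where q > 0 or d = 1 enters: the deviation of the Gram matrix is of order
  k^a, negligible against k^alpha if a < alpha, which holds for q > 0; for d = 1 it vanishes. Two
  weights w are used: u / n^(alpha/2) for the deterministic normalisation, and u / sqrt(sigma_n^2),
  cut off where sigma_n^2 is small, for the random one. Every one-step error is bounded by terms c
  n^s k^(-1-s) n^(-delta) with s, delta > 0, whose sums over k >= n vanish uniformly. Since
  sigma_n^2 / H n is Cauchy in L^1, Laplace transforms converge along the whole sequence, and a weak
  limit along a subsequence suffices to identify the law.\<close>

definition gquot :: "real \<Rightarrow> real \<Rightarrow> real" where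
  "gquot c x = Gamma (x + c) / Gamma x"

lemma gquot_pos: "0 \<le> c \<Longrightarrow> 0 < x \<Longrightarrow> 0 < gquot c x"
  unfolding gquot_def by (intro divide_pos_pos Gamma_real_pos) auto

lemma Gamma_plus1_pos: "0 < (x::real) \<Longrightarrow> Gamma (x + 1) = x * Gamma x"
  by (rule Gamma_plus1) (auto elim: nonpos_Ints_cases)

text \<open>The factor \<open>1 + c / x\<close> is exactly the one by which a conditional mean grows
  when the drift is c / x times the current value, so dividing by \<open>gquot c\<close> produces
  martingales without any asymptotic error.\<close>

lemma gquot_plus1:
  assumes "0 \<le> c" "0 < x" shows "gquot c (x + 1) = gquot c x * (1 + c / x)"
proof -
  have "Gamma (x + 1 + c) = (x + c) * Gamma (x + c)"
    using Gamma_plus1_pos[of "x + c"] assms by (simp add: add_ac)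
  moreover have "Gamma (x + 1) = x * Gamma x"
    using Gamma_plus1_pos assms by simp
  moreover have "0 < Gamma x" using assms by simp
  ultimately show ?thesis using assms unfolding gquot_def by (simp add: field_simps)
qed

lemma Gamma_log_convex:
  assumes "0 < x" "0 < y" "0 \<le> t" "t \<le> (1::real)"
  shows "Gamma ((1 - t) * x + t * y) \<le> Gamma x powr (1 - t) * Gamma y powr t"
proof -
  have pos: "0 < (1 - t) * x + t * y"
    using assms by (metis add_0 add_nonneg_pos add_pos_nonneg diff_ge_0_iff_ge less_eq_real_def mult_nonneg_nonneg mult_pos_pos diff_gt_0_iff_gt mult_1 eq_diff_eq)
  have "(ln \<circ> Gamma) ((1 - t) *\<^sub>R x + t *\<^sub>R y) \<le> (1 - t) * (ln \<circ> Gamma) x + t * (ln \<circ> Gamma) y"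
    using convex_onD[OF log_convex_Gamma_real, of t x y] assms by auto
  then have "ln (Gamma ((1 - t) * x + t * y)) \<le> ln (Gamma x powr (1 - t) * Gamma y powr t)"
    using assms by (subst ln_mult) (auto simp: ln_powr intro!: Gamma_eq_zero_iff[THEN iffD1] simp: Gamma_eq_zero_iff elim!: nonpos_Ints_cases)
  then show ?thesis
    using assms pos by (subst (asm) ln_le_cancel_iff) (auto simp: zero_less_mult_iff Gamma_eq_zero_iff elim!: nonpos_Ints_cases)
qed

text \<open>\<open>x + c\<close> is the convex combination of \<open>x\<close> and
  \<open>x + 1\<close> with weight \<open>c\<close> on the latter, so log-convexity and the
  functional equation suffice.\<close>

lemma gautschi_upper:
  assumes "0 \<le> c" "c \<le> 1" "0 < x"
  shows "gquot c x \<le> x powr c"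
proof -
  have "Gamma (x + c) = Gamma ((1 - c) * x + c * (x + 1))"
    by (simp add: algebra_simps)
  also have "\<dots> \<le> Gamma x powr (1 - c) * Gamma (x + 1) powr c"
    using assms by (intro Gamma_log_convex) auto
  also have "\<dots> = Gamma x powr (1 - c) * (x powr c * Gamma x powr c)"
    using assms by (simp add: Gamma_plus1_pos powr_mult)
  also have "\<dots> = x powr c * Gamma x"
    using assms by (simp add: powr_add[symmetric] mult_ac Gamma_eq_zero_iff nonpos_Ints_def)
  finally show ?thesis
    using assms unfolding gquot_def by (simp add: pos_divide_le_eq)
qed

text \<open>The same argument with shifted points: \<open>x + 1\<close> lies between
  \<open>x + c\<close> and \<open>x + c + 1\<close>, with weight \<open>1 - c\<close> on the
  latter.\<close>

lemma gautschi_lower: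
  assumes "0 \<le> c" "c \<le> 1" "0 < x"
  shows "x powr c * (x / (x + 1)) \<le> gquot c x"
proof -
  have "x * Gamma x = Gamma (x + 1)"
    using assms by (simp add: Gamma_plus1_pos)
  also have "\<dots> = Gamma ((1 - (1 - c)) * (x + c) + (1 - c) * (x + c + 1))"
    by (simp add: algebra_simps)
  also have "\<dots> \<le> Gamma (x + c) powr (1 - (1 - c)) * Gamma (x + c + 1) powr (1 - c)"
    using assms by (intro Gamma_log_convex) auto
  also have "\<dots> = Gamma (x + c) powr c * ((x + c) powr (1 - c) * Gamma (x + c) powr (1 - c))"
    using assms by (simp add: Gamma_plus1_pos powr_mult)
  also have "\<dots> = Gamma (x + c) * (x + c) powr (1 - c)"
    using assms by (simp add: powr_add[symmetric] mult_ac Gamma_eq_zero_iff nonpos_Ints_def)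
  finally have *: "x \<le> gquot c x * (x + c) powr (1 - c)"
    using assms unfolding gquot_def by (simp add: field_simps)
  \<comment> \<open>The factor \<open>x / (x + 1)\<close> pays for enlarging \<open>x + c\<close> to
    \<open>x + 1\<close>; what is left is \<open>x\<close> times
    \<open>(x / (x + 1)) powr c\<close>, at most \<open>x\<close>.\<close>
  have "x powr c * (x / (x + 1)) * (x + c) powr (1 - c)
      \<le> x powr c * (x / (x + 1)) * (x + 1) powr (1 - c)"
    using assms by (intro mult_left_mono powr_mono2) auto
  also have "\<dots> = x * (x powr c / (x + 1) powr c)"
    using assms by (simp add: powr_diff)
  also have "\<dots> \<le> x * 1"
    using assms by (intro mult_left_mono) (auto simp: divide_le_eq_1 intro!: powr_mono2)
  also have "\<dots> \<le> gquot c x * (x + c) powr (1 - c)" using * by simp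
  finally show ?thesis
    using assms by (subst (asm) mult_le_cancel_right) auto
qed

lemma gquot_bounds:
  assumes "0 \<le> c" "c \<le> 1" "1 \<le> n"
  shows "real n powr c / 2 \<le> gquot c (real n)" "gquot c (real n) \<le> real n powr c"
proof -
  have "real n powr c * (1 / 2) \<le> real n powr c * (real n / (real n + 1))"
    using assms by (intro mult_left_mono) (auto simp: field_simps)
  also have "\<dots> \<le> gquot c (real n)"
    using gautschi_lower[of c "real n"] assms by simp
  finally show "real n powr c / 2 \<le> gquot c (real n)" by simp
qed (use gautschi_upper[of c "real n"] assms in auto)

text \<open>Gautschi's two bounds differ by n^c / (n + 1), which is at most 1. This bounded error
  lets \<open>G n\<close> replace n^(p - q) in front of the limit \<open>L\<close>, because the
  normalisation of the limit theorems tends to infinity.\<close>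

lemma powr_gquot_diff:
  assumes "0 \<le> c" "c \<le> 1" "1 \<le> n"
  shows "\<bar>real n powr c - gquot c (real n)\<bar> \<le> 1"
proof -
  have "real n powr c * (real n / (real n + 1)) \<le> gquot c (real n)" "gquot c (real n) \<le> real n powr c"
    using gautschi_lower[of c "real n"] gautschi_upper[of c "real n"] assms by auto
  moreover have "real n powr c * (real n / (real n + 1)) = real n powr c - real n powr c / (real n + 1)"
    using assms by (simp add: field_simps)
  moreover have "real n powr c / (real n + 1) \<le> 1"
  proof -
    have "real n powr c \<le> real n powr 1" using assms by (intro powr_mono) auto
    then show ?thesis using assms by (simp add: field_simps)
  qed
  ultimately show ?thesis by linarith
qed

text \<open>Gautschi's inequality covers exponents up to 1; each further unit in the exponent c
  multiplies the ratio by 1 + c / n, which tends to 1. Larger exponents occur as m (1 - r) in the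
  moments of order m.\<close>

lemma gquot_asymp:
  assumes "0 \<le> c"
  shows "(\<lambda>n. gquot c (real n) / real n powr c) \<longlonglongrightarrow> 1"
proof -
  have pos1: "(\<lambda>n. gquot c (real n) / real n powr c) \<longlonglongrightarrow> 1" if c: "0 \<le> c" "c \<le> 1" for c
  proof (rule tendsto_sandwich)
    show "\<forall>\<^sub>F n in sequentially. real n / (real n + 1) \<le> gquot c (real n) / real n powr c"
      using eventually_gt_at_top[of "0::nat"]
    proof eventually_elim
      case (elim n) then show ?case using gautschi_lower[of c "real n"] c by (simp add: field_simps)
    qed
    show "\<forall>\<^sub>F n in sequentially. gquot c (real n) / real n powr c \<le> 1"
      using eventually_gt_at_top[of "0::nat"]
    proof eventually_elim
      case (elim n) then show ?case using gautschi_upper[of c "real n"] c by (simp add: field_simps)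
    qed
    show "(\<lambda>n. real n / (real n + 1)) \<longlonglongrightarrow> 1"
      using LIMSEQ_n_over_Suc_n by (simp add: add.commute)
  qed auto
  have "(\<lambda>n. gquot (c' + real m) (real n) / real n powr (c' + real m)) \<longlonglongrightarrow> 1"
    if c: "0 \<le> c'" "c' \<le> 1" for c' m
  proof (induction m)
    case 0 then show ?case using pos1[OF c] by simp
  next
    case (Suc m)
    have "(\<lambda>n. gquot (c' + real m) (real n) / real n powr (c' + real m) * (1 + (c' + real m) / real n)) \<longlonglongrightarrow> 1 * (1 + 0)"
      by (intro tendsto_mult tendsto_add Suc tendsto_const lim_const_over_n)
    then show ?case
    proof (rule Lim_transform_eventually[OF tendsto_eq_rhs])
      show "\<forall>\<^sub>F n in sequentially. gquot (c' + real m) (real n) / real n powr (c' + real m) * (1 + (c' + real m) / real n)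
          = gquot (c' + real (Suc m)) (real n) / real n powr (c' + real (Suc m))"
        using eventually_gt_at_top[of "0::nat"]
      proof eventually_elim
        case (elim n)
        have "Gamma (real n + (c' + real (Suc m))) = (real n + (c' + real m)) * Gamma (real n + (c' + real m))"
          using Gamma_plus1_pos[of "real n + (c' + real m)"] elim c by (simp add: add_ac)
        moreover have "real n powr (c' + real (Suc m)) = real n powr (c' + real m) * real n"
          using elim powr_add[of "real n" "c' + real m" 1] by (simp add: add_ac)
        ultimately show ?case using elim by (simp add: gquot_def field_simps)
      qed
    qed simp
  qed
  from this[of "frac c" "nat \<lfloor>c\<rfloor>"] show ?thesis
    using assms frac_lt_1[of c] by (simp add: frac_def)
qed

section \<open>Tails of power sums and a linear recursion with a source term\<close>

lemma powr_tail_term: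
  assumes "0 < s" "1 \<le> (k::nat)"
  shows "real k powr (-1 - s) \<le> 2 powr (1 + s) / s * (real k powr (-s) - real (Suc k) powr (-s))"
proof -
  have "\<exists>z. real k < z \<and> z < real (Suc k) \<and>
    real (Suc k) powr (-s) - real k powr (-s) = (real (Suc k) - real k) * (- s * z powr (- s - 1))"
  proof (rule MVT2)
    fix x :: real assume "real k \<le> x"
    then have "0 < x" using assms by simp
    then show "((\<lambda>x. x powr (-s)) has_real_derivative - s * x powr (- s - 1)) (at x)"
      by (auto intro!: derivative_eq_intros simp: powr_diff)
  qed simp
  then obtain z where z: "real k < z" "z < real (Suc k)"
    "real (Suc k) powr (-s) - real k powr (-s) = (real (Suc k) - real k) * (- s * z powr (- s - 1))"
    by blast
  \<comment> \<open>Since z < k + 1 <= 2 k, the power at z may be replaced by its value at 2 k; this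
    is the origin of the factor \<open>2 powr (1 + s)\<close>.\<close>
  have le: "(2 * real k) powr (-1 - s) \<le> z powr (-1 - s)"
    using z assms by (intro powr_mono2') auto
  have "s * (2 * real k) powr (-1 - s) \<le> real k powr (-s) - real (Suc k) powr (-s)"
  proof -
    have "s * (2 * real k) powr (-1 - s) \<le> s * z powr (-1 - s)"
      using le assms by (intro mult_left_mono) auto
    moreover have "-1 - s = - s - 1" by simp
    ultimately show ?thesis using z(3) by (metis (no_types, opaque_lifting) add_diff_cancel_left' minus_diff_eq minus_mult_left mult_1 neg_le_iff_le of_nat_Suc add.commute)
  qed
  moreover have "(2 * real k) powr (-1 - s) = real k powr (-1 - s) / 2 powr (1 + s)"
    by (subst powr_mult) (auto simp: field_simps simp flip: powr_add)
  moreover have "2 powr (1 + s) / s * (s * (2 * real k) powr (-1 - s)) \<le> 2 powr (1 + s) / s * (real k powr (-s) - real (Suc k) powr (-s))"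
    using calculation(1) assms by (intro mult_left_mono) auto
  ultimately show ?thesis using assms by simp
qed

text \<open>Telescopes \<open>powr_tail_term\<close>. The bound depends neither on n nor on N, so
  any additional factor n^(-delta) makes such a sum of errors vanish.\<close>

lemma powr_tail_sum:
  assumes "0 < s" "1 \<le> n" "n \<le> N"
  shows "(\<Sum>k=n..<N. real n powr s * real k powr (-1 - s)) \<le> 2 powr (1 + s) / s"
proof -
  have "(\<Sum>k=n..<N. real k powr (-1 - s))
      \<le> (\<Sum>k=n..<N. 2 powr (1 + s) / s * (real k powr (-s) - real (Suc k) powr (-s)))"
    using assms by (intro sum_mono powr_tail_term) auto
  also have "\<dots> = 2 powr (1 + s) / s * (real n powr (-s) - real N powr (-s))"
    using sum_Suc_diff'[OF assms(3), of "\<lambda>k. - (real k powr (-s))"]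
    by (subst sum_distrib_left[symmetric]) simp
  also have "\<dots> \<le> 2 powr (1 + s) / s * real n powr (-s)"
    using assms by (intro mult_left_mono) auto
  finally have "real n powr s * (\<Sum>k=n..<N. real k powr (-1 - s)) \<le> real n powr s * (2 powr (1 + s) / s * real n powr (-s))"
    by (intro mult_left_mono) auto
  also have "\<dots> = 2 powr (1 + s) / s"
    using assms by (simp add: powr_add[symmetric] mult_ac flip: powr_add)
  finally show ?thesis by (simp add: sum_distrib_left)
qed

text \<open>Over the common denominator \<open>(gquot a (real (Suc k)))^2\<close> the two numerators
  carry the factors (1 + a / k)^2 and 1 + c / k; the last factor is their difference.\<close>

lemma gquot_ratio_diff:
  fixes a c :: real
  assumes "0 \<le> a" "0 \<le> c" "1 \<le> k"
  shows "gquot c (real k) / (gquot a (real k))\<^sup>2 - gquot c (real (Suc k)) / (gquot a (real (Suc k)))\<^sup>2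
    = gquot c (real k) / (gquot a (real (Suc k)))\<^sup>2 * ((2 * a - c) / k + a\<^sup>2 / k\<^sup>2)"
proof -
  define g h where "g = gquot a (real k)" and "h = gquot c (real k)"
  have "0 < g" using gquot_pos[of a "real k"] assms by (simp add: g_def)
  moreover have "0 < 1 + a / k" using assms by (intro add_pos_nonneg) auto
  moreover have "gquot a (real (Suc k)) = g * (1 + a / k)" "gquot c (real (Suc k)) = h * (1 + c / k)"
    using gquot_plus1[of _ "real k"] assms by (auto simp: g_def h_def add.commute)
  moreover have "h / g\<^sup>2 - h * (1 + c / k) / (g * (1 + a / k))\<^sup>2
      = h / (g * (1 + a / k))\<^sup>2 * ((1 + a / k)\<^sup>2 - (1 + c / k))"
  proof -
    have "h / g\<^sup>2 = h / (g * (1 + a / k))\<^sup>2 * (1 + a / k)\<^sup>2"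
      using calculation(1,2) by (simp add: power_mult_distrib)
    then show ?thesis by (simp add: algebra_simps add_divide_distrib diff_divide_distrib)
  qed
  moreover have "(1 + a / k)\<^sup>2 - (1 + c / k) = (2 * a - c) / k + a\<^sup>2 / k\<^sup>2"
    using assms by (simp add: field_simps power2_eq_square)
  ultimately show ?thesis by (simp add: g_def h_def)
qed

lemma gquot_ratio_tendsto_0:
  assumes "0 \<le> a" "a \<le> 1" "0 \<le> c" "c \<le> 1" "c < 2 * a"
  shows "(\<lambda>n. gquot c (real n) / (gquot a (real n))\<^sup>2) \<longlonglongrightarrow> 0"
proof (rule tendsto_sandwich)
  show "\<forall>\<^sub>F n in sequentially. gquot c (real n) / (gquot a (real n))\<^sup>2 \<le> 4 * real n powr (c - 2 * a)"
    using eventually_ge_at_top[of "1::nat"]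
  proof eventually_elim
    case (elim n)
    have "(real n powr a / 2)\<^sup>2 \<le> (gquot a (real n))\<^sup>2"
      using gquot_bounds(1)[of a n] assms elim by (intro power_mono) auto
    then have "gquot c (real n) / (gquot a (real n))\<^sup>2 \<le> real n powr c / (real n powr a / 2)\<^sup>2"
      using gquot_bounds(2)[of c n] assms elim gquot_pos[of c "real n"] by (intro frac_le) auto
    also have "\<dots> = 4 * real n powr (c - 2 * a)"
      using elim by (simp add: powr_diff power_divide powr_power[symmetric] powr_realpow[symmetric] powr_powr mult.commute)
    finally show ?case .
  qed
  show "\<forall>\<^sub>F n in sequentially. 0 \<le> gquot c (real n) / (gquot a (real n))\<^sup>2"
    using eventually_ge_at_top[of "1::nat"]
    by eventually_elim (use gquot_pos[of c] assms in \<open>auto intro!: divide_nonneg_nonneg simp: less_imp_le\<close>)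
  have "filterlim (\<lambda>n. real n) at_top sequentially" by (rule filterlim_real_sequentially)
  then have "(\<lambda>n. real n powr (c - 2 * a)) \<longlonglongrightarrow> 0"
    using assms by (intro tendsto_neg_powr) auto
  then show "(\<lambda>n. 4 * real n powr (c - 2 * a)) \<longlonglongrightarrow> 0"
    by (auto intro!: tendsto_eq_intros)
qed auto

text \<open>The ratio \<open>gquot c / (gquot a)\<^sup>2\<close> serves as a Lyapunov function for the perturbation.\<close>

lemma perturbed_recursion_bound:
  fixes y :: "nat \<Rightarrow> real"
  assumes a: "0 \<le> a" "a \<le> 1" and c: "0 \<le> c" "c \<le> 1" "c < 2 * a" and D: "0 \<le> D"
    and rec: "\<And>k. 1 \<le> k \<Longrightarrow> y (Suc k) \<le> (1 + 2 * a / k) * y k + D * real k powr (c - 1)"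
    and nn: "\<And>k. 1 \<le> k \<Longrightarrow> 0 \<le> y k"
  shows "\<exists>C\<ge>0. \<forall>k\<ge>1. y k \<le> C * real k powr (2 * a)"
proof -
  define G H where "G = (\<lambda>k. gquot a (real k))" and "H = (\<lambda>k. gquot c (real k))"
  \<comment> \<open>The 2 makes up for \<open>H k\<close> being only at least half of k^c, and 2 a -
    c is the leading coefficient of the decrease of \<open>H k / (G k)^2\<close>. With this
    \<open>E\<close> the decrease absorbs the source term.\<close>
  define E where "E = 2 * D / (2 * a - c)"
  define \<Phi> where "\<Phi> k = y k / (G k)\<^sup>2 + E * (H k / (G k)\<^sup>2)" for k
  have pos: "0 < G k" "0 < H k" if "1 \<le> k" for k
    using that a c by (auto simp: G_def H_def intro!: gquot_pos)
  have \<Phi>_Suc: "\<Phi> (Suc k) \<le> \<Phi> k" if k: "1 \<le> k" for k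
  proof -
    have GS: "G (Suc k) = G k * (1 + a / k)"
      using gquot_plus1[of a "real k"] a k by (simp add: G_def add.commute)
    \<comment> \<open>Since \<open>y k\<close> is nonnegative, its factor may be raised to the
      square by which \<open>(G k)^2\<close> grows; the homogeneous part is then constant after
      division.\<close>
    have "1 + 2 * a / k \<le> (1 + a / k)\<^sup>2"
      by (simp add: power2_sum power_divide)
    then have "(1 + 2 * a / k) * y k \<le> (1 + a / k)\<^sup>2 * y k"
      using nn[OF k] by (intro mult_right_mono) auto
    then have "y (Suc k) \<le> (1 + a / k)\<^sup>2 * y k + D * real k powr (c - 1)"
      using rec[OF k] by simp
    then have "y (Suc k) / (G (Suc k))\<^sup>2 \<le> ((1 + a / k)\<^sup>2 * y k + D * real k powr (c - 1)) / (G (Suc k))\<^sup>2"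
      by (intro divide_right_mono) auto
    also have "\<dots> = y k / (G k)\<^sup>2 + D * (real k powr (c - 1) / (G (Suc k))\<^sup>2)"
    proof -
      have "0 < 1 + a / k" using a k by (intro add_pos_nonneg) auto
      then show ?thesis using pos[OF k] by (simp add: GS add_divide_distrib power_mult_distrib)
    qed
    also have "D * (real k powr (c - 1) / (G (Suc k))\<^sup>2) \<le> E * (H k / (G k)\<^sup>2 - H (Suc k) / (G (Suc k))\<^sup>2)"
    proof -
      have "D * real k powr (c - 1) = D * (real k powr c / k)"
        using k by (simp add: powr_diff)
      also have "\<dots> \<le> D * (2 * H k / k)"
        using gquot_bounds(1)[of c k] c k D by (intro mult_left_mono divide_right_mono) (auto simp: H_def)
      also have "\<dots> = E * (H k * ((2 * a - c) / k))"
        using c by (simp add: E_def)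
      also have "\<dots> \<le> E * (H k * ((2 * a - c) / k + a\<^sup>2 / k\<^sup>2))"
        using pos(2)[OF k] D c by (intro mult_left_mono) (auto simp: E_def)
      finally have "D * real k powr (c - 1) / (G (Suc k))\<^sup>2 \<le> E * (H k * ((2 * a - c) / k + a\<^sup>2 / k\<^sup>2)) / (G (Suc k))\<^sup>2"
        by (intro divide_right_mono) auto
      then show ?thesis
        using gquot_ratio_diff[of a c k] a c k by (simp add: G_def H_def)
    qed
    finally show ?thesis by (simp add: \<Phi>_def algebra_simps)
  qed
  have \<Phi>: "\<Phi> k \<le> \<Phi> 1" if "1 \<le> k" for k
    using that
  proof (induction k rule: dec_induct)
    case (step n) then show ?case using \<Phi>_Suc[of n] by simp
  qed simp
  have E0: "0 \<le> E" using D c by (simp add: E_def)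
  have "0 \<le> \<Phi> 1" using nn[of 1] pos[of 1] E0 unfolding \<Phi>_def
    by (intro add_nonneg_nonneg mult_nonneg_nonneg divide_nonneg_nonneg) auto
  moreover have "y k \<le> \<Phi> 1 * real k powr (2 * a)" if k: "1 \<le> k" for k
  proof -
    have "y k / (G k)\<^sup>2 \<le> \<Phi> k" using E0 pos[OF k] by (simp add: \<Phi>_def)
    also have "\<dots> \<le> \<Phi> 1" by (rule \<Phi>[OF k])
    finally have "y k \<le> \<Phi> 1 * (G k)\<^sup>2"
      using pos[OF k] by (simp add: field_simps)
    also have "\<dots> \<le> \<Phi> 1 * (real k powr a)\<^sup>2"
      using gquot_bounds(2)[of a k] a k pos(1)[OF k] \<open>0 \<le> \<Phi> 1\<close>
      by (intro mult_left_mono power_mono) (auto simp: G_def less_imp_le)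
    also have "(real k powr a)\<^sup>2 = real k powr (2 * a)"
      using k by (simp add: powr_realpow[symmetric] powr_powr mult.commute)
    finally show ?thesis .
  qed
  ultimately show ?thesis by blast
qed

lemma summable_mittag_leffler:
  assumes "0 < c" "c \<le> 1"
  shows "summable (\<lambda>n. (t::real) ^ n / Gamma (1 + real n * c))"
proof -
  \<comment> \<open>Chosen so that from N on x^c >= 4 |t| holds; the Gamma quotient is then at least
    2 |t|, and the ratio test applies with 1/2.\<close>
  obtain N :: nat where N: "N > (4 * \<bar>t\<bar>) powr (1 / c) / c"
    using reals_Archimedean2 by blast
  show ?thesis
  proof (rule summable_ratio_test)
    fix n assume "n \<ge> N"
    define x where "x = 1 + real n * c"
    have "1 \<le> x" using assms by (auto simp: x_def)
    then have x: "1 \<le> x" "0 < x" by auto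
    have "4 * \<bar>t\<bar> \<le> x powr c"
    proof (cases "t = 0")
      case False
      have "(4 * \<bar>t\<bar>) powr (1 / c) \<le> real N * c" using N assms by (simp add: field_simps)
      also have "\<dots> \<le> x" using \<open>n \<ge> N\<close> assms by (simp add: x_def) (smt (verit) mult_right_mono of_nat_mono)
      finally have "((4 * \<bar>t\<bar>) powr (1 / c)) powr c \<le> x powr c"
        using assms by (intro powr_mono2) auto
      then show ?thesis using assms False by (simp add: powr_powr)
    qed simp
    also have "\<dots> / 2 \<le> gquot c x"
    proof -
      have "x powr c * (1 / 2) \<le> x powr c * (x / (x + 1))"
        using x by (intro mult_left_mono) (auto simp: field_simps)
      also have "\<dots> \<le> gquot c x" using gautschi_lower[of c x] assms x by simp
      finally show ?thesis by simp
    qed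
    finally have "2 * \<bar>t\<bar> \<le> gquot c x" by simp
    moreover have "0 < Gamma x" using x by simp
    ultimately have "2 * \<bar>t\<bar> * Gamma x \<le> Gamma (x + c)" by (simp add: gquot_def field_simps)
    moreover have "0 < Gamma (x + c)" using x assms by (intro Gamma_real_pos) auto
    ultimately have "\<bar>t\<bar> / Gamma (x + c) \<le> 1 / 2 * (1 / Gamma x)"
      using \<open>0 < Gamma x\<close> by (simp add: field_simps)
    then have "\<bar>t\<bar> ^ n * (\<bar>t\<bar> / Gamma (x + c)) \<le> \<bar>t\<bar> ^ n * (1 / 2 * (1 / Gamma x))"
      by (intro mult_left_mono) auto
    moreover have "1 + real (Suc n) * c = x + c" by (simp add: x_def algebra_simps)
    ultimately show "norm (t ^ Suc n / Gamma (1 + real (Suc n) * c)) \<le> 1 / 2 * norm (t ^ n / Gamma (1 + real n * c))"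
      using \<open>0 < Gamma x\<close> \<open>0 < Gamma (x + c)\<close>
      unfolding x_def[symmetric] by (simp add: abs_mult power_abs mult_ac)
  qed auto
qed

section \<open>Levy continuity in Euclidean space\<close>

lemma norm_sq_Basis: "(norm v)\<^sup>2 = (\<Sum>e\<in>Basis. (v \<bullet> e)\<^sup>2)"
  for v :: "'a::euclidean_space"
  by (subst power2_norm_eq_inner, subst euclidean_inner) (simp add: power2_eq_square)

text \<open>Lebesgue measure is the image of a product of one-dimensional Lebesgue measures under
  the coordinate map, so products of functions of single coordinates integrate factor by
  factor.\<close>

lemma integral_lborel_prod:
  fixes f :: "'a::euclidean_space \<Rightarrow> real \<Rightarrow> 'b::{real_normed_field,banach,second_countable_topology}"
  assumes [measurable]: "\<And>b. b \<in> Basis \<Longrightarrow> integrable lborel (f b)"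
  shows "(\<integral>x. (\<Prod>b\<in>Basis. f b (x \<bullet> b)) \<partial>lborel) = (\<Prod>b\<in>Basis. \<integral>t. f b t \<partial>lborel)"
    and "integrable lborel (\<lambda>x. \<Prod>b\<in>Basis. f b (x \<bullet> b))"
proof -
  interpret product_sigma_finite "\<lambda>_::'a. lborel :: real measure" by standard
  have m: "(\<lambda>x. \<Prod>b\<in>Basis. f b (x \<bullet> b)) \<in> borel_measurable borel"
    using borel_measurable_integrable[OF assms]
    by (intro borel_measurable_prod) (auto intro!: measurable_compose[where N=borel])
  have eq: "(\<Prod>b\<in>Basis. f b ((\<Sum>b\<in>Basis. x b *\<^sub>R b) \<bullet> b)) = (\<Prod>b\<in>Basis. f b (x b))" for x :: "'a \<Rightarrow> real"
    by (intro prod.cong) (auto simp: inner_sum_left inner_Basis if_distrib sum.If_cases cong: if_cong)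
  have ms: "(\<lambda>x. \<Sum>b\<in>(Basis::'a set). x b *\<^sub>R b) \<in> measurable (\<Pi>\<^sub>M b\<in>Basis. lborel) borel"
    by measurable
  show "(\<integral>x. (\<Prod>b\<in>Basis. f b (x \<bullet> b)) \<partial>lborel) = (\<Prod>b\<in>Basis. \<integral>t. f b t \<partial>lborel)"
    by (subst lborel_eq, subst integral_distr[OF ms m], subst eq) (rule product_integral_prod[OF finite_Basis assms])
  show "integrable lborel (\<lambda>x. \<Prod>b\<in>Basis. f b (x \<bullet> b))"
    by (subst lborel_eq, subst integrable_distr_eq[OF ms m], subst eq) (rule product_integrable_prod[OF finite_Basis assms])
qed

text \<open>Rescaling by \<open>sqrt s\<close> reduces to the standard normal law, whose
  characteristic function is known, taken at \<open>t * sqrt s\<close>.\<close>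

lemma gaussian_fourier_1d:
  fixes s t :: real
  assumes s: "0 < s"
  shows "integrable lborel (\<lambda>x. exp (- x\<^sup>2 / (2 * s)) *\<^sub>R cis (t * x))"
    and "(\<integral>x. exp (- x\<^sup>2 / (2 * s)) *\<^sub>R cis (t * x) \<partial>lborel) = of_real (sqrt (2 * pi * s) * exp (- s * t\<^sup>2 / 2))"
proof -
  interpret real_distribution std_normal_distribution by (rule real_dist_normal_dist)
  define T where "T = t * sqrt s"
  define F :: "real \<Rightarrow> complex" where "F x = std_normal_density x *\<^sub>R cis (T * x)" for x
  have mc: "(\<lambda>x. cis (T * x)) \<in> borel_measurable lborel" by (auto intro!: borel_measurable_continuous_onI continuous_intros)
  have int: "integrable lborel F"
  proof -
    have "integrable std_normal_distribution (\<lambda>x. cis (T * x))"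
      using integrable_iexp[of "\<lambda>x. T * x"] by (simp add: cis_conv_exp)
    then show ?thesis unfolding F_def
      by (subst (asm) integrable_density) (use mc in auto)
  qed
  have val: "(\<integral>x. F x \<partial>lborel) = of_real (exp (- T\<^sup>2 / 2))"
  proof -
    have "(\<integral>x. F x \<partial>lborel) = (\<integral>x. cis (T * x) \<partial>std_normal_distribution)"
      unfolding F_def by (subst integral_density) (use mc in auto)
    also have "\<dots> = char std_normal_distribution T"
      by (simp add: char_def cis_conv_exp)
    finally show ?thesis by (simp add: char_std_normal_distribution)
  qed
  have s': "sqrt s \<noteq> 0" "1 / sqrt s \<noteq> 0" using s by auto
  have eq: "exp (- x\<^sup>2 / (2 * s)) *\<^sub>R cis (t * x) = sqrt (2 * pi) *\<^sub>R F (0 + (1 / sqrt s) * x)" for x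
  proof -
    have "T * (x / sqrt s) = t * x" using s by (simp add: T_def)
    moreover have "(x / sqrt s)\<^sup>2 = x\<^sup>2 / s" using s by (simp add: power_divide)
    moreover have "sqrt (2 * pi) * (1 / sqrt (2 * pi) * c) = c" for c :: real by simp
    ultimately show ?thesis by (simp add: F_def std_normal_density_def mult.commute[of 2 s] del: real_sqrt_mult)
  qed
  show "integrable lborel (\<lambda>x. exp (- x\<^sup>2 / (2 * s)) *\<^sub>R cis (t * x))"
    unfolding eq using lborel_integrable_real_affine[OF int s'(2), of 0] by (intro integrable_scaleR_right) auto
  have "(\<integral>x. F x \<partial>lborel) = \<bar>1 / sqrt s\<bar> *\<^sub>R (\<integral>x. F (0 + (1 / sqrt s) * x) \<partial>lborel)"
    using s' by (intro lborel_integral_real_affine) auto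
  then have "(\<integral>x. F (0 + (1 / sqrt s) * x) \<partial>lborel) = sqrt s *\<^sub>R of_real (exp (- T\<^sup>2 / 2))"
    using s val by (simp add: field_simps scaleR_conv_of_real)
  then show "(\<integral>x. exp (- x\<^sup>2 / (2 * s)) *\<^sub>R cis (t * x) \<partial>lborel) = of_real (sqrt (2 * pi * s) * exp (- s * t\<^sup>2 / 2))"
    unfolding eq using s by (simp add: T_def scaleR_conv_of_real real_sqrt_mult power_mult_distrib mult_ac)
qed

text \<open>Density of the centred Gaussian law with covariance \<open>s\<close> times the identity;
  \<open>s\<close> is a variance.\<close>

definition heat_kernel :: "real \<Rightarrow> 'a::euclidean_space \<Rightarrow> real" where
  "heat_kernel s x = exp (- (norm x)\<^sup>2 / (2 * s)) / sqrt ((2 * pi * s) ^ DIM('a))"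

lemma measurable_cis_inner [measurable (raw)]:
  fixes f g :: "'b \<Rightarrow> 'a::euclidean_space"
  assumes [measurable]: "f \<in> borel_measurable M" "g \<in> borel_measurable M"
  shows "(\<lambda>x. cis (f x \<bullet> g x)) \<in> borel_measurable M"
  by (rule borel_measurable_continuous_on[of cis]) (auto intro: continuous_intros)

lemma heat_kernel_measurable [measurable]: "heat_kernel s \<in> borel_measurable borel"
  unfolding heat_kernel_def[abs_def] by measurable

text \<open>Both the Gaussian and the character are products over the coordinates, so the
  one-dimensional formula is multiplied up.\<close>

lemma gaussian_fourier:
  fixes u :: "'a::euclidean_space"
  assumes s: "0 < s"
  shows "integrable lborel (\<lambda>x. exp (- (norm x)\<^sup>2 / (2 * s)) *\<^sub>R cis (u \<bullet> x))" (is ?I)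
    and "(\<integral>x. exp (- (norm x)\<^sup>2 / (2 * s)) *\<^sub>R cis (u \<bullet> x) \<partial>lborel)
      = of_real (sqrt ((2 * pi * s) ^ DIM('a)) * exp (- s * (norm u)\<^sup>2 / 2))" (is ?V)
proof -
  define f :: "'a \<Rightarrow> real \<Rightarrow> complex" where "f b x = exp (- x\<^sup>2 / (2 * s)) *\<^sub>R cis ((u \<bullet> b) * x)" for b x
  have exp_sum: "cis (\<Sum>b\<in>A. g b) = (\<Prod>b\<in>A. cis (g b))" if "finite A" for A and g :: "'a \<Rightarrow> real"
    using that by induction (auto simp flip: cis_mult)
  have eq: "exp (- (norm x)\<^sup>2 / (2 * s)) *\<^sub>R cis (u \<bullet> x) = (\<Prod>b\<in>Basis. f b (x \<bullet> b))" for x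
  proof -
    have "- (norm x)\<^sup>2 / (2 * s) = (\<Sum>b\<in>Basis. - (x \<bullet> b)\<^sup>2 / (2 * s))"
      by (simp add: norm_sq_Basis sum_divide_distrib sum_negf)
    moreover have "u \<bullet> x = (\<Sum>b\<in>Basis. (u \<bullet> b) * (x \<bullet> b))" by (rule euclidean_inner)
    ultimately show ?thesis
      by (simp add: f_def exp_sum exp_sum[OF finite_Basis] prod.distrib scaleR_conv_of_real exp_sum)
        (simp add: exp_sum Transcendental.exp_sum flip: of_real_prod)
  qed
  have int: "integrable lborel (f b)" for b
    unfolding f_def using gaussian_fourier_1d(1)[OF s] by auto
  show ?I unfolding eq by (rule integral_lborel_prod(2)) (rule int)
  have "(\<integral>x. exp (- (norm x)\<^sup>2 / (2 * s)) *\<^sub>R cis (u \<bullet> x) \<partial>lborel) = (\<Prod>b\<in>Basis. \<integral>t. f b t \<partial>lborel)"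
    unfolding eq by (rule integral_lborel_prod(1)) (rule int)
  also have "\<dots> = (\<Prod>b\<in>Basis. of_real (sqrt (2 * pi * s) * exp (- s * (u \<bullet> b)\<^sup>2 / 2)))"
    unfolding f_def gaussian_fourier_1d(2)[OF s] ..
  also have "\<dots> = of_real (sqrt (2 * pi * s) ^ DIM('a) * exp (\<Sum>b\<in>Basis. - s * (u \<bullet> b)\<^sup>2 / 2))"
    by (simp add: prod.distrib Transcendental.exp_sum flip: of_real_prod)
  also have "(\<Sum>b\<in>Basis. - s * (u \<bullet> b)\<^sup>2 / 2) = - s * (norm u)\<^sup>2 / 2"
    by (simp add: norm_sq_Basis sum_divide_distrib sum_distrib_left)
  finally show ?V by (simp add: real_sqrt_power)
qed

lemma heat_kernel_integrable:
  assumes "0 < s" shows "integrable lborel (heat_kernel s :: 'a::euclidean_space \<Rightarrow> real)"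
    and "(\<integral>x. heat_kernel s x \<partial>(lborel :: 'a measure)) = 1"
proof -
  have i: "integrable lborel (\<lambda>x::'a. exp (- (norm x)\<^sup>2 / (2 * s)))"
    using integrable_norm[OF gaussian_fourier(1)[OF assms, of "0::'a"]] by simp
  then show "integrable lborel (heat_kernel s :: 'a \<Rightarrow> real)"
    unfolding heat_kernel_def[abs_def] by (rule integrable_divide_zero)
  have "complex_of_real (\<integral>x. exp (- (norm (x::'a))\<^sup>2 / (2 * s)) \<partial>lborel) = of_real (sqrt ((2 * pi * s) ^ DIM('a)))"
    using gaussian_fourier(2)[OF assms, of "0::'a"] by (simp add: scaleR_conv_of_real)
  then have "(\<integral>x. exp (- (norm (x::'a))\<^sup>2 / (2 * s)) \<partial>lborel) = sqrt ((2 * pi * s) ^ DIM('a))"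
    by (simp only: of_real_eq_iff)
  then show "(\<integral>x. heat_kernel s x \<partial>(lborel :: 'a measure)) = 1"
    unfolding heat_kernel_def[abs_def] using assms by simp
qed


lemma heat_kernel_nonneg: "0 < s \<Longrightarrow> 0 \<le> heat_kernel s x"
  by (simp add: heat_kernel_def)

lemma heat_kernel_le:
  fixes x :: "'a::euclidean_space"
  shows "0 < s \<Longrightarrow> heat_kernel s x \<le> heat_kernel s (0::'a)"
  by (simp add: heat_kernel_def divide_right_mono)

lemma heat_kernel_minus: "heat_kernel s (x - y) = heat_kernel s (y - x)"
  by (simp add: heat_kernel_def norm_minus_commute)

lemma integral_lborel_translate:
  fixes g :: "'a::euclidean_space \<Rightarrow> real" and x :: 'a
  assumes [measurable]: "g \<in> borel_measurable borel"
  shows "integrable lborel (\<lambda>y. g (y - x)) \<longleftrightarrow> integrable lborel g"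
    and "(\<integral>y. g (y - x) \<partial>lborel) = (\<integral>y. g y \<partial>lborel)"
proof -
  have "integrable (distr lborel borel ((+) (- x))) g \<longleftrightarrow> integrable lborel (\<lambda>y. g (- x + y))"
    by (rule integrable_distr_eq) auto
  then show "integrable lborel (\<lambda>y. g (y - x)) \<longleftrightarrow> integrable lborel g"
    by (simp add: lborel_distr_plus)
  have "integral\<^sup>L (distr lborel borel ((+) (- x))) g = (\<integral>y. g (- x + y) \<partial>lborel)"
    by (rule integral_distr) auto
  then show "(\<integral>y. g (y - x) \<partial>lborel) = (\<integral>y. g y \<partial>lborel)"
    by (simp add: lborel_distr_plus)
qed

text \<open>With z = |x|^2 / (4 s), the inequality z exp (- 2 z) <= exp (- z) compares with the
  kernel of variance \<open>2 * s\<close>, which has mass 1; \<open>sqrt (2 ^ DIM('a))\<close> is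
  the quotient of the normalising constants. Only the linear decay in \<open>s\<close>
  matters.\<close>

lemma heat_kernel_second_moment:
  assumes s: "0 < s"
  shows "integrable lborel (\<lambda>x::'a::euclidean_space. (norm x)\<^sup>2 * heat_kernel s x)" (is "integrable _ ?f")
    and "(\<integral>x. (norm (x::'a))\<^sup>2 * heat_kernel s x \<partial>lborel) \<le> 4 * s * sqrt (2 ^ DIM('a))"
proof -
  have le: "(norm x)\<^sup>2 * heat_kernel s x \<le> 4 * s * sqrt (2 ^ DIM('a)) * heat_kernel (2 * s) x" for x :: 'a
  proof -
    define z where "z = (norm x)\<^sup>2 / (4 * s)"
    have "z \<le> exp z" using exp_ge_add_one_self[of z] by linarith
    then have "z * exp (- 2 * z) \<le> exp z * exp (- 2 * z)" by (intro mult_right_mono) auto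
    also have "\<dots> = exp (- z)" by (simp add: mult_exp_exp)
    finally have *: "4 * s * (z * exp (- 2 * z)) \<le> 4 * s * exp (- z)" using s by simp
    have z: "4 * s * z = (norm x)\<^sup>2" "- 2 * z = - (norm x)\<^sup>2 / (2 * s)" "- z = - (norm x)\<^sup>2 / (2 * (2 * s))"
      using s by (auto simp: z_def)
    have "(2 * pi * (2 * s)) ^ DIM('a) = 2 ^ DIM('a) * (2 * pi * s) ^ DIM('a)"
      by (subst power_mult_distrib[symmetric]) (simp only: mult_ac)
    then have "4 * s * sqrt (2 ^ DIM('a)) * heat_kernel (2 * s) x = 4 * s * exp (- z) / sqrt ((2 * pi * s) ^ DIM('a))"
      using s by (simp add: heat_kernel_def z(3) real_sqrt_mult)
    moreover have "(norm x)\<^sup>2 * heat_kernel s x = 4 * s * (z * exp (- 2 * z)) / sqrt ((2 * pi * s) ^ DIM('a))"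
      unfolding heat_kernel_def z(2) z(1)[symmetric] by simp
    ultimately show ?thesis
      using * s by (simp only:) (intro divide_right_mono, auto)
  qed
  have i: "integrable lborel (\<lambda>x::'a. 4 * s * sqrt (2 ^ DIM('a)) * heat_kernel (2 * s) x)"
    using heat_kernel_integrable(1)[of "2 * s", where 'a='a] s by (intro integrable_mult_right) auto
  show int: "integrable lborel ?f"
    by (rule Bochner_Integration.integrable_bound[OF i]) (use s le in \<open>auto simp: heat_kernel_nonneg intro!: AE_I2\<close>)
  have "(\<integral>x. ?f x \<partial>lborel) \<le> (\<integral>x. 4 * s * sqrt (2 ^ DIM('a)) * heat_kernel (2 * s) x \<partial>(lborel :: 'a measure))"
    by (intro integral_mono int i le)
  also have "\<dots> = 4 * s * sqrt (2 ^ DIM('a))"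
    using heat_kernel_integrable[of "2 * s", where 'a='a] s by simp
  finally show "(\<integral>x. ?f x \<partial>lborel) \<le> 4 * s * sqrt (2 ^ DIM('a))" .
qed

text \<open>Up to scaling the Gaussian is its own Fourier transform, so this instance of Fourier
  inversion is \<open>gaussian_fourier\<close> with variance \<open>1 / s\<close>.\<close>

lemma heat_kernel_fourier:
  fixes x :: "'a::euclidean_space"
  assumes s: "0 < s"
  shows "integrable lborel (\<lambda>u::'a. exp (- (norm u)\<^sup>2 / (2 * (1 / s))) / (2 * pi) ^ DIM('a))"
    and "complex_of_real (heat_kernel s x)
      = (\<integral>u. (exp (- (norm u)\<^sup>2 / (2 * (1 / s))) / (2 * pi) ^ DIM('a)) *\<^sub>R cis (x \<bullet> u) \<partial>lborel)"
proof -
  have i: "integrable lborel (\<lambda>u::'a. exp (- (norm u)\<^sup>2 / (2 * (1 / s))))"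
    using integrable_norm[OF gaussian_fourier(1)[of "1 / s" "0::'a"]] s by simp
  then show "integrable lborel (\<lambda>u::'a. exp (- (norm u)\<^sup>2 / (2 * (1 / s))) / (2 * pi) ^ DIM('a))"
    by (rule integrable_divide_zero)
  have "(2 * pi * (1 / s)) ^ DIM('a) = ((2 * pi) ^ DIM('a))\<^sup>2 / (2 * pi * s) ^ DIM('a)"
    using s by (simp add: power2_eq_square power_divide power_mult_distrib)
  then have sq: "sqrt ((2 * pi * (1 / s)) ^ DIM('a)) / (2 * pi) ^ DIM('a) = 1 / sqrt ((2 * pi * s) ^ DIM('a))"
    by (simp add: real_sqrt_divide)
  have "(\<integral>u. (exp (- (norm u)\<^sup>2 / (2 * (1 / s))) / (2 * pi) ^ DIM('a)) *\<^sub>R cis (x \<bullet> u) \<partial>lborel)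
      = (1 / (2 * pi) ^ DIM('a)) *\<^sub>R (\<integral>u. exp (- (norm u)\<^sup>2 / (2 * (1 / s))) *\<^sub>R cis (x \<bullet> u) \<partial>lborel)"
    by (subst integral_scaleR_right[symmetric]) simp
  also have "\<dots> = of_real ((sqrt ((2 * pi * (1 / s)) ^ DIM('a)) / (2 * pi) ^ DIM('a)) * exp (- (1 / s) * (norm x)\<^sup>2 / 2))"
    using s by (subst gaussian_fourier(2)) (auto simp: scaleR_conv_of_real)
  also have "\<dots> = of_real (heat_kernel s x)"
    unfolding sq heat_kernel_def by simp
  finally show "complex_of_real (heat_kernel s x)
      = (\<integral>u. (exp (- (norm u)\<^sup>2 / (2 * (1 / s))) / (2 * pi) ^ DIM('a)) *\<^sub>R cis (x \<bullet> u) \<partial>lborel)" ..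
qed

section \<open>Smoothing a measure by the heat kernel\<close>

definition charfun :: "'a::euclidean_space measure \<Rightarrow> 'a \<Rightarrow> complex" where
  "charfun \<nu> u = (\<integral>x. cis (u \<bullet> x) \<partial>\<nu>)"

locale borel_prob = prob_space \<nu> for \<nu> :: "'a::euclidean_space measure" +
  assumes sets_borel [measurable_cong, simp]: "sets \<nu> = sets borel"
begin

lemma space_UNIV [simp]: "space \<nu> = UNIV"
  using sets_eq_imp_space_eq[OF sets_borel] by simp

lemma norm_charfun_le: "norm (charfun \<nu> u) \<le> 1"
proof -
  have "norm (charfun \<nu> u) \<le> (\<integral>x. norm (cis (u \<bullet> x)) \<partial>\<nu>)"
    unfolding charfun_def by (rule integral_norm_bound)
  then show ?thesis by (simp add: prob_space[unfolded space_UNIV])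
qed

lemma charfun_measurable [measurable]: "charfun \<nu> \<in> borel_measurable borel"
proof -
  have "(\<lambda>u. \<integral>x. cis (u \<bullet> x) \<partial>\<nu>) \<in> borel_measurable (borel :: 'a measure)"
    by (rule borel_measurable_lebesgue_integral) measurable
  then show ?thesis by (simp add: charfun_def[abs_def])
qed

text \<open>Fubini, after inserting the Fourier representation of the kernel. The density of the
  smoothed measure thus depends on \<open>\<nu>\<close> only through its characteristic function,
  integrated against a fixed Gaussian weight.\<close>

lemma smoothed_density:
  assumes s: "0 < s"
  shows "complex_of_real (\<integral>x. heat_kernel s (x - y) \<partial>\<nu>)
    = (\<integral>u. (exp (- (norm u)\<^sup>2 / (2 * (1 / s))) / (2 * pi) ^ DIM('a)) *\<^sub>R (cis (- (y \<bullet> u)) * charfun \<nu> u) \<partial>lborel)"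
proof -
  define g where "g u = exp (- (norm (u::'a))\<^sup>2 / (2 * (1 / s))) / (2 * pi) ^ DIM('a)" for u
  interpret P: pair_sigma_finite "lborel :: 'a measure" \<nu> by standard
  have gm [measurable]: "g \<in> borel_measurable borel" unfolding g_def by measurable
  have gi: "integrable lborel g" unfolding g_def by (rule heat_kernel_fourier(1)[OF s])
  have g0: "0 \<le> g u" for u by (simp add: g_def)
  have int: "integrable (lborel \<Otimes>\<^sub>M \<nu>) (\<lambda>(u, x). g u *\<^sub>R cis ((x - y) \<bullet> u))"
  proof (rule P.Fubini_integrable)
    show "(\<lambda>(u, x). g u *\<^sub>R cis ((x - y) \<bullet> u)) \<in> borel_measurable (lborel \<Otimes>\<^sub>M \<nu>)"
      by measurable
    show "integrable lborel (\<lambda>u. \<integral>x. norm (case (u, x) of (u, x) \<Rightarrow> g u *\<^sub>R cis ((x - y) \<bullet> u)) \<partial>\<nu>)"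
      using gi g0 by (simp add: prob_space[unfolded space_UNIV])
    show "AE u in lborel. integrable \<nu> (\<lambda>x. case (u, x) of (u, x) \<Rightarrow> g u *\<^sub>R cis ((x - y) \<bullet> u))"
    proof (rule AE_I2)
      fix u show "integrable \<nu> (\<lambda>x. case (u, x) of (u, x) \<Rightarrow> g u *\<^sub>R cis ((x - y) \<bullet> u))"
        by (rule integrable_const_bound[where B="g u"]) (auto simp: g0)
    qed
  qed
  have "complex_of_real (\<integral>x. heat_kernel s (x - y) \<partial>\<nu>) = (\<integral>x. complex_of_real (heat_kernel s (x - y)) \<partial>\<nu>)"
    by simp
  also have "\<dots> = (\<integral>x. (\<integral>u. g u *\<^sub>R cis ((x - y) \<bullet> u) \<partial>lborel) \<partial>\<nu>)"
    unfolding g_def by (subst heat_kernel_fourier(2)[OF s]) simp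
  also have "\<dots> = (\<integral>u. (\<integral>x. g u *\<^sub>R cis ((x - y) \<bullet> u) \<partial>\<nu>) \<partial>lborel)"
    by (rule P.Fubini_integral[OF int])
  also have "\<dots> = (\<integral>u. g u *\<^sub>R (cis (- (y \<bullet> u)) * charfun \<nu> u) \<partial>lborel)"
  proof (rule Bochner_Integration.integral_cong)
    fix u
    have "cis ((x - y) \<bullet> u) = cis (- (y \<bullet> u)) * cis (u \<bullet> x)" for x
      by (simp add: cis_mult inner_diff_left inner_commute[of u x] add.commute)
    then have "(\<integral>x. g u *\<^sub>R cis ((x - y) \<bullet> u) \<partial>\<nu>) = (\<integral>x. (g u *\<^sub>R cis (- (y \<bullet> u))) * cis (u \<bullet> x) \<partial>\<nu>)"
      by simp
    also have "\<dots> = (g u *\<^sub>R cis (- (y \<bullet> u))) * charfun \<nu> u"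
      unfolding charfun_def by (rule integral_mult_right_zero)
    finally show "(\<integral>x. g u *\<^sub>R cis ((x - y) \<bullet> u) \<partial>\<nu>) = g u *\<^sub>R (cis (- (y \<bullet> u)) * charfun \<nu> u)"
      by simp
  qed simp
  finally show ?thesis unfolding g_def .
qed

lemma heat_kernel_integrable_shift: "0 < s \<Longrightarrow> integrable \<nu> (\<lambda>x. heat_kernel s (x - y))"
  by (rule integrable_const_bound[where B="heat_kernel s (0::'a)"]) (auto simp: heat_kernel_nonneg heat_kernel_le)

text \<open>Fubini moves the smoothing from the test function to the measure, where
  \<open>smoothed_density\<close> applies.\<close>

lemma integral_smoothed:
  fixes f :: "'a \<Rightarrow> real"
  assumes s: "0 < s" and f: "integrable lborel f"
  shows "(\<integral>x. (\<integral>y. f y * heat_kernel s (x - y) \<partial>lborel) \<partial>\<nu>) = (\<integral>y. f y * (\<integral>x. heat_kernel s (x - y) \<partial>\<nu>) \<partial>lborel)"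
    and "integrable \<nu> (\<lambda>x. \<integral>y. f y * heat_kernel s (x - y) \<partial>lborel)"
proof -
  interpret P: pair_sigma_finite "lborel :: 'a measure" \<nu> by standard
  have [measurable]: "f \<in> borel_measurable borel" using f by auto
  have hk [measurable]: "(\<lambda>y. \<integral>x. heat_kernel s (x - y) \<partial>\<nu>) \<in> borel_measurable borel"
    by (rule borel_measurable_lebesgue_integral) measurable
  have hb: "0 \<le> (\<integral>x. heat_kernel s (x - y) \<partial>\<nu>)" "(\<integral>x. heat_kernel s (x - y) \<partial>\<nu>) \<le> heat_kernel s (0::'a)" for y
  proof -
    show "0 \<le> (\<integral>x. heat_kernel s (x - y) \<partial>\<nu>)" by (simp add: heat_kernel_nonneg s)
    show "(\<integral>x. heat_kernel s (x - y) \<partial>\<nu>) \<le> heat_kernel s (0::'a)"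
      using integral_mono[OF heat_kernel_integrable_shift[OF s, of y], of "\<lambda>_. heat_kernel s (0::'a)"]
      by (simp add: heat_kernel_le s prob_space[unfolded space_UNIV])
  qed
  have int: "integrable (lborel \<Otimes>\<^sub>M \<nu>) (\<lambda>(y, x). f y * heat_kernel s (x - y))"
  proof (rule P.Fubini_integrable)
    show "(\<lambda>(y, x). f y * heat_kernel s (x - y)) \<in> borel_measurable (lborel \<Otimes>\<^sub>M \<nu>)"
      by measurable
    have "integrable lborel (\<lambda>y. \<bar>f y\<bar> * (\<integral>x. heat_kernel s (x - y) \<partial>\<nu>))"
    proof (rule Bochner_Integration.integrable_bound)
      show "integrable lborel (\<lambda>y. \<bar>f y\<bar> * heat_kernel s (0::'a))"
        using f by (intro integrable_mult_left integrable_abs)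
    qed (use hb in \<open>auto simp: abs_mult heat_kernel_nonneg[OF s] intro!: mult_left_mono\<close>)
    then show "integrable lborel (\<lambda>y. \<integral>x. norm (case (y, x) of (y, x) \<Rightarrow> f y * heat_kernel s (x - y)) \<partial>\<nu>)"
      by (simp add: abs_mult heat_kernel_nonneg s)
    show "AE y in lborel. integrable \<nu> (\<lambda>x. case (y, x) of (y, x) \<Rightarrow> f y * heat_kernel s (x - y))"
      by (auto intro!: AE_I2 integrable_mult_right heat_kernel_integrable_shift s)
  qed
  show "integrable \<nu> (\<lambda>x. \<integral>y. f y * heat_kernel s (x - y) \<partial>lborel)"
    using P.integrable_snd[OF int] by simp
  show "(\<integral>x. (\<integral>y. f y * heat_kernel s (x - y) \<partial>lborel) \<partial>\<nu>) = (\<integral>y. f y * (\<integral>x. heat_kernel s (x - y) \<partial>\<nu>) \<partial>lborel)"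
    using P.Fubini_integral[OF int] by simp
qed

end

text \<open>Within distance \<open>\<eta>\<close> the increment of \<open>f\<close> is at most
  \<open>\<epsilon>\<close>; elsewhere it is at most 2 C, hence at most 2 C |y - x|^2 / eta^2.
  Integrating the sum of both bounds leaves the mass and the second moment of the kernel, so the
  error is uniform in \<open>x\<close>.\<close>

lemma smoothing_error:
  fixes f :: "'a::euclidean_space \<Rightarrow> real"
  assumes s: "0 < s" and f [measurable]: "f \<in> borel_measurable borel" and C: "\<And>x. \<bar>f x\<bar> \<le> C"
    and \<eta>: "0 < \<eta>" "0 \<le> \<epsilon>" "\<And>x y. norm (y - x) < \<eta> \<Longrightarrow> \<bar>f y - f x\<bar> \<le> \<epsilon>"
  shows "\<bar>(\<integral>y. f y * heat_kernel s (x - y) \<partial>lborel) - f x\<bar> \<le> \<epsilon> + 2 * C / \<eta>\<^sup>2 * (4 * s * sqrt (2 ^ DIM('a)))"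
proof -
  have C0: "0 \<le> C" using C[of 0] by linarith
  have k: "integrable lborel (\<lambda>y. heat_kernel s (x - y))" "(\<integral>y. heat_kernel s (x - y) \<partial>lborel) = 1"
    using integral_lborel_translate[of "heat_kernel s" x] heat_kernel_integrable[OF s, where 'a='a]
    by (auto simp: heat_kernel_minus[of s x])
  have k2: "integrable lborel (\<lambda>y. (norm (y - x))\<^sup>2 * heat_kernel s (x - y))"
      "(\<integral>y. (norm (y - x))\<^sup>2 * heat_kernel s (x - y) \<partial>lborel) \<le> 4 * s * sqrt (2 ^ DIM('a))"
    using integral_lborel_translate[of "\<lambda>z. (norm z)\<^sup>2 * heat_kernel s z" x] heat_kernel_second_moment[OF s, where 'a='a]
    by (auto simp: heat_kernel_minus[of s x])
  have fk: "integrable lborel (\<lambda>y. f y * heat_kernel s (x - y))"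
  proof (rule Bochner_Integration.integrable_bound)
    show "integrable lborel (\<lambda>y. C * heat_kernel s (x - y))" using k by auto
  qed (use C C0 heat_kernel_nonneg[OF s] in \<open>auto simp: abs_mult intro!: mult_right_mono\<close>)
  have "(\<integral>y. f y * heat_kernel s (x - y) \<partial>lborel) - f x = (\<integral>y. (f y - f x) * heat_kernel s (x - y) \<partial>lborel)"
    using fk k by (simp add: left_diff_distrib)
  also have "\<bar>\<dots>\<bar> \<le> (\<integral>y. \<bar>(f y - f x) * heat_kernel s (x - y)\<bar> \<partial>lborel)"
    by (rule integral_abs_bound)
  also have "\<dots> \<le> (\<integral>y. \<epsilon> * heat_kernel s (x - y) + 2 * C / \<eta>\<^sup>2 * ((norm (y - x))\<^sup>2 * heat_kernel s (x - y)) \<partial>lborel)"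
  proof (rule integral_mono)
    show "integrable lborel (\<lambda>y. \<bar>(f y - f x) * heat_kernel s (x - y)\<bar>)"
      using fk k by (intro integrable_abs) (simp add: left_diff_distrib)
    show "integrable lborel (\<lambda>y. \<epsilon> * heat_kernel s (x - y) + 2 * C / \<eta>\<^sup>2 * ((norm (y - x))\<^sup>2 * heat_kernel s (x - y)))"
      using k k2 by (intro Bochner_Integration.integrable_add integrable_mult_right) auto
    fix y
    have "\<bar>f y - f x\<bar> \<le> \<epsilon> + 2 * C / \<eta>\<^sup>2 * (norm (y - x))\<^sup>2"
    proof (cases "norm (y - x) < \<eta>")
      case True
      then have "\<bar>f y - f x\<bar> \<le> \<epsilon>" by (rule \<eta>(3))
      moreover have "0 \<le> 2 * C / \<eta>\<^sup>2 * (norm (y - x))\<^sup>2" using C0 by simp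
      ultimately show ?thesis by linarith
    next
      case False
      then have "\<eta>\<^sup>2 \<le> (norm (y - x))\<^sup>2" using \<eta>(1) by (intro power_mono) auto
      then have "2 * C * 1 \<le> 2 * C * ((norm (y - x))\<^sup>2 / \<eta>\<^sup>2)"
        using C0 \<eta>(1) by (intro mult_left_mono) (auto simp: le_divide_eq)
      moreover have "\<bar>f y - f x\<bar> \<le> 2 * C" using C[of y] C[of x] by linarith
      ultimately show ?thesis using \<eta>(2) by simp
    qed
    then have "\<bar>f y - f x\<bar> * heat_kernel s (x - y) \<le> (\<epsilon> + 2 * C / \<eta>\<^sup>2 * (norm (y - x))\<^sup>2) * heat_kernel s (x - y)"
      by (intro mult_right_mono heat_kernel_nonneg s)
    then show "\<bar>(f y - f x) * heat_kernel s (x - y)\<bar> \<le> \<epsilon> * heat_kernel s (x - y) + 2 * C / \<eta>\<^sup>2 * ((norm (y - x))\<^sup>2 * heat_kernel s (x - y))"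
      by (simp add: abs_mult heat_kernel_nonneg s distrib_right mult.assoc)
  qed
  also have "\<dots> = \<epsilon> + 2 * C / \<eta>\<^sup>2 * (\<integral>y. (norm (y - x))\<^sup>2 * heat_kernel s (x - y) \<partial>lborel)"
    using k k2 by (subst Bochner_Integration.integral_add) auto
  also have "\<dots> \<le> \<epsilon> + 2 * C / \<eta>\<^sup>2 * (4 * s * sqrt (2 ^ DIM('a)))"
    using k2 C0 by (intro add_left_mono mult_left_mono) auto
  finally show ?thesis .
qed

context
  fixes \<nu> :: "nat \<Rightarrow> 'a::euclidean_space measure" and \<mu> :: "'a measure"
  assumes \<nu>: "\<And>n. borel_prob (\<nu> n)" and \<mu>: "borel_prob \<mu>"
    and char: "\<And>u. (\<lambda>n. charfun (\<nu> n) u) \<longlonglongrightarrow> charfun \<mu> u"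
begin

interpretation N: borel_prob "\<nu> n" for n by (rule \<nu>)
interpretation M: borel_prob \<mu> by (rule \<mu>)

text \<open>Characteristic functions are bounded by 1, so the Gaussian weight dominates the
  integrands.\<close>

lemma smoothed_density_tendsto:
  assumes s: "0 < s"
  shows "(\<lambda>n. \<integral>x. heat_kernel s (x - y) \<partial>\<nu> n) \<longlonglongrightarrow> (\<integral>x. heat_kernel s (x - y) \<partial>\<mu>)"
proof -
  define g where "g u = exp (- (norm (u::'a))\<^sup>2 / (2 * (1 / s))) / (2 * pi) ^ DIM('a)" for u
  have gm [measurable]: "g \<in> borel_measurable borel" unfolding g_def by measurable
  have g0: "0 \<le> g u" for u by (simp add: g_def)
  have "(\<lambda>n. \<integral>u. g u *\<^sub>R (cis (- (y \<bullet> u)) * charfun (\<nu> n) u) \<partial>lborel)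
     \<longlonglongrightarrow> (\<integral>u. g u *\<^sub>R (cis (- (y \<bullet> u)) * charfun \<mu> u) \<partial>lborel)"
  proof (rule integral_dominated_convergence[where w=g])
    show "integrable lborel g" unfolding g_def by (rule heat_kernel_fourier(1)[OF s])
    have [measurable]: "(\<lambda>u. cis (- (y \<bullet> u))) \<in> borel_measurable borel"
      by (auto intro!: borel_measurable_continuous_onI continuous_intros)
    show "(\<lambda>u. g u *\<^sub>R (cis (- (y \<bullet> u)) * charfun \<mu> u)) \<in> borel_measurable lborel"
      by measurable
    show "(\<lambda>u. g u *\<^sub>R (cis (- (y \<bullet> u)) * charfun (\<nu> n) u)) \<in> borel_measurable lborel" for n
      by measurable
    show "AE u in lborel. (\<lambda>n. g u *\<^sub>R (cis (- (y \<bullet> u)) * charfun (\<nu> n) u)) \<longlonglongrightarrow> g u *\<^sub>R (cis (- (y \<bullet> u)) * charfun \<mu> u)"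
      by (intro AE_I2 tendsto_intros char)
    show "AE u in lborel. norm (g u *\<^sub>R (cis (- (y \<bullet> u)) * charfun (\<nu> n) u)) \<le> g u" for n
      using N.norm_charfun_le[of n] g0 by (intro AE_I2) (auto simp: norm_mult intro!: mult_left_le)
  qed
  then have "(\<lambda>n. complex_of_real (\<integral>x. heat_kernel s (x - y) \<partial>\<nu> n)) \<longlonglongrightarrow> of_real (\<integral>x. heat_kernel s (x - y) \<partial>\<mu>)"
    unfolding g_def N.smoothed_density[OF s] M.smoothed_density[OF s] .
  then show ?thesis by (simp only: tendsto_of_real_iff)
qed

lemma smoothed_tendsto:
  fixes f :: "'a \<Rightarrow> real"
  assumes s: "0 < s" and f: "integrable lborel f"
  shows "(\<lambda>n. \<integral>x. (\<integral>y. f y * heat_kernel s (x - y) \<partial>lborel) \<partial>\<nu> n) \<longlonglongrightarrow> (\<integral>x. (\<integral>y. f y * heat_kernel s (x - y) \<partial>lborel) \<partial>\<mu>)"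
  unfolding N.integral_smoothed(1)[OF s f] M.integral_smoothed(1)[OF s f]
proof (rule integral_dominated_convergence[where w="\<lambda>y. \<bar>f y\<bar> * heat_kernel s (0::'a)"])
  have [measurable]: "f \<in> borel_measurable borel" using f by auto
  have [measurable]: "(\<lambda>y. \<integral>x. heat_kernel s (x - y) \<partial>\<nu> n) \<in> borel_measurable borel" for n
    by (rule N.borel_measurable_lebesgue_integral) measurable
  have [measurable]: "(\<lambda>y. \<integral>x. heat_kernel s (x - y) \<partial>\<mu>) \<in> borel_measurable borel"
    by (rule M.borel_measurable_lebesgue_integral) measurable
  show "(\<lambda>y. f y * (\<integral>x. heat_kernel s (x - y) \<partial>\<mu>)) \<in> borel_measurable lborel" by measurable
  show "(\<lambda>y. f y * (\<integral>x. heat_kernel s (x - y) \<partial>\<nu> n)) \<in> borel_measurable lborel" for n by measurable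
  show "integrable lborel (\<lambda>y. \<bar>f y\<bar> * heat_kernel s (0::'a))"
    using f by (intro integrable_mult_left integrable_abs)
  show "AE y in lborel. (\<lambda>n. f y * (\<integral>x. heat_kernel s (x - y) \<partial>\<nu> n)) \<longlonglongrightarrow> f y * (\<integral>x. heat_kernel s (x - y) \<partial>\<mu>)"
    by (intro AE_I2 tendsto_intros smoothed_density_tendsto s)
  show "AE y in lborel. norm (f y * (\<integral>x. heat_kernel s (x - y) \<partial>\<nu> n)) \<le> \<bar>f y\<bar> * heat_kernel s (0::'a)" for n
  proof (rule AE_I2)
    fix y
    have "(\<integral>x. heat_kernel s (x - y) \<partial>\<nu> n) \<le> heat_kernel s (0::'a)"
      using integral_mono[OF N.heat_kernel_integrable_shift[OF s, of n y], of "\<lambda>_. heat_kernel s (0::'a)"]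
      by (simp add: heat_kernel_le s N.prob_space[unfolded N.space_UNIV])
    moreover have "0 \<le> (\<integral>x. heat_kernel s (x - y) \<partial>\<nu> n)" by (simp add: heat_kernel_nonneg s)
    ultimately show "norm (f y * (\<integral>x. heat_kernel s (x - y) \<partial>\<nu> n)) \<le> \<bar>f y\<bar> * heat_kernel s (0::'a)"
      by (auto simp: abs_mult intro!: mult_left_mono)
  qed
qed

text \<open>Smoothing \<open>f\<close> changes its integrals under all \<open>\<nu> n\<close> and
  under \<open>\<mu>\<close> by a small amount that does not depend on n, and for the smoothed
  function convergence is already known.\<close>

lemma compact_support_tendsto:
  fixes f :: "'a \<Rightarrow> real"
  assumes cont: "continuous_on UNIV f" and supp: "\<And>x. R < norm x \<Longrightarrow> f x = 0"
  shows "(\<lambda>n. \<integral>x. f x \<partial>\<nu> n) \<longlonglongrightarrow> (\<integral>x. f x \<partial>\<mu>)"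
proof -
  have m [measurable]: "f \<in> borel_measurable borel" by (rule borel_measurable_continuous_onI[OF cont])
  have cb: "compact (f ` cball 0 \<bar>R\<bar>)"
    by (intro compact_continuous_image continuous_on_subset[OF cont]) auto
  then obtain C where C0: "0 < C" and C': "\<And>x. x \<in> cball 0 \<bar>R\<bar> \<Longrightarrow> norm (f x) \<le> C"
    using compact_imp_bounded[OF cb] unfolding bounded_pos by blast
  have C: "\<bar>f x\<bar> \<le> C" for x
    using C'[of x] supp[of x] C0 by (cases "norm x \<le> \<bar>R\<bar>") auto
  have int: "integrable lborel f"
  proof -
    have "integrable lborel (\<lambda>x. indicator (cball 0 \<bar>R\<bar>) x *\<^sub>R f x)"
      by (rule borel_integrable_compact) (auto intro: continuous_on_subset[OF cont])
    also have "(\<lambda>x. indicator (cball 0 \<bar>R\<bar>) x *\<^sub>R f x) = f"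
      using supp by (auto simp: fun_eq_iff indicator_def)
    finally show ?thesis .
  qed
  \<comment> \<open>The margin 1 ensures that two points at distance below 1, one of them within
    radius |R|, both lie in the larger ball.\<close>
  have uc: "uniformly_continuous_on (cball 0 (\<bar>R\<bar> + 1)) f"
    by (intro compact_uniformly_continuous continuous_on_subset[OF cont]) auto
  have fint: "integrable (\<nu> n) f" "integrable \<mu> f" for n
    by (rule N.integrable_const_bound[where B=C] M.integrable_const_bound[where B=C]; use C in auto)+
  show ?thesis
  proof (rule LIMSEQ_I)
    fix e :: real assume e: "0 < e"
    define \<epsilon> where "\<epsilon> = e / 8"
    have \<epsilon>: "0 < \<epsilon>" using e by (simp add: \<epsilon>_def)
    obtain \<eta>' where \<eta>': "0 < \<eta>'" "\<And>x y. x \<in> cball 0 (\<bar>R\<bar> + 1) \<Longrightarrow> y \<in> cball 0 (\<bar>R\<bar> + 1) \<Longrightarrow> dist y x < \<eta>' \<Longrightarrow> dist (f y) (f x) < \<epsilon>"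
      using uc \<epsilon> unfolding uniformly_continuous_on_def by metis
    define \<eta> where "\<eta> = min \<eta>' 1"
    have \<eta>: "0 < \<eta>" using \<eta>' by (simp add: \<eta>_def)
    have \<eta>2: "\<bar>f y - f x\<bar> \<le> \<epsilon>" if "norm (y - x) < \<eta>" for x y
    proof (cases "norm x \<le> \<bar>R\<bar> \<or> norm y \<le> \<bar>R\<bar>")
      case True
      then have "norm x \<le> \<bar>R\<bar> + 1" "norm y \<le> \<bar>R\<bar> + 1"
        using that norm_triangle_ineq2[of y x] norm_triangle_ineq2[of x y] by (auto simp: \<eta>_def norm_minus_commute)
      then show ?thesis using \<eta>'(2)[of x y] that by (auto simp: dist_norm \<eta>_def)
    next
      case False
      then show ?thesis using supp[of x] supp[of y] \<epsilon> by auto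
    qed
    \<comment> \<open>\<open>D * s\<close> is the second term of the bound in
      \<open>smoothing_error\<close>, so the choice \<open>s = \<epsilon> / D\<close> makes it equal
      to \<open>\<epsilon>\<close>.\<close>
    define D where "D = 2 * C / \<eta>\<^sup>2 * (4 * sqrt (2 ^ DIM('a)))"
    have D: "0 < D" using C0 \<eta> by (simp add: D_def)
    define s where "s = \<epsilon> / D"
    have s: "0 < s" using \<epsilon> D by (simp add: s_def)
    define g where "g x = (\<integral>y. f y * heat_kernel s (x - y) \<partial>lborel)" for x
    have g: "\<bar>g x - f x\<bar> \<le> 2 * \<epsilon>" for x
    proof -
      have "\<bar>g x - f x\<bar> \<le> \<epsilon> + 2 * C / \<eta>\<^sup>2 * (4 * s * sqrt (2 ^ DIM('a)))"
        unfolding g_def by (rule smoothing_error[OF s m C \<eta> _ \<eta>2]) (use \<epsilon> in auto)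
      also have "\<dots> = \<epsilon> + D * s" by (simp add: D_def)
      also have "\<dots> = 2 * \<epsilon>" using D by (simp add: s_def)
      finally show ?thesis .
    qed
    have gint: "integrable (\<nu> n) g" "integrable \<mu> g" for n
      unfolding g_def by (rule N.integral_smoothed(2)[OF s int] M.integral_smoothed(2)[OF s int])+
    have dn: "\<bar>(\<integral>x. g x \<partial>\<nu> n) - (\<integral>x. f x \<partial>\<nu> n)\<bar> \<le> 2 * \<epsilon>" for n
    proof -
      have "\<bar>\<integral>x. g x - f x \<partial>\<nu> n\<bar> \<le> (\<integral>x. \<bar>g x - f x\<bar> \<partial>\<nu> n)" by (rule integral_abs_bound)
      also have "\<dots> \<le> (\<integral>x. 2 * \<epsilon> \<partial>\<nu> n)"
        using g gint fint by (intro integral_mono integrable_abs) auto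
      finally show ?thesis using gint fint by (simp add: N.prob_space[unfolded N.space_UNIV])
    qed
    have dm: "\<bar>(\<integral>x. g x \<partial>\<mu>) - (\<integral>x. f x \<partial>\<mu>)\<bar> \<le> 2 * \<epsilon>"
    proof -
      have "\<bar>\<integral>x. g x - f x \<partial>\<mu>\<bar> \<le> (\<integral>x. \<bar>g x - f x\<bar> \<partial>\<mu>)" by (rule integral_abs_bound)
      also have "\<dots> \<le> (\<integral>x. 2 * \<epsilon> \<partial>\<mu>)"
        using g gint fint by (intro integral_mono integrable_abs) auto
      finally show ?thesis using gint fint by (simp add: M.prob_space[unfolded M.space_UNIV])
    qed
    have "(\<lambda>n. \<integral>x. g x \<partial>\<nu> n) \<longlonglongrightarrow> (\<integral>x. g x \<partial>\<mu>)"
      unfolding g_def by (rule smoothed_tendsto[OF s int])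
    then obtain no where no: "\<And>n. n \<ge> no \<Longrightarrow> \<bar>(\<integral>x. g x \<partial>\<nu> n) - (\<integral>x. g x \<partial>\<mu>)\<bar> < \<epsilon>"
      using LIMSEQ_D[OF _ \<epsilon>] by (metis real_norm_def)
    have "norm ((\<integral>x. f x \<partial>\<nu> n) - (\<integral>x. f x \<partial>\<mu>)) < e" if "n \<ge> no" for n
      using no[OF that] dn[of n] dm \<epsilon> unfolding \<epsilon>_def real_norm_def by linarith
    then show "\<exists>no. \<forall>n\<ge>no. norm ((\<integral>x. f x \<partial>\<nu> n) - (\<integral>x. f x \<partial>\<mu>)) < e" by blast
  qed
qed

text \<open>Tightness comes for free: the cut-off \<open>\<psi> R\<close> has compact support, so
  its integrals under \<open>\<nu> n\<close> converge to the one under \<open>\<mu>\<close>, which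
  is close to 1 for large R. Hence the mass outside a large ball is eventually small, and
  \<open>f\<close> may be replaced by its product with the cut-off.\<close>

theorem levy_continuity_euclidean:
  fixes f :: "'a \<Rightarrow> real"
  assumes cont: "continuous_on UNIV f" and bdd: "bounded (range f)"
  shows "(\<lambda>n. \<integral>x. f x \<partial>\<nu> n) \<longlonglongrightarrow> (\<integral>x. f x \<partial>\<mu>)"
proof -
  have m [measurable]: "f \<in> borel_measurable borel" by (rule borel_measurable_continuous_onI[OF cont])
  obtain C where C0: "0 < C" and C: "\<And>x. \<bar>f x\<bar> \<le> C"
    using bdd unfolding bounded_pos by auto
  define \<psi> :: "nat \<Rightarrow> 'a \<Rightarrow> real" where "\<psi> R x = max 0 (min 1 (real R + 1 - norm x))" for R x
  have \<psi>c: "continuous_on UNIV (\<psi> R)" for R unfolding \<psi>_def by (intro continuous_intros)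
  have [measurable]: "\<psi> R \<in> borel_measurable borel" for R by (rule borel_measurable_continuous_onI[OF \<psi>c])
  have \<psi>b: "0 \<le> \<psi> R x" "\<psi> R x \<le> 1" for R x by (auto simp: \<psi>_def)
  have \<psi>0: "\<psi> R x = 0" if "real R + 1 < norm x" for R x using that by (auto simp: \<psi>_def)
  have fint: "integrable (\<nu> n) f" "integrable \<mu> f" for n
    by (rule N.integrable_const_bound[where B=C] M.integrable_const_bound[where B=C]; use C in auto)+
  have \<psi>int: "integrable (\<nu> n) (\<psi> R)" "integrable \<mu> (\<psi> R)" for n R
    by (rule N.integrable_const_bound[where B=1] M.integrable_const_bound[where B=1]; use \<psi>b in auto)+
  have f\<psi>int: "integrable (\<nu> n) (\<lambda>x. f x * \<psi> R x)" "integrable \<mu> (\<lambda>x. f x * \<psi> R x)" for n R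
    using C \<psi>b C0
    by (auto intro!: N.integrable_const_bound[where B="C * 1"] M.integrable_const_bound[where B="C * 1"] AE_I2 mult_mono simp: abs_mult simp del: mult_1_right)
  have near: "\<bar>(\<integral>x. f x \<partial>\<rho>) - (\<integral>x. f x * \<psi> R x \<partial>\<rho>)\<bar> \<le> C * (1 - (\<integral>x. \<psi> R x \<partial>\<rho>))"
    if "borel_prob \<rho>" "integrable \<rho> f" "integrable \<rho> (\<psi> R)" "integrable \<rho> (\<lambda>x. f x * \<psi> R x)" for \<rho> R
  proof -
    interpret P: borel_prob \<rho> by fact
    have "\<bar>\<integral>x. f x - f x * \<psi> R x \<partial>\<rho>\<bar> \<le> (\<integral>x. \<bar>f x - f x * \<psi> R x\<bar> \<partial>\<rho>)" by (rule integral_abs_bound)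
    also have "\<dots> \<le> (\<integral>x. C * (1 - \<psi> R x) \<partial>\<rho>)"
    proof (rule integral_mono)
      fix x
      have "\<bar>f x - f x * \<psi> R x\<bar> = \<bar>f x\<bar> * (1 - \<psi> R x)"
        using \<psi>b[of R x] by (simp add: abs_mult flip: right_diff_distrib[of "f x" 1, simplified])
      also have "\<dots> \<le> C * (1 - \<psi> R x)" using C \<psi>b[of R x] by (intro mult_right_mono) auto
      finally show "\<bar>f x - f x * \<psi> R x\<bar> \<le> C * (1 - \<psi> R x)" .
    qed (use that in auto)
    finally show ?thesis using that by (simp add: P.prob_space[unfolded P.space_UNIV])
  qed
  show ?thesis
  proof (rule LIMSEQ_I)
    fix e :: real assume e: "0 < e"
    define \<epsilon> where "\<epsilon> = e / (8 * (C + 1))"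
    have \<epsilon>: "0 < \<epsilon>" using e C0 by (simp add: \<epsilon>_def)
    have "(\<lambda>R. \<integral>x. \<psi> R x \<partial>\<mu>) \<longlonglongrightarrow> (\<integral>x. 1 \<partial>\<mu>)"
    proof (rule integral_dominated_convergence[where w="\<lambda>_. 1"])
      show "AE x in \<mu>. (\<lambda>R. \<psi> R x) \<longlonglongrightarrow> 1"
      proof (rule AE_I2, rule tendsto_eventually)
        fix x :: 'a
        obtain k :: nat where k: "norm x \<le> real k" using real_arch_simple by blast
        show "\<forall>\<^sub>F R in sequentially. \<psi> R x = 1"
          using eventually_ge_at_top[of k] by eventually_elim (use k in \<open>auto simp: \<psi>_def\<close>)
      qed
    qed (use \<psi>b in auto)
    then have "(\<lambda>R. \<integral>x. \<psi> R x \<partial>\<mu>) \<longlonglongrightarrow> 1" by (simp add: M.prob_space[unfolded M.space_UNIV])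
    from LIMSEQ_D[OF this \<epsilon>] obtain R where R: "\<bar>(\<integral>x. \<psi> R x \<partial>\<mu>) - 1\<bar> < \<epsilon>"
      by auto
    have "(\<lambda>n. \<integral>x. \<psi> R x \<partial>\<nu> n) \<longlonglongrightarrow> (\<integral>x. \<psi> R x \<partial>\<mu>)"
      by (rule compact_support_tendsto[OF \<psi>c \<psi>0])
    from LIMSEQ_D[OF this \<epsilon>] obtain n1 where n1: "\<And>n. n \<ge> n1 \<Longrightarrow> \<bar>(\<integral>x. \<psi> R x \<partial>\<nu> n) - (\<integral>x. \<psi> R x \<partial>\<mu>)\<bar> < \<epsilon>"
      by auto
    have "(\<lambda>n. \<integral>x. f x * \<psi> R x \<partial>\<nu> n) \<longlonglongrightarrow> (\<integral>x. f x * \<psi> R x \<partial>\<mu>)"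
      by (rule compact_support_tendsto[where R="real R + 1"]) (auto intro!: continuous_intros cont \<psi>c simp: \<psi>0)
    from LIMSEQ_D[OF this \<epsilon>] obtain n2 where n2: "\<And>n. n \<ge> n2 \<Longrightarrow> \<bar>(\<integral>x. f x * \<psi> R x \<partial>\<nu> n) - (\<integral>x. f x * \<psi> R x \<partial>\<mu>)\<bar> < \<epsilon>"
      by auto
    have "norm ((\<integral>x. f x \<partial>\<nu> n) - (\<integral>x. f x \<partial>\<mu>)) < e" if n: "n \<ge> max n1 n2" for n
    proof -
      have a: "\<bar>(\<integral>x. f x \<partial>\<nu> n) - (\<integral>x. f x * \<psi> R x \<partial>\<nu> n)\<bar> \<le> C * (1 - (\<integral>x. \<psi> R x \<partial>\<nu> n))"
        by (rule near) (use \<nu> fint \<psi>int f\<psi>int in auto)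
      have b: "\<bar>(\<integral>x. f x \<partial>\<mu>) - (\<integral>x. f x * \<psi> R x \<partial>\<mu>)\<bar> \<le> C * (1 - (\<integral>x. \<psi> R x \<partial>\<mu>))"
        by (rule near) (use \<mu> fint \<psi>int f\<psi>int in auto)
      have "1 - (\<integral>x. \<psi> R x \<partial>\<nu> n) \<le> 2 * \<epsilon>" "1 - (\<integral>x. \<psi> R x \<partial>\<mu>) \<le> \<epsilon>"
        using R n1[of n] n by auto
      then have "C * (1 - (\<integral>x. \<psi> R x \<partial>\<nu> n)) \<le> C * (2 * \<epsilon>)" "C * (1 - (\<integral>x. \<psi> R x \<partial>\<mu>)) \<le> C * \<epsilon>"
        using C0 by (auto intro!: mult_left_mono)
      then have "\<bar>(\<integral>x. f x \<partial>\<nu> n) - (\<integral>x. f x \<partial>\<mu>)\<bar> \<le> C * (2 * \<epsilon>) + C * \<epsilon> + \<epsilon>"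
        using a b n2[of n] n by auto
      also have "\<dots> \<le> 3 * ((C + 1) * \<epsilon>)" using \<epsilon> by (simp add: algebra_simps)
      also have "(C + 1) * \<epsilon> = e / 8" using C0 by (simp add: \<epsilon>_def field_simps)
      finally have "\<bar>(\<integral>x. f x \<partial>\<nu> n) - (\<integral>x. f x \<partial>\<mu>)\<bar> < e" using e by simp
      then show ?thesis by simp
    qed
    then show "\<exists>no. \<forall>n\<ge>no. norm ((\<integral>x. f x \<partial>\<nu> n) - (\<integral>x. f x \<partial>\<mu>)) < e" by blast
  qed
qed

end

section \<open>The conditional law of a step\<close>

lemma sigma_rv_eq: "Y \<in> space M \<rightarrow> space N \<Longrightarrow> sigma_rv M N Y = {Y -` S \<inter> space M |S. S \<in> sets N}"
  by (simp add: sigma_rv_def sets_vimage_algebra2)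

lemma sigma_rv_subset: "Y \<in> measurable M N \<Longrightarrow> sigma_rv M N Y \<subseteq> sets M"
  by (auto simp: sigma_rv_eq measurable_space Pi_iff intro: measurable_sets)

lemma matrix_vector_mult_borel [measurable (raw)]:
  fixes f :: "'w \<Rightarrow> real^'n^'m" and g :: "'w \<Rightarrow> real^'n"
  assumes [measurable]: "f \<in> borel_measurable M" "g \<in> borel_measurable M"
  shows "(\<lambda>\<omega>. f \<omega> *v g \<omega>) \<in> borel_measurable M"
proof -
  have "continuous_on UNIV (\<lambda>x. fst x *v snd x :: real^'m)" for x :: "(real^'n^'m) \<times> (real^'n)"
    unfolding matrix_vector_mult_def by (intro continuous_on_vec_lambda continuous_intros)
  then have "(\<lambda>x. fst x *v snd x :: real^'m) \<in> borel_measurable (borel :: ((real^'n^'m) \<times> (real^'n)) measure)"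
    by (intro borel_measurable_continuous_onI) 
  from measurable_compose[OF _ this, of "\<lambda>\<omega>. (f \<omega>, g \<omega>)" M]
  show ?thesis by simp
qed

text \<open>Independence read as an equality of measures: on \<open>F\<close>, the measure whose
  density is the indicator of \<open>C\<close> is \<open>prob C\<close> times the original one.
  Restriction to \<open>F\<close> is expressed as the image under the identity map from
  \<open>M\<close> to \<open>F\<close>.\<close>

lemma (in prob_space) integral_indicator_indep:
  fixes H :: "'a \<Rightarrow> 'b::{banach,second_countable_topology}"
  assumes sub: "subalgebra M F" and C: "C \<in> events"
    and ind: "\<And>E. E \<in> sets F \<Longrightarrow> prob (C \<inter> E) = prob C * prob E"
    and H: "H \<in> borel_measurable F"
  shows "(\<integral>\<omega>. indicator C \<omega> *\<^sub>R H \<omega> \<partial>M) = prob C *\<^sub>R (\<integral>\<omega>. H \<omega> \<partial>M)"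
proof -
  have idF: "(\<lambda>\<omega>. \<omega>) \<in> measurable M F"
    using sub by (auto simp: subalgebra_def measurable_def intro: sets.sets_into_space[THEN Int_absorb1] subsetD)
  have HM: "H \<in> borel_measurable M"
    using measurable_compose[OF idF H] by simp
  have idD: "(\<lambda>\<omega>. \<omega>) \<in> measurable (density M (indicator C)) F"
    using idF by simp
  have eq: "distr (density M (indicator C)) F (\<lambda>\<omega>. \<omega>) = density (distr M F (\<lambda>\<omega>. \<omega>)) (\<lambda>_. ennreal (prob C))"
  proof (rule measure_eqI)
    fix E assume "E \<in> sets (distr (density M (indicator C)) F (\<lambda>\<omega>. \<omega>))"
    then have E: "E \<in> sets F" by simp
    then have EM: "E \<in> sets M" using sub by (auto simp: subalgebra_def)
    then have sp: "(\<lambda>\<omega>. \<omega>) -` E \<inter> space M = E" using sets.sets_into_space by auto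
    have "emeasure (density M (indicator C)) E = (\<integral>\<^sup>+\<omega>. indicator (C \<inter> E) \<omega> \<partial>M)"
      using EM C by (subst emeasure_density) (auto intro!: nn_integral_cong simp: indicator_def simp del: nn_integral_indicator)
    also have "\<dots> = emeasure M (C \<inter> E)"
      using EM C by (intro nn_integral_indicator) auto
    also have "\<dots> = emeasure M C * emeasure M E"
      using ind[OF E] by (simp add: emeasure_eq_measure ennreal_mult)
    finally show "emeasure (distr (density M (indicator C)) F (\<lambda>\<omega>. \<omega>)) E
        = emeasure (density (distr M F (\<lambda>\<omega>. \<omega>)) (\<lambda>_. ennreal (prob C))) E"
      using E EM sp idF idD by (simp add: emeasure_distr emeasure_density_const emeasure_eq_measure)
  qed simp
  have "(\<integral>\<omega>. indicator C \<omega> *\<^sub>R H \<omega> \<partial>M) = (\<integral>\<omega>. H \<omega> \<partial>density M (\<lambda>\<omega>. ennreal (indicator C \<omega>)))"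
    using HM C by (subst integral_density) auto
  also have "\<dots> = (\<integral>\<omega>. H \<omega> \<partial>distr (density M (indicator C)) F (\<lambda>\<omega>. \<omega>))"
    using H idD by (subst integral_distr) (auto simp: ennreal_indicator)
  also have "\<dots> = prob C *\<^sub>R (\<integral>\<omega>. H \<omega> \<partial>distr M F (\<lambda>\<omega>. \<omega>))"
    unfolding eq using H by (subst integral_density) (auto simp: measure_nonneg)
  also have "(\<integral>\<omega>. H \<omega> \<partial>distr M F (\<lambda>\<omega>. \<omega>)) = (\<integral>\<omega>. H \<omega> \<partial>M)"
    using H idF by (subst integral_distr) auto
  finally show ?thesis .
qed

text \<open>Subtraction modulo n with representatives 1, ..., n: the orbit of the index
  \<open>k\<close> under the cyclic shift.\<close>

lemma bij_betw_reflect: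
  fixes k n :: nat
  assumes "1 \<le> k" "k \<le> n"
  shows "bij_betw (\<lambda>i. if i < k then k - i else k + n - i) {..<n} {1..n}"
  by (rule bij_betwI[where g="\<lambda>j. if j \<le> k then k - j else k + n - j"]) (use assms in auto)

context merws
begin

section \<open>The natural filtration and the independence of the next step from it\<close>

definition F :: "nat \<Rightarrow> 'w measure" where
  "F n = sigma (space M) (\<Union>k\<in>{1..n}. sigma_rv M borel (X k))"

text \<open>Strong induction, because a step refers back to an arbitrary earlier index; that index
  takes finitely many values, so the selected step is measurable.\<close>

lemma X_measurable [measurable]: "1 \<le> k \<Longrightarrow> X k \<in> borel_measurable M"
proof (induction k rule: less_induct)
  case (less k)
  show ?case
  proof (cases "k = 1")
    case False
    obtain n where n: "k = n + 1" "1 \<le> n" using less.prems False by (intro that[of "k - 1"]) auto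
    have [measurable]: "U (n + 1) \<in> measurable M (count_space {1..n})" using U_rv[OF n(2)] .
    have [measurable]: "A (n + 1) \<in> borel_measurable M" using A_rv[OF n(2)] .
    have "(\<lambda>\<omega>. X (U (n + 1) \<omega>) \<omega>) \<in> borel_measurable M"
    proof (rule measurable_compose_countable'[where I="{1..n}" and f=X])
      show "X i \<in> borel_measurable M" if "i \<in> {1..n}" for i
        using less.IH[of i] that n by auto
      show "U (n + 1) \<in> measurable M (count_space {1..n})" using U_rv[OF n(2)] .
      show "countable {1..n}" by simp
    qed
    then have "(\<lambda>\<omega>. A (n + 1) \<omega> *v X (U (n + 1) \<omega>) \<omega>) \<in> borel_measurable M"
      by measurable
    also have "?this \<longleftrightarrow> X (n + 1) \<in> borel_measurable M"
      by (rule measurable_cong) (use step[OF n(2)] in auto)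
    finally show ?thesis by (simp add: n)
  qed (use X1_rv in simp)
qed

lemma F_gen_events: "(\<Union>k\<in>{1..n}. sigma_rv M borel (X k)) \<subseteq> events"
proof (rule UN_least)
  fix k assume "k \<in> {1..n}"
  then show "sigma_rv M borel (X k) \<subseteq> events" by (intro sigma_rv_subset X_measurable) auto
qed

lemma F_gen_Pow: "(\<Union>k\<in>{1..n}. sigma_rv M borel (X k)) \<subseteq> Pow (space M)"
  using F_gen_events sets.space_closed by blast

lemma space_F [simp]: "space (F n) = space M"
  unfolding F_def by (rule space_measure_of[OF F_gen_Pow])

lemma sets_F: "sets (F n) = sigma_sets (space M) (\<Union>k\<in>{1..n}. sigma_rv M borel (X k))"
  unfolding F_def by (rule sets_measure_of[OF F_gen_Pow])

lemma F_subalgebra: "subalgebra M (F n)"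
proof -
  have "sigma_sets (space M) (\<Union>k\<in>{1..n}. sigma_rv M borel (X k)) \<subseteq> sets M"
    by (rule sets.sigma_sets_subset[OF F_gen_events])
  then show ?thesis by (simp add: subalgebra_def sets_F)
qed

lemma F_mono: "m \<le> n \<Longrightarrow> f \<in> measurable (F m) N \<Longrightarrow> f \<in> measurable (F n) N"
proof -
  assume mn: "m \<le> n"
  have "sets (F m) \<subseteq> sets (F n)"
    unfolding sets_F
  proof (rule sigma_sets_mono', rule UN_mono)
    show "{1..m} \<subseteq> {1..n}" using mn by simp
  qed (rule subset_refl)
  then show "f \<in> measurable (F m) N \<Longrightarrow> f \<in> measurable (F n) N"
    by (auto simp: measurable_def)
qed

lemma F_measurable: "f \<in> measurable (F n) N \<Longrightarrow> f \<in> measurable M N"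
  by (rule measurable_from_subalg[OF F_subalgebra])

lemma X_F [measurable]: "1 \<le> k \<Longrightarrow> k \<le> n \<Longrightarrow> X k \<in> borel_measurable (F n)"
proof (rule measurableI)
  fix S :: "(real^'d) set" assume "1 \<le> k" "k \<le> n" "S \<in> sets borel"
  then have "X k -` S \<inter> space M \<in> (\<Union>k\<in>{1..n}. sigma_rv M borel (X k))"
    by (auto simp: sigma_rv_eq intro!: bexI[of _ k])
  then show "X k -` S \<inter> space (F n) \<in> sets (F n)"
    unfolding sets_F by auto
qed auto

lemma indep_step:
  assumes n: "1 \<le> n" and j: "j \<in> {1..n}" and E: "E \<in> sets (F n)"
  shows "prob ({\<omega>\<in>space M. A (n + 1) \<omega> = B \<and> U (n + 1) \<omega> = j} \<inter> E)
    = prob {\<omega>\<in>space M. A (n + 1) \<omega> = B} * (1 / n) * prob E"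
proof -
  define GG where "GG = (!) [sigma_rv M borel (A (n + 1)),
                sigma_rv M (count_space {1..n}) (U (n + 1)),
                sigma_sets (space M) (\<Union>k\<in>{1..n}. sigma_rv M borel (X k))]"
  define EE where "EE = (!) [{\<omega>\<in>space M. A (n + 1) \<omega> = B}, {\<omega>\<in>space M. U (n + 1) \<omega> = j}, E]"
  have three: "{..<3} = {0, 1, 2::nat}" by auto
  have "prob (\<Inter>i\<in>{..<3}. EE i) = (\<Prod>i\<in>{..<3}. prob (EE i))"
  proof (rule indep_setsD)
    show "indep_sets GG {..<3}" unfolding GG_def by (rule indep[OF n])
    have "{\<omega>\<in>space M. A (n + 1) \<omega> = B} \<in> sigma_rv M borel (A (n + 1))"
      by (auto simp: sigma_rv_eq intro!: exI[of _ "{B}"])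
    moreover have "{\<omega>\<in>space M. U (n + 1) \<omega> = j} \<in> sigma_rv M (count_space {1..n}) (U (n + 1))"
      using measurable_space[OF U_rv[OF n]] j
      by (subst sigma_rv_eq) (auto intro!: exI[of _ "{j}"])
    ultimately show "\<forall>i\<in>{..<3}. EE i \<in> GG i"
      unfolding three using E by (simp add: EE_def GG_def sets_F numeral_2_eq_2)
    show "{..<3::nat} \<subseteq> {..<3}" "finite {..<3::nat}" "{..<3::nat} \<noteq> {}" by (simp_all add: three)
  qed
  then have "prob ({\<omega>\<in>space M. A (n + 1) \<omega> = B} \<inter> ({\<omega>\<in>space M. U (n + 1) \<omega> = j} \<inter> E))
    = prob {\<omega>\<in>space M. A (n + 1) \<omega> = B} * (prob {\<omega>\<in>space M. U (n + 1) \<omega> = j} * prob E)"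
    unfolding three by (simp add: EE_def numeral_2_eq_2)
  moreover have "{\<omega>\<in>space M. A (n + 1) \<omega> = B} \<inter> ({\<omega>\<in>space M. U (n + 1) \<omega> = j} \<inter> E)
     = {\<omega>\<in>space M. A (n + 1) \<omega> = B \<and> U (n + 1) \<omega> = j} \<inter> E" by auto
  ultimately show ?thesis using U_uniform[OF n j] by simp
qed

section \<open>The values of the random matrix as bijections of the signed basis vectors\<close>

abbreviation J :: "real^'d^'d" where "J \<equiv> cyclic_matrix b"

definition rot :: "nat \<Rightarrow> real^'d^'d" where "rot i = matrix_power J i"

definition pos :: "'d \<Rightarrow> nat" where "pos x = inv_into {1..CARD('d)} b x"

lemma d_pos: "1 \<le> CARD('d)" by (simp add: Suc_leI)

lemma b_pos: "b (pos x) = x" and pos_mem: "pos x \<in> {1..CARD('d)}"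
proof -
  have "x \<in> b ` {1..CARD('d)}" using enum by (auto simp: bij_betw_def)
  then show "b (pos x) = x" "pos x \<in> {1..CARD('d)}"
    unfolding pos_def by (rule f_inv_into_f, rule inv_into_into)
qed

lemma pos_b: "k \<in> {1..CARD('d)} \<Longrightarrow> pos (b k) = k"
  unfolding pos_def using enum by (intro inv_into_f_f) (auto simp: bij_betw_def)

lemma b_eq_iff: "k \<in> {1..CARD('d)} \<Longrightarrow> l \<in> {1..CARD('d)} \<Longrightarrow> b k = b l \<longleftrightarrow> k = l"
  by (metis pos_b)

text \<open>Column \<open>b k\<close> of \<open>J\<close> has its single 1 in row
  \<open>b (k - 1)\<close>, cyclically, so \<open>J\<close> lowers the index by one and sends the
  first basis vector to the last.\<close>

lemma J_axis:
  assumes k: "k \<in> {1..CARD('d)}"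
  shows "J *v axis (b k) 1 = axis (b (if k = 1 then CARD('d) else k - 1)) 1"
proof (rule vec_eq_iff[THEN iffD2], rule allI)
  fix i
  have "(J *v axis (b k) 1) $ i = J $ i $ b k"
    by (simp add: matrix_vector_mult_basis column_def)
  also have "\<dots> = (if i = b (if k = 1 then CARD('d) else k - 1) then 1 else 0)"
  proof -
    have ex: "(\<exists>l\<in>{1..<CARD('d)}. i = b l \<and> b k = b (l + 1)) \<longleftrightarrow> 2 \<le> k \<and> i = b (k - 1)"
    proof
      assume "\<exists>l\<in>{1..<CARD('d)}. i = b l \<and> b k = b (l + 1)"
      then obtain l where "l \<in> {1..<CARD('d)}" "i = b l" "b k = b (l + 1)" by blast
      then show "2 \<le> k \<and> i = b (k - 1)" using b_eq_iff[OF k, of "l + 1"] by auto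
    next
      assume "2 \<le> k \<and> i = b (k - 1)"
      then show "\<exists>l\<in>{1..<CARD('d)}. i = b l \<and> b k = b (l + 1)"
        using k by (intro bexI[of _ "k - 1"]) auto
    qed
    have b1: "b k = b 1 \<longleftrightarrow> k = 1" using b_eq_iff[OF k, of 1] d_pos by simp
    have "J $ i $ b k = (if (\<exists>l\<in>{1..<CARD('d)}. i = b l \<and> b k = b (l + 1)) \<or> (i = b CARD('d) \<and> b k = b 1) then 1 else 0)"
      unfolding cyclic_matrix_def by (simp only: vec_lambda_beta)
    also have "((\<exists>l\<in>{1..<CARD('d)}. i = b l \<and> b k = b (l + 1)) \<or> (i = b CARD('d) \<and> b k = b 1))
        \<longleftrightarrow> i = b (if k = 1 then CARD('d) else k - 1)"
      unfolding ex b1 using k by (cases "k = 1") auto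
    finally show ?thesis .
  qed
  finally show "(J *v axis (b k) 1) $ i = axis (b (if k = 1 then CARD('d) else k - 1)) 1 $ i"
    by (simp add: axis_def)
qed

lemma rot_Suc: "rot (Suc i) = J ** rot i"
  by (simp add: rot_def matrix_power_def)

lemma rot_0: "rot 0 = mat 1"
  by (simp add: rot_def matrix_power_def)

lemma rot_axis:
  assumes k: "k \<in> {1..CARD('d)}" and i: "i < CARD('d)"
  shows "rot i *v axis (b k) 1 = axis (b (if i < k then k - i else k + CARD('d) - i)) 1"
  using i
proof (induction i)
  case 0 then show ?case using k by (simp add: rot_0)
next
  case (Suc i)
  let ?l = "if i < k then k - i else k + CARD('d) - i"
  have l: "?l \<in> {1..CARD('d)}" using k Suc by auto
  have "rot (Suc i) *v axis (b k) 1 = J *v axis (b ?l) 1"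
    using Suc by (simp add: rot_Suc matrix_vector_mul_assoc[symmetric])
  also have "\<dots> = axis (b (if ?l = 1 then CARD('d) else ?l - 1)) 1" by (rule J_axis[OF l])
  also have "(if ?l = 1 then CARD('d) else ?l - 1) = (if Suc i < k then k - Suc i else k + CARD('d) - Suc i)"
    using k Suc.prems by (auto split: if_splits)
  finally show ?case .
qed

text \<open>The powers of the cyclic shift act simply transitively on the basis: each basis vector
  is reached from a given one by exactly one power below d.\<close>

lemma rot_axis_bij:
  "bij_betw (\<lambda>i. rot i *v axis x 1) {..<CARD('d)} (Basis :: (real^'d) set)"
proof -
  define k where "k = pos x"
  have k: "k \<in> {1..CARD('d)}" and bk: "b k = x" using pos_mem b_pos by (auto simp: k_def)
  let ?f = "\<lambda>i. if i < k then k - i else k + CARD('d) - i"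
  have "bij_betw ?f {..<CARD('d)} {1..CARD('d)}"
    using k by (intro bij_betw_reflect) auto
  then have "bij_betw (b \<circ> ?f) {..<CARD('d)} (UNIV :: 'd set)"
    by (rule bij_betw_trans[OF _ enum])
  moreover have "bij_betw (\<lambda>i::'d. axis i (1::real)) UNIV (Basis :: (real^'d) set)"
    by (auto simp: bij_betw_def inj_on_def axis_eq_axis Basis_vec_def)
  ultimately have "bij_betw ((\<lambda>i::'d. axis i (1::real)) \<circ> (b \<circ> ?f)) {..<CARD('d)} (Basis :: (real^'d) set)"
    by (rule bij_betw_trans)
  moreover have "((\<lambda>i::'d. axis i (1::real)) \<circ> (b \<circ> ?f)) i = rot i *v axis x 1" if "i \<in> {..<CARD('d)}" for i
    using rot_axis[OF k, of i] that bk by simp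
  ultimately show ?thesis
    using bij_betw_cong[of "{..<CARD('d)}" "(\<lambda>i::'d. axis i (1::real)) \<circ> (b \<circ> ?f)" "\<lambda>i. rot i *v axis x 1" Basis] by blast
qed

definition units :: "(real^'d) set" where "units = Basis \<union> uminus ` Basis"

lemma finite_units [simp]: "finite units" by (simp add: units_def)

lemma norm_units: "y \<in> units \<Longrightarrow> norm y = 1" by (auto simp: units_def)

lemma zero_not_units [simp]: "0 \<notin> units" using norm_units[of 0] by auto

lemma scaled_Basis_inj:
  fixes e e' :: "real^'d"
  assumes "e \<in> Basis" "e' \<in> Basis" "s \<in> {1, - 1 :: real}" "s' \<in> {1, - 1}" "s *\<^sub>R e = s' *\<^sub>R e'"
  shows "s = s' \<and> e = e'"
proof -
  have "s = (s *\<^sub>R e) \<bullet> e" using assms(1) by (simp add: inner_Basis)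
  also have "\<dots> = s' * (e' \<bullet> e)" using assms(5) by simp
  finally show ?thesis using assms by (auto simp: inner_Basis split: if_splits)
qed

lemma sum_units: "(\<Sum>y\<in>units. f y) = (\<Sum>e\<in>Basis. f e + f (- e))"
  for f :: "real^'d \<Rightarrow> 'b::comm_monoid_add"
proof -
  have "(Basis :: (real^'d) set) \<inter> uminus ` Basis = {}"
    using scaled_Basis_inj[of _ _ 1 "- 1"] by fastforce
  then have "(\<Sum>y\<in>units. f y) = (\<Sum>y\<in>Basis. f y) + (\<Sum>y\<in>uminus ` Basis. f y)"
    unfolding units_def by (intro sum.union_disjoint) auto
  also have "(\<Sum>y\<in>uminus ` Basis. f y) = (\<Sum>e\<in>Basis. f (- e))"
    by (subst sum.reindex) (auto simp: inj_on_def)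
  finally show ?thesis by (simp add: sum.distrib)
qed

lemma units_iff: "y \<in> units \<longleftrightarrow> (\<exists>s\<in>{1, - 1 :: real}. \<exists>e\<in>Basis. y = s *\<^sub>R e)"
  by (auto simp: units_def)

text \<open>Labels for the 2 d nonzero values of the random matrix: an exponent of the cyclic matrix
  and a sign. The label \<open>(0, 1)\<close> stands for the identity.\<close>

definition idx :: "(nat \<times> real) set" where "idx = {..<CARD('d)} \<times> {1, - 1}"

definition sm :: "nat \<times> real \<Rightarrow> real^'d^'d" where "sm m = snd m *\<^sub>R rot (fst m)"

definition wt :: "nat \<times> real \<Rightarrow> real" where "wt m = (if m = (0, 1) then p else q)"

lemma finite_idx [simp]: "finite idx" by (simp add: idx_def)

lemma idx01: "(0, 1) \<in> idx" by (simp add: idx_def)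

lemma sm01: "sm (0, 1) = mat 1" by (simp add: sm_def rot_0)

lemma sm_mult: "sm m *v x = snd m *\<^sub>R (rot (fst m) *v x)"
  by (simp add: sm_def scaleR_matrix_vector_assoc)

text \<open>Simple transitivity including signs: the rotations act simply transitively on the basis
  and the sign is chosen freely, so each signed basis vector is hit by exactly one of the 2 d
  matrices.\<close>

lemma sm_units_bij:
  assumes "x \<in> units" shows "bij_betw (\<lambda>m. sm m *v x) idx units"
proof -
  obtain s c where s: "s \<in> {1, - 1 :: real}" and x: "x = s *\<^sub>R axis c 1"
  proof -
    obtain s e where se: "s \<in> {1, - 1 :: real}" "e \<in> Basis" "x = s *\<^sub>R e"
      using assms unfolding units_iff by blast
    obtain c where "e = axis c 1" using se(2) by (auto simp: Basis_vec_def)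
    then show thesis using that se by blast
  qed
  have val: "sm m *v x = (snd m * s) *\<^sub>R (rot (fst m) *v axis c 1)" for m
    by (simp add: sm_mult x matrix_vector_mult_scaleR)
  have B: "i < CARD('d) \<Longrightarrow> rot i *v axis c 1 \<in> Basis" for i
    using rot_axis_bij[of c] unfolding bij_betw_def by blast
  show ?thesis
    unfolding bij_betw_def
  proof
    show "inj_on (\<lambda>m. sm m *v x) idx"
    proof (rule inj_onI)
      fix m m' assume m: "m \<in> idx" "m' \<in> idx" "sm m *v x = sm m' *v x"
      have i: "fst m < CARD('d)" "fst m' < CARD('d)" and t: "snd m \<in> {1, - 1}" "snd m' \<in> {1, - 1}"
        using m by (simp_all add: idx_def mem_Times_iff)
      have ts: "snd m * s \<in> {1, - 1}" "snd m' * s \<in> {1, - 1}" using t s by auto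
      from scaled_Basis_inj[OF B[OF i(1)] B[OF i(2)] ts]
      have "snd m * s = snd m' * s" "rot (fst m) *v axis c 1 = rot (fst m') *v axis c 1"
        using m(3) unfolding val by blast+
      moreover have "inj_on (\<lambda>i. rot i *v axis c 1) {..<CARD('d)}"
        using rot_axis_bij[of c] by (rule bij_betw_imp_inj_on)
      ultimately show "m = m'"
        using i s by (auto simp: inj_on_def prod_eq_iff)
    qed
    show "(\<lambda>m. sm m *v x) ` idx = units"
    proof
      show "(\<lambda>m. sm m *v x) ` idx \<subseteq> units"
      proof (rule image_subsetI)
        fix m assume m: "m \<in> idx"
        have i: "fst m < CARD('d)" and t: "snd m \<in> {1, - 1}"
          using m by (simp_all add: idx_def mem_Times_iff)
        have "snd m * s \<in> {1, - 1}" using t s by auto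
        then show "sm m *v x \<in> units" unfolding units_iff val using B[OF i] by blast
      qed
      show "units \<subseteq> (\<lambda>m. sm m *v x) ` idx"
      proof
        fix y assume "y \<in> units"
        then obtain t e where t: "t \<in> {1, - 1 :: real}" and e: "e \<in> Basis" and y: "y = t *\<^sub>R e"
          unfolding units_iff by blast
        have "e \<in> (\<lambda>i. rot i *v axis c 1) ` {..<CARD('d)}"
          using rot_axis_bij[of c] e unfolding bij_betw_def by simp
        then obtain i where i: "i \<in> {..<CARD('d)}" "e = rot i *v axis c 1" by blast
        have "(i, t * s) \<in> idx" using i(1) t s by (auto simp: idx_def)
        moreover have "sm (i, t * s) *v x = y" using s by (auto simp: val y i(2))
        ultimately show "y \<in> (\<lambda>m. sm m *v x) ` idx" by blast
      qed
    qed
  qed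
qed

text \<open>Exactly one of the matrices sends a unit vector x to y; its weight is \<open>p\<close>
  if it is the identity, that is x = y, and \<open>q\<close> otherwise. The factor |x|^2 makes the
  formula valid for x = 0 as well, where both sides vanish.\<close>

lemma wt_sum_eq:
  assumes y: "y \<in> units" and x: "x \<in> insert 0 units"
  shows "(\<Sum>m\<in>idx. wt m * indicator {y} (sm m *v x)) = (p - q) * indicator {y} x + q * (norm x)\<^sup>2"
proof (cases "x = 0")
  case True then show ?thesis using y by (auto simp: indicator_def)
next
  case False
  then have xu: "x \<in> units" using x by simp
  have inj: "inj_on (\<lambda>m. sm m *v x) idx" and im: "(\<lambda>m. sm m *v x) ` idx = units"
    using sm_units_bij[OF xu] by (simp_all add: bij_betw_def)
  have "y \<in> (\<lambda>m. sm m *v x) ` idx" using im y by simp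
  then obtain m0 where m0: "m0 \<in> idx" "sm m0 *v x = y" by (elim imageE) simp
  have "(\<Sum>m\<in>idx. wt m * indicator {y} (sm m *v x)) = (\<Sum>m\<in>{m0}. wt m * indicator {y} (sm m *v x))"
    by (rule sum.mono_neutral_right) (use m0 inj in \<open>auto simp: inj_on_def indicator_def\<close>)
  also have "\<dots> = wt m0" using m0 by simp
  also have "\<dots> = (p - q) * indicator {y} x + q"
  proof (cases "x = y")
    case True
    then have "sm (0, 1) *v x = sm m0 *v x" using m0 by (simp add: sm01)
    then have "m0 = (0, 1)" using inj idx01 m0(1) by (auto simp: inj_on_def)
    then show ?thesis using True by (simp add: wt_def)
  next
    case False
    then have "m0 \<noteq> (0, 1)" using m0 by (auto simp: sm01)
    then show ?thesis using False by (simp add: wt_def)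
  qed
  finally show ?thesis using norm_units[OF xu] by simp
qed

lemma A_prob:
  assumes n: "1 \<le> n" and m: "m \<in> idx"
  shows "prob {\<omega>\<in>space M. A (n + 1) \<omega> = sm m} = wt m"
proof -
  obtain i s where ims: "m = (i, s)" "i < CARD('d)" "s = 1 \<or> s = - 1"
    using m unfolding idx_def by blast
  show ?thesis
  proof (cases "i = 0")
    case True
    then show ?thesis using A_id[OF n] ims by (auto simp: wt_def sm_def rot_0)
  next
    case False
    then have "i \<in> {1..<CARD('d)}" using ims by simp
    from A_cyclic[OF n this] show ?thesis
      using ims False by (auto simp: wt_def sm_def rot_def)
  qed
qed

lemma sm_inj: "inj_on sm idx"
proof (rule inj_onI)
  fix m m' assume m: "m \<in> idx" "m' \<in> idx" "sm m = sm m'"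
  have "axis (b 1) 1 \<in> units" by (auto simp: units_def Basis_vec_def)
  from bij_betw_imp_inj_on[OF sm_units_bij[OF this]] show "m = m'"
    using m by (auto simp: inj_on_def)
qed

lemma sm_nonzero: "m \<in> idx \<Longrightarrow> sm m \<noteq> 0"
proof
  assume m: "m \<in> idx" "sm m = 0"
  have u: "axis (b 1) 1 \<in> units" by (auto simp: units_def Basis_vec_def)
  have "sm m *v axis (b 1) 1 \<in> units"
    using sm_units_bij[OF u] m(1) by (auto simp: bij_betw_def)
  then show False using m(2) by simp
qed

lemma wt_total: "(\<Sum>m\<in>idx. wt m) = 1 - r"
proof -
  have "(\<Sum>m\<in>idx. wt m) = (\<Sum>m\<in>idx. q + (if m = (0, 1) then p - q else 0))"
    by (intro sum.cong) (auto simp: wt_def)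
  also have "\<dots> = q * real (card idx) + (p - q)"
    using idx01 by (simp add: sum.distrib)
  also have "card idx = 2 * CARD('d)" by (simp add: idx_def card_cartesian_product)
  finally show ?thesis using total by (simp add: algebra_simps)
qed

lemma AE_values:
  fixes Y :: "'w \<Rightarrow> 'v::{t2_space}"
  assumes Y: "Y \<in> borel_measurable M" and V: "finite V"
    and one: "(\<Sum>v\<in>V. prob {\<omega>\<in>space M. Y \<omega> = v}) = 1"
  shows "AE \<omega> in M. Y \<omega> \<in> V"
proof -
  have ev: "{\<omega>\<in>space M. Y \<omega> = v} \<in> events" for v
    using measurable_sets[OF Y, of "{v}"] by (simp add: vimage_def Int_def conj_commute)
  have "prob (\<Union>v\<in>V. {\<omega>\<in>space M. Y \<omega> = v}) = (\<Sum>v\<in>V. prob {\<omega>\<in>space M. Y \<omega> = v})"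
    by (rule finite_measure_finite_Union[OF V]) (use ev in \<open>auto simp: disjoint_family_on_def\<close>)
  then have "prob (\<Union>v\<in>V. {\<omega>\<in>space M. Y \<omega> = v}) = 1" using one by simp
  from AE_prob_1[OF this] show ?thesis by eventually_elim auto
qed

lemma AE_A: assumes n: "1 \<le> n" shows "AE \<omega> in M. A (n + 1) \<omega> \<in> insert 0 (sm ` idx)"
proof (rule AE_values)
  show "A (n + 1) \<in> borel_measurable M" by (rule A_rv[OF n])
  have "(\<Sum>v\<in>sm ` idx. prob {\<omega>\<in>space M. A (n + 1) \<omega> = v}) = (\<Sum>m\<in>idx. wt m)"
    by (subst sum.reindex[OF sm_inj]) (use A_prob[OF n] in auto)
  moreover have "0 \<notin> sm ` idx" using sm_nonzero by fastforce
  ultimately show "(\<Sum>v\<in>insert 0 (sm ` idx). prob {\<omega>\<in>space M. A (n + 1) \<omega> = v}) = 1"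
    using A_zero[OF n] by (simp add: wt_total)
qed simp

lemma AE_X1: "AE \<omega> in M. X 1 \<omega> \<in> units"
proof (rule AE_values)
  have "(\<Sum>y\<in>units. prob {\<omega> \<in> space M. X 1 \<omega> = y}) = (\<Sum>e\<in>(Basis :: (real^'d) set). 1 / real CARD('d))"
    unfolding sum_units
  proof (rule sum.cong)
    fix e :: "real^'d" assume "e \<in> Basis"
    then obtain c where c: "e = axis c 1" by (auto simp: Basis_vec_def)
    from X1_uniform[OF pos_mem[of c]]
    show "prob {\<omega> \<in> space M. X 1 \<omega> = e} + prob {\<omega> \<in> space M. X 1 \<omega> = - e} = 1 / real CARD('d)"
      by (simp add: b_pos c)
  qed simp
  then show "(\<Sum>y\<in>units. prob {\<omega> \<in> space M. X 1 \<omega> = y}) = 1" by simp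
qed (use X1_rv in auto)

text \<open>The null sets of all times are discarded at once, so that the induction over
  \<open>k\<close> runs along a single path.\<close>

lemma AE_X: "AE \<omega> in M. X 1 \<omega> \<in> units \<and> (\<forall>k\<ge>1. X k \<omega> \<in> insert 0 units)"
proof -
  have "AE \<omega> in M. \<forall>n. 1 \<le> n \<longrightarrow> A (n + 1) \<omega> \<in> insert 0 (sm ` idx)"
    unfolding AE_all_countable
  proof
    fix n show "AE \<omega> in M. 1 \<le> n \<longrightarrow> A (n + 1) \<omega> \<in> insert 0 (sm ` idx)"
      using AE_A[of n] by (cases "1 \<le> n") auto
  qed
  with AE_X1 AE_space show ?thesis
  proof eventually_elim
    case (elim \<omega>)
    have "X k \<omega> \<in> insert 0 units" if "1 \<le> k" for k
      using that
    proof (induction k rule: less_induct)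
      case (less k)
      show ?case
      proof (cases "k = 1")
        case False
        define n where "n = k - 1"
        have n: "1 \<le> n" "k = n + 1" using False less.prems by (simp_all add: n_def)
        have U: "U (n + 1) \<omega> \<in> {1..n}" using measurable_space[OF U_rv[OF n(1)]] elim(2) by simp
        then have XU: "X (U (n + 1) \<omega>) \<omega> \<in> insert 0 units" using less.IH[of "U (n + 1) \<omega>"] n by simp
        have "A (n + 1) \<omega> \<in> insert 0 (sm ` idx)" using elim(3) n(1) by blast
        then have "A (n + 1) \<omega> *v X (U (n + 1) \<omega>) \<omega> \<in> insert 0 units"
        proof
          assume "A (n + 1) \<omega> \<in> sm ` idx"
          then obtain m where "m \<in> idx" "A (n + 1) \<omega> = sm m" by blast
          then show ?thesis using XU sm_units_bij unfolding bij_betw_def by auto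
        qed simp
        then show ?thesis using step[OF n(1) elim(2)] n(2) by simp
      qed (use elim(1) in simp)
    qed
    then show ?case using elim(1) by blast
  qed
qed

text \<open>For a unit vector \<open>y\<close> this is the conditional probability that step n + 1
  equals \<open>y\<close>, given the first n steps; see \<open>integral_step_indicator\<close>. It
  is kept as a sum over the earlier steps so that \<open>wt_sum_eq\<close> applies to each
  summand.\<close>

definition rate :: "nat \<Rightarrow> real^'d \<Rightarrow> 'w \<Rightarrow> real" where
  "rate n y \<omega> = (\<Sum>j=1..n. (p - q) * indicator {y} (X j \<omega>) + q * (norm (X j \<omega>))\<^sup>2) / n"

lemma integrable_bounded_scaleR:
  fixes H :: "'w \<Rightarrow> 'b::{banach,second_countable_topology}"
  assumes "integrable M H" "f \<in> borel_measurable M" "\<And>\<omega>. \<bar>f \<omega>\<bar> \<le> (C::real)"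
  shows "integrable M (\<lambda>\<omega>. f \<omega> *\<^sub>R H \<omega>)"
proof (rule Bochner_Integration.integrable_bound)
  have "0 \<le> C" using assms(3)[of undefined] by linarith
  then show "AE \<omega> in M. norm (f \<omega> *\<^sub>R H \<omega>) \<le> norm (C *\<^sub>R H \<omega>)"
    using assms(3) by (intro AE_I2) (simp add: mult_right_mono)
qed (use assms in auto)

lemma integral_double_sum:
  fixes f :: "'i \<Rightarrow> 'k \<Rightarrow> 'w \<Rightarrow> 'b::{banach,second_countable_topology}"
  assumes "\<And>j m. j \<in> I \<Longrightarrow> integrable M (f j m)"
  shows "(\<integral>\<omega>. (\<Sum>j\<in>I. \<Sum>m\<in>K. f j m \<omega>) \<partial>M) = (\<Sum>j\<in>I. \<Sum>m\<in>K. \<integral>\<omega>. f j m \<omega> \<partial>M)"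
  using assms by (simp add: Bochner_Integration.integral_sum Bochner_Integration.integrable_sum)

text \<open>The conditional probability in weak form, tested against integrable
  \<open>F n\<close>-measurable \<open>H\<close>, so that no version of a conditional expectation
  has to be chosen. The integrand is split by the values of the matrix and of the memory index; each
  such event is independent of \<open>F n\<close>.\<close>

lemma integral_step_indicator:
  fixes H :: "'w \<Rightarrow> 'b::{banach,second_countable_topology}"
  assumes n: "1 \<le> n" and y: "y \<in> units" and HF: "H \<in> borel_measurable (F n)" and H: "integrable M H"
  shows "(\<integral>\<omega>. indicator {y} (X (n + 1) \<omega>) *\<^sub>R H \<omega> \<partial>M) = (\<integral>\<omega>. rate n y \<omega> *\<^sub>R H \<omega> \<partial>M)"
proof -
  define C where "C j m = {\<omega>\<in>space M. A (n + 1) \<omega> = sm m \<and> U (n + 1) \<omega> = j}" for j m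
  define g where "g j m \<omega> = (indicator {y} (sm m *v X j \<omega>) :: real)" for j m \<omega>
  have [measurable]: "A (n + 1) \<in> borel_measurable M" using A_rv[OF n] .
  have [measurable]: "U (n + 1) \<in> measurable M (count_space {1..n})" using U_rv[OF n] .
  have CE: "C j m \<in> events" if "j \<in> {1..n}" for j m
  proof -
    have "{\<omega>\<in>space M. A (n + 1) \<omega> = sm m} \<in> events" by measurable
    moreover have "U (n + 1) -` {j} \<inter> space M \<in> events"
      using that by (intro measurable_sets[OF U_rv[OF n]]) auto
    moreover have "C j m = {\<omega>\<in>space M. A (n + 1) \<omega> = sm m} \<inter> (U (n + 1) -` {j} \<inter> space M)"
      by (auto simp: C_def)
    ultimately show ?thesis by simp
  qed
  have gF: "g j m \<in> borel_measurable (F n)" if "j \<in> {1..n}" for j m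
  proof -
    have [measurable]: "X j \<in> borel_measurable (F n)" using that by (intro X_F) auto
    show ?thesis unfolding g_def by measurable
  qed
  have gM: "g j m \<in> borel_measurable M" if "j \<in> {1..n}" for j m
    by (rule F_measurable[OF gF[OF that]])
  have gb: "\<bar>g j m \<omega>\<bar> \<le> 1" for j m \<omega> by (simp add: g_def indicator_def)
  have gH: "integrable M (\<lambda>\<omega>. g j m \<omega> *\<^sub>R H \<omega>)" if "j \<in> {1..n}" for j m
    by (rule integrable_bounded_scaleR[OF H gM[OF that] gb])
  have CgH: "integrable M (\<lambda>\<omega>. indicator (C j m) \<omega> *\<^sub>R (g j m \<omega> *\<^sub>R H \<omega>))" if "j \<in> {1..n}" for j m
    by (rule integrable_mult_indicator[OF CE[OF that] gH[OF that]])
  \<comment> \<open>At most one pair (j, m) contributes: the actual memory index and the label of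
    the actual matrix, unique by \<open>sm_inj\<close>. If the matrix is 0, all summands vanish, and
    so does the left side because \<open>y\<close> is not 0.\<close>
  have ae: "AE \<omega> in M. indicator {y} (X (n + 1) \<omega>) *\<^sub>R H \<omega>
     = (\<Sum>j\<in>{1..n}. \<Sum>m\<in>idx. indicator (C j m) \<omega> *\<^sub>R (g j m \<omega> *\<^sub>R H \<omega>))"
    using AE_A[OF n] AE_space
  proof eventually_elim
    case (elim \<omega>)
    define j0 where "j0 = U (n + 1) \<omega>"
    have U: "j0 \<in> {1..n}" using measurable_space[OF U_rv[OF n]] elim(2) by (simp add: j0_def)
    have "(\<Sum>j\<in>{1..n}. \<Sum>m\<in>idx. indicator (C j m) \<omega> *\<^sub>R (g j m \<omega> *\<^sub>R H \<omega>))
      = (\<Sum>j\<in>{j0}. \<Sum>m\<in>idx. indicator (C j m) \<omega> *\<^sub>R (g j m \<omega> *\<^sub>R H \<omega>))"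
    proof (rule sum.mono_neutral_right)
      show "\<forall>j\<in>{1..n} - {j0}. (\<Sum>m\<in>idx. indicator (C j m) \<omega> *\<^sub>R (g j m \<omega> *\<^sub>R H \<omega>)) = 0"
        by (simp add: C_def j0_def)
    qed (use U in simp_all)
    also have "\<dots> = (\<Sum>m\<in>idx. indicator (C j0 m) \<omega> *\<^sub>R (g j0 m \<omega> *\<^sub>R H \<omega>))" by simp
    also have "\<dots> = indicator {y} (X (n + 1) \<omega>) *\<^sub>R H \<omega>"
    proof (cases "A (n + 1) \<omega> = 0")
      case True
      have z: "indicator (C j0 m) \<omega> *\<^sub>R (g j0 m \<omega> *\<^sub>R H \<omega>) = 0" if "m \<in> idx" for m
      proof -
        have "\<omega> \<notin> C j0 m" using sm_nonzero[OF that] True unfolding C_def by simp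
        then show ?thesis by simp
      qed
      have "X (n + 1) \<omega> = 0" using step[OF n elim(2)] True by simp
      moreover have "y \<noteq> 0" using y zero_not_units by blast
      ultimately have "indicator {y} (X (n + 1) \<omega>) *\<^sub>R H \<omega> = 0" by simp
      then show ?thesis using z by (simp only: sum.neutral_const sum.cong)
    next
      case False
      then obtain m0 where m0: "m0 \<in> idx" "A (n + 1) \<omega> = sm m0" using elim(1) by blast
      have "(\<Sum>m\<in>idx. indicator (C j0 m) \<omega> *\<^sub>R (g j0 m \<omega> *\<^sub>R H \<omega>))
         = (\<Sum>m\<in>{m0}. indicator (C j0 m) \<omega> *\<^sub>R (g j0 m \<omega> *\<^sub>R H \<omega>))"
      proof (rule sum.mono_neutral_right)
        show "\<forall>m\<in>idx - {m0}. indicator (C j0 m) \<omega> *\<^sub>R (g j0 m \<omega> *\<^sub>R H \<omega>) = 0"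
        proof
          fix m assume m: "m \<in> idx - {m0}"
          then have "sm m \<noteq> sm m0" using sm_inj m0(1) by (auto dest: inj_onD)
          then have "\<omega> \<notin> C j0 m" using m0(2) unfolding C_def by simp
          then show "indicator (C j0 m) \<omega> *\<^sub>R (g j0 m \<omega> *\<^sub>R H \<omega>) = 0" by simp
        qed
      qed (simp_all add: m0(1))
      also have "\<dots> = g j0 m0 \<omega> *\<^sub>R H \<omega>" using m0 elim(2) by (simp add: C_def j0_def)
      finally show ?thesis using step[OF n elim(2)] m0 by (simp add: g_def j0_def)
    qed
    finally show ?case ..
  qed
  have "(\<integral>\<omega>. indicator {y} (X (n + 1) \<omega>) *\<^sub>R H \<omega> \<partial>M)
      = (\<integral>\<omega>. (\<Sum>j\<in>{1..n}. \<Sum>m\<in>idx. indicator (C j m) \<omega> *\<^sub>R (g j m \<omega> *\<^sub>R H \<omega>)) \<partial>M)"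
  proof (rule integral_cong_AE[OF _ _ ae])
    have [measurable]: "H \<in> borel_measurable M" using H by auto
    have [measurable]: "X (n + 1) \<in> borel_measurable M" by (rule X_measurable) simp
    show "(\<lambda>\<omega>. indicator {y} (X (n + 1) \<omega>) *\<^sub>R H \<omega>) \<in> borel_measurable M" by measurable
    show "(\<lambda>\<omega>. \<Sum>j\<in>{1..n}. \<Sum>m\<in>idx. indicator (C j m) \<omega> *\<^sub>R (g j m \<omega> *\<^sub>R H \<omega>)) \<in> borel_measurable M"
      by (intro borel_measurable_sum borel_measurable_integrable[OF CgH])
  qed
  also have "\<dots> = (\<Sum>j\<in>{1..n}. \<Sum>m\<in>idx. \<integral>\<omega>. indicator (C j m) \<omega> *\<^sub>R (g j m \<omega> *\<^sub>R H \<omega>) \<partial>M)"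
    by (rule integral_double_sum) (rule CgH)
  also have "\<dots> = (\<Sum>j\<in>{1..n}. \<Sum>m\<in>idx. (wt m / n) *\<^sub>R (\<integral>\<omega>. g j m \<omega> *\<^sub>R H \<omega> \<partial>M))"
  proof (intro sum.cong refl)
    fix j m assume j: "j \<in> {1..n}" and m: "m \<in> idx"
    have pC: "prob (C j m) = wt m / n"
    proof -
      have sp: "space M \<in> sets (F n)" using sets.top[of "F n"] by simp
      have "prob (C j m \<inter> space M) = wt m * (1 / n) * 1"
        unfolding C_def using indep_step[OF n j sp, of "sm m"] A_prob[OF n m] prob_space by (simp only:)
      moreover have "C j m \<inter> space M = C j m" unfolding C_def by blast
      ultimately show ?thesis by simp
    qed
    have "(\<integral>\<omega>. indicator (C j m) \<omega> *\<^sub>R (g j m \<omega> *\<^sub>R H \<omega>) \<partial>M) = prob (C j m) *\<^sub>R (\<integral>\<omega>. g j m \<omega> *\<^sub>R H \<omega> \<partial>M)"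
    proof (rule integral_indicator_indep[OF F_subalgebra[of n] CE[OF j]])
      fix E assume E: "E \<in> sets (F n)"
      show "prob (C j m \<inter> E) = prob (C j m) * prob E"
        unfolding pC using indep_step[OF n j E, of "sm m"] A_prob[OF n m] unfolding C_def by simp
    next
      show "(\<lambda>\<omega>. g j m \<omega> *\<^sub>R H \<omega>) \<in> borel_measurable (F n)"
        by (rule borel_measurable_scaleR[OF gF[OF j] HF])
    qed
    then show "(\<integral>\<omega>. indicator (C j m) \<omega> *\<^sub>R (g j m \<omega> *\<^sub>R H \<omega>) \<partial>M) = (wt m / n) *\<^sub>R (\<integral>\<omega>. g j m \<omega> *\<^sub>R H \<omega> \<partial>M)"
      unfolding pC .
  qed
  also have "\<dots> = (\<Sum>j\<in>{1..n}. \<Sum>m\<in>idx. \<integral>\<omega>. (wt m / n) *\<^sub>R (g j m \<omega> *\<^sub>R H \<omega>) \<partial>M)"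
    by (simp only: integral_scaleR_right)
  also have "\<dots> = (\<integral>\<omega>. (\<Sum>j\<in>{1..n}. \<Sum>m\<in>idx. (wt m / n) *\<^sub>R (g j m \<omega> *\<^sub>R H \<omega>)) \<partial>M)"
    by (rule integral_double_sum[symmetric]) (rule integrable_scaleR_right[OF gH])
  also have "\<dots> = (\<integral>\<omega>. rate n y \<omega> *\<^sub>R H \<omega> \<partial>M)"
  proof (rule integral_cong_AE)
    show "(\<lambda>\<omega>. \<Sum>j\<in>{1..n}. \<Sum>m\<in>idx. (wt m / n) *\<^sub>R (g j m \<omega> *\<^sub>R H \<omega>)) \<in> borel_measurable M"
      by (intro borel_measurable_sum borel_measurable_integrable[OF integrable_scaleR_right[OF gH]])
    have [measurable]: "H \<in> borel_measurable M" using H by auto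
    have [measurable]: "rate n y \<in> borel_measurable M"
      unfolding rate_def[abs_def] by (intro borel_measurable_divide borel_measurable_sum borel_measurable_add borel_measurable_times borel_measurable_const borel_measurable_power borel_measurable_norm measurable_compose[OF X_measurable borel_measurable_indicator] X_measurable) auto
    show "(\<lambda>\<omega>. rate n y \<omega> *\<^sub>R H \<omega>) \<in> borel_measurable M" by measurable
    \<comment> \<open>The sum over the labels is evaluated by \<open>wt_sum_eq\<close> at
      \<open>X j \<omega>\<close>, which has to be 0 or a unit vector; hence the identity holds
      almost everywhere.\<close>
    show "AE \<omega> in M. (\<Sum>j\<in>{1..n}. \<Sum>m\<in>idx. (wt m / n) *\<^sub>R (g j m \<omega> *\<^sub>R H \<omega>)) = rate n y \<omega> *\<^sub>R H \<omega>"
      using AE_X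
    proof eventually_elim
      case (elim \<omega>)
      have "(\<Sum>j\<in>{1..n}. \<Sum>m\<in>idx. (wt m / n) *\<^sub>R (g j m \<omega> *\<^sub>R H \<omega>))
        = (\<Sum>j\<in>{1..n}. (\<Sum>m\<in>idx. wt m * g j m \<omega>) / n) *\<^sub>R H \<omega>"
        by (simp add: scaleR_sum_left sum_divide_distrib)
      also have "(\<Sum>j\<in>{1..n}. (\<Sum>m\<in>idx. wt m * g j m \<omega>) / n) = rate n y \<omega>"
        unfolding rate_def sum_divide_distrib[symmetric] g_def
      proof (intro arg_cong[where f="\<lambda>x. x / real n"] sum.cong refl)
        fix j assume "j \<in> {1..n}"
        then have "X j \<omega> \<in> insert 0 units" using elim by simp
        from wt_sum_eq[OF y this]
        show "(\<Sum>m\<in>idx. wt m * indicator {y} (sm m *v X j \<omega>)) = (p - q) * indicator {y} (X j \<omega>) + q * (norm (X j \<omega>))\<^sup>2" .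
      qed
      finally show ?case .
    qed
  qed
  finally show ?thesis .
qed

section \<open>Pathwise identities on an almost sure event\<close>

lemma alpha_eq: "1 - r = (p - q) + 2 * real CARD('d) * q"
  using total by (simp add: algebra_simps)

lemma q_nonneg: "0 \<le> q" and p_nonneg: "0 \<le> p" and r_pos: "0 < r" "r < 1"
  using q_range p_range r_range by auto

lemma walk_F [measurable]: "n \<le> k \<Longrightarrow> walk X n \<in> borel_measurable (F k)"
  unfolding walk_def[abs_def] by (intro borel_measurable_sum X_F) auto

lemma sigma_sq_F [measurable]: "n \<le> k \<Longrightarrow> sigma_sq X n \<in> borel_measurable (F k)"
  unfolding sigma_sq_def[abs_def]
  by (intro borel_measurable_sum borel_measurable_power borel_measurable_norm X_F) auto

lemma rate_F [measurable]: "n \<le> k \<Longrightarrow> rate n y \<in> borel_measurable (F k)"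
  unfolding rate_def[abs_def]
  by (intro borel_measurable_divide borel_measurable_sum borel_measurable_add borel_measurable_times
    borel_measurable_const borel_measurable_power borel_measurable_norm X_F
    measurable_compose[OF X_F borel_measurable_indicator]) auto

lemma walk_M [measurable]: "walk X n \<in> borel_measurable M"
  by (rule F_measurable[OF walk_F[OF order_refl]])

lemma sigma_sq_M [measurable]: "sigma_sq X n \<in> borel_measurable M"
  by (rule F_measurable[OF sigma_sq_F[OF order_refl]])

lemma rate_M [measurable]: "rate n y \<in> borel_measurable M"
  by (rule F_measurable[OF rate_F[OF order_refl]])

text \<open>A single almost sure event for all times, so that the identities below can be stated
  pointwise.\<close>

definition good :: "'w \<Rightarrow> bool" where
  "good \<omega> \<longleftrightarrow> X 1 \<omega> \<in> units \<and> (\<forall>k\<ge>1. X k \<omega> \<in> insert 0 units)"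

lemma AE_good: "AE \<omega> in M. good \<omega>"
  using AE_X by (simp add: good_def)

lemma walk_Suc: "walk X (Suc n) \<omega> = walk X n \<omega> + X (Suc n) \<omega>"
  by (simp add: walk_def)

lemma sigma_sq_Suc: "sigma_sq X (Suc n) \<omega> = sigma_sq X n \<omega> + (norm (X (Suc n) \<omega>))\<^sup>2"
  by (simp add: sigma_sq_def)

lemma sigma_sq_nonneg: "0 \<le> sigma_sq X n \<omega>"
  by (simp add: sigma_sq_def sum_nonneg)

lemma good_X: "good \<omega> \<Longrightarrow> 1 \<le> k \<Longrightarrow> X k \<omega> \<in> insert 0 units"
  by (simp add: good_def)

lemma good_norm_X: "good \<omega> \<Longrightarrow> 1 \<le> k \<Longrightarrow> norm (X k \<omega>) \<le> 1"
  using good_X[of \<omega> k] norm_units by fastforce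

lemma good_norm_X_sq: "good \<omega> \<Longrightarrow> 1 \<le> k \<Longrightarrow> (norm (X k \<omega>))\<^sup>2 = indicator (- {0}) (X k \<omega>)"
  using good_X[of \<omega> k] norm_units by (auto simp: indicator_def)

lemma good_norm_walk: assumes "good \<omega>" shows "norm (walk X n \<omega>) \<le> n"
proof -
  have "norm (walk X n \<omega>) \<le> (\<Sum>k=1..n. norm (X k \<omega>))" unfolding walk_def by (rule norm_sum)
  also have "\<dots> \<le> (\<Sum>k=1..n. 1)" by (intro sum_mono good_norm_X assms) simp
  finally show ?thesis by simp
qed

lemma good_sigma_sq_le: assumes "good \<omega>" shows "sigma_sq X n \<omega> \<le> n"
proof -
  have "sigma_sq X n \<omega> \<le> (\<Sum>k=1..n. 1)" unfolding sigma_sq_def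
  proof (intro sum_mono)
    fix k assume "k \<in> {1..n}"
    then show "(norm (X k \<omega>))\<^sup>2 \<le> 1"
      using good_norm_X[OF assms, of k] by (simp add: power_le_one)
  qed
  then show ?thesis by simp
qed

lemma good_sigma_sq_1: assumes "good \<omega>" shows "sigma_sq X 1 \<omega> = 1"
  using assms norm_units by (simp add: sigma_sq_def good_def)

lemma good_sigma_sq_ge: assumes "good \<omega>" "1 \<le> n" shows "1 \<le> sigma_sq X n \<omega>"
  using assms(2)
proof (induction n rule: dec_induct)
  case base then show ?case using good_sigma_sq_1[OF assms(1)] by simp
next
  case (step n) then show ?case by (simp add: sigma_sq_Suc add_increasing2)
qed

lemma good_sigma_sq_Nats: assumes "good \<omega>" shows "sigma_sq X n \<omega> \<in> \<nat>"
proof (induction n)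
  case (Suc n)
  have "(norm (X (Suc n) \<omega>))\<^sup>2 \<in> \<nat>" using good_norm_X_sq[OF assms, of "Suc n"] by (simp add: indicator_def)
  then show ?case using Suc by (simp add: sigma_sq_Suc)
qed (simp add: sigma_sq_def)

text \<open>The indicator in \<open>rate\<close> picks the value of f at each earlier step, while
  the term with \<open>q\<close> is the same for all units. The squared norm discards zero steps, at
  which f need not vanish.\<close>

lemma good_rate_sum:
  fixes f :: "real^'d \<Rightarrow> 'b::real_vector"
  assumes "good \<omega>"
  shows "(\<Sum>y\<in>units. rate n y \<omega> *\<^sub>R f y)
    = (1 / n) *\<^sub>R ((p - q) *\<^sub>R (\<Sum>j=1..n. (norm (X j \<omega>))\<^sup>2 *\<^sub>R f (X j \<omega>)) + (q * sigma_sq X n \<omega>) *\<^sub>R (\<Sum>y\<in>units. f y))"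
proof -
  have j: "(\<Sum>y\<in>units. ((p - q) * indicator {y} (X j \<omega>) + q * (norm (X j \<omega>))\<^sup>2) *\<^sub>R f y)
    = (p - q) *\<^sub>R (norm (X j \<omega>))\<^sup>2 *\<^sub>R f (X j \<omega>) + (q * (norm (X j \<omega>))\<^sup>2) *\<^sub>R (\<Sum>y\<in>units. f y)" if "1 \<le> j" for j
  proof -
    have "(\<Sum>y\<in>units. indicator {y} (X j \<omega>) *\<^sub>R f y) = (norm (X j \<omega>))\<^sup>2 *\<^sub>R f (X j \<omega>)"
    proof (cases "X j \<omega> \<in> units")
      case True
      have "(\<Sum>y\<in>units. indicator {y} (X j \<omega>) *\<^sub>R f y) = (\<Sum>y\<in>{X j \<omega>}. indicator {y} (X j \<omega>) *\<^sub>R f y)"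
        by (rule sum.mono_neutral_right) (use True in \<open>auto simp: indicator_def\<close>)
      then show ?thesis using norm_units[OF True] by simp
    next
      case False
      then have "X j \<omega> = 0" using good_X[OF assms that] by simp
      then show ?thesis using False by (auto intro!: sum.neutral simp: indicator_def)
    qed
    then show ?thesis
      by (simp add: scaleR_add_left sum.distrib scaleR_sum_right[symmetric] flip: scaleR_scaleR)
  qed
  have "(\<Sum>y\<in>units. rate n y \<omega> *\<^sub>R f y)
    = (1 / n) *\<^sub>R (\<Sum>y\<in>units. \<Sum>j=1..n. ((p - q) * indicator {y} (X j \<omega>) + q * (norm (X j \<omega>))\<^sup>2) *\<^sub>R f y)"
    by (simp add: rate_def scaleR_sum_right scaleR_sum_left sum_divide_distrib)
  also have "\<dots> = (1 / n) *\<^sub>R (\<Sum>j=1..n. \<Sum>y\<in>units. ((p - q) * indicator {y} (X j \<omega>) + q * (norm (X j \<omega>))\<^sup>2) *\<^sub>R f y)"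
    by (subst sum.swap) simp
  also have "\<dots> = (1 / n) *\<^sub>R (\<Sum>j=1..n. (p - q) *\<^sub>R (norm (X j \<omega>))\<^sup>2 *\<^sub>R f (X j \<omega>) + (q * (norm (X j \<omega>))\<^sup>2) *\<^sub>R (\<Sum>y\<in>units. f y))"
    using j by simp
  also have "\<dots> = (1 / n) *\<^sub>R ((p - q) *\<^sub>R (\<Sum>j=1..n. (norm (X j \<omega>))\<^sup>2 *\<^sub>R f (X j \<omega>)) + (q * sigma_sq X n \<omega>) *\<^sub>R (\<Sum>y\<in>units. f y))"
    by (simp only: sum.distrib scaleR_sum_right[symmetric] sigma_sq_def sum_distrib_left scaleR_sum_left)
  finally show ?thesis .
qed

lemma card_units: "card units = 2 * CARD('d)"
proof -
  have "real (card units) = (\<Sum>y\<in>units. 1)" by simp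
  also have "\<dots> = (\<Sum>e\<in>(Basis :: (real^'d) set). 2)" unfolding sum_units by simp
  finally show ?thesis by simp
qed

text \<open>There are 2 d units, so each earlier nonzero step contributes (p - q) + 2 d q = 1 - r.
  This is the conditional probability that the walk moves.\<close>

lemma good_rate_total:
  assumes "good \<omega>" shows "(\<Sum>y\<in>units. rate n y \<omega>) = (1 - r) * sigma_sq X n \<omega> / n"
proof -
  have "(\<Sum>y\<in>units. rate n y \<omega>) = (1 / n) * ((p - q) * (\<Sum>j=1..n. (norm (X j \<omega>))\<^sup>2) + (q * sigma_sq X n \<omega>) * (2 * real CARD('d)))"
    using good_rate_sum[OF assms, of n "\<lambda>_. 1::real"] by (simp add: card_units)
  also have "\<dots> = (1 - r) * sigma_sq X n \<omega> / n"
    unfolding alpha_eq sigma_sq_def[symmetric] by (simp add: algebra_simps add_divide_distrib diff_divide_distrib)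
  finally show ?thesis .
qed

lemma rate_nonneg:
  assumes "good \<omega>" "y \<in> units" shows "0 \<le> rate n y \<omega>"
proof -
  have "0 \<le> (p - q) * indicator {y} (X j \<omega>) + q * (norm (X j \<omega>))\<^sup>2" for j
  proof (cases "X j \<omega> = y")
    case True
    then have "norm (X j \<omega>) = 1" using norm_units[OF assms(2)] by simp
    then show ?thesis using p_nonneg True by simp
  qed (use q_nonneg in simp)
  then show ?thesis
    unfolding rate_def by (intro divide_nonneg_nonneg sum_nonneg) auto
qed

lemma rate_total_le_1:
  assumes "good \<omega>" shows "(\<Sum>y\<in>units. rate n y \<omega>) \<le> 1"
proof (cases "n = 0")
  case False
  have "(1 - r) * sigma_sq X n \<omega> \<le> 1 * real n"
    using good_sigma_sq_le[OF assms, of n] r_pos sigma_sq_nonneg[of n \<omega>] by (intro mult_mono) auto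
  then show ?thesis using False by (simp add: good_rate_total[OF assms])
qed (simp add: rate_def)

lemma rate_le_1: "good \<omega> \<Longrightarrow> y \<in> units \<Longrightarrow> rate n y \<omega> \<le> 1"
  using member_le_sum[of y units "\<lambda>y. rate n y \<omega>"] rate_nonneg rate_total_le_1[of \<omega> n] by fastforce

lemma integrable_good_bound:
  fixes f :: "'w \<Rightarrow> 'b::{banach,second_countable_topology}"
  assumes "f \<in> borel_measurable M" "\<And>\<omega>. good \<omega> \<Longrightarrow> norm (f \<omega>) \<le> B"
  shows "integrable M f"
proof (rule integrable_const_bound[where B=B])
  show "AE \<omega> in M. norm (f \<omega>) \<le> B" using AE_good by eventually_elim (rule assms(2))
qed (rule assms(1))

lemma integrable_rate_scaleR:
  fixes H :: "'w \<Rightarrow> 'b::{banach,second_countable_topology}"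
  assumes "integrable M H" "y \<in> units"
  shows "integrable M (\<lambda>\<omega>. rate n y \<omega> *\<^sub>R H \<omega>)"
proof (rule Bochner_Integration.integrable_bound[OF assms(1)])
  show "(\<lambda>\<omega>. rate n y \<omega> *\<^sub>R H \<omega>) \<in> borel_measurable M" using assms by measurable
  show "AE \<omega> in M. norm (rate n y \<omega> *\<^sub>R H \<omega>) \<le> norm (H \<omega>)"
    using AE_good
  proof eventually_elim
    case (elim \<omega>)
    then show ?case
      using rate_nonneg[OF elim assms(2), of n] rate_le_1[OF elim assms(2), of n] by (simp add: mult_left_le_one_le)
  qed
qed

text \<open>The one-step tower property for a functional of the next step and the past. The value
  \<open>\<Psi> 0\<close> is split off because the zero step carries the probability complementary
  to the rates of the units.\<close>

lemma step_expectation: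
  fixes \<Psi> :: "real^'d \<Rightarrow> 'w \<Rightarrow> 'b::{banach,second_countable_topology}"
  assumes n: "1 \<le> n"
    and mF: "\<And>y. y \<in> insert 0 units \<Longrightarrow> \<Psi> y \<in> borel_measurable (F n)"
    and int: "\<And>y. y \<in> insert 0 units \<Longrightarrow> integrable M (\<Psi> y)"
    and meas: "(\<lambda>\<omega>. \<Psi> (X (Suc n) \<omega>) \<omega>) \<in> borel_measurable M"
  shows "integrable M (\<lambda>\<omega>. \<Psi> (X (Suc n) \<omega>) \<omega>)"
    and "integrable M (\<lambda>\<omega>. \<Psi> 0 \<omega> + (\<Sum>y\<in>units. rate n y \<omega> *\<^sub>R (\<Psi> y \<omega> - \<Psi> 0 \<omega>)))"
    and "(\<integral>\<omega>. \<Psi> (X (Suc n) \<omega>) \<omega> \<partial>M) = (\<integral>\<omega>. \<Psi> 0 \<omega> + (\<Sum>y\<in>units. rate n y \<omega> *\<^sub>R (\<Psi> y \<omega> - \<Psi> 0 \<omega>)) \<partial>M)"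
proof -
  define g where "g \<omega> = \<Psi> 0 \<omega> + (\<Sum>y\<in>units. indicator {y} (X (Suc n) \<omega>) *\<^sub>R (\<Psi> y \<omega> - \<Psi> 0 \<omega>))" for \<omega>
  have [measurable]: "X (Suc n) \<in> borel_measurable M" by (rule X_measurable) simp
  have d: "integrable M (\<lambda>\<omega>. \<Psi> y \<omega> - \<Psi> 0 \<omega>)" if "y \<in> units" for y
    using int[of y] int[of 0] that by simp
  have dF: "(\<lambda>\<omega>. \<Psi> y \<omega> - \<Psi> 0 \<omega>) \<in> borel_measurable (F n)" if "y \<in> units" for y
    using mF[of y] mF[of 0] that by simp
  have i: "integrable M (\<lambda>\<omega>. indicator {y} (X (Suc n) \<omega>) *\<^sub>R (\<Psi> y \<omega> - \<Psi> 0 \<omega>))" if "y \<in> units" for y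
    by (rule integrable_bounded_scaleR[OF d[OF that], where C=1]) (simp_all add: indicator_def)
  have gi: "integrable M g"
    unfolding g_def by (intro Bochner_Integration.integrable_add Bochner_Integration.integrable_sum int i) simp_all
  have ae: "AE \<omega> in M. g \<omega> = \<Psi> (X (Suc n) \<omega>) \<omega>"
    using AE_good
  proof eventually_elim
    case (elim \<omega>)
    show ?case
    proof (cases "X (Suc n) \<omega> \<in> units")
      case True
      have "(\<Sum>y\<in>units. indicator {y} (X (Suc n) \<omega>) *\<^sub>R (\<Psi> y \<omega> - \<Psi> 0 \<omega>))
         = (\<Sum>y\<in>{X (Suc n) \<omega>}. indicator {y} (X (Suc n) \<omega>) *\<^sub>R (\<Psi> y \<omega> - \<Psi> 0 \<omega>))"
        by (rule sum.mono_neutral_right) (use True in \<open>auto simp: indicator_def\<close>)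
      then show ?thesis by (simp add: g_def)
    next
      case False
      then have "X (Suc n) \<omega> = 0" using good_X[OF elim, of "Suc n"] by simp
      then show ?thesis by (simp add: g_def)
    qed
  qed
  show "integrable M (\<lambda>\<omega>. \<Psi> (X (Suc n) \<omega>) \<omega>)"
    by (rule integrable_cong_AE_imp[OF gi meas]) (use ae in \<open>eventually_elim, simp\<close>)
  show "integrable M (\<lambda>\<omega>. \<Psi> 0 \<omega> + (\<Sum>y\<in>units. rate n y \<omega> *\<^sub>R (\<Psi> y \<omega> - \<Psi> 0 \<omega>)))"
    by (intro Bochner_Integration.integrable_add Bochner_Integration.integrable_sum int integrable_rate_scaleR d) simp_all
  have "(\<integral>\<omega>. \<Psi> (X (Suc n) \<omega>) \<omega> \<partial>M) = (\<integral>\<omega>. g \<omega> \<partial>M)"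
    by (rule integral_cong_AE[OF meas _]) (use gi ae in \<open>auto elim: eventually_mono\<close>)
  also have "\<dots> = (\<integral>\<omega>. \<Psi> 0 \<omega> \<partial>M) + (\<integral>\<omega>. (\<Sum>y\<in>units. indicator {y} (X (Suc n) \<omega>) *\<^sub>R (\<Psi> y \<omega> - \<Psi> 0 \<omega>)) \<partial>M)"
    unfolding g_def by (intro Bochner_Integration.integral_add Bochner_Integration.integrable_sum int i) simp_all
  also have "(\<integral>\<omega>. (\<Sum>y\<in>units. indicator {y} (X (Suc n) \<omega>) *\<^sub>R (\<Psi> y \<omega> - \<Psi> 0 \<omega>)) \<partial>M)
     = (\<Sum>y\<in>units. \<integral>\<omega>. indicator {y} (X (Suc n) \<omega>) *\<^sub>R (\<Psi> y \<omega> - \<Psi> 0 \<omega>) \<partial>M)"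
    by (rule Bochner_Integration.integral_sum[OF i])
  also have "\<dots> = (\<Sum>y\<in>units. \<integral>\<omega>. rate n y \<omega> *\<^sub>R (\<Psi> y \<omega> - \<Psi> 0 \<omega>) \<partial>M)"
    by (intro sum.cong refl) (use integral_step_indicator[OF n _ dF d] in simp)
  also have "\<dots> = (\<integral>\<omega>. (\<Sum>y\<in>units. rate n y \<omega> *\<^sub>R (\<Psi> y \<omega> - \<Psi> 0 \<omega>)) \<partial>M)"
    by (rule Bochner_Integration.integral_sum[symmetric, OF integrable_rate_scaleR[OF d]]) 
  also have "(\<integral>\<omega>. \<Psi> 0 \<omega> \<partial>M) + \<dots> = (\<integral>\<omega>. \<Psi> 0 \<omega> + (\<Sum>y\<in>units. rate n y \<omega> *\<^sub>R (\<Psi> y \<omega> - \<Psi> 0 \<omega>)) \<partial>M)"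
    by (rule Bochner_Integration.integral_add[symmetric]) (intro Bochner_Integration.integrable_sum int integrable_rate_scaleR d; simp)+
  finally show "(\<integral>\<omega>. \<Psi> (X (Suc n) \<omega>) \<omega> \<partial>M) = (\<integral>\<omega>. \<Psi> 0 \<omega> + (\<Sum>y\<in>units. rate n y \<omega> *\<^sub>R (\<Psi> y \<omega> - \<Psi> 0 \<omega>)) \<partial>M)" .
qed

section \<open>The number of nonzero steps as a Markov chain\<close>

definition moves :: "nat \<Rightarrow> 'w \<Rightarrow> nat" where "moves n \<omega> = nat \<lfloor>sigma_sq X n \<omega>\<rfloor>"

lemma real_moves: "good \<omega> \<Longrightarrow> real (moves n \<omega>) = sigma_sq X n \<omega>"
  using good_sigma_sq_Nats[of \<omega> n] by (auto simp: moves_def elim: Nats_cases)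

lemma moves_Suc: "good \<omega> \<Longrightarrow> moves (Suc n) \<omega> = moves n \<omega> + (if X (Suc n) \<omega> = 0 then 0 else 1)"
proof -
  assume g: "good \<omega>"
  have "real (moves (Suc n) \<omega>) = real (moves n \<omega> + (if X (Suc n) \<omega> = 0 then 0 else 1))"
    using good_norm_X_sq[OF g, of "Suc n"] by (simp add: real_moves[OF g] sigma_sq_Suc)
  then show ?thesis by (simp only: of_nat_eq_iff)
qed

lemma moves_le: "good \<omega> \<Longrightarrow> moves n \<omega> \<le> n"
  using good_sigma_sq_le[of \<omega> n] real_moves[of \<omega> n] by linarith

lemma moves_ge: "good \<omega> \<Longrightarrow> 1 \<le> n \<Longrightarrow> 1 \<le> moves n \<omega>"
  using good_sigma_sq_ge[of \<omega> n] real_moves[of \<omega> n] by linarith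

lemma moves_F: "moves n \<in> measurable (F n) (count_space UNIV)"
  unfolding moves_def[abs_def] using sigma_sq_F[OF order_refl, of n] by measurable

lemma moves_M [measurable]: "moves n \<in> measurable M (count_space UNIV)"
  by (rule F_measurable[OF moves_F])

lemma integrable_moves:
  fixes f :: "nat \<Rightarrow> real"
  shows "integrable M (\<lambda>\<omega>. f (moves n \<omega> + c))"
proof (rule integrable_good_bound)
  show "(\<lambda>\<omega>. f (moves n \<omega> + c)) \<in> borel_measurable M" by measurable
  fix \<omega> assume "good \<omega>"
  then have "moves n \<omega> + c \<in> {..n + c}" using moves_le by simp
  then show "norm (f (moves n \<omega> + c)) \<le> (\<Sum>i\<in>{..n + c}. \<bar>f i\<bar>)"
    using member_le_sum[of "moves n \<omega> + c" "{..n + c}" "\<lambda>i. \<bar>f i\<bar>"] by simp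
qed

text \<open>The count passes from k to k + 1 with conditional probability (1 - r) k / n, so the
  hypothesis says that \<open>f\<close> is an eigenfunction of the one-step operator, with
  eigenvalue 1 + (1 - r) c / n. It is used for rising factorials, with c = m, and for a Gamma
  quotient, with c = -1/2.\<close>

lemma moves_expectation:
  fixes f :: "nat \<Rightarrow> real"
  assumes n: "1 \<le> n" and f: "\<And>k. 1 \<le> k \<Longrightarrow> real k * (f (k + 1) - f k) = c * f k"
  shows "(\<integral>\<omega>. f (moves (Suc n) \<omega>) \<partial>M) = (1 + (1 - r) * c / n) * (\<integral>\<omega>. f (moves n \<omega>) \<partial>M)"
proof -
  \<comment> \<open>By \<open>moves_Suc\<close> the new count depends on the step only through
    whether it is 0.\<close>
  define \<Psi> where "\<Psi> y \<omega> = f (moves n \<omega> + (if y = (0 :: real^'d) then 0 else 1))" for y \<omega>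
  have XM [measurable]: "X (Suc n) \<in> borel_measurable M" by (rule X_measurable) simp
  have m: "(\<lambda>\<omega>. \<Psi> (X (Suc n) \<omega>) \<omega>) \<in> borel_measurable M"
    unfolding \<Psi>_def by measurable
  have ae: "AE \<omega> in M. f (moves (Suc n) \<omega>) = \<Psi> (X (Suc n) \<omega>) \<omega>"
    using AE_good by eventually_elim (simp add: \<Psi>_def moves_Suc)
  have "(\<integral>\<omega>. f (moves (Suc n) \<omega>) \<partial>M) = (\<integral>\<omega>. \<Psi> (X (Suc n) \<omega>) \<omega> \<partial>M)"
    by (rule integral_cong_AE[OF _ m ae]) measurable
  also have "\<dots> = (\<integral>\<omega>. \<Psi> 0 \<omega> + (\<Sum>y\<in>units. rate n y \<omega> *\<^sub>R (\<Psi> y \<omega> - \<Psi> 0 \<omega>)) \<partial>M)"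
  proof (rule step_expectation(3)[where \<Psi>=\<Psi>, OF n _ _ m])
    show "\<Psi> y \<in> borel_measurable (F n)" for y
      unfolding \<Psi>_def by (rule measurable_compose[OF moves_F]) simp
    show "integrable M (\<Psi> y)" for y
      unfolding \<Psi>_def by (rule integrable_moves)
  qed
  also have "\<dots> = (\<integral>\<omega>. (1 + (1 - r) * c / n) * f (moves n \<omega>) \<partial>M)"
  proof (rule integral_cong_AE)
    show "(\<lambda>\<omega>. \<Psi> 0 \<omega> + (\<Sum>y\<in>units. rate n y \<omega> *\<^sub>R (\<Psi> y \<omega> - \<Psi> 0 \<omega>))) \<in> borel_measurable M"
      unfolding \<Psi>_def by measurable
    show "AE \<omega> in M. \<Psi> 0 \<omega> + (\<Sum>y\<in>units. rate n y \<omega> *\<^sub>R (\<Psi> y \<omega> - \<Psi> 0 \<omega>)) = (1 + (1 - r) * c / n) * f (moves n \<omega>)"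
      using AE_good
    proof eventually_elim
      case (elim \<omega>)
      let ?k = "moves n \<omega>"
      have "(\<Sum>y\<in>units. rate n y \<omega> *\<^sub>R (\<Psi> y \<omega> - \<Psi> 0 \<omega>)) = (\<Sum>y\<in>units. rate n y \<omega> * (f (?k + 1) - f ?k))"
      proof (rule sum.cong[OF refl])
        fix y assume "y \<in> units"
        then have "y \<noteq> 0" using zero_not_units by blast
        then show "rate n y \<omega> *\<^sub>R (\<Psi> y \<omega> - \<Psi> 0 \<omega>) = rate n y \<omega> * (f (?k + 1) - f ?k)" by (simp add: \<Psi>_def)
      qed
      also have "\<dots> = (1 - r) * real ?k / n * (f (?k + 1) - f ?k)"
        by (simp only: sum_distrib_right[symmetric] good_rate_total[OF elim] real_moves[OF elim])
      also have "\<dots> = (1 - r) / n * (real ?k * (f (?k + 1) - f ?k))" by simp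
      also have "\<dots> = (1 - r) / n * (c * f ?k)"
        using f[OF moves_ge[OF elim n]] by simp
      finally show ?case by (simp add: \<Psi>_def algebra_simps)
    qed
  qed measurable
  finally show ?thesis by simp
qed

lemma moves_1: "good \<omega> \<Longrightarrow> moves 1 \<omega> = 1"
  using good_sigma_sq_1[of \<omega>] by (simp add: moves_def)

lemma moves_expectation_1: "(\<integral>\<omega>. f (moves 1 \<omega>) \<partial>M) = (f 1 :: real)"
proof -
  have "(\<integral>\<omega>. f (moves 1 \<omega>) \<partial>M) = (\<integral>\<omega>. f 1 \<partial>M)"
    by (rule integral_cong_AE) (use AE_good in \<open>auto elim!: eventually_mono simp: moves_1[simplified]\<close>)
  then show ?thesis by (simp add: prob_space)
qed

text \<open>Rising factorials are eigenfunctions with c = m. The eigenvalues 1 + m (1 - r) / n are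
  the growth factors of \<open>gquot (real m * (1 - r))\<close>, and the chain starts at 1, where
  the rising factorial equals m!.\<close>

lemma pochhammer_moment:
  assumes "1 \<le> n"
  shows "(\<integral>\<omega>. pochhammer (real (moves n \<omega>)) m \<partial>M) = fact m * gquot (real m * (1 - r)) (real n) / Gamma (1 + real m * (1 - r))"
  using assms
proof (induction n rule: dec_induct)
  case base
  have "0 < Gamma (1 + real m * (1 - r))" using r_pos by (intro Gamma_real_pos add_pos_nonneg) auto
  then show ?case
    using moves_expectation_1[of "\<lambda>k. pochhammer (real k) m"] by (simp add: gquot_def pochhammer_fact)
next
  case (step n)
  have "real k * (pochhammer (real (k + 1)) m - pochhammer (real k) m) = real m * pochhammer (real k) m" for k
  proof -
    have "real k * pochhammer (real k + 1) m = pochhammer (real k) (Suc m)" by (simp add: pochhammer_rec)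
    also have "\<dots> = pochhammer (real k) m * (real k + real m)" by (simp add: pochhammer_Suc)
    finally show ?thesis by (simp add: algebra_simps)
  qed
  from moves_expectation[OF step(1), of "\<lambda>k. pochhammer (real k) m", OF this]
  have "(\<integral>\<omega>. pochhammer (real (moves (Suc n) \<omega>)) m \<partial>M) = (1 + (1 - r) * real m / n) * (\<integral>\<omega>. pochhammer (real (moves n \<omega>)) m \<partial>M)" .
  moreover have "gquot (real m * (1 - r)) (real (Suc n)) = gquot (real m * (1 - r)) (real n) * (1 + real m * (1 - r) / n)"
    using gquot_plus1[of "real m * (1 - r)" "real n"] step(1) r_pos by (simp add: add.commute)
  ultimately show ?case using step(3) by (simp add: mult_ac)
qed

end

section \<open>Moments\<close>

lemma gquot_le_powr:
  assumes "0 \<le> c"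
  shows "\<exists>C>0. \<forall>n\<ge>1. gquot c (real n) \<le> C * real n powr c"
proof -
  have "Bseq (\<lambda>n. gquot c (real n) / real n powr c)"
    using gquot_asymp[OF assms] by (intro convergent_imp_Bseq convergentI)
  then obtain C where C: "0 < C" "\<And>n. \<bar>gquot c (real n) / real n powr c\<bar> \<le> C"
    unfolding Bseq_def by auto
  have "gquot c (real n) \<le> C * real n powr c" if "1 \<le> n" for n
  proof -
    have "gquot c (real n) / real n powr c \<le> C" using C(2)[of n] by linarith
    then show ?thesis using that by (simp add: pos_divide_le_eq)
  qed
  then show ?thesis using C(1) by blast
qed

lemma power_le_pochhammer: "0 \<le> (x::real) \<Longrightarrow> x ^ m \<le> pochhammer x m"
proof (induction m)
  case (Suc m)
  have "x ^ m * x \<le> pochhammer x m * (x + real m)"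
    using Suc by (intro mult_mono) (auto intro: order_trans[OF zero_le_power])
  then show ?case by (simp add: pochhammer_Suc mult.commute)
qed simp

text \<open>A rising factorial and a power differ by lower order terms only; this is how explicit
  rising factorial moments yield the asymptotics of ordinary moments.\<close>

lemma pochhammer_minus_power_le:
  "\<exists>C\<ge>0. \<forall>x\<ge>0. pochhammer x (Suc m) - x ^ Suc m \<le> C * pochhammer (x::real) m"
proof (induction m)
  case 0 then show ?case by (intro exI[of _ 0]) simp
next
  case (Suc m)
  then obtain C where C: "0 \<le> C" "\<And>x::real. 0 \<le> x \<Longrightarrow> pochhammer x (Suc m) - x ^ Suc m \<le> C * pochhammer x m" by blast
  have "pochhammer x (Suc (Suc m)) - x ^ Suc (Suc m) \<le> (C + real (Suc m)) * pochhammer x (Suc m)" if x: "0 \<le> x" for x :: real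
  proof -
    have p: "0 \<le> pochhammer x m" using power_le_pochhammer[OF x, of m] x by (meson order_trans zero_le_power)
    have "pochhammer x (Suc (Suc m)) - x ^ Suc (Suc m) = x * (pochhammer x (Suc m) - x ^ Suc m) + real (Suc m) * pochhammer x (Suc m)"
      by (simp only: pochhammer_Suc[of x "Suc m"]) (simp add: algebra_simps)
    also have "\<dots> \<le> x * (C * pochhammer x m) + real (Suc m) * pochhammer x (Suc m)"
      using C(2)[OF x] x by (intro add_right_mono mult_left_mono)
    also have "x * (C * pochhammer x m) \<le> C * pochhammer x (Suc m)"
    proof -
      have "C * (pochhammer x m * x) \<le> C * (pochhammer x m * (x + real m))"
        using C(1) p by (intro mult_left_mono) auto
      then show ?thesis by (simp add: pochhammer_Suc mult_ac)
    qed
    finally show ?thesis by (simp add: algebra_simps)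
  qed
  then show ?case using C(1) by (intro exI[of _ "C + real (Suc m)"]) auto
qed

context merws
begin

section \<open>Moments of the number of nonzero steps\<close>

lemma moves_pow_eq: "AE \<omega> in M. (sigma_sq X n \<omega>) ^ m = real (moves n \<omega>) ^ m"
  using AE_good by eventually_elim (simp add: real_moves)

lemma integrable_sigma_sq_pow: "integrable M (\<lambda>\<omega>. (sigma_sq X n \<omega>) ^ m)"
proof (rule integrable_good_bound)
  fix \<omega> assume "good \<omega>"
  then show "norm ((sigma_sq X n \<omega>) ^ m) \<le> real n ^ m"
    using good_sigma_sq_le[of \<omega> n] sigma_sq_nonneg[of n \<omega>] by (simp add: power_mono)
qed measurable

lemma integrable_sigma_sq: "integrable M (sigma_sq X n)"
  using integrable_sigma_sq_pow[of n 1] by simp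

lemma sigma_sq_moment_eq: "(\<integral>\<omega>. (sigma_sq X n \<omega>) ^ m \<partial>M) = (\<integral>\<omega>. real (moves n \<omega>) ^ m \<partial>M)"
  by (rule integral_cong_AE[OF _ _ moves_pow_eq]) measurable

lemma sigma_sq_moment_le:
  "\<exists>C>0. \<forall>n\<ge>1. (\<integral>\<omega>. (sigma_sq X n \<omega>) ^ m \<partial>M) \<le> C * real n powr (real m * (1 - r))"
proof -
  have G: "0 < Gamma (1 + real m * (1 - r))" using r_pos by (intro Gamma_real_pos add_pos_nonneg) auto
  obtain C where C: "0 < C" "\<And>n. 1 \<le> n \<Longrightarrow> gquot (real m * (1 - r)) (real n) \<le> C * real n powr (real m * (1 - r))"
    using gquot_le_powr[of "real m * (1 - r)"] r_pos by auto
  have "(\<integral>\<omega>. (sigma_sq X n \<omega>) ^ m \<partial>M) \<le> fact m * C / Gamma (1 + real m * (1 - r)) * real n powr (real m * (1 - r))" if "1 \<le> n" for n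
  proof -
    have "(\<integral>\<omega>. (sigma_sq X n \<omega>) ^ m \<partial>M) \<le> (\<integral>\<omega>. pochhammer (real (moves n \<omega>)) m \<partial>M)"
      unfolding sigma_sq_moment_eq
      using integrable_moves[of "\<lambda>k. real k ^ m" n 0] integrable_moves[of "\<lambda>k. pochhammer (real k) m" n 0]
      by (intro integral_mono) (simp_all add: power_le_pochhammer)
    also have "\<dots> = fact m * gquot (real m * (1 - r)) (real n) / Gamma (1 + real m * (1 - r))"
      by (rule pochhammer_moment[OF that])
    also have "\<dots> \<le> fact m * (C * real n powr (real m * (1 - r))) / Gamma (1 + real m * (1 - r))"
      using C(2)[OF that] G by (intro divide_right_mono mult_left_mono) auto
    finally show ?thesis by simp
  qed
  moreover have "0 < fact m * C / Gamma (1 + real m * (1 - r))" using C(1) G by simp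
  ultimately show ?thesis by blast
qed

lemma sigma_sq_mean_le: "\<exists>C>0. \<forall>n\<ge>1. (\<integral>\<omega>. sigma_sq X n \<omega> \<partial>M) \<le> C * real n powr (1 - r)"
  using sigma_sq_moment_le[of 1] by simp

text \<open>A sandwich: the power of order m lies between the rising factorial of order m and the
  same minus a multiple of the one of order m - 1, whose expectation is smaller by a factor of order
  n^(-(1 - r)).\<close>

lemma scaled_moment_tendsto:
  "(\<lambda>n. \<integral>\<omega>. (sigma_sq X n \<omega> / real n powr (1 - r)) ^ m \<partial>M) \<longlonglongrightarrow> fact m / Gamma (1 + real m * (1 - r))"
proof -
  let ?\<alpha> = "1 - r"
  have poch: "(\<lambda>n. (\<integral>\<omega>. pochhammer (real (moves n \<omega>)) m \<partial>M) / real n powr (real m * ?\<alpha>)) \<longlonglongrightarrow> fact m / Gamma (1 + real m * ?\<alpha>)" for m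
  proof -
    have "(\<lambda>n. fact m / Gamma (1 + real m * ?\<alpha>) * (gquot (real m * ?\<alpha>) (real n) / real n powr (real m * ?\<alpha>))) \<longlonglongrightarrow> fact m / Gamma (1 + real m * ?\<alpha>) * 1"
      using r_pos by (intro tendsto_mult tendsto_const gquot_asymp) auto
    then show ?thesis
    proof (rule Lim_transform_eventually[OF tendsto_eq_rhs])
      show "\<forall>\<^sub>F n in sequentially. fact m / Gamma (1 + real m * ?\<alpha>) * (gquot (real m * ?\<alpha>) (real n) / real n powr (real m * ?\<alpha>))
          = (\<integral>\<omega>. pochhammer (real (moves n \<omega>)) m \<partial>M) / real n powr (real m * ?\<alpha>)"
        using eventually_ge_at_top[of 1]
      proof eventually_elim
        case (elim n)
        show ?case unfolding pochhammer_moment[OF elim] by simp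
      qed
    qed simp
  qed
  \<comment> \<open>The identity fails for m = 0 at n = 0, since \<open>0 powr 0\<close> is 0 while
    a zeroth power is 1; the case m = 0 is treated apart.\<close>
  have scale: "(\<integral>\<omega>. (sigma_sq X n \<omega> / real n powr ?\<alpha>) ^ m \<partial>M) = (\<integral>\<omega>. real (moves n \<omega>) ^ m \<partial>M) / real n powr (real m * ?\<alpha>)" if "m \<noteq> 0" for n
  proof -
    have "(real n powr ?\<alpha>) ^ m = real n powr (real m * ?\<alpha>)"
    proof (cases "n = 0")
      case False then show ?thesis by (induction m) (simp_all add: powr_add[symmetric] algebra_simps)
    qed (use that in simp)
    then show ?thesis by (simp add: power_divide sigma_sq_moment_eq)
  qed
  have ip: "integrable M (\<lambda>\<omega>. pochhammer (real (moves n \<omega>)) m)" "integrable M (\<lambda>\<omega>. real (moves n \<omega>) ^ m)" for n m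
    using integrable_moves[of "\<lambda>k. real k ^ m" n 0] integrable_moves[of "\<lambda>k. pochhammer (real k) m" n 0] by simp_all
  have up: "(\<integral>\<omega>. real (moves n \<omega>) ^ m \<partial>M) \<le> (\<integral>\<omega>. pochhammer (real (moves n \<omega>)) m \<partial>M)" for n
    by (intro integral_mono ip) (simp add: power_le_pochhammer)
  show ?thesis
  proof (cases m)
    case 0 then show ?thesis by (simp add: prob_space)
  next
    case (Suc k)
    obtain C where C: "0 \<le> C" "\<And>x::real. 0 \<le> x \<Longrightarrow> pochhammer x (Suc k) - x ^ Suc k \<le> C * pochhammer x k"
      using pochhammer_minus_power_le[of k] by auto
    have lo: "(\<integral>\<omega>. pochhammer (real (moves n \<omega>)) m \<partial>M) - C * (\<integral>\<omega>. pochhammer (real (moves n \<omega>)) k \<partial>M) \<le> (\<integral>\<omega>. real (moves n \<omega>) ^ m \<partial>M)" for n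
    proof -
      have "(\<integral>\<omega>. pochhammer (real (moves n \<omega>)) m - C * pochhammer (real (moves n \<omega>)) k \<partial>M) \<le> (\<integral>\<omega>. real (moves n \<omega>) ^ m \<partial>M)"
      proof (rule integral_mono)
        fix \<omega> show "pochhammer (real (moves n \<omega>)) m - C * pochhammer (real (moves n \<omega>)) k \<le> real (moves n \<omega>) ^ m"
          using C(2)[of "real (moves n \<omega>)"] Suc by simp
      qed (intro Bochner_Integration.integrable_diff integrable_mult_right ip)+
      then show ?thesis using ip by simp
    qed
    have small: "(\<lambda>n. (\<integral>\<omega>. pochhammer (real (moves n \<omega>)) k \<partial>M) / real n powr (real m * ?\<alpha>)) \<longlonglongrightarrow> 0"
    proof -
      have "(\<lambda>n. (\<integral>\<omega>. pochhammer (real (moves n \<omega>)) k \<partial>M) / real n powr (real k * ?\<alpha>) * real n powr (- ?\<alpha>)) \<longlonglongrightarrow> fact k / Gamma (1 + real k * ?\<alpha>) * 0"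
        using r_pos by (intro tendsto_mult poch tendsto_neg_powr filterlim_real_sequentially) auto
      moreover have "(\<integral>\<omega>. pochhammer (real (moves n \<omega>)) k \<partial>M) / real n powr (real k * ?\<alpha>) * real n powr (- ?\<alpha>)
        = (\<integral>\<omega>. pochhammer (real (moves n \<omega>)) k \<partial>M) / real n powr (real m * ?\<alpha>)" for n
      proof -
        have "real m * ?\<alpha> = real k * ?\<alpha> + ?\<alpha>" by (simp add: Suc algebra_simps)
        then show ?thesis
          by (simp only: powr_add powr_minus divide_inverse inverse_mult_distrib mult.assoc)
      qed
      ultimately show ?thesis by simp
    qed
    have "(\<lambda>n. (\<integral>\<omega>. real (moves n \<omega>) ^ m \<partial>M) / real n powr (real m * ?\<alpha>)) \<longlonglongrightarrow> fact m / Gamma (1 + real m * ?\<alpha>)"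
    proof (rule tendsto_sandwich)
      show "(\<lambda>n. (\<integral>\<omega>. pochhammer (real (moves n \<omega>)) m \<partial>M) / real n powr (real m * ?\<alpha>) - C * ((\<integral>\<omega>. pochhammer (real (moves n \<omega>)) k \<partial>M) / real n powr (real m * ?\<alpha>))) \<longlonglongrightarrow> fact m / Gamma (1 + real m * ?\<alpha>)"
        using tendsto_diff[OF poch[of m] tendsto_mult_left[OF small, of C]] by simp
      show "\<forall>\<^sub>F n in sequentially. (\<integral>\<omega>. pochhammer (real (moves n \<omega>)) m \<partial>M) / real n powr (real m * ?\<alpha>) - C * ((\<integral>\<omega>. pochhammer (real (moves n \<omega>)) k \<partial>M) / real n powr (real m * ?\<alpha>)) \<le> (\<integral>\<omega>. real (moves n \<omega>) ^ m \<partial>M) / real n powr (real m * ?\<alpha>)"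
      proof (rule always_eventually, rule allI)
        fix n
        show "(\<integral>\<omega>. pochhammer (real (moves n \<omega>)) m \<partial>M) / real n powr (real m * ?\<alpha>) - C * ((\<integral>\<omega>. pochhammer (real (moves n \<omega>)) k \<partial>M) / real n powr (real m * ?\<alpha>)) \<le> (\<integral>\<omega>. real (moves n \<omega>) ^ m \<partial>M) / real n powr (real m * ?\<alpha>)"
          using divide_right_mono[OF lo[of n], of "real n powr (real m * ?\<alpha>)"] by (simp add: diff_divide_distrib)
      qed
      show "\<forall>\<^sub>F n in sequentially. (\<integral>\<omega>. real (moves n \<omega>) ^ m \<partial>M) / real n powr (real m * ?\<alpha>) \<le> (\<integral>\<omega>. pochhammer (real (moves n \<omega>)) m \<partial>M) / real n powr (real m * ?\<alpha>)"
        by (intro always_eventually allI divide_right_mono up) simp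
    qed (rule poch)
    then show ?thesis using Suc by (subst scale) auto
  qed
qed

text \<open>A negative moment keeps the rescaled number of moves away from \<open>0\<close>.\<close>

lemma sigma_sq_small_ball:
  assumes n: "1 \<le> n" and e: "0 < \<epsilon>"
  shows "prob {\<omega>\<in>space M. sigma_sq X n \<omega> < \<epsilon> * real n powr (1 - r)} \<le> Gamma (1 / 2) * sqrt \<epsilon>"
proof -
  let ?\<alpha> = "1 - r"
  \<comment> \<open>A substitute for k^(-1/2): by Gautschi's inequality it is at least that, and it
    is an eigenfunction with c = -1/2, so its expectation obeys an exact recursion.\<close>
  define f where "f k = Gamma (real k - 1 / 2) / Gamma (real k)" for k :: nat
  have f1: "f 1 = Gamma (1 / 2)" by (simp add: f_def)
  have fpos: "0 < f k" if "1 \<le> k" for k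
    unfolding f_def using that by (intro divide_pos_pos Gamma_real_pos) auto
  have fstep: "real k * (f (k + 1) - f k) = - (1 / 2) * f k" if "1 \<le> k" for k
  proof -
    have "Gamma (real (k + 1)) = real k * Gamma (real k)"
      using Gamma_plus1_pos[of "real k"] that by (simp add: add.commute)
    moreover have "Gamma (real (k + 1) - 1 / 2) = (real k - 1 / 2) * Gamma (real k - 1 / 2)"
      using Gamma_plus1_pos[of "real k - 1 / 2"] that by (simp add: algebra_simps)
    ultimately have "real k * f (k + 1) = (real k - 1 / 2) * f k" using that unfolding f_def by simp
    then show ?thesis by (simp add: algebra_simps)
  qed
  have flow: "1 / sqrt (real k) \<le> f k" if "1 \<le> k" for k
  proof -
    define x where "x = real k - 1 / 2"
    have x: "0 < x" "x \<le> real k" using that by (auto simp: x_def)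
    have "gquot (1 / 2) x \<le> x powr (1 / 2)" using x by (intro gautschi_upper) auto
    also have "\<dots> = sqrt x" using x by (simp add: powr_half_sqrt)
    also have "\<dots> \<le> sqrt (real k)" using x by simp
    finally have "Gamma (real k) / Gamma x \<le> sqrt (real k)" by (simp add: gquot_def x_def)
    moreover have "0 < Gamma (real k)" "0 < Gamma x" using that x by (auto intro!: Gamma_real_pos)
    ultimately show ?thesis using that by (simp add: f_def x_def[symmetric] field_simps)
  qed
  have E: "(\<integral>\<omega>. f (moves n \<omega>) \<partial>M) \<le> f 1 * real n powr (- ?\<alpha> / 2)"
    using n
  proof (induction n rule: dec_induct)
    case base then show ?case using moves_expectation_1[of f] by simp
  next
    case (step n)
    have n0: "0 < real n" using step(1) by simp
    \<comment> \<open>Young's inequality yields Bernoulli's inequality for the exponent (1 - r) / 2.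
      Then (1 - x) (1 + x) <= 1 with x = (1 - r) / (2 n) compares the eigenvalue 1 - x with the
      decay of n^(-(1 - r) / 2).\<close>
    have "(1 + 1 / real n) powr (?\<alpha> / 2) \<le> 1 + ?\<alpha> / 2 * (1 / real n)"
      using Youngs_inequality_0[of "?\<alpha> / 2" "1 - ?\<alpha> / 2" "1 + 1 / real n" 1] r_pos n0
      by (simp add: field_simps)
    moreover have "real (Suc n) = real n * (1 + 1 / real n)" using n0 by (simp add: field_simps)
    ultimately have a: "real (Suc n) powr (?\<alpha> / 2) \<le> real n powr (?\<alpha> / 2) * (1 + ?\<alpha> / (2 * n))"
      using n0 by (simp add: powr_mult)
    have "(1 - ?\<alpha> / (2 * n)) * real (Suc n) powr (?\<alpha> / 2) \<le> (1 - ?\<alpha> / (2 * n)) * (real n powr (?\<alpha> / 2) * (1 + ?\<alpha> / (2 * n)))"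
    proof (rule mult_left_mono[OF a])
      have "?\<alpha> \<le> 2 * real n" using step(1) r_pos by linarith
      then show "0 \<le> 1 - ?\<alpha> / (2 * n)" using n0 by (simp add: field_simps)
    qed
    also have "\<dots> = real n powr (?\<alpha> / 2) * (1 - (?\<alpha> / (2 * n))\<^sup>2)"
    proof -
      have "(1 - x) * (P * (1 + x)) = P * (1 - x\<^sup>2)" for x P :: real by (simp add: power2_eq_square algebra_simps)
      then show ?thesis .
    qed
    also have "\<dots> \<le> real n powr (?\<alpha> / 2) * 1" by (intro mult_left_mono) auto
    finally have b: "(1 - ?\<alpha> / (2 * n)) * real (Suc n) powr (?\<alpha> / 2) \<le> real n powr (?\<alpha> / 2)" by simp
    have c: "(1 - ?\<alpha> / (2 * n)) * real n powr (- ?\<alpha> / 2) \<le> real (Suc n) powr (- ?\<alpha> / 2)"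
    proof -
      have "x * inverse P \<le> inverse P'" if "0 < P" "0 < P'" "x * P' \<le> P" for x P P' :: real
        using that by (simp add: field_simps)
      from this[OF _ _ b] have "(1 - ?\<alpha> / (2 * n)) * inverse (real n powr (?\<alpha> / 2)) \<le> inverse (real (Suc n) powr (?\<alpha> / 2))"
        using n0 by simp
      moreover have "- ?\<alpha> / 2 = - (?\<alpha> / 2)" by (rule minus_divide_left[symmetric])
      ultimately show ?thesis by (simp only: powr_minus)
    qed
    have "(\<integral>\<omega>. f (moves (Suc n) \<omega>) \<partial>M) = (1 - ?\<alpha> / (2 * n)) * (\<integral>\<omega>. f (moves n \<omega>) \<partial>M)"
      using moves_expectation[OF step(1), of f "- (1 / 2)", OF fstep] by (simp add: mult_ac)
    also have "\<dots> \<le> (1 - ?\<alpha> / (2 * n)) * (f 1 * real n powr (- ?\<alpha> / 2))"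
    proof (rule mult_left_mono[OF step(3)])
      have "?\<alpha> \<le> 2 * real n" using step(1) r_pos by linarith
      then show "0 \<le> 1 - ?\<alpha> / (2 * n)" using n0 by (simp add: field_simps)
    qed
    also have "\<dots> \<le> f 1 * real (Suc n) powr (- ?\<alpha> / 2)"
      using mult_left_mono[OF c, of "f 1"] fpos[of 1] by (simp add: mult_ac)
    finally show ?case .
  qed
  define t where "t = \<epsilon> * real n powr ?\<alpha>"
  have t: "0 < t" using e n by (simp add: t_def)
  define T where "T = {\<omega>\<in>space M. sigma_sq X n \<omega> < t}"
  have TM [measurable]: "T \<in> events" unfolding T_def by measurable
  \<comment> \<open>Markov's inequality: on \<open>T\<close> the variable
    \<open>f (moves n \<omega>)\<close> is at least \<open>1 / sqrt t\<close>.\<close>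
  have "prob T / sqrt t = (\<integral>\<omega>. indicator T \<omega> / sqrt t \<partial>M)" by simp
  also have "\<dots> \<le> (\<integral>\<omega>. f (moves n \<omega>) \<partial>M)"
  proof (rule integral_mono_AE)
    show "integrable M (\<lambda>\<omega>. indicator T \<omega> / sqrt t)" by (intro integrable_divide_zero) (simp add: emeasure_eq_measure)
    show "integrable M (\<lambda>\<omega>. f (moves n \<omega>))" using integrable_moves[of f n 0] by simp
    show "AE \<omega> in M. indicator T \<omega> / sqrt t \<le> f (moves n \<omega>)"
      using AE_good
    proof eventually_elim
      case (elim \<omega>)
      have k: "1 \<le> moves n \<omega>" by (rule moves_ge[OF elim n])
      show ?case
      proof (cases "\<omega> \<in> T")
        case True
        then have "real (moves n \<omega>) < t" by (simp add: real_moves[OF elim] T_def)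
        then have "1 / sqrt t \<le> 1 / sqrt (real (moves n \<omega>))" using k t by (intro divide_left_mono) auto
        also have "\<dots> \<le> f (moves n \<omega>)" by (rule flow[OF k])
        finally show ?thesis using True by simp
      qed (use fpos[OF k] in simp)
    qed
  qed
  also have "\<dots> \<le> f 1 * real n powr (- ?\<alpha> / 2)" by (rule E)
  finally have "prob T \<le> f 1 * real n powr (- ?\<alpha> / 2) * sqrt t" using t by (simp add: pos_divide_le_eq)
  also have "sqrt t = sqrt \<epsilon> * real n powr (?\<alpha> / 2)"
    using n by (simp add: t_def real_sqrt_mult powr_half_sqrt[symmetric] powr_powr)
  also have "f 1 * real n powr (- ?\<alpha> / 2) * (sqrt \<epsilon> * real n powr (?\<alpha> / 2)) = f 1 * sqrt \<epsilon>"
  proof -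
    have "real n powr (- ?\<alpha> / 2) * real n powr (?\<alpha> / 2) = real n powr (- ?\<alpha> / 2 + ?\<alpha> / 2)"
      by (rule powr_add[symmetric])
    also have "- ?\<alpha> / 2 + ?\<alpha> / 2 = 0" by (simp add: field_simps)
    finally show ?thesis using n by (simp add: mult_ac)
  qed
  finally show ?thesis unfolding T_def t_def f1 .
qed

end

text \<open>Replaces Cauchy-Schwarz by |y| <= y^2 / (2 t) + t / 2, where \<open>t\<close> is the
  expected size. A second moment of order t^2 thus gives integrability and a first moment of order
  t.\<close>

lemma (in prob_space) expectation_abs_le:
  fixes Y :: "'a \<Rightarrow> real"
  assumes [measurable]: "Y \<in> borel_measurable M" and i: "integrable M (\<lambda>\<omega>. (Y \<omega>)\<^sup>2)"
    and t: "0 < t" and le: "(\<integral>\<omega>. (Y \<omega>)\<^sup>2 \<partial>M) \<le> C * t\<^sup>2"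
  shows "integrable M Y" "(\<integral>\<omega>. \<bar>Y \<omega>\<bar> \<partial>M) \<le> (C + 1) / 2 * t"
proof -
  have p: "\<bar>y\<bar> \<le> y\<^sup>2 / (2 * t) + t / 2" for y :: real
  proof -
    have "0 \<le> (\<bar>y\<bar> - t)\<^sup>2" by simp
    then have "2 * t * \<bar>y\<bar> \<le> y\<^sup>2 + t\<^sup>2" by (simp add: power2_diff algebra_simps)
    then have "\<bar>y\<bar> \<le> (y\<^sup>2 + t\<^sup>2) / (2 * t)" using t by (simp add: field_simps)
    also have "\<dots> = y\<^sup>2 / (2 * t) + t / 2" using t by (simp add: add_divide_distrib power2_eq_square)
    finally show ?thesis .
  qed
  have i2: "integrable M (\<lambda>\<omega>. (Y \<omega>)\<^sup>2 / (2 * t) + t / 2)" using i by simp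
  show iY: "integrable M Y"
  proof (rule Bochner_Integration.integrable_bound[OF i2])
    show "AE \<omega> in M. norm (Y \<omega>) \<le> norm ((Y \<omega>)\<^sup>2 / (2 * t) + t / 2)"
      using p t by (intro AE_I2) (simp add: abs_le_iff order_trans[OF p])
  qed simp
  have "(\<integral>\<omega>. \<bar>Y \<omega>\<bar> \<partial>M) \<le> (\<integral>\<omega>. (Y \<omega>)\<^sup>2 / (2 * t) + t / 2 \<partial>M)"
    by (intro integral_mono integrable_abs iY i2 p)
  also have "\<dots> = (\<integral>\<omega>. (Y \<omega>)\<^sup>2 \<partial>M) / (2 * t) + t / 2" using i by (simp add: prob_space)
  also have "\<dots> \<le> (C * t\<^sup>2) / (2 * t) + t / 2" using le t by (intro add_right_mono divide_right_mono) auto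
  also have "\<dots> = (C + 1) / 2 * t" using t by (simp add: power2_eq_square field_simps)
  finally show "(\<integral>\<omega>. \<bar>Y \<omega>\<bar> \<partial>M) \<le> (C + 1) / 2 * t" .
qed

context merws
begin

section \<open>Drift and second moments of the walk and of its Gram matrix\<close>

lemma sum_units_uminus: "(\<Sum>y\<in>units. y) = 0"
  unfolding sum_units by simp

lemma sum_units_inner_sq: "(\<Sum>y\<in>units. (w \<bullet> y)\<^sup>2) = 2 * (norm w)\<^sup>2"
  unfolding sum_units norm_sq_Basis by (simp add: sum_distrib_left)

text \<open>The contribution of \<open>q\<close> is a multiple of the sum of all units, which is 0.
  The drift is therefore (p - q) / n times the walk, and division by \<open>gquot (p - q)\<close>
  gives a martingale.\<close>

lemma good_rate_vec:
  assumes "good \<omega>" shows "(\<Sum>y\<in>units. rate n y \<omega> *\<^sub>R y) = ((p - q) / n) *\<^sub>R walk X n \<omega>"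
proof -
  have "(norm (X j \<omega>))\<^sup>2 *\<^sub>R X j \<omega> = X j \<omega>" if "j \<in> {1..n}" for j
    using good_norm_X_sq[OF assms, of j] that by (cases "X j \<omega> = 0") (simp_all add: indicator_def)
  then have "(\<Sum>j=1..n. (norm (X j \<omega>))\<^sup>2 *\<^sub>R X j \<omega>) = walk X n \<omega>"
    unfolding walk_def by (intro sum.cong refl)
  then show ?thesis
    unfolding good_rate_sum[OF assms] sum_units_uminus by simp
qed

lemma good_rate_inner:
  assumes "good \<omega>" shows "(\<Sum>y\<in>units. rate n y \<omega> * (w \<bullet> y)) = (p - q) / n * (w \<bullet> walk X n \<omega>)"
proof -
  have "(\<Sum>y\<in>units. rate n y \<omega> * (w \<bullet> y)) = w \<bullet> (\<Sum>y\<in>units. rate n y \<omega> *\<^sub>R y)"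
    by (simp add: inner_sum_right)
  then show ?thesis unfolding good_rate_vec[OF assms] by simp
qed

lemma good_rate_inner_sq:
  assumes "good \<omega>"
  shows "(\<Sum>y\<in>units. rate n y \<omega> * (w \<bullet> y)\<^sup>2)
    = ((p - q) * (\<Sum>j=1..n. (w \<bullet> X j \<omega>)\<^sup>2) + 2 * q * sigma_sq X n \<omega> * (norm w)\<^sup>2) / n"
proof -
  have "(norm (X j \<omega>))\<^sup>2 *\<^sub>R (w \<bullet> X j \<omega>)\<^sup>2 = (w \<bullet> X j \<omega>)\<^sup>2" if "j \<in> {1..n}" for j
    using good_norm_X_sq[OF assms, of j] that by (cases "X j \<omega> = 0") (simp_all add: indicator_def)
  then have "(\<Sum>j=1..n. (norm (X j \<omega>))\<^sup>2 *\<^sub>R (w \<bullet> X j \<omega>)\<^sup>2) = (\<Sum>j=1..n. (w \<bullet> X j \<omega>)\<^sup>2)"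
    by (intro sum.cong refl)
  with good_rate_sum[OF assms, of n "\<lambda>y. (w \<bullet> y)\<^sup>2"] show ?thesis
    unfolding sum_units_inner_sq by (simp add: mult_ac)
qed

lemma integrable_walk_sq: "integrable M (\<lambda>\<omega>. (norm (walk X n \<omega> + y))\<^sup>2)"
proof (rule integrable_good_bound)
  fix \<omega> assume "good \<omega>"
  then have "norm (walk X n \<omega> + y) \<le> real n + norm y"
    using good_norm_walk[of \<omega> n] norm_triangle_ineq[of "walk X n \<omega>" y] by linarith
  then show "norm ((norm (walk X n \<omega> + y))\<^sup>2) \<le> (real n + norm y)\<^sup>2" by (simp add: power_mono)
qed measurable

text \<open>The first factor comes from the drift in the cross term; the last term is the
  probability of a move, since a move adds 1 to the squared norm besides the cross term.\<close>

lemma walk_second_moment_step: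
  assumes n: "1 \<le> n"
  shows "(\<integral>\<omega>. (norm (walk X (Suc n) \<omega>))\<^sup>2 \<partial>M)
    = (1 + 2 * (p - q) / n) * (\<integral>\<omega>. (norm (walk X n \<omega>))\<^sup>2 \<partial>M) + (1 - r) / n * (\<integral>\<omega>. sigma_sq X n \<omega> \<partial>M)"
proof -
  define \<Psi> where "\<Psi> y \<omega> = (norm (walk X n \<omega> + y))\<^sup>2" for y \<omega>
  have XM [measurable]: "X (Suc n) \<in> borel_measurable M" by (rule X_measurable) simp
  have m: "(\<lambda>\<omega>. \<Psi> (X (Suc n) \<omega>) \<omega>) \<in> borel_measurable M" unfolding \<Psi>_def by measurable
  have "(\<integral>\<omega>. (norm (walk X (Suc n) \<omega>))\<^sup>2 \<partial>M) = (\<integral>\<omega>. \<Psi> (X (Suc n) \<omega>) \<omega> \<partial>M)"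
    by (simp add: \<Psi>_def walk_Suc)
  also have "\<dots> = (\<integral>\<omega>. \<Psi> 0 \<omega> + (\<Sum>y\<in>units. rate n y \<omega> *\<^sub>R (\<Psi> y \<omega> - \<Psi> 0 \<omega>)) \<partial>M)"
  proof (rule step_expectation(3)[where \<Psi>=\<Psi>, OF n _ _ m])
    show "\<Psi> y \<in> borel_measurable (F n)" for y
      unfolding \<Psi>_def using walk_F[OF order_refl, of n] by measurable
    show "integrable M (\<Psi> y)" for y
      unfolding \<Psi>_def by (rule integrable_walk_sq)
  qed
  also have "\<dots> = (\<integral>\<omega>. (1 + 2 * (p - q) / n) * (norm (walk X n \<omega>))\<^sup>2 + (1 - r) / n * sigma_sq X n \<omega> \<partial>M)"
  proof (rule integral_cong_AE)
    show "(\<lambda>\<omega>. \<Psi> 0 \<omega> + (\<Sum>y\<in>units. rate n y \<omega> *\<^sub>R (\<Psi> y \<omega> - \<Psi> 0 \<omega>))) \<in> borel_measurable M"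
      unfolding \<Psi>_def by measurable
    show "AE \<omega> in M. \<Psi> 0 \<omega> + (\<Sum>y\<in>units. rate n y \<omega> *\<^sub>R (\<Psi> y \<omega> - \<Psi> 0 \<omega>))
      = (1 + 2 * (p - q) / n) * (norm (walk X n \<omega>))\<^sup>2 + (1 - r) / n * sigma_sq X n \<omega>"
      using AE_good
    proof eventually_elim
      case (elim \<omega>)
      let ?S = "walk X n \<omega>"
      have "(\<Sum>y\<in>units. rate n y \<omega> *\<^sub>R (\<Psi> y \<omega> - \<Psi> 0 \<omega>)) = (\<Sum>y\<in>units. 2 * (rate n y \<omega> * (?S \<bullet> y)) + rate n y \<omega>)"
      proof (rule sum.cong[OF refl])
        fix y assume "y \<in> units"
        then have "(norm y)\<^sup>2 = 1" by (simp add: norm_units)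
        then have "\<Psi> y \<omega> - \<Psi> 0 \<omega> = 2 * (?S \<bullet> y) + 1"
          by (simp add: \<Psi>_def power2_norm_eq_inner inner_add_left inner_add_right inner_commute)
        then show "rate n y \<omega> *\<^sub>R (\<Psi> y \<omega> - \<Psi> 0 \<omega>) = 2 * (rate n y \<omega> * (?S \<bullet> y)) + rate n y \<omega>"
          by (simp add: algebra_simps)
      qed
      also have "\<dots> = 2 * ((p - q) / n * (?S \<bullet> ?S)) + (1 - r) * sigma_sq X n \<omega> / n"
        by (simp only: sum.distrib sum_distrib_left[symmetric] good_rate_inner[OF elim] good_rate_total[OF elim])
      finally show ?case by (simp add: \<Psi>_def power2_norm_eq_inner algebra_simps)
    qed
  qed measurable
  also have "\<dots> = (1 + 2 * (p - q) / n) * (\<integral>\<omega>. (norm (walk X n \<omega>))\<^sup>2 \<partial>M) + (1 - r) / n * (\<integral>\<omega>. sigma_sq X n \<omega> \<partial>M)"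
    using integrable_walk_sq[of n 0] integrable_sigma_sq[of n]
    by (subst Bochner_Integration.integral_add) auto
  finally show ?thesis .
qed

text \<open>Deviation of the diagonal Gram matrix from a multiple of the identity.\<close>

definition gram_dev :: "nat \<Rightarrow> real^'d \<Rightarrow> 'w \<Rightarrow> real" where
  "gram_dev n e \<omega> = (\<Sum>j=1..n. (e \<bullet> X j \<omega>)\<^sup>2) - sigma_sq X n \<omega> / CARD('d)"

lemma gram_dev_Suc:
  "gram_dev (Suc n) e \<omega> = gram_dev n e \<omega> + ((e \<bullet> X (Suc n) \<omega>)\<^sup>2 - (norm (X (Suc n) \<omega>))\<^sup>2 / CARD('d))"
  by (simp add: gram_dev_def sigma_sq_Suc add_divide_distrib)

lemma gram_dev_F: "n \<le> k \<Longrightarrow> gram_dev n e \<in> borel_measurable (F k)"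
  unfolding gram_dev_def[abs_def]
  by (intro borel_measurable_diff borel_measurable_divide borel_measurable_sum borel_measurable_power borel_measurable_inner borel_measurable_const X_F sigma_sq_F) auto

lemma gram_dev_M [measurable]: "gram_dev n e \<in> borel_measurable M"
  by (rule F_measurable[OF gram_dev_F[OF order_refl]])

lemma Basis_inner_units:
  assumes "e \<in> Basis" "y \<in> units" shows "0 \<le> (e \<bullet> y)\<^sup>2" "(e \<bullet> y)\<^sup>2 \<le> 1"
proof -
  have "\<bar>e \<bullet> y\<bar> \<le> 1" using Cauchy_Schwarz_ineq2[of e y] assms by (simp add: norm_units)
  then show "(e \<bullet> y)\<^sup>2 \<le> 1" by (simp add: abs_square_le_1)
qed simp

lemma gram_dev_bound:
  assumes "good \<omega>" "e \<in> Basis" shows "\<bar>gram_dev n e \<omega>\<bar> \<le> n"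
proof (induction n)
  case (Suc n)
  have d: "0 \<le> 1 / real CARD('d)" "1 / real CARD('d) \<le> 1" using d_pos by auto
  have "\<bar>(e \<bullet> X (Suc n) \<omega>)\<^sup>2 - (norm (X (Suc n) \<omega>))\<^sup>2 / CARD('d)\<bar> \<le> 1"
  proof (cases "X (Suc n) \<omega> = 0")
    case False
    then have "X (Suc n) \<omega> \<in> units" using good_X[OF assms(1), of "Suc n"] by simp
    then have "0 \<le> (e \<bullet> X (Suc n) \<omega>)\<^sup>2" "(e \<bullet> X (Suc n) \<omega>)\<^sup>2 \<le> 1" "norm (X (Suc n) \<omega>) = 1"
      using Basis_inner_units[OF assms(2)] norm_units by blast+
    moreover have "\<bar>u - 1 / real CARD('d)\<bar> \<le> 1" if "0 \<le> u" "u \<le> 1" for u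
      using that d unfolding abs_le_iff by linarith
    ultimately show ?thesis by simp
  qed simp
  then show ?case using Suc unfolding gram_dev_Suc by linarith
qed (simp add: gram_dev_def sigma_sq_def)

text \<open>The isotropic part of the conditional second moment cancels, so the deviation has the
  same drift factor (p - q) / n as the walk. Its increments are at most 1 in absolute value and
  vanish when the walk stops, which leads to the recursion of the walk, now as an
  inequality.\<close>

lemma gram_dev_second_moment_step:
  assumes n: "1 \<le> n" and e: "e \<in> Basis"
  shows "(\<integral>\<omega>. (gram_dev (Suc n) e \<omega>)\<^sup>2 \<partial>M)
    \<le> (1 + 2 * (p - q) / n) * (\<integral>\<omega>. (gram_dev n e \<omega>)\<^sup>2 \<partial>M) + (1 - r) / n * (\<integral>\<omega>. sigma_sq X n \<omega> \<partial>M)"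
proof -
  define c where "c y = (e \<bullet> y)\<^sup>2 - (norm y)\<^sup>2 / CARD('d)" for y
  define \<Psi> where "\<Psi> y \<omega> = (gram_dev n e \<omega> + c y)\<^sup>2" for y \<omega>
  have XM [measurable]: "X (Suc n) \<in> borel_measurable M" by (rule X_measurable) simp
  have m: "(\<lambda>\<omega>. \<Psi> (X (Suc n) \<omega>) \<omega>) \<in> borel_measurable M" unfolding \<Psi>_def c_def by measurable
  have int: "integrable M (\<Psi> y)" for y
    unfolding \<Psi>_def
  proof (rule integrable_good_bound)
    fix \<omega> assume "good \<omega>"
    then have "\<bar>gram_dev n e \<omega> + c y\<bar> \<le> real n + \<bar>c y\<bar>"
      using gram_dev_bound[OF _ e, of \<omega> n] by linarith
    then show "norm ((gram_dev n e \<omega> + c y)\<^sup>2) \<le> (real n + \<bar>c y\<bar>)\<^sup>2"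
      by (simp add: abs_le_square_iff[symmetric])
  qed measurable
  have F: "\<Psi> y \<in> borel_measurable (F n)" for y
    unfolding \<Psi>_def using gram_dev_F[OF order_refl, of n e] by measurable
  have d0: "c 0 = 0" by (simp add: c_def)
  have "\<Psi> 0 = (\<lambda>\<omega>. (gram_dev n e \<omega>)\<^sup>2)" by (simp add: \<Psi>_def fun_eq_iff d0)
  then have int0: "integrable M (\<lambda>\<omega>. (gram_dev n e \<omega>)\<^sup>2)" using int[of 0] by simp
  have "(\<integral>\<omega>. (gram_dev (Suc n) e \<omega>)\<^sup>2 \<partial>M) = (\<integral>\<omega>. \<Psi> (X (Suc n) \<omega>) \<omega> \<partial>M)"
    by (simp add: \<Psi>_def c_def gram_dev_Suc)
  also have "\<dots> = (\<integral>\<omega>. \<Psi> 0 \<omega> + (\<Sum>y\<in>units. rate n y \<omega> *\<^sub>R (\<Psi> y \<omega> - \<Psi> 0 \<omega>)) \<partial>M)"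
    by (rule step_expectation(3)[where \<Psi>=\<Psi>, OF n F int m])
  also have "\<dots> \<le> (\<integral>\<omega>. (1 + 2 * (p - q) / n) * (gram_dev n e \<omega>)\<^sup>2 + (1 - r) / n * sigma_sq X n \<omega> \<partial>M)"
  proof (rule integral_mono_AE)
    show "integrable M (\<lambda>\<omega>. \<Psi> 0 \<omega> + (\<Sum>y\<in>units. rate n y \<omega> *\<^sub>R (\<Psi> y \<omega> - \<Psi> 0 \<omega>)))"
      by (rule step_expectation(2)[where \<Psi>=\<Psi>, OF n F int m])
    show "integrable M (\<lambda>\<omega>. (1 + 2 * (p - q) / n) * (gram_dev n e \<omega>)\<^sup>2 + (1 - r) / n * sigma_sq X n \<omega>)"
      using int0 integrable_sigma_sq[of n] by (intro Bochner_Integration.integrable_add integrable_mult_right)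
    show "AE \<omega> in M. \<Psi> 0 \<omega> + (\<Sum>y\<in>units. rate n y \<omega> *\<^sub>R (\<Psi> y \<omega> - \<Psi> 0 \<omega>))
      \<le> (1 + 2 * (p - q) / n) * (gram_dev n e \<omega>)\<^sup>2 + (1 - r) / n * sigma_sq X n \<omega>"
      using AE_good
    proof eventually_elim
      case (elim \<omega>)
      let ?Q = "gram_dev n e \<omega>"
      have c1: "(c y)\<^sup>2 \<le> 1" and cy: "c y = (e \<bullet> y)\<^sup>2 - 1 / CARD('d)" if "y \<in> units" for y
      proof -
        show cy: "c y = (e \<bullet> y)\<^sup>2 - 1 / CARD('d)" using that by (simp add: c_def norm_units)
        have "0 \<le> 1 / real CARD('d)" "1 / real CARD('d) \<le> 1" using d_pos by auto
        then have "\<bar>c y\<bar> \<le> 1" using Basis_inner_units[OF e that] unfolding cy abs_le_iff by linarith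
        then show "(c y)\<^sup>2 \<le> 1" by (simp add: abs_square_le_1)
      qed
      have "(\<Sum>y\<in>units. rate n y \<omega> *\<^sub>R (\<Psi> y \<omega> - \<Psi> 0 \<omega>)) \<le> (\<Sum>y\<in>units. 2 * ?Q * (rate n y \<omega> * (e \<bullet> y)\<^sup>2 - rate n y \<omega> / CARD('d)) + rate n y \<omega>)"
      proof (rule sum_mono)
        fix y assume y: "y \<in> units"
        have "\<Psi> y \<omega> - \<Psi> 0 \<omega> = 2 * ?Q * c y + (c y)\<^sup>2" by (simp add: \<Psi>_def d0 power2_sum)
        also have "\<dots> \<le> 2 * ?Q * c y + 1" using c1[OF y] by simp
        finally have "rate n y \<omega> * (\<Psi> y \<omega> - \<Psi> 0 \<omega>) \<le> rate n y \<omega> * (2 * ?Q * c y + 1)"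
          by (rule mult_left_mono) (rule rate_nonneg[OF elim y])
        then show "rate n y \<omega> *\<^sub>R (\<Psi> y \<omega> - \<Psi> 0 \<omega>) \<le> 2 * ?Q * (rate n y \<omega> * (e \<bullet> y)\<^sup>2 - rate n y \<omega> / CARD('d)) + rate n y \<omega>"
          by (simp add: cy[OF y] algebra_simps)
      qed
      also have "\<dots> = 2 * ?Q * (((p - q) * (\<Sum>j=1..n. (e \<bullet> X j \<omega>)\<^sup>2) + 2 * q * sigma_sq X n \<omega> * (norm e)\<^sup>2) / n - (1 - r) * sigma_sq X n \<omega> / n / CARD('d)) + (1 - r) * sigma_sq X n \<omega> / n"
        by (simp only: sum.distrib sum_distrib_left[symmetric] sum_subtractf sum_divide_distrib[symmetric] good_rate_inner_sq[OF elim] good_rate_total[OF elim])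
      \<comment> \<open>The cancellation: by \<open>alpha_eq\<close> the term with \<open>q\<close>
        is exactly what completes the trace part to (p - q) times \<open>gram_dev\<close>.\<close>
      also have "((p - q) * (\<Sum>j=1..n. (e \<bullet> X j \<omega>)\<^sup>2) + 2 * q * sigma_sq X n \<omega> * (norm e)\<^sup>2) / n - (1 - r) * sigma_sq X n \<omega> / n / CARD('d) = (p - q) / n * ?Q"
      proof -
        have "(1 - r) * sigma_sq X n \<omega> / CARD('d) = (p - q) * sigma_sq X n \<omega> / CARD('d) + 2 * q * sigma_sq X n \<omega>"
          unfolding alpha_eq by (simp add: field_simps)
        then have "((p - q) * (\<Sum>j=1..n. (e \<bullet> X j \<omega>)\<^sup>2) + 2 * q * sigma_sq X n \<omega>) - (1 - r) * sigma_sq X n \<omega> / CARD('d) = (p - q) * ?Q"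
          unfolding gram_dev_def by (simp add: algebra_simps)
        moreover have "u / n - (1 - r) * sigma_sq X n \<omega> / n / CARD('d) = (u - (1 - r) * sigma_sq X n \<omega> / CARD('d)) / n" for u
          by (simp add: diff_divide_distrib)
        moreover have "(norm e)\<^sup>2 = 1" using e by simp
        ultimately show ?thesis by (simp only: mult_1_right times_divide_eq_left)
      qed
      finally show ?case by (simp add: \<Psi>_def d0 power2_eq_square algebra_simps)
    qed
  qed
  also have "\<dots> = (1 + 2 * (p - q) / n) * (\<integral>\<omega>. (gram_dev n e \<omega>)\<^sup>2 \<partial>M) + (1 - r) / n * (\<integral>\<omega>. sigma_sq X n \<omega> \<partial>M)"
    using int0 integrable_sigma_sq[of n]
    by (subst Bochner_Integration.integral_add) auto
  finally show ?thesis .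
qed

end

text \<open>The first assumption is the condition on p in the theorem, rewritten by
  \<open>alpha_eq\<close>. The second gives \<open>p - q < 1 - r\<close> as soon as d > 1, which
  makes the Gram matrix asymptotically isotropic.\<close>

locale superdiffusive_merws = merws M b p q r X U A
  for M :: "'w measure" and b :: "nat \<Rightarrow> 'd::finite" and p q r :: real
    and X :: "nat \<Rightarrow> 'w \<Rightarrow> real^'d" and U :: "nat \<Rightarrow> 'w \<Rightarrow> nat" and A :: "nat \<Rightarrow> 'w \<Rightarrow> real^'d^'d" +
  assumes superdiffusive: "1 - r < 2 * (p - q)"
    and nondegenerate: "0 < q \<or> CARD('d) = 1"
begin

lemma a_bounds: "0 < p - q" "p - q \<le> 1 - r" "p - q < 1" "p - q \<le> 1"
proof -
  have "0 < 2 * (p - q)" using superdiffusive r_pos(2) by linarith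
  then show "0 < p - q" by simp
  have "0 \<le> 2 * real CARD('d) * q" using q_nonneg by simp
  then show "p - q \<le> 1 - r" unfolding alpha_eq by linarith
  then show "p - q < 1" "p - q \<le> 1" using r_pos by linarith+
qed

text \<open>The source term is of order n^((1 - r) - 1). As 1 - r < 2 (p - q), it does not change
  the growth rate of the homogeneous recursion. Both the walk and the Gram deviation are treated
  this way.\<close>

lemma recursion_bound:
  fixes y :: "nat \<Rightarrow> real"
  assumes rec: "\<And>n. 1 \<le> n \<Longrightarrow> y (Suc n) \<le> (1 + 2 * (p - q) / n) * y n + (1 - r) / n * (\<integral>\<omega>. sigma_sq X n \<omega> \<partial>M)"
    and nn: "\<And>n. 0 \<le> y n"
  shows "\<exists>C\<ge>0. \<forall>n\<ge>1. y n \<le> C * real n powr (2 * (p - q))"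
proof -
  obtain C where C: "0 < C" "\<And>n. 1 \<le> n \<Longrightarrow> (\<integral>\<omega>. sigma_sq X n \<omega> \<partial>M) \<le> C * real n powr (1 - r)"
    using sigma_sq_mean_le by blast
  show ?thesis
  proof (rule perturbed_recursion_bound[where c="1 - r" and D="(1 - r) * C"])
    fix n :: nat assume n: "1 \<le> n"
    have "(1 - r) / n * (\<integral>\<omega>. sigma_sq X n \<omega> \<partial>M) \<le> (1 - r) / n * (C * real n powr (1 - r))"
      using C(2)[OF n] r_pos by (intro mult_left_mono) auto
    also have "\<dots> = (1 - r) * C * real n powr ((1 - r) - 1)"
    proof -
      have "real n powr (x - 1) = real n powr x / n" for x using n by (simp add: powr_diff)
      then show ?thesis by (simp only:) simp
    qed
    finally show "y (Suc n) \<le> (1 + 2 * (p - q) / n) * y n + (1 - r) * C * real n powr ((1 - r) - 1)"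
      using rec[OF n] by linarith
  qed (use a_bounds superdiffusive C nn r_pos in auto)
qed

lemma walk_second_moment_le:
  "\<exists>C\<ge>0. \<forall>n\<ge>1. (\<integral>\<omega>. (norm (walk X n \<omega>))\<^sup>2 \<partial>M) \<le> C * real n powr (2 * (p - q))"
  by (rule recursion_bound) (use walk_second_moment_step in auto)

text \<open>The point is \<open>\<beta> < 1 - r\<close>: the deviation is negligible against n^(1 -
  r), the order of \<open>sigma_sq\<close>. For d = 1 it vanishes almost surely; otherwise q > 0,
  and the second moment gives the exponent p - q < 1 - r.\<close>

lemma gram_dev_abs_le:
  "\<exists>\<beta> C. \<beta> < 1 - r \<and> \<beta> < 2 * (p - q) \<and> 0 \<le> C \<and>
     (\<forall>e\<in>Basis. \<forall>n\<ge>1. integrable M (gram_dev n e) \<and> (\<integral>\<omega>. \<bar>gram_dev n e \<omega>\<bar> \<partial>M) \<le> C * real n powr \<beta>)"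
proof (cases "CARD('d) = 1")
  case True
  have zero: "AE \<omega> in M. gram_dev n e \<omega> = 0" if e: "e \<in> Basis" for e n
    using AE_good
  proof eventually_elim
    case (elim \<omega>)
    have "card (Basis :: (real^'d) set) = 1" using True by simp
    then obtain f where f: "(Basis :: (real^'d) set) = {f}" by (rule card_1_singletonE)
    have "e \<in> {f}" using e unfolding f .
    then have "e = f" by simp
    then have B: "Basis = {e}" using f by (simp only:)
    have "(e \<bullet> x)\<^sup>2 = (norm x)\<^sup>2" for x
      by (subst power2_norm_eq_inner, subst euclidean_inner) (simp add: B power2_eq_square inner_commute)
    then show ?case using True by (simp add: gram_dev_def sigma_sq_def)
  qed
  have "integrable M (gram_dev n e) \<and> (\<integral>\<omega>. \<bar>gram_dev n e \<omega>\<bar> \<partial>M) \<le> 0 * real n powr ((1 - r) / 2)" if e: "e \<in> Basis" for e n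
  proof
    show "integrable M (gram_dev n e)"
      by (rule integrable_cong_AE_imp[of M "\<lambda>_. 0"]) (use zero[OF e] in \<open>auto elim: eventually_mono\<close>)
    have "(\<integral>\<omega>. \<bar>gram_dev n e \<omega>\<bar> \<partial>M) = (\<integral>\<omega>. 0 \<partial>M)"
      by (rule integral_cong_AE) (use zero[OF e] in \<open>auto elim: eventually_mono\<close>)
    then show "(\<integral>\<omega>. \<bar>gram_dev n e \<omega>\<bar> \<partial>M) \<le> 0 * real n powr ((1 - r) / 2)" by simp
  qed
  \<comment> \<open>With the constant 0, any exponent below both 1 - r and 2 (p - q) would serve as
    witness.\<close>
  then show ?thesis
    using r_pos superdiffusive by (intro exI[of _ "(1 - r) / 2"] exI[of _ 0]) auto
next
  case False
  then have "0 < q" using nondegenerate by simp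
  then have lt: "p - q < 1 - r" unfolding alpha_eq by simp
  have ex: "\<exists>C\<ge>0. \<forall>n\<ge>1. (\<integral>\<omega>. (gram_dev n e \<omega>)\<^sup>2 \<partial>M) \<le> C * real n powr (2 * (p - q))" if "e \<in> Basis" for e
    by (rule recursion_bound) (use gram_dev_second_moment_step that in auto)
  \<comment> \<open>One constant is wanted for all directions, so a constant is chosen for each of
    the finitely many basis vectors and these are summed.\<close>
  define c where "c e = (SOME C. C \<ge> 0 \<and> (\<forall>n\<ge>1. (\<integral>\<omega>. (gram_dev n e \<omega>)\<^sup>2 \<partial>M) \<le> C * real n powr (2 * (p - q))))" for e
  have c: "0 \<le> c e" "1 \<le> n \<Longrightarrow> (\<integral>\<omega>. (gram_dev n e \<omega>)\<^sup>2 \<partial>M) \<le> c e * real n powr (2 * (p - q))" if "e \<in> Basis" for e n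
    using someI_ex[OF ex[OF that, unfolded Bex_def]] unfolding c_def by blast+
  define C where "C = (\<Sum>e\<in>Basis. c e)"
  have C0: "0 \<le> C" unfolding C_def by (intro sum_nonneg c)
  have cC: "c e \<le> C" if "e \<in> Basis" for e
    unfolding C_def by (rule member_le_sum) (use c that in auto)
  have "integrable M (gram_dev n e) \<and> (\<integral>\<omega>. \<bar>gram_dev n e \<omega>\<bar> \<partial>M) \<le> (C + 1) / 2 * real n powr (p - q)"
    if e: "e \<in> Basis" and n: "1 \<le> n" for e n
  proof -
    have i: "integrable M (\<lambda>\<omega>. (gram_dev n e \<omega>)\<^sup>2)"
    proof (rule integrable_good_bound)
      fix \<omega> assume "good \<omega>"
      then show "norm ((gram_dev n e \<omega>)\<^sup>2) \<le> (real n)\<^sup>2"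
        using gram_dev_bound[OF _ e, of \<omega> n] by (simp add: abs_le_square_iff[symmetric])
    qed measurable
    have "(real n powr (p - q))\<^sup>2 = real n powr (2 * (p - q))"
      by (simp add: power2_eq_square powr_add[symmetric])
    moreover have "c e * real n powr (2 * (p - q)) \<le> C * real n powr (2 * (p - q))"
      by (intro mult_right_mono cC e) simp
    ultimately have "(\<integral>\<omega>. (gram_dev n e \<omega>)\<^sup>2 \<partial>M) \<le> C * (real n powr (p - q))\<^sup>2"
      using c(2)[OF e n] by simp
    with expectation_abs_le[OF _ i, of "real n powr (p - q)" C] n show ?thesis by simp
  qed
  then show ?thesis using lt a_bounds C0
    by (intro exI[of _ "p - q"] exI[of _ "(C + 1) / 2"]) auto
qed

section \<open>Normalising sequences and the normalised number of moves\<close>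

definition H :: "nat \<Rightarrow> real" where "H n = gquot (1 - r) (real n)"

definition G :: "nat \<Rightarrow> real" where "G n = gquot (p - q) (real n)"

lemma H_pos: "1 \<le> n \<Longrightarrow> 0 < H n"
  unfolding H_def using r_pos by (intro gquot_pos) auto

lemma G_pos: "1 \<le> n \<Longrightarrow> 0 < G n"
  unfolding G_def using a_bounds by (intro gquot_pos) auto

lemma H_Suc: "1 \<le> n \<Longrightarrow> H (Suc n) = H n * (1 + (1 - r) / n)"
  using gquot_plus1[of "1 - r" "real n"] r_pos by (simp add: H_def add.commute)

lemma G_Suc: "1 \<le> n \<Longrightarrow> G (Suc n) = G n * (1 + (p - q) / n)"
  using gquot_plus1[of "p - q" "real n"] a_bounds by (simp add: G_def add.commute)

lemma H_bounds: "1 \<le> n \<Longrightarrow> real n powr (1 - r) / 2 \<le> H n" "1 \<le> n \<Longrightarrow> H n \<le> real n powr (1 - r)"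
  unfolding H_def using gquot_bounds[of "1 - r" n] r_pos by auto

lemma G_bounds: "1 \<le> n \<Longrightarrow> real n powr (p - q) / 2 \<le> G n" "1 \<le> n \<Longrightarrow> G n \<le> real n powr (p - q)"
  unfolding G_def using gquot_bounds[of "p - q" n] a_bounds by auto

lemma H_mono: "1 \<le> n \<Longrightarrow> H n \<le> H (Suc n)"
  using H_Suc[of n] H_pos[of n] r_pos by (simp add: algebra_simps)

lemma G_mono: "1 \<le> n \<Longrightarrow> G n \<le> G (Suc n)"
  using G_Suc[of n] G_pos[of n] a_bounds by (simp add: algebra_simps)

text \<open>A martingale, since the conditional mean of \<open>sigma_sq\<close> grows by the same
  factor as \<open>H\<close>. Its small increments allow \<open>sigma_sq X k\<close> to be replaced
  by the prediction H k / H n times \<open>sigma_sq X n\<close>.\<close>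

definition W :: "nat \<Rightarrow> 'w \<Rightarrow> real" where "W n \<omega> = sigma_sq X n \<omega> / H n"

lemma W_F: "n \<le> k \<Longrightarrow> W n \<in> borel_measurable (F k)"
  unfolding W_def[abs_def] by (intro borel_measurable_divide sigma_sq_F borel_measurable_const)

lemma W_M [measurable]: "W n \<in> borel_measurable M"
  unfolding W_def[abs_def] by measurable

lemma W_bound: "good \<omega> \<Longrightarrow> 1 \<le> n \<Longrightarrow> \<bar>W n \<omega>\<bar> \<le> real n / H n"
  using good_sigma_sq_le[of \<omega> n] sigma_sq_nonneg[of n \<omega>] H_pos[of n]
  unfolding W_def by (simp add: divide_right_mono)

text \<open>Orthogonality of martingale increments: the cross term vanishes, and the conditional
  second moment of the increment is at most the probability of a move divided by
  \<open>(H (Suc k))^2\<close>. Equality is lost by dropping the square of a conditional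
  mean.\<close>

lemma W_increment:
  assumes n: "1 \<le> n" and k: "n \<le> k"
  shows "(\<integral>\<omega>. (W (Suc k) \<omega> - W n \<omega>)\<^sup>2 \<partial>M)
    \<le> (\<integral>\<omega>. (W k \<omega> - W n \<omega>)\<^sup>2 \<partial>M) + (1 - r) / k / (H (Suc k))\<^sup>2 * (\<integral>\<omega>. sigma_sq X k \<omega> \<partial>M)"
proof -
  have k1: "1 \<le> k" using n k by simp
  define h where "h = 1 / H (Suc k)"
  define \<Psi> where "\<Psi> y \<omega> = ((sigma_sq X k \<omega> + (norm y)\<^sup>2) * h - W n \<omega>)\<^sup>2" for y :: "real^'d" and \<omega>
  have XM [measurable]: "X (Suc k) \<in> borel_measurable M" by (rule X_measurable) simp
  have m: "(\<lambda>\<omega>. \<Psi> (X (Suc k) \<omega>) \<omega>) \<in> borel_measurable M" unfolding \<Psi>_def by measurable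
  have int: "integrable M (\<Psi> y)" for y
    unfolding \<Psi>_def
  proof (rule integrable_good_bound)
    fix \<omega> assume g: "good \<omega>"
    have "\<bar>(sigma_sq X k \<omega> + (norm y)\<^sup>2) * h\<bar> \<le> (real k + (norm y)\<^sup>2) * \<bar>h\<bar>"
      using good_sigma_sq_le[OF g, of k] sigma_sq_nonneg[of k \<omega>] by (simp add: abs_mult mult_right_mono)
    then have "\<bar>(sigma_sq X k \<omega> + (norm y)\<^sup>2) * h - W n \<omega>\<bar> \<le> (real k + (norm y)\<^sup>2) * \<bar>h\<bar> + real n / H n"
      using W_bound[OF g n] by linarith
    then show "norm (((sigma_sq X k \<omega> + (norm y)\<^sup>2) * h - W n \<omega>)\<^sup>2) \<le> ((real k + (norm y)\<^sup>2) * \<bar>h\<bar> + real n / H n)\<^sup>2"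
      by (simp add: abs_le_square_iff[symmetric])
  qed measurable
  have F: "\<Psi> y \<in> borel_measurable (F k)" for y
    unfolding \<Psi>_def using sigma_sq_F[OF order_refl, of k] W_F[OF k] by measurable
  have WS: "W k \<omega> = sigma_sq X k \<omega> * (1 + (1 - r) / k) * h" for \<omega>
    unfolding W_def h_def H_Suc[OF k1] using H_pos[OF k1] r_pos k1
    by (simp add: add_pos_nonneg less_imp_neq[symmetric])
  have iW: "integrable M (\<lambda>\<omega>. (W k \<omega> - W n \<omega>)\<^sup>2)"
  proof (rule integrable_good_bound)
    fix \<omega> assume g: "good \<omega>"
    then have "\<bar>W k \<omega> - W n \<omega>\<bar> \<le> real k / H k + real n / H n"
      using W_bound[OF g n] W_bound[OF g k1] by linarith
    then show "norm ((W k \<omega> - W n \<omega>)\<^sup>2) \<le> (real k / H k + real n / H n)\<^sup>2"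
      by (simp add: abs_le_square_iff[symmetric])
  qed measurable
  have "(\<integral>\<omega>. (W (Suc k) \<omega> - W n \<omega>)\<^sup>2 \<partial>M) = (\<integral>\<omega>. \<Psi> (X (Suc k) \<omega>) \<omega> \<partial>M)"
    by (simp add: \<Psi>_def W_def h_def sigma_sq_Suc)
  also have "\<dots> = (\<integral>\<omega>. \<Psi> 0 \<omega> + (\<Sum>y\<in>units. rate k y \<omega> *\<^sub>R (\<Psi> y \<omega> - \<Psi> 0 \<omega>)) \<partial>M)"
    by (rule step_expectation(3)[where \<Psi>=\<Psi>, OF k1 F int m])
  also have "\<dots> \<le> (\<integral>\<omega>. (W k \<omega> - W n \<omega>)\<^sup>2 + (1 - r) / k / (H (Suc k))\<^sup>2 * sigma_sq X k \<omega> \<partial>M)"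
  proof (rule integral_mono_AE)
    show "integrable M (\<lambda>\<omega>. \<Psi> 0 \<omega> + (\<Sum>y\<in>units. rate k y \<omega> *\<^sub>R (\<Psi> y \<omega> - \<Psi> 0 \<omega>)))"
      by (rule step_expectation(2)[where \<Psi>=\<Psi>, OF k1 F int m])
    show "integrable M (\<lambda>\<omega>. (W k \<omega> - W n \<omega>)\<^sup>2 + (1 - r) / k / (H (Suc k))\<^sup>2 * sigma_sq X k \<omega>)"
      by (intro Bochner_Integration.integrable_add integrable_mult_right iW integrable_sigma_sq)
    show "AE \<omega> in M. \<Psi> 0 \<omega> + (\<Sum>y\<in>units. rate k y \<omega> *\<^sub>R (\<Psi> y \<omega> - \<Psi> 0 \<omega>))
       \<le> (W k \<omega> - W n \<omega>)\<^sup>2 + (1 - r) / k / (H (Suc k))\<^sup>2 * sigma_sq X k \<omega>"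
      using AE_good
    proof eventually_elim
      case (elim \<omega>)
      define x where "x = sigma_sq X k \<omega> * h - W n \<omega>"
      define \<rho> where "\<rho> = (1 - r) * sigma_sq X k \<omega> / k"
      have "(\<Sum>y\<in>units. rate k y \<omega> *\<^sub>R (\<Psi> y \<omega> - \<Psi> 0 \<omega>)) = (\<Sum>y\<in>units. rate k y \<omega> * (2 * x * h + h\<^sup>2))"
      proof (rule sum.cong[OF refl])
        fix y assume "y \<in> units"
        then have "(norm y)\<^sup>2 = 1" by (simp add: norm_units)
        then have "\<Psi> y \<omega> = (x + h)\<^sup>2" "\<Psi> 0 \<omega> = x\<^sup>2" by (simp_all add: \<Psi>_def x_def algebra_simps)
        then show "rate k y \<omega> *\<^sub>R (\<Psi> y \<omega> - \<Psi> 0 \<omega>) = rate k y \<omega> * (2 * x * h + h\<^sup>2)"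
          by (simp add: power2_sum)
      qed
      also have "\<dots> = \<rho> * (2 * x * h + h\<^sup>2)"
        by (simp only: sum_distrib_right[symmetric] good_rate_total[OF elim] \<rho>_def)
      finally have L: "\<Psi> 0 \<omega> + (\<Sum>y\<in>units. rate k y \<omega> *\<^sub>R (\<Psi> y \<omega> - \<Psi> 0 \<omega>)) = x\<^sup>2 + \<rho> * (2 * x * h + h\<^sup>2)"
        by (simp add: \<Psi>_def x_def)
      have "W k \<omega> - W n \<omega> = x + \<rho> * h" unfolding WS x_def \<rho>_def by (simp add: algebra_simps)
      moreover have "(1 - r) / k / (H (Suc k))\<^sup>2 * sigma_sq X k \<omega> = \<rho> * h\<^sup>2"
        by (simp add: \<rho>_def h_def power_divide)
      moreover have "x\<^sup>2 + \<rho> * (2 * x * h + h\<^sup>2) \<le> (x + \<rho> * h)\<^sup>2 + \<rho> * h\<^sup>2"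
        by (simp add: power2_sum power_mult_distrib algebra_simps)
      ultimately show ?case unfolding L by simp
    qed
  qed
  also have "\<dots> = (\<integral>\<omega>. (W k \<omega> - W n \<omega>)\<^sup>2 \<partial>M) + (1 - r) / k / (H (Suc k))\<^sup>2 * (\<integral>\<omega>. sigma_sq X k \<omega> \<partial>M)"
    using iW integrable_sigma_sq[of k] by (subst Bochner_Integration.integral_add) auto
  finally show ?thesis .
qed

text \<open>The increments of the second moment are at most of order j^(-1 - (1 - r)); summed from n
  on they are of order n^(-(1 - r)), and \<open>expectation_abs_le\<close> takes the square
  root.\<close>

lemma W_cauchy:
  "\<exists>C\<ge>0. \<forall>n\<ge>1. \<forall>k\<ge>n. integrable M (\<lambda>\<omega>. W k \<omega> - W n \<omega>)
     \<and> (\<integral>\<omega>. \<bar>W k \<omega> - W n \<omega>\<bar> \<partial>M) \<le> C * real n powr (- (1 - r) / 2)"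
proof -
  let ?\<alpha> = "1 - r"
  obtain C where C: "0 < C" "\<And>n. 1 \<le> n \<Longrightarrow> (\<integral>\<omega>. sigma_sq X n \<omega> \<partial>M) \<le> C * real n powr (1 - r)"
    using sigma_sq_mean_le by blast
  define D where "D = ?\<alpha> * 4 * C * (2 powr (1 + ?\<alpha>) / ?\<alpha>)"
  have D0: "0 \<le> D" using C r_pos by (simp add: D_def)
  have "integrable M (\<lambda>\<omega>. W k \<omega> - W n \<omega>) \<and> (\<integral>\<omega>. \<bar>W k \<omega> - W n \<omega>\<bar> \<partial>M) \<le> (D + 1) / 2 * real n powr (- ?\<alpha> / 2)"
    if n: "1 \<le> n" and k: "n \<le> k" for n k
  proof -
    have inc: "?\<alpha> / j / (H (Suc j))\<^sup>2 * (\<integral>\<omega>. sigma_sq X j \<omega> \<partial>M) \<le> ?\<alpha> * 4 * C * real j powr (- 1 - ?\<alpha>)"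
      if j: "1 \<le> j" for j
    proof -
      have "real j powr ?\<alpha> / 2 \<le> H (Suc j)" using H_bounds(1)[OF j] H_mono[OF j] by linarith
      then have "(real j powr ?\<alpha> / 2)\<^sup>2 \<le> (H (Suc j))\<^sup>2" by (intro power_mono) auto
      then have h: "1 / (H (Suc j))\<^sup>2 \<le> 1 / (real j powr ?\<alpha> / 2)\<^sup>2" using j H_pos[of "Suc j"] by (intro divide_left_mono mult_pos_pos) auto
      have "?\<alpha> / j / (H (Suc j))\<^sup>2 * (\<integral>\<omega>. sigma_sq X j \<omega> \<partial>M) \<le> ?\<alpha> / j / (H (Suc j))\<^sup>2 * (C * real j powr ?\<alpha>)"
        using C(2)[OF j] r_pos by (intro mult_left_mono) auto
      also have "\<dots> = ?\<alpha> / j * (C * real j powr ?\<alpha>) * (1 / (H (Suc j))\<^sup>2)" by simp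
      also have "\<dots> \<le> ?\<alpha> / j * (C * real j powr ?\<alpha>) * (1 / (real j powr ?\<alpha> / 2)\<^sup>2)"
        using h C r_pos by (intro mult_left_mono) auto
      also have "\<dots> = ?\<alpha> * 4 * C * (1 / (real j * real j powr ?\<alpha>))"
        using j by (simp add: power2_eq_square field_simps)
      also have "1 / (real j * real j powr ?\<alpha>) = real j powr (- 1 - ?\<alpha>)"
        using j by (simp add: powr_diff powr_minus field_simps power2_eq_square)
      finally show ?thesis .
    qed
    have "(\<integral>\<omega>. (W k \<omega> - W n \<omega>)\<^sup>2 \<partial>M) \<le> (\<Sum>j=n..<k. ?\<alpha> * 4 * C * real j powr (- 1 - ?\<alpha>))"
      using k
    proof (induction k rule: dec_induct)
      case base show ?case by simp
    next
      case (step j)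
      then have "1 \<le> j" using n by simp
      from W_increment[OF n step(1)] inc[OF this]
      show ?case using step by simp
    qed
    also have "\<dots> = ?\<alpha> * 4 * C * (\<Sum>j=n..<k. real j powr (- 1 - ?\<alpha>))" by (rule sum_distrib_left[symmetric])
    also have "\<dots> \<le> D * (real n powr (- ?\<alpha> / 2))\<^sup>2"
    proof -
      have "real n powr ?\<alpha> * (\<Sum>j=n..<k. real j powr (- 1 - ?\<alpha>)) \<le> 2 powr (1 + ?\<alpha>) / ?\<alpha>"
        using powr_tail_sum[of ?\<alpha> n k] n k r_pos by (simp add: sum_distrib_left)
      then have "(\<Sum>j=n..<k. real j powr (- 1 - ?\<alpha>)) \<le> 2 powr (1 + ?\<alpha>) / ?\<alpha> / real n powr ?\<alpha>"
        using n by (subst pos_le_divide_eq) (auto simp: mult.commute)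
      moreover have "(real n powr (- ?\<alpha> / 2))\<^sup>2 = 1 / real n powr ?\<alpha>"
      proof -
        have "(real n powr (- ?\<alpha> / 2))\<^sup>2 = real n powr (- ?\<alpha> / 2 + - ?\<alpha> / 2)"
          by (simp only: power2_eq_square powr_add)
        also have "- ?\<alpha> / 2 + - ?\<alpha> / 2 = - ?\<alpha>" by (rule field_sum_of_halves)
        finally show ?thesis by (simp only: powr_minus_divide)
      qed
      ultimately show ?thesis
        using mult_left_mono[of "\<Sum>j=n..<k. real j powr (- 1 - ?\<alpha>)" "2 powr (1 + ?\<alpha>) / ?\<alpha> / real n powr ?\<alpha>" "?\<alpha> * 4 * C"] C r_pos
        by (simp only: D_def) (simp add: mult.assoc)
    qed
    finally have le: "(\<integral>\<omega>. (W k \<omega> - W n \<omega>)\<^sup>2 \<partial>M) \<le> D * (real n powr (- ?\<alpha> / 2))\<^sup>2" .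
    have iW: "integrable M (\<lambda>\<omega>. (W k \<omega> - W n \<omega>)\<^sup>2)"
    proof (rule integrable_good_bound)
      fix \<omega> assume g: "good \<omega>"
      then have "\<bar>W k \<omega> - W n \<omega>\<bar> \<le> real k / H k + real n / H n"
        using W_bound[OF g n] W_bound[OF g, of k] n k by linarith
      then show "norm ((W k \<omega> - W n \<omega>)\<^sup>2) \<le> (real k / H k + real n / H n)\<^sup>2"
        by (simp add: abs_le_square_iff[symmetric])
    qed measurable
    from expectation_abs_le[OF _ iW _ le] n show ?thesis by simp
  qed
  then show ?thesis using D0 by (intro exI[of _ "(D + 1) / 2"]) auto
qed

end

section \<open>The characteristic function of the tail\<close>

lemma exp_minus_taylor: "0 \<le> u \<Longrightarrow> \<bar>exp (- u) - (1 - u)\<bar> \<le> u\<^sup>2" for u :: real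
proof -
  assume u: "0 \<le> u"
  have "1 - u \<le> exp (- u)" using exp_ge_add_one_self[of "- u"] by simp
  moreover have "exp (- u) \<le> 1 / (1 + u)"
    using exp_ge_add_one_self[of u] u by (simp add: exp_minus field_simps)
  moreover have "1 / (1 + u) \<le> 1 - u + u\<^sup>2"
  proof -
    have "(1 - u + u\<^sup>2) * (1 + u) = 1 + u ^ 3" by (simp add: power2_eq_square power3_eq_cube algebra_simps)
    then have "1 \<le> (1 - u + u\<^sup>2) * (1 + u)" using u by simp
    then show ?thesis using u by (simp add: pos_divide_le_eq)
  qed
  ultimately show ?thesis by linarith
qed

lemma cis_taylor: "norm (cis x - (1 + \<i> * x - of_real (x\<^sup>2 / 2))) \<le> \<bar>x\<bar> ^ 3 / 6"
proof -
  have "cmod (iexp x - (\<Sum>k\<le>2. (\<i> * x) ^ k / fact k)) \<le> \<bar>x\<bar> ^ Suc 2 / fact (Suc 2)"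
    by (rule iexp_approx1)
  moreover have "(\<Sum>k\<le>2. (\<i> * x) ^ k / fact k) = 1 + \<i> * x - of_real (x\<^sup>2 / 2)"
    by (simp add: numeral_2_eq_2 power2_eq_square complex_eq_iff)
  ultimately show ?thesis by (simp add: cis_conv_exp fact_numeral numeral_3_eq_3 del: of_real_divide)
qed

text \<open>For a centred law with variance V the second order expansion is 1 - V / 2, and
  \<open>exp (- v / 2)\<close> is close to 1 - v / 2. The three errors are the mismatch of V with
  the intended variance \<open>v\<close>, the third absolute moment, and the remainder of the
  exponential.\<close>

lemma charfun_taylor:
  fixes \<pi>' x :: "'i \<Rightarrow> real"
  assumes fin: "finite I" and nn: "\<And>i. i \<in> I \<Longrightarrow> 0 \<le> \<pi>' i" and one: "(\<Sum>i\<in>I. \<pi>' i) = 1"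
    and mean: "(\<Sum>i\<in>I. \<pi>' i * x i) = 0" and v: "0 \<le> v"
  shows "norm ((\<Sum>i\<in>I. \<pi>' i *\<^sub>R cis (x i)) - of_real (exp (- v / 2)))
    \<le> \<bar>(\<Sum>i\<in>I. \<pi>' i * (x i)\<^sup>2) - v\<bar> / 2 + (\<Sum>i\<in>I. \<pi>' i * \<bar>x i\<bar> ^ 3) / 6 + v\<^sup>2 / 4"
proof -
  define V where "V = (\<Sum>i\<in>I. \<pi>' i * (x i)\<^sup>2)"
  have "(\<Sum>i\<in>I. \<pi>' i *\<^sub>R (1 + \<i> * x i - of_real ((x i)\<^sup>2 / 2)))
     = of_real (\<Sum>i\<in>I. \<pi>' i) + \<i> * of_real (\<Sum>i\<in>I. \<pi>' i * x i) - of_real (V / 2)"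
    by (simp add: V_def scaleR_conv_of_real sum.distrib sum_subtractf sum_distrib_left sum_divide_distrib algebra_simps)
  then have e: "(\<Sum>i\<in>I. \<pi>' i *\<^sub>R (1 + \<i> * x i - of_real ((x i)\<^sup>2 / 2))) = of_real (1 - V / 2)"
    by (simp add: one mean)
  have "norm ((\<Sum>i\<in>I. \<pi>' i *\<^sub>R cis (x i)) - of_real (1 - V / 2))
     = norm (\<Sum>i\<in>I. \<pi>' i *\<^sub>R (cis (x i) - (1 + \<i> * x i - of_real ((x i)\<^sup>2 / 2))))"
    unfolding e[symmetric] by (simp add: sum_subtractf[symmetric] scaleR_diff_right[symmetric] del: of_real_divide)
  also have "\<dots> \<le> (\<Sum>i\<in>I. norm (\<pi>' i *\<^sub>R (cis (x i) - (1 + \<i> * x i - of_real ((x i)\<^sup>2 / 2)))))"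
    by (rule norm_sum)
  also have "\<dots> \<le> (\<Sum>i\<in>I. \<pi>' i * \<bar>x i\<bar> ^ 3 / 6)"
  proof (rule sum_mono)
    fix i assume "i \<in> I"
    then show "norm (\<pi>' i *\<^sub>R (cis (x i) - (1 + \<i> * x i - of_real ((x i)\<^sup>2 / 2)))) \<le> \<pi>' i * \<bar>x i\<bar> ^ 3 / 6"
      using mult_left_mono[OF cis_taylor[of "x i"] nn[of i]] nn[of i] by (simp del: of_real_divide)
  qed
  finally have 1: "norm ((\<Sum>i\<in>I. \<pi>' i *\<^sub>R cis (x i)) - of_real (1 - V / 2)) \<le> (\<Sum>i\<in>I. \<pi>' i * \<bar>x i\<bar> ^ 3) / 6"
    by (simp add: sum_divide_distrib)
  have "norm (complex_of_real (1 - V / 2) - of_real (exp (- v / 2))) = \<bar>(1 - V / 2) - exp (- v / 2)\<bar>"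
    by (simp only: of_real_diff[symmetric] norm_of_real)
  also have "\<dots> \<le> \<bar>V - v\<bar> / 2 + v\<^sup>2 / 4"
  proof -
    have "\<bar>exp (- v / 2) - (1 - v / 2)\<bar> \<le> v\<^sup>2 / 4"
      using exp_minus_taylor[of "v / 2"] v by (simp add: power_divide)
    moreover have "\<bar>(1 - V / 2) - E\<bar> \<le> \<bar>V - v\<bar> / 2 + s" if "\<bar>E - (1 - v / 2)\<bar> \<le> s" for E s :: real
    proof -
      have "(1 - V / 2) - E = (1 - v / 2 - E) + (v - V) / 2" by (simp add: field_simps)
      then have "\<bar>(1 - V / 2) - E\<bar> \<le> \<bar>1 - v / 2 - E\<bar> + \<bar>(v - V) / 2\<bar>" by (metis abs_triangle_ineq)
      also have "\<bar>1 - v / 2 - E\<bar> \<le> s" using that by (simp only: abs_minus_commute)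
      also have "\<bar>(v - V) / 2\<bar> = \<bar>V - v\<bar> / 2" by (simp add: abs_minus_commute)
      finally show ?thesis by simp
    qed
    ultimately show ?thesis by blast
  qed
  finally have 2: "norm (complex_of_real (1 - V / 2) - of_real (exp (- v / 2))) \<le> \<bar>V - v\<bar> / 2 + v\<^sup>2 / 4" .
  have "norm ((\<Sum>i\<in>I. \<pi>' i *\<^sub>R cis (x i)) - of_real (exp (- v / 2)))
     \<le> norm ((\<Sum>i\<in>I. \<pi>' i *\<^sub>R cis (x i)) - of_real (1 - V / 2)) + norm (complex_of_real (1 - V / 2) - of_real (exp (- v / 2)))"
    using norm_triangle_ineq[of "(\<Sum>i\<in>I. \<pi>' i *\<^sub>R cis (x i)) - of_real (1 - V / 2)" "complex_of_real (1 - V / 2) - of_real (exp (- v / 2))"] by simp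
  with 1 2 show ?thesis unfolding V_def by linarith
qed

context superdiffusive_merws
begin

text \<open>Solves \<open>theta_mult\<close>, so that \<open>\<theta>\<close> times the leading part
  of the decrement of \<open>B\<close> matches the conditional variance per direction. It equals
  vartheta^2 of the theorem after cancelling 2 d - 1.\<close>

definition \<theta> :: real where "\<theta> = (1 - r) / (CARD('d) * (2 * (p - q) - (1 - r)))"

definition B :: "nat \<Rightarrow> real" where "B n = H n / (G n)\<^sup>2"

lemma theta_pos: "0 < \<theta>" unfolding \<theta>_def using r_pos superdiffusive by simp

lemma theta_mult: "\<theta> * (2 * (p - q) - (1 - r)) = (1 - r) / CARD('d)"
  unfolding \<theta>_def using superdiffusive by simp

lemma B_pos: "1 \<le> n \<Longrightarrow> 0 < B n"
  unfolding B_def by (intro divide_pos_pos zero_less_power H_pos G_pos)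

lemma B_diff:
  assumes "1 \<le> k"
  shows "B k - B (Suc k) = H k / (G (Suc k))\<^sup>2 * ((2 * (p - q) - (1 - r)) / k + (p - q)\<^sup>2 / k\<^sup>2)"
  unfolding B_def H_def G_def using gquot_ratio_diff[of "p - q" "1 - r" k] a_bounds r_pos assms by simp

lemma B_tendsto_0: "B \<longlonglongrightarrow> 0"
  unfolding B_def[abs_def] H_def G_def
  by (rule gquot_ratio_tendsto_0) (use a_bounds r_pos superdiffusive in auto)

text \<open>Divided by \<open>B n\<close> so that the product with \<open>B n\<close> is theta |w|^2
  sigma_n^2. The product with the decrement of \<open>B\<close> at k is then the variance that step
  k + 1 is expected to contribute.\<close>

definition \<kappa> :: "nat \<Rightarrow> ('w \<Rightarrow> real^'d) \<Rightarrow> 'w \<Rightarrow> real" where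
  "\<kappa> n w \<omega> = \<theta> * (norm (w \<omega>))\<^sup>2 * sigma_sq X n \<omega> / B n"

text \<open>It is 0 at k = n and tends to the quantity of interest, because the walk divided by
  \<open>G\<close> tends to \<open>L\<close>. At finite k it involves only the first k steps when
  \<open>w\<close> is known at time n <= k, so \<open>L\<close> stays out of the one-step
  analysis.\<close>

definition tail :: "nat \<Rightarrow> ('w \<Rightarrow> real^'d) \<Rightarrow> nat \<Rightarrow> 'w \<Rightarrow> real" where
  "tail n w k \<omega> = w \<omega> \<bullet> (walk X n \<omega> - (G n / G k) *\<^sub>R walk X k \<omega>)"

text \<open>Its expectation interpolates between the Gaussian value at \<open>k = n\<close> and the characteristic
  function of the tail as \<open>k\<close> tends to infinity, and it is nearly a martingale in \<open>k\<close>.\<close>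

definition interp :: "nat \<Rightarrow> ('w \<Rightarrow> real^'d) \<Rightarrow> nat \<Rightarrow> 'w \<Rightarrow> complex" where
  "interp n w k \<omega> = exp (- \<kappa> n w \<omega> * B k / 2) *\<^sub>R cis (tail n w k \<omega>)"

text \<open>The bracket lists the four sources of variance mismatch: anisotropy of the Gram matrix,
  fluctuation of \<open>W\<close>, the squared conditional mean, and the 1 / k^2 term in the
  decrement of \<open>B\<close>. The third moment and the squared intended variance follow.
  \<open>\<Omega>\<close> is a bound on |w|^2.\<close>

definition err :: "real \<Rightarrow> nat \<Rightarrow> nat \<Rightarrow> 'w \<Rightarrow> real" where
  "err \<Omega> n k \<omega> = (G n / G (Suc k))\<^sup>2 * \<Omega> / 2 *
       ((p - q) / k * (\<Sum>e\<in>Basis. \<bar>gram_dev k e \<omega>\<bar>) + (1 - r) / CARD('d) / k * H k * \<bar>W k \<omega> - W n \<omega>\<bar>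
         + (p - q)\<^sup>2 / k\<^sup>2 * (norm (walk X k \<omega>))\<^sup>2 + \<theta> * (p - q)\<^sup>2 / k\<^sup>2 * (H k / H n) * sigma_sq X n \<omega>)
     + (G n / G (Suc k)) ^ 3 * \<Omega> * sqrt \<Omega> * (1 - r) / 3 / k * sigma_sq X k \<omega>
     + ((G n / G (Suc k))\<^sup>2 * \<Omega> * (H k / H n) * ((1 - r) / CARD('d) + \<theta> * (p - q)\<^sup>2) / k)\<^sup>2 / 4 * (sigma_sq X n \<omega>)\<^sup>2"

text \<open>A step has at most one nonzero coordinate, so the mixed products in the square
  vanish.\<close>

lemma inner_sq_units:
  assumes "x \<in> insert 0 units"
  shows "(w \<bullet> x)\<^sup>2 = (\<Sum>e\<in>Basis. (w \<bullet> e)\<^sup>2 * (e \<bullet> x)\<^sup>2)"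
proof (cases "x = 0")
  case False
  then have "x \<in> units" using assms by simp
  then obtain s e where x: "s \<in> {1, - 1 :: real}" "e \<in> Basis" "x = s *\<^sub>R e"
    unfolding units_iff by blast
  have "(\<Sum>f\<in>Basis. (w \<bullet> f)\<^sup>2 * (f \<bullet> x)\<^sup>2) = (\<Sum>f\<in>Basis. if f = e then (w \<bullet> e)\<^sup>2 * s\<^sup>2 else 0)"
    using x(2) by (intro sum.cong refl) (auto simp: x(3) inner_Basis)
  also have "\<dots> = (w \<bullet> x)\<^sup>2" using x(2) by (simp add: x(3) power_mult_distrib mult.commute)
  finally show ?thesis ..
qed simp

text \<open>The Gram matrix is split into \<open>gram_dev\<close> and its isotropic part; the latter
  combines with the term in \<open>q\<close> to the coefficient (1 - r) / d.\<close>

lemma conditional_variance: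
  assumes g: "good \<omega>" and k: "1 \<le> k"
  shows "(\<Sum>y\<in>units. rate k y \<omega> * (w \<bullet> y)\<^sup>2)
    = (p - q) / k * (\<Sum>e\<in>Basis. (w \<bullet> e)\<^sup>2 * gram_dev k e \<omega>) + (1 - r) / CARD('d) / k * (norm w)\<^sup>2 * sigma_sq X k \<omega>"
proof -
  have "(\<Sum>j=1..k. (w \<bullet> X j \<omega>)\<^sup>2) = (\<Sum>j=1..k. \<Sum>e\<in>Basis. (w \<bullet> e)\<^sup>2 * (e \<bullet> X j \<omega>)\<^sup>2)"
    by (intro sum.cong refl inner_sq_units good_X[OF g]) simp
  also have "\<dots> = (\<Sum>e\<in>Basis. (w \<bullet> e)\<^sup>2 * (\<Sum>j=1..k. (e \<bullet> X j \<omega>)\<^sup>2))"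
    by (subst sum.swap) (simp only: sum_distrib_left)
  also have "\<dots> = (\<Sum>e\<in>Basis. (w \<bullet> e)\<^sup>2 * gram_dev k e \<omega> + (w \<bullet> e)\<^sup>2 * (sigma_sq X k \<omega> / CARD('d)))"
    by (simp add: gram_dev_def algebra_simps)
  also have "\<dots> = (\<Sum>e\<in>Basis. (w \<bullet> e)\<^sup>2 * gram_dev k e \<omega>) + (norm w)\<^sup>2 * (sigma_sq X k \<omega> / CARD('d))"
    by (simp only: sum.distrib sum_distrib_right[symmetric] norm_sq_Basis)
  finally have s: "(\<Sum>j=1..k. (w \<bullet> X j \<omega>)\<^sup>2) = (\<Sum>e\<in>Basis. (w \<bullet> e)\<^sup>2 * gram_dev k e \<omega>) + (norm w)\<^sup>2 * (sigma_sq X k \<omega> / CARD('d))" .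
  have "(p - q) * ((norm w)\<^sup>2 * (sigma_sq X k \<omega> / CARD('d))) + 2 * q * sigma_sq X k \<omega> * (norm w)\<^sup>2
     = (1 - r) / CARD('d) * (norm w)\<^sup>2 * sigma_sq X k \<omega>"
    unfolding alpha_eq by (simp add: field_simps)
  then show ?thesis
    unfolding good_rate_inner_sq[OF g] s
    by (simp only: distrib_left add.assoc add_divide_distrib) (simp add: algebra_simps)
qed

text \<open>Given the past, \<open>tail\<close> at k + 1 is \<open>tail\<close> at k plus a centred
  bounded variable. Once the common factor \<open>Pre\<close>, of modulus at most 1, is removed, the
  characteristic function of this variable is compared with the Gaussian factor of variance
  \<open>v\<close> by \<open>charfun_taylor\<close>.\<close>

lemma conditional_step_error:
  assumes g: "good \<omega>" and n: "1 \<le> n" and k: "n \<le> k" and \<Omega>: "(norm (w \<omega>))\<^sup>2 \<le> \<Omega>"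
  defines "\<Psi> \<equiv> \<lambda>y. exp (- \<kappa> n w \<omega> * B (Suc k) / 2) *\<^sub>R cis (w \<omega> \<bullet> (walk X n \<omega> - (G n / G (Suc k)) *\<^sub>R (walk X k \<omega> + y)))"
  shows "norm (\<Psi> 0 + (\<Sum>y\<in>units. rate k y \<omega> *\<^sub>R (\<Psi> y - \<Psi> 0)) - interp n w k \<omega>) \<le> err \<Omega> n k \<omega>"
proof -
  let ?a = "p - q" and ?\<alpha> = "1 - r" and ?S = "walk X k \<omega>" and ?w = "w \<omega>"
  have k1: "1 \<le> k" using n k by simp
  then have k0: "0 < real k" by simp
  define \<gamma> where "\<gamma> = G n / G (Suc k)"
  have \<gamma>: "0 < \<gamma>" unfolding \<gamma>_def using G_pos[OF n] G_pos[of "Suc k"] by simp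
  \<comment> \<open>\<open>c\<close> is the conditional mean of the inner product of
    \<open>?w\<close> with the next step, and \<open>prb\<close> completes the rates to a
    probability on the units and 0.\<close>
  define c where "c = ?a / k * (?w \<bullet> ?S)"
  define x where "x y = - (\<gamma> * (?w \<bullet> y - c))" for y
  define prb where "prb y = (if y = 0 then 1 - (\<Sum>y\<in>units. rate k y \<omega>) else rate k y \<omega>)" for y
  define v where "v = \<kappa> n w \<omega> * (B k - B (Suc k))"
  define Pre where "Pre = exp (- \<kappa> n w \<omega> * B (Suc k) / 2) *\<^sub>R cis (tail n w k \<omega>)"
  have sumI: "(\<Sum>y\<in>insert 0 units. prb y *\<^sub>R f y) = f 0 + (\<Sum>y\<in>units. rate k y \<omega> *\<^sub>R (f y - f 0))" for f :: "real^'d \<Rightarrow> 'c::real_vector"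
  proof -
    have "(\<Sum>y\<in>units. prb y *\<^sub>R f y) = (\<Sum>y\<in>units. rate k y \<omega> *\<^sub>R f y)"
      by (intro sum.cong refl) (auto simp: prb_def)
    then have "(\<Sum>y\<in>insert 0 units. prb y *\<^sub>R f y) = (1 - (\<Sum>y\<in>units. rate k y \<omega>)) *\<^sub>R f 0 + (\<Sum>y\<in>units. rate k y \<omega> *\<^sub>R f y)"
      by (simp add: prb_def)
    then show ?thesis by (simp add: scaleR_diff_left scaleR_diff_right sum_subtractf scaleR_sum_left)
  qed
  have \<kappa>0: "0 \<le> \<kappa> n w \<omega>" unfolding \<kappa>_def using theta_pos B_pos[OF n] sigma_sq_nonneg by simp
  have B_dec: "0 \<le> B k - B (Suc k)"
    unfolding B_diff[OF k1] using H_pos[OF k1] superdiffusive k0 by simp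
  have v0: "0 \<le> v" unfolding v_def using \<kappa>0 B_dec by simp
  \<comment> \<open>Here the choice of \<open>G\<close> pays off: the factor 1 + (p - q) / k
    supplies exactly the drift that centres \<open>x\<close>.\<close>
  have Gk: "G n / G k = \<gamma> * (1 + ?a / k)"
    unfolding \<gamma>_def G_Suc[OF k1] using G_pos[OF k1] a_bounds k0 by (simp add: add_pos_pos less_imp_neq[symmetric])
  have \<Psi>_eq: "\<Psi> y = Pre * cis (x y)" for y
  proof -
    have "?w \<bullet> (walk X n \<omega> - \<gamma> *\<^sub>R (?S + y)) = tail n w k \<omega> + x y"
      unfolding tail_def Gk x_def c_def by (simp add: inner_diff_right inner_add_right algebra_simps)
    then show ?thesis unfolding \<Psi>_def Pre_def \<gamma>_def[symmetric] by (simp add: cis_mult)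
  qed
  have interp_eq: "interp n w k \<omega> = Pre * of_real (exp (- v / 2))"
  proof -
    have "- \<kappa> n w \<omega> * B k / 2 = - \<kappa> n w \<omega> * B (Suc k) / 2 + - v / 2"
      unfolding v_def by (simp add: field_simps)
    then have "exp (- \<kappa> n w \<omega> * B k / 2) = exp (- \<kappa> n w \<omega> * B (Suc k) / 2) * exp (- v / 2)"
      by (simp only: exp_add)
    then show ?thesis unfolding interp_def Pre_def by (simp only: scaleR_conv_of_real of_real_mult) (simp add: mult_ac)
  qed
  have normPre: "norm Pre \<le> 1"
    unfolding Pre_def using \<kappa>0 B_pos[of "Suc k"] by (simp add: mult_nonneg_nonneg less_imp_le)
  have prb0: "0 \<le> prb y" if "y \<in> insert 0 units" for y
    unfolding prb_def using that rate_nonneg[OF g] rate_total_le_1[OF g, of k] by auto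
  have prb1: "(\<Sum>y\<in>insert 0 units. prb y) = 1" using sumI[of "\<lambda>_. 1::real"] by simp
  have wy: "(\<Sum>y\<in>insert 0 units. prb y * (?w \<bullet> y)) = c"
    using sumI[of "\<lambda>y. ?w \<bullet> y"] good_rate_inner[OF g, of k ?w] by (simp add: c_def)
  define V where "V = (\<Sum>y\<in>units. rate k y \<omega> * (?w \<bullet> y)\<^sup>2)"
  have wy2: "(\<Sum>y\<in>insert 0 units. prb y * (?w \<bullet> y)\<^sup>2) = V"
    using sumI[of "\<lambda>y. (?w \<bullet> y)\<^sup>2"] by (simp add: V_def)
  have mean: "(\<Sum>y\<in>insert 0 units. prb y * x y) = 0"
  proof -
    have "(\<Sum>y\<in>insert 0 units. prb y * x y) = (\<Sum>y\<in>insert 0 units. \<gamma> * c * prb y - \<gamma> * (prb y * (?w \<bullet> y)))"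
      by (intro sum.cong refl) (simp add: x_def algebra_simps)
    also have "\<dots> = \<gamma> * c * 1 - \<gamma> * c"
      by (simp only: sum_subtractf sum_distrib_left[symmetric] prb1 wy)
    finally show ?thesis by simp
  qed
  have var: "(\<Sum>y\<in>insert 0 units. prb y * (x y)\<^sup>2) = \<gamma>\<^sup>2 * (V - c\<^sup>2)"
  proof -
    have "(\<Sum>y\<in>insert 0 units. prb y * (x y)\<^sup>2) = (\<Sum>y\<in>insert 0 units. \<gamma>\<^sup>2 * (prb y * (?w \<bullet> y)\<^sup>2) - 2 * \<gamma>\<^sup>2 * c * (prb y * (?w \<bullet> y)) + \<gamma>\<^sup>2 * c\<^sup>2 * prb y)"
      by (intro sum.cong refl) (simp add: x_def power2_eq_square algebra_simps)
    also have "\<dots> = \<gamma>\<^sup>2 * V - 2 * \<gamma>\<^sup>2 * c * c + \<gamma>\<^sup>2 * c\<^sup>2 * 1"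
      by (simp only: sum.distrib sum_subtractf sum_distrib_left[symmetric] prb1 wy wy2)
    also have "\<dots> = \<gamma>\<^sup>2 * (V - c\<^sup>2)" by (simp add: power2_eq_square algebra_simps)
    finally show ?thesis .
  qed
  have main: "norm (\<Psi> 0 + (\<Sum>y\<in>units. rate k y \<omega> *\<^sub>R (\<Psi> y - \<Psi> 0)) - interp n w k \<omega>)
    \<le> \<bar>\<gamma>\<^sup>2 * (V - c\<^sup>2) - v\<bar> / 2 + (\<Sum>y\<in>insert 0 units. prb y * \<bar>x y\<bar> ^ 3) / 6 + v\<^sup>2 / 4"
  proof -
    have "\<Psi> 0 + (\<Sum>y\<in>units. rate k y \<omega> *\<^sub>R (\<Psi> y - \<Psi> 0)) - interp n w k \<omega>
      = Pre * ((\<Sum>y\<in>insert 0 units. prb y *\<^sub>R cis (x y)) - of_real (exp (- v / 2)))"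
    proof -
      have "\<Psi> 0 + (\<Sum>y\<in>units. rate k y \<omega> *\<^sub>R (\<Psi> y - \<Psi> 0)) = (\<Sum>y\<in>insert 0 units. prb y *\<^sub>R \<Psi> y)"
        by (rule sumI[symmetric])
      also have "\<dots> = Pre * (\<Sum>y\<in>insert 0 units. prb y *\<^sub>R cis (x y))"
        unfolding \<Psi>_eq by (simp only: sum_distrib_left mult_scaleR_right)
      finally show ?thesis unfolding interp_eq by (simp only: right_diff_distrib)
    qed
    then have "norm (\<Psi> 0 + (\<Sum>y\<in>units. rate k y \<omega> *\<^sub>R (\<Psi> y - \<Psi> 0)) - interp n w k \<omega>)
      \<le> 1 * norm ((\<Sum>y\<in>insert 0 units. prb y *\<^sub>R cis (x y)) - of_real (exp (- v / 2)))"
      using normPre by (simp only: norm_mult) (intro mult_right_mono, auto)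
    also have "\<dots> \<le> \<bar>\<gamma>\<^sup>2 * (V - c\<^sup>2) - v\<bar> / 2 + (\<Sum>y\<in>insert 0 units. prb y * \<bar>x y\<bar> ^ 3) / 6 + v\<^sup>2 / 4"
      using charfun_taylor[OF _ prb0 prb1 mean v0] by (simp only: var finite_insert finite_units mult_1_left simp_thms)
    finally show ?thesis .
  qed
  have w0: "0 \<le> (norm ?w)\<^sup>2" by simp
  have \<Omega>0: "0 \<le> \<Omega>" using \<Omega> w0 by linarith
  have hk: "0 < H k" "0 < H n" using H_pos k1 n by auto
  have V_eq: "V = ?a / k * (\<Sum>e\<in>Basis. (?w \<bullet> e)\<^sup>2 * gram_dev k e \<omega>) + ?\<alpha> / CARD('d) / k * (norm ?w)\<^sup>2 * sigma_sq X k \<omega>"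
    unfolding V_def by (rule conditional_variance[OF g k1])
  \<comment> \<open>By \<open>theta_mult\<close> the leading part of the decrement of
    \<open>B\<close> becomes the isotropic part of the conditional variance, with
    \<open>sigma_sq X k\<close> replaced by its prediction from time n.\<close>
  have v_eq: "v = \<gamma>\<^sup>2 * ((norm ?w)\<^sup>2 * (H k / H n * sigma_sq X n \<omega>) * (?\<alpha> / CARD('d) / k + \<theta> * ?a\<^sup>2 / k\<^sup>2))"
  proof -
    have "v = \<theta> * (norm ?w)\<^sup>2 * sigma_sq X n \<omega> / (H n / (G n)\<^sup>2) * (H k / (G (Suc k))\<^sup>2 * ((2 * ?a - ?\<alpha>) / k + ?a\<^sup>2 / k\<^sup>2))"
      unfolding v_def \<kappa>_def B_diff[OF k1] by (simp only: B_def)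
    also have "\<dots> = \<gamma>\<^sup>2 * ((norm ?w)\<^sup>2 * (H k / H n * sigma_sq X n \<omega>) * (\<theta> * (2 * ?a - ?\<alpha>) / k + \<theta> * ?a\<^sup>2 / k\<^sup>2))"
      unfolding \<gamma>_def by (simp add: power_divide field_simps)
    finally show ?thesis unfolding theta_mult .
  qed
  have E1: "\<bar>\<gamma>\<^sup>2 * (V - c\<^sup>2) - v\<bar> \<le> \<gamma>\<^sup>2 * \<Omega> * (?a / k * (\<Sum>e\<in>Basis. \<bar>gram_dev k e \<omega>\<bar>) + ?\<alpha> / CARD('d) / k * H k * \<bar>W k \<omega> - W n \<omega>\<bar>
         + ?a\<^sup>2 / k\<^sup>2 * (norm ?S)\<^sup>2 + \<theta> * ?a\<^sup>2 / k\<^sup>2 * (H k / H n) * sigma_sq X n \<omega>)" (is "_ \<le> \<gamma>\<^sup>2 * \<Omega> * ?X")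
  proof -
    \<comment> \<open>\<open>t1\<close> is the anisotropy, \<open>t2\<close> the difference between
      \<open>sigma_sq X k\<close> and its prediction, and \<open>t4\<close> the part of
      \<open>v\<close> of order 1 / k^2.\<close>
    define t1 where "t1 = ?a / k * (\<Sum>e\<in>Basis. (?w \<bullet> e)\<^sup>2 * gram_dev k e \<omega>)"
    define t2 where "t2 = ?\<alpha> / CARD('d) / k * (norm ?w)\<^sup>2 * (sigma_sq X k \<omega> - H k / H n * sigma_sq X n \<omega>)"
    define t4 where "t4 = (norm ?w)\<^sup>2 * (\<theta> * ?a\<^sup>2 / k\<^sup>2 * (H k / H n * sigma_sq X n \<omega>))"
    have eq: "\<gamma>\<^sup>2 * (V - c\<^sup>2) - v = \<gamma>\<^sup>2 * (t1 + t2 - c\<^sup>2 - t4)"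
    proof -
      have "g2 * ((t + a1 * w2 * z) - c2) - g2 * (w2 * hz * (a1 + th)) = g2 * (t + a1 * w2 * (z - hz) - c2 - w2 * (th * hz))"
        for g2 t a1 w2 z c2 hz th :: real
        by (simp add: algebra_simps)
      then show ?thesis unfolding V_eq v_eq t1_def t2_def t4_def by blast
    qed
    have "\<bar>(\<Sum>e\<in>Basis. (?w \<bullet> e)\<^sup>2 * gram_dev k e \<omega>)\<bar> \<le> (\<Sum>e\<in>Basis. \<bar>(?w \<bullet> e)\<^sup>2 * gram_dev k e \<omega>\<bar>)"
      by (rule sum_abs)
    also have "\<dots> \<le> (\<Sum>e\<in>Basis. \<Omega> * \<bar>gram_dev k e \<omega>\<bar>)"
    proof (rule sum_mono)
      fix e :: "real^'d" assume "e \<in> Basis"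
      then have "(?w \<bullet> e)\<^sup>2 \<le> (norm ?w)\<^sup>2" using Basis_le_norm[of e ?w] by (simp add: abs_le_square_iff[symmetric])
      then have "(?w \<bullet> e)\<^sup>2 \<le> \<Omega>" using \<Omega> by linarith
      then show "\<bar>(?w \<bullet> e)\<^sup>2 * gram_dev k e \<omega>\<bar> \<le> \<Omega> * \<bar>gram_dev k e \<omega>\<bar>"
        by (simp add: abs_mult mult_right_mono)
    qed
    also have "\<dots> = \<Omega> * (\<Sum>e\<in>Basis. \<bar>gram_dev k e \<omega>\<bar>)" by (rule sum_distrib_left[symmetric])
    finally have "?a / k * \<bar>(\<Sum>e\<in>Basis. (?w \<bullet> e)\<^sup>2 * gram_dev k e \<omega>)\<bar> \<le> ?a / k * (\<Omega> * (\<Sum>e\<in>Basis. \<bar>gram_dev k e \<omega>\<bar>))"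
      using a_bounds by (intro mult_left_mono) auto
    then have b1: "\<bar>t1\<bar> \<le> \<Omega> * (?a / k * (\<Sum>e\<in>Basis. \<bar>gram_dev k e \<omega>\<bar>))"
      using a_bounds unfolding t1_def by (simp add: abs_mult mult_ac)
    have Wd: "sigma_sq X k \<omega> - H k / H n * sigma_sq X n \<omega> = H k * (W k \<omega> - W n \<omega>)"
      unfolding W_def using hk by (simp add: field_simps)
    have "\<bar>t2\<bar> = (norm ?w)\<^sup>2 * (?\<alpha> / CARD('d) / k * H k * \<bar>W k \<omega> - W n \<omega>\<bar>)"
      unfolding t2_def Wd using hk r_pos by (simp add: abs_mult)
    also have "\<dots> \<le> \<Omega> * (?\<alpha> / CARD('d) / k * H k * \<bar>W k \<omega> - W n \<omega>\<bar>)"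
      using \<Omega> hk r_pos by (intro mult_right_mono) auto
    finally have b2: "\<bar>t2\<bar> \<le> \<Omega> * (?\<alpha> / CARD('d) / k * H k * \<bar>W k \<omega> - W n \<omega>\<bar>)" .
    have "(?w \<bullet> ?S)\<^sup>2 \<le> (norm ?w)\<^sup>2 * (norm ?S)\<^sup>2"
      using Cauchy_Schwarz_ineq[of ?w ?S] by (simp add: power2_norm_eq_inner)
    also have "\<dots> \<le> \<Omega> * (norm ?S)\<^sup>2" using \<Omega> by (intro mult_right_mono) auto
    finally have "?a\<^sup>2 / k\<^sup>2 * (?w \<bullet> ?S)\<^sup>2 \<le> ?a\<^sup>2 / k\<^sup>2 * (\<Omega> * (norm ?S)\<^sup>2)" by (intro mult_left_mono) auto
    then have b3: "\<bar>c\<^sup>2\<bar> \<le> \<Omega> * (?a\<^sup>2 / k\<^sup>2 * (norm ?S)\<^sup>2)"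
      unfolding c_def by (simp add: power_mult_distrib power_divide mult_ac)
    have n4: "0 \<le> \<theta> * ?a\<^sup>2 / k\<^sup>2 * (H k / H n) * sigma_sq X n \<omega>"
      using theta_pos hk sigma_sq_nonneg by simp
    have t4_eq: "t4 = (norm ?w)\<^sup>2 * (\<theta> * ?a\<^sup>2 / k\<^sup>2 * (H k / H n) * sigma_sq X n \<omega>)"
      unfolding t4_def by (simp only: mult.assoc)
    have "\<bar>t4\<bar> = t4" unfolding t4_eq by (rule abs_of_nonneg[OF mult_nonneg_nonneg[OF w0 n4]])
    then have b4: "\<bar>t4\<bar> \<le> \<Omega> * (\<theta> * ?a\<^sup>2 / k\<^sup>2 * (H k / H n) * sigma_sq X n \<omega>)"
      using mult_right_mono[OF \<Omega> n4] unfolding t4_eq by (simp only:)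
    have four: "\<bar>u1 + u2 - u3 - u4\<bar> \<le> x1 + x2 + x3 + x4"
      if "\<bar>u1\<bar> \<le> x1" "\<bar>u2\<bar> \<le> x2" "\<bar>u3\<bar> \<le> x3" "\<bar>u4\<bar> \<le> x4" for u1 u2 u3 u4 x1 x2 x3 x4 :: real
      using that by linarith
    have "\<bar>t1 + t2 - c\<^sup>2 - t4\<bar> \<le> \<Omega> * ?X"
      using four[OF b1 b2 b3 b4] by (simp only: distrib_left)
    then have "\<gamma>\<^sup>2 * \<bar>t1 + t2 - c\<^sup>2 - t4\<bar> \<le> \<gamma>\<^sup>2 * (\<Omega> * ?X)" by (intro mult_left_mono) auto
    then show ?thesis unfolding eq by (simp only: abs_mult abs_power2 mult.assoc)
  qed
  have E2: "(\<Sum>y\<in>insert 0 units. prb y * \<bar>x y\<bar> ^ 3) \<le> 2 * (\<gamma> ^ 3 * \<Omega> * sqrt \<Omega> * ?\<alpha> / k * sigma_sq X k \<omega>)"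
  proof -
    have nw: "norm ?w \<le> sqrt \<Omega>" using \<Omega> by (simp add: real_le_rsqrt)
    have cb: "\<bar>c\<bar> \<le> norm ?w"
    proof -
      have "\<bar>?w \<bullet> ?S\<bar> \<le> norm ?w * norm ?S" by (rule Cauchy_Schwarz_ineq2)
      also have "\<dots> \<le> norm ?w * k" using good_norm_walk[OF g, of k] by (intro mult_left_mono) auto
      finally have "?a / k * \<bar>?w \<bullet> ?S\<bar> \<le> ?a / k * (norm ?w * k)" using a_bounds by (intro mult_left_mono) auto
      also have "\<dots> = ?a * norm ?w" using k0 by simp
      also have "\<dots> \<le> 1 * norm ?w" using a_bounds by (intro mult_right_mono) auto
      finally show ?thesis unfolding c_def using a_bounds by (simp add: abs_mult)
    qed
    \<comment> \<open>Both the inner product with \<open>y\<close> and its mean \<open>c\<close> are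
      at most |w|, the latter because the walk has norm at most k and p - q <= 1. The third moment
      is then at most this bound times the variance.\<close>
    have xb: "\<bar>x y\<bar> \<le> 2 * \<gamma> * sqrt \<Omega>" if "y \<in> insert 0 units" for y
    proof -
      have "norm y \<le> 1" using that norm_units by auto
      then have "norm ?w * norm y \<le> norm ?w * 1" by (intro mult_left_mono) auto
      then have "\<bar>?w \<bullet> y\<bar> \<le> norm ?w" using Cauchy_Schwarz_ineq2[of ?w y] by linarith
      then have "\<bar>?w \<bullet> y - c\<bar> \<le> 2 * sqrt \<Omega>" using cb nw by linarith
      then have "\<gamma> * \<bar>?w \<bullet> y - c\<bar> \<le> \<gamma> * (2 * sqrt \<Omega>)" using \<gamma> by (intro mult_left_mono) auto
      then show ?thesis unfolding x_def using \<gamma> by (simp add: abs_mult mult_ac)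
    qed
    have "(\<Sum>y\<in>insert 0 units. prb y * \<bar>x y\<bar> ^ 3) \<le> (\<Sum>y\<in>insert 0 units. 2 * \<gamma> * sqrt \<Omega> * (prb y * (x y)\<^sup>2))"
    proof (rule sum_mono)
      fix y assume y: "y \<in> insert 0 units"
      have "\<bar>x y\<bar> * (prb y * (x y)\<^sup>2) \<le> 2 * \<gamma> * sqrt \<Omega> * (prb y * (x y)\<^sup>2)"
        using xb[OF y] prb0[OF y] by (intro mult_right_mono) auto
      then show "prb y * \<bar>x y\<bar> ^ 3 \<le> 2 * \<gamma> * sqrt \<Omega> * (prb y * (x y)\<^sup>2)"
        by (simp add: power3_eq_cube power2_eq_square mult_ac)
    qed
    also have "\<dots> = 2 * \<gamma> * sqrt \<Omega> * (\<gamma>\<^sup>2 * (V - c\<^sup>2))" by (simp only: sum_distrib_left[symmetric] var)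
    also have "\<dots> \<le> 2 * \<gamma> * sqrt \<Omega> * (\<gamma>\<^sup>2 * (\<Omega> * (?\<alpha> * sigma_sq X k \<omega> / k)))"
    proof (intro mult_left_mono)
      have "V \<le> (\<Sum>y\<in>units. rate k y \<omega> * \<Omega>)" unfolding V_def
      proof (intro sum_mono mult_left_mono rate_nonneg[OF g])
        fix y assume y: "y \<in> units"
        have "(?w \<bullet> y)\<^sup>2 \<le> (norm ?w)\<^sup>2"
          using Cauchy_Schwarz_ineq2[of ?w y] norm_units[OF y] by (simp add: abs_le_square_iff[symmetric])
        then show "(?w \<bullet> y)\<^sup>2 \<le> \<Omega>" using \<Omega> by linarith
      qed
      also have "\<dots> = (\<Sum>y\<in>units. rate k y \<omega>) * \<Omega>" by (rule sum_distrib_right[symmetric])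
      also have "\<dots> = \<Omega> * (?\<alpha> * sigma_sq X k \<omega> / k)"
        unfolding good_rate_total[OF g] by (rule mult.commute)
      finally show "V - c\<^sup>2 \<le> \<Omega> * (?\<alpha> * sigma_sq X k \<omega> / k)" using zero_le_power2[of c] by linarith
    qed (use \<gamma> \<Omega>0 in auto)
    also have "\<dots> = 2 * (\<gamma> ^ 3 * \<Omega> * sqrt \<Omega> * ?\<alpha> / k * sigma_sq X k \<omega>)"
      by (simp add: power3_eq_cube power2_eq_square)
    finally show ?thesis .
  qed
  have E3: "v\<^sup>2 \<le> (\<gamma>\<^sup>2 * \<Omega> * (H k / H n) * (?\<alpha> / CARD('d) + \<theta> * ?a\<^sup>2) / k)\<^sup>2 * (sigma_sq X n \<omega>)\<^sup>2"
  proof -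
    have k_ge: "1 \<le> real k" using k1 by simp
    have "\<theta> * ?a\<^sup>2 / k\<^sup>2 \<le> \<theta> * ?a\<^sup>2 / k"
      using theta_pos k_ge by (intro divide_left_mono) (auto simp: power2_eq_square)
    then have i: "?\<alpha> / CARD('d) / k + \<theta> * ?a\<^sup>2 / k\<^sup>2 \<le> (?\<alpha> / CARD('d) + \<theta> * ?a\<^sup>2) / k"
      unfolding add_divide_distrib by (rule add_left_mono)
    have "v \<le> \<gamma>\<^sup>2 * (\<Omega> * (H k / H n * sigma_sq X n \<omega>) * ((?\<alpha> / CARD('d) + \<theta> * ?a\<^sup>2) / k))"
      unfolding v_eq
    proof -
      have hz: "0 \<le> H k / H n * sigma_sq X n \<omega>"
        using hk sigma_sq_nonneg by (intro mult_nonneg_nonneg divide_nonneg_nonneg) (auto simp: less_imp_le)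
      have lhs: "0 \<le> ?\<alpha> / CARD('d) / k + \<theta> * ?a\<^sup>2 / k\<^sup>2"
        using theta_pos r_pos by (intro add_nonneg_nonneg divide_nonneg_nonneg mult_nonneg_nonneg) auto
      have "(norm ?w)\<^sup>2 * (H k / H n * sigma_sq X n \<omega>) \<le> \<Omega> * (H k / H n * sigma_sq X n \<omega>)"
        by (rule mult_right_mono[OF \<Omega> hz])
      from mult_mono[OF this i mult_nonneg_nonneg[OF \<Omega>0 hz] lhs]
      show "\<gamma>\<^sup>2 * ((norm ?w)\<^sup>2 * (H k / H n * sigma_sq X n \<omega>) * (?\<alpha> / CARD('d) / k + \<theta> * ?a\<^sup>2 / k\<^sup>2))
        \<le> \<gamma>\<^sup>2 * (\<Omega> * (H k / H n * sigma_sq X n \<omega>) * ((?\<alpha> / CARD('d) + \<theta> * ?a\<^sup>2) / k))"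
        by (rule mult_left_mono) simp
    qed
    also have "\<dots> = \<gamma>\<^sup>2 * \<Omega> * (H k / H n) * (?\<alpha> / CARD('d) + \<theta> * ?a\<^sup>2) / k * sigma_sq X n \<omega>" by simp
    finally show ?thesis using v0 by (simp only: power_mult_distrib[symmetric]) (rule power_mono)
  qed
  have "norm (\<Psi> 0 + (\<Sum>y\<in>units. rate k y \<omega> *\<^sub>R (\<Psi> y - \<Psi> 0)) - interp n w k \<omega>)
    \<le> (\<gamma>\<^sup>2 * \<Omega> * (?a / k * (\<Sum>e\<in>Basis. \<bar>gram_dev k e \<omega>\<bar>) + ?\<alpha> / CARD('d) / k * H k * \<bar>W k \<omega> - W n \<omega>\<bar>
         + ?a\<^sup>2 / k\<^sup>2 * (norm ?S)\<^sup>2 + \<theta> * ?a\<^sup>2 / k\<^sup>2 * (H k / H n) * sigma_sq X n \<omega>)) / 2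
      + (2 * (\<gamma> ^ 3 * \<Omega> * sqrt \<Omega> * ?\<alpha> / k * sigma_sq X k \<omega>)) / 6
      + ((\<gamma>\<^sup>2 * \<Omega> * (H k / H n) * (?\<alpha> / CARD('d) + \<theta> * ?a\<^sup>2) / k)\<^sup>2 * (sigma_sq X n \<omega>)\<^sup>2) / 4"
  proof -
    have "N \<le> A' / 2 + B' / 6 + C' / 4" if "N \<le> A / 2 + B / 6 + C / 4" "A \<le> A'" "B \<le> B'" "C \<le> C'"
      for N A A' B B' C C' :: real using that by linarith
    from this[OF main E1 E2 E3] show ?thesis .
  qed
  also have "\<dots> = err \<Omega> n k \<omega>"
  proof -
    have e1: "(u * x) / 2 = u / 2 * x" and e2: "(2 * (u * c / y * z)) / 6 = u * c / 3 / y * z"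
      and e3: "(u * z) / 4 = u / 4 * z" for u x y z c :: real by simp_all
    show ?thesis unfolding err_def \<gamma>_def[symmetric] e1 e2 e3 ..
  qed
  finally show ?thesis .
qed

lemma kappa_nonneg: "1 \<le> n \<Longrightarrow> 0 \<le> \<kappa> n w \<omega>"
  unfolding \<kappa>_def using theta_pos B_pos[of n] sigma_sq_nonneg[of n \<omega>]
  by (intro divide_nonneg_nonneg mult_nonneg_nonneg) auto

lemma kappa_F: "w \<in> borel_measurable (F n) \<Longrightarrow> \<kappa> n w \<in> borel_measurable (F n)"
  unfolding \<kappa>_def[abs_def]
  by (intro borel_measurable_divide borel_measurable_times borel_measurable_const borel_measurable_power
    measurable_compose[OF _ borel_measurable_norm] sigma_sq_F order_refl)

lemma kappa_M [measurable]: "w \<in> borel_measurable M \<Longrightarrow> \<kappa> n w \<in> borel_measurable M"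
  unfolding \<kappa>_def[abs_def]
  by (intro borel_measurable_divide borel_measurable_times borel_measurable_const borel_measurable_power
    measurable_compose[OF _ borel_measurable_norm] sigma_sq_M)

lemma interp_measurable [measurable]:
  assumes [measurable]: "w \<in> borel_measurable M" shows "interp n w k \<in> borel_measurable M"
  unfolding interp_def[abs_def] tail_def[abs_def] by measurable

lemma interp_norm_le: "1 \<le> n \<Longrightarrow> 1 \<le> k \<Longrightarrow> norm (interp n w k \<omega>) \<le> 1"
  unfolding interp_def using kappa_nonneg[of n w \<omega>] B_pos[of k]
  by (simp add: mult_nonneg_nonneg less_imp_le)

lemma integrable_interp: "w \<in> borel_measurable M \<Longrightarrow> 1 \<le> n \<Longrightarrow> 1 \<le> k \<Longrightarrow> integrable M (interp n w k)"
  by (rule integrable_const_bound[where B=1]) (auto intro!: interp_norm_le AE_I2)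

lemma integrable_gram_dev: assumes "e \<in> Basis" shows "integrable M (\<lambda>\<omega>. \<bar>gram_dev k e \<omega>\<bar>)"
proof (rule integrable_good_bound)
  fix \<omega> assume "good \<omega>"
  then show "norm \<bar>gram_dev k e \<omega>\<bar> \<le> real k" using gram_dev_bound[OF _ assms] by simp
qed measurable

lemma integrable_W_diff: "1 \<le> n \<Longrightarrow> n \<le> k \<Longrightarrow> integrable M (\<lambda>\<omega>. \<bar>W k \<omega> - W n \<omega>\<bar>)"
proof (rule integrable_good_bound)
  fix \<omega> assume n: "1 \<le> n" "n \<le> k" and g: "good \<omega>"
  then have "\<bar>W k \<omega> - W n \<omega>\<bar> \<le> real k / H k + real n / H n"
    using W_bound[OF g, of n] W_bound[OF g, of k] by linarith
  then show "norm \<bar>W k \<omega> - W n \<omega>\<bar> \<le> real k / H k + real n / H n" by simp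
qed measurable

lemma expectation_err:
  assumes n: "1 \<le> n" and k: "n \<le> k"
  shows "integrable M (err \<Omega> n k)"
    and "(\<integral>\<omega>. err \<Omega> n k \<omega> \<partial>M) = (G n / G (Suc k))\<^sup>2 * \<Omega> / 2 *
       ((p - q) / k * (\<Sum>e\<in>Basis. \<integral>\<omega>. \<bar>gram_dev k e \<omega>\<bar> \<partial>M) + (1 - r) / CARD('d) / k * H k * (\<integral>\<omega>. \<bar>W k \<omega> - W n \<omega>\<bar> \<partial>M)
         + (p - q)\<^sup>2 / k\<^sup>2 * (\<integral>\<omega>. (norm (walk X k \<omega>))\<^sup>2 \<partial>M) + \<theta> * (p - q)\<^sup>2 / k\<^sup>2 * (H k / H n) * (\<integral>\<omega>. sigma_sq X n \<omega> \<partial>M))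
     + (G n / G (Suc k)) ^ 3 * \<Omega> * sqrt \<Omega> * (1 - r) / 3 / k * (\<integral>\<omega>. sigma_sq X k \<omega> \<partial>M)
     + ((G n / G (Suc k))\<^sup>2 * \<Omega> * (H k / H n) * ((1 - r) / CARD('d) + \<theta> * (p - q)\<^sup>2) / k)\<^sup>2 / 4 * (\<integral>\<omega>. (sigma_sq X n \<omega>)\<^sup>2 \<partial>M)"
proof -
  have i1: "integrable M (\<lambda>\<omega>. \<Sum>e\<in>Basis. \<bar>gram_dev k e \<omega>\<bar>)"
    by (intro Bochner_Integration.integrable_sum integrable_gram_dev)
  have e1: "(\<integral>\<omega>. (\<Sum>e\<in>Basis. \<bar>gram_dev k e \<omega>\<bar>) \<partial>M) = (\<Sum>e\<in>Basis. \<integral>\<omega>. \<bar>gram_dev k e \<omega>\<bar> \<partial>M)"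
    by (rule Bochner_Integration.integral_sum) (rule integrable_gram_dev)
  note i2 = integrable_W_diff[OF n k]
  have i3: "integrable M (\<lambda>\<omega>. (norm (walk X k \<omega>))\<^sup>2)" using integrable_walk_sq[of k 0] by simp
  note i4 = integrable_sigma_sq[of n] and i5 = integrable_sigma_sq[of k] and i6 = integrable_sigma_sq_pow[of n 2]
  have lin: "integrable M (\<lambda>\<omega>. c0 * (c1 * f1 \<omega> + c2 * f2 \<omega> + c3 * f3 \<omega> + c4 * f4 \<omega>) + c5 * f5 \<omega> + c6 * f6 \<omega>)"
    "(\<integral>\<omega>. c0 * (c1 * f1 \<omega> + c2 * f2 \<omega> + c3 * f3 \<omega> + c4 * f4 \<omega>) + c5 * f5 \<omega> + c6 * f6 \<omega> \<partial>M)
      = c0 * (c1 * (\<integral>\<omega>. f1 \<omega> \<partial>M) + c2 * (\<integral>\<omega>. f2 \<omega> \<partial>M) + c3 * (\<integral>\<omega>. f3 \<omega> \<partial>M) + c4 * (\<integral>\<omega>. f4 \<omega> \<partial>M)) + c5 * (\<integral>\<omega>. f5 \<omega> \<partial>M) + c6 * (\<integral>\<omega>. f6 \<omega> \<partial>M)"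
    if "integrable M f1" "integrable M f2" "integrable M f3" "integrable M f4" "integrable M f5" "integrable M f6"
    for c0 c1 c2 c3 c4 c5 c6 :: real and f1 f2 f3 f4 f5 f6 :: "'w \<Rightarrow> real"
    using that by simp_all
  show "integrable M (err \<Omega> n k)"
    unfolding err_def[abs_def] by (rule lin(1)[OF i1 i2 i3 i4 i5 i6])
  show "(\<integral>\<omega>. err \<Omega> n k \<omega> \<partial>M) = (G n / G (Suc k))\<^sup>2 * \<Omega> / 2 *
       ((p - q) / k * (\<Sum>e\<in>Basis. \<integral>\<omega>. \<bar>gram_dev k e \<omega>\<bar> \<partial>M) + (1 - r) / CARD('d) / k * H k * (\<integral>\<omega>. \<bar>W k \<omega> - W n \<omega>\<bar> \<partial>M)
         + (p - q)\<^sup>2 / k\<^sup>2 * (\<integral>\<omega>. (norm (walk X k \<omega>))\<^sup>2 \<partial>M) + \<theta> * (p - q)\<^sup>2 / k\<^sup>2 * (H k / H n) * (\<integral>\<omega>. sigma_sq X n \<omega> \<partial>M))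
     + (G n / G (Suc k)) ^ 3 * \<Omega> * sqrt \<Omega> * (1 - r) / 3 / k * (\<integral>\<omega>. sigma_sq X k \<omega> \<partial>M)
     + ((G n / G (Suc k))\<^sup>2 * \<Omega> * (H k / H n) * ((1 - r) / CARD('d) + \<theta> * (p - q)\<^sup>2) / k)\<^sup>2 / 4 * (\<integral>\<omega>. (sigma_sq X n \<omega>)\<^sup>2 \<partial>M)"
    unfolding err_def lin(2)[OF i1 i2 i3 i4 i5 i6] e1 ..
qed

text \<open>Integrates \<open>conditional_step_error\<close>. That \<open>w\<close> is known at time
  n enters here: the tower property requires \<open>\<Psi> y\<close> to be
  \<open>F k\<close>-measurable.\<close>

lemma interp_step:
  assumes n: "1 \<le> n" and k: "n \<le> k" and wF: "w \<in> borel_measurable (F n)"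
    and \<Omega>: "\<And>\<omega>. (norm (w \<omega>))\<^sup>2 \<le> \<Omega>"
  shows "norm ((\<integral>\<omega>. interp n w (Suc k) \<omega> \<partial>M) - (\<integral>\<omega>. interp n w k \<omega> \<partial>M)) \<le> (\<integral>\<omega>. err \<Omega> n k \<omega> \<partial>M)"
proof -
  have k1: "1 \<le> k" using n k by simp
  have wM [measurable]: "w \<in> borel_measurable M" by (rule F_measurable[OF wF])
  define \<Psi> where "\<Psi> y \<omega> = exp (- \<kappa> n w \<omega> * B (Suc k) / 2) *\<^sub>R cis (w \<omega> \<bullet> (walk X n \<omega> - (G n / G (Suc k)) *\<^sub>R (walk X k \<omega> + y)))" for y \<omega>
  have XM [measurable]: "X (Suc k) \<in> borel_measurable M" by (rule X_measurable) simp
  have m: "(\<lambda>\<omega>. \<Psi> (X (Suc k) \<omega>) \<omega>) \<in> borel_measurable M" unfolding \<Psi>_def by measurable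
  have F: "\<Psi> y \<in> borel_measurable (F k)" for y
  proof -
    have [measurable]: "w \<in> borel_measurable (F k)" by (rule F_mono[OF k wF])
    have [measurable]: "\<kappa> n w \<in> borel_measurable (F k)" by (rule F_mono[OF k kappa_F[OF wF]])
    have [measurable]: "walk X n \<in> borel_measurable (F k)" by (rule walk_F[OF k])
    have [measurable]: "walk X k \<in> borel_measurable (F k)" by (rule walk_F[OF order_refl])
    show ?thesis unfolding \<Psi>_def by measurable
  qed
  have int: "integrable M (\<Psi> y)" for y
  proof (rule integrable_const_bound[where B=1])
    show "\<Psi> y \<in> borel_measurable M" by (rule F_measurable[OF F])
    show "AE \<omega> in M. norm (\<Psi> y \<omega>) \<le> 1"
    proof (rule AE_I2)
      fix \<omega>
      have "0 \<le> \<kappa> n w \<omega> * B (Suc k)" using kappa_nonneg[OF n] B_pos[of "Suc k"] by (intro mult_nonneg_nonneg) (auto simp: less_imp_le)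
      then show "norm (\<Psi> y \<omega>) \<le> 1" unfolding \<Psi>_def by simp
    qed
  qed
  have "(\<integral>\<omega>. interp n w (Suc k) \<omega> \<partial>M) = (\<integral>\<omega>. \<Psi> (X (Suc k) \<omega>) \<omega> \<partial>M)"
    by (simp add: interp_def tail_def \<Psi>_def walk_Suc)
  also have "\<dots> = (\<integral>\<omega>. \<Psi> 0 \<omega> + (\<Sum>y\<in>units. rate k y \<omega> *\<^sub>R (\<Psi> y \<omega> - \<Psi> 0 \<omega>)) \<partial>M)"
    by (rule step_expectation(3)[where \<Psi>=\<Psi>, OF k1 F int m])
  finally have "(\<integral>\<omega>. interp n w (Suc k) \<omega> \<partial>M) - (\<integral>\<omega>. interp n w k \<omega> \<partial>M)
     = (\<integral>\<omega>. \<Psi> 0 \<omega> + (\<Sum>y\<in>units. rate k y \<omega> *\<^sub>R (\<Psi> y \<omega> - \<Psi> 0 \<omega>)) - interp n w k \<omega> \<partial>M)"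
    using Bochner_Integration.integral_diff[OF step_expectation(2)[where \<Psi>=\<Psi>, OF k1 F int m] integrable_interp[OF wM n k1]] by simp
  also have "norm \<dots> \<le> (\<integral>\<omega>. norm (\<Psi> 0 \<omega> + (\<Sum>y\<in>units. rate k y \<omega> *\<^sub>R (\<Psi> y \<omega> - \<Psi> 0 \<omega>)) - interp n w k \<omega>) \<partial>M)"
    by (rule integral_norm_bound)
  also have "\<dots> \<le> (\<integral>\<omega>. err \<Omega> n k \<omega> \<partial>M)"
  proof (rule integral_mono_AE)
    show "integrable M (\<lambda>\<omega>. norm (\<Psi> 0 \<omega> + (\<Sum>y\<in>units. rate k y \<omega> *\<^sub>R (\<Psi> y \<omega> - \<Psi> 0 \<omega>)) - interp n w k \<omega>))"
      by (intro integrable_norm Bochner_Integration.integrable_diff step_expectation(2)[where \<Psi>=\<Psi>, OF k1 F int m] integrable_interp[OF wM n k1])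
    show "AE \<omega> in M. norm (\<Psi> 0 \<omega> + (\<Sum>y\<in>units. rate k y \<omega> *\<^sub>R (\<Psi> y \<omega> - \<Psi> 0 \<omega>)) - interp n w k \<omega>) \<le> err \<Omega> n k \<omega>"
      using AE_good
    proof eventually_elim
      case (elim \<omega>)
      show ?case unfolding \<Psi>_def by (rule conditional_step_error[OF elim n k \<Omega>])
    qed
  qed (rule expectation_err(1)[OF n k])
  finally show ?thesis .
qed

section \<open>Summation of the one-step errors\<close>

lemma powr_collect:
  fixes x y s \<delta> :: real
  assumes "0 < x" "0 < y" "u = s - \<delta>" "v = - 1 - s"
  shows "x powr u * y powr v = x powr s * y powr (- 1 - s) * x powr (- \<delta>)"
proof -
  have "x powr u = x powr s * x powr (- \<delta>)" unfolding assms(3) by (simp add: powr_add[symmetric])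
  then show ?thesis by (simp add: assms(4))
qed

text \<open>A triple (c, s, delta) stands for the bound c n^s k^(-1-s) n^(-delta). With |w|^2 of
  order n^(-(1 - r)), the growth rates of \<open>G\<close>, \<open>H\<close> and the moments bring
  all six terms of \<open>err\<close> into this form; s > 0 gives summability in k, and delta > 0
  makes the sum vanish.\<close>

lemma err_bound:
  assumes K: "0 \<le> K"
  shows "\<exists>T :: (real \<times> real \<times> real) list. (\<forall>(c, s, \<delta>)\<in>set T. 0 \<le> c \<and> 0 < s \<and> 0 < \<delta>) \<and>
    (\<forall>n\<ge>1. \<forall>k\<ge>n. (\<integral>\<omega>. err (K * real n powr (- (1 - r))) n k \<omega> \<partial>M)
       \<le> (\<Sum>(c, s, \<delta>)\<leftarrow>T. c * (real n powr s * real k powr (- 1 - s) * real n powr (- \<delta>))))"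
proof -
  define a \<alpha> d where "a = p - q" and "\<alpha> = 1 - r" and "d = real CARD('d)"
  have a: "0 < a" "a \<le> \<alpha>" "a < 1" and \<alpha>: "0 < \<alpha>" "\<alpha> < 1" and s2: "\<alpha> < 2 * a" and d0: "1 \<le> d"
    using a_bounds r_pos superdiffusive d_pos by (auto simp: a_def \<alpha>_def d_def)
  obtain \<beta> Cg where \<beta>: "\<beta> < \<alpha>" "\<beta> < 2 * a" "0 \<le> Cg"
    and Cg: "\<And>e n. e \<in> Basis \<Longrightarrow> 1 \<le> n \<Longrightarrow> (\<integral>\<omega>. \<bar>gram_dev n e \<omega>\<bar> \<partial>M) \<le> Cg * real n powr \<beta>"
    using gram_dev_abs_le unfolding a_def \<alpha>_def by blast
  obtain Cw where Cw0: "0 \<le> Cw" and Cw: "\<And>n k. 1 \<le> n \<Longrightarrow> n \<le> k \<Longrightarrow> (\<integral>\<omega>. \<bar>W k \<omega> - W n \<omega>\<bar> \<partial>M) \<le> Cw * real n powr (- \<alpha> / 2)"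
    using W_cauchy unfolding \<alpha>_def by blast
  obtain Cs where Cs0: "0 \<le> Cs" and Cs: "\<And>n. 1 \<le> n \<Longrightarrow> (\<integral>\<omega>. (norm (walk X n \<omega>))\<^sup>2 \<partial>M) \<le> Cs * real n powr (2 * a)"
    using walk_second_moment_le unfolding a_def by blast
  obtain Cz where Cz0: "0 < Cz" and Cz: "\<And>n. 1 \<le> n \<Longrightarrow> (\<integral>\<omega>. sigma_sq X n \<omega> \<partial>M) \<le> Cz * real n powr \<alpha>"
    using sigma_sq_mean_le unfolding \<alpha>_def by blast
  obtain C2 where C20: "0 < C2" and C2: "\<And>n. 1 \<le> n \<Longrightarrow> (\<integral>\<omega>. (sigma_sq X n \<omega>)\<^sup>2 \<partial>M) \<le> C2 * real n powr (2 * \<alpha>)"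
    using sigma_sq_moment_le[of 2] unfolding \<alpha>_def by auto
  define C1 where "C1 = \<alpha> / d + \<theta> * a\<^sup>2"
  have C10: "0 \<le> C1" using \<alpha> d0 theta_pos by (simp add: C1_def)
  \<comment> \<open>In the order of the terms of \<open>err\<close>. The gains delta stem from the
    smaller order of the Gram deviation, the rate in \<open>W_cauchy\<close>, the squared drift with
    1 + alpha - 2 a = (1 - a) + (alpha - a) > 0, an extra 1 / k, the factor
    \<open>sqrt \<Omega>\<close> of the third moment, and again an extra 1 / k.\<close>
  define T where "T = [(2 * K * a * d * Cg, 2 * a - \<beta>, \<alpha> - \<beta>), (2 * K * (\<alpha> / d) * Cw, 2 * a - \<alpha>, \<alpha> / 2),
      (2 * K * a\<^sup>2 * Cs, 1, 1 + \<alpha> - 2 * a), (4 * K * \<theta> * a\<^sup>2 * Cz, 2 * a - \<alpha> + 1, 1),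
      (8 * K * sqrt K * \<alpha> / 3 * Cz, 3 * a - \<alpha>, \<alpha> / 2), (16 * K\<^sup>2 * C1\<^sup>2 * C2, 4 * a - 2 * \<alpha> + 1, 1)]"
  have T: "\<forall>(c, s, \<delta>)\<in>set T. 0 \<le> c \<and> 0 < s \<and> 0 < \<delta>"
    unfolding T_def using K a \<alpha> s2 d0 \<beta> Cw0 Cs0 Cz0 C20 theta_pos by (auto intro!: mult_nonneg_nonneg)
  have "(\<integral>\<omega>. err (K * real n powr (- \<alpha>)) n k \<omega> \<partial>M)
       \<le> (\<Sum>(c, s, \<delta>)\<leftarrow>T. c * (real n powr s * real k powr (- 1 - s) * real n powr (- \<delta>)))" if n: "1 \<le> n" and k: "n \<le> k" for n k
  proof -
    define x y where "x = real n" and "y = real k"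
    have k1: "1 \<le> k" using n k by simp
    have x: "0 < x" and y: "0 < y" using n k1 by (simp_all add: x_def y_def)
    define \<gamma> where "\<gamma> = G n / G (Suc k)"
    define \<Omega> where "\<Omega> = K * x powr (- \<alpha>)"
    define \<eta> where "\<eta> = H k / H n"
    have \<gamma>0: "0 \<le> \<gamma>" unfolding \<gamma>_def using G_pos[OF n] G_pos[of "Suc k"] by simp
    have \<gamma>: "\<gamma> \<le> 2 * (x powr a * y powr (- a))"
    proof -
      have "y powr a / 2 \<le> G (Suc k)" using G_bounds(1)[OF k1] G_mono[OF k1] by (simp add: y_def a_def)
      moreover have "0 < y powr a / 2" using y by simp
      ultimately have "\<gamma> \<le> x powr a / (y powr a / 2)"
        unfolding \<gamma>_def using G_bounds(2)[OF n] by (intro frac_le) (auto simp: x_def a_def)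
      then show ?thesis by (simp add: powr_minus field_simps)
    qed
    have \<eta>0: "0 \<le> \<eta>" unfolding \<eta>_def using H_pos[OF n] H_pos[OF k1] by simp
    have \<eta>: "\<eta> \<le> 2 * (y powr \<alpha> * x powr (- \<alpha>))"
    proof -
      have "0 < x powr \<alpha> / 2" using x by simp
      then have "\<eta> \<le> y powr \<alpha> / (x powr \<alpha> / 2)"
        unfolding \<eta>_def using H_bounds(2)[OF k1] H_bounds(1)[OF n] by (intro frac_le) (auto simp: x_def y_def \<alpha>_def)
      then show ?thesis by (simp add: powr_minus field_simps)
    qed
    have \<Omega>0: "0 \<le> \<Omega>" unfolding \<Omega>_def using K by simp
    have sq\<Omega>: "sqrt \<Omega> = sqrt K * x powr (- \<alpha> / 2)"
      unfolding \<Omega>_def by (simp add: real_sqrt_mult powr_half_sqrt[symmetric] powr_powr)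
    define P where "P = x powr (2 * a - \<alpha>) * y powr (- 2 * a)"
    have P0: "0 \<le> P" by (simp add: P_def)
    have \<gamma>2: "\<gamma>\<^sup>2 * \<Omega> \<le> 4 * K * P"
    proof -
      have "\<gamma>\<^sup>2 \<le> (2 * (x powr a * y powr (- a)))\<^sup>2" using \<gamma> \<gamma>0 by (rule power_mono)
      also have "\<dots> = 4 * (x powr (2 * a) * y powr (- 2 * a))"
      proof -
        have "(z powr u)\<^sup>2 = z powr (2 * u)" for z u :: real by (simp add: power2_eq_square powr_add[symmetric])
        then show ?thesis by (simp add: power_mult_distrib)
      qed
      finally have "\<gamma>\<^sup>2 * \<Omega> \<le> 4 * (x powr (2 * a) * y powr (- 2 * a)) * \<Omega>" using \<Omega>0 by (rule mult_right_mono)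
      also have "\<dots> = 4 * K * P"
      proof -
        have "x powr (2 * a - \<alpha>) = x powr (2 * a) * x powr (- \<alpha>)" by (simp add: powr_add[symmetric])
        then show ?thesis unfolding P_def \<Omega>_def by simp
      qed
      finally show ?thesis .
    qed
    have mm: "\<gamma>\<^sup>2 * \<Omega> / 2 * u \<le> 2 * K * P * v" if "u \<le> v" "0 \<le> u" for u v
    proof (rule mult_mono[OF _ that(1) _ that(2)])
      show "\<gamma>\<^sup>2 * \<Omega> / 2 \<le> 2 * K * P" using \<gamma>2 by simp
      show "0 \<le> 2 * K * P" using K P0 by simp
    qed
    have inv: "1 / y = y powr (- 1)" "1 / y\<^sup>2 = y powr (- 2)"
      using y by (simp_all add: powr_minus_divide powr_numeral)
    have t1: "\<gamma>\<^sup>2 * \<Omega> / 2 * (a / y * (\<Sum>e\<in>Basis. \<integral>\<omega>. \<bar>gram_dev k e \<omega>\<bar> \<partial>M))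
      \<le> (2 * K * a * d * Cg) * (x powr (2 * a - \<beta>) * y powr (- 1 - (2 * a - \<beta>)) * x powr (- (\<alpha> - \<beta>)))"
    proof -
      have "(\<Sum>e\<in>(Basis :: (real^'d) set). \<integral>\<omega>. \<bar>gram_dev k e \<omega>\<bar> \<partial>M) \<le> (\<Sum>e\<in>(Basis :: (real^'d) set). Cg * y powr \<beta>)"
        unfolding y_def by (intro sum_mono Cg k1)
      also have "\<dots> = d * (Cg * y powr \<beta>)" by (simp add: d_def)
      finally have "a / y * (\<Sum>e\<in>Basis. \<integral>\<omega>. \<bar>gram_dev k e \<omega>\<bar> \<partial>M) \<le> a / y * (d * (Cg * y powr \<beta>))"
        using a y by (intro mult_left_mono) auto
      moreover have "0 \<le> a / y * (\<Sum>e\<in>Basis. \<integral>\<omega>. \<bar>gram_dev k e \<omega>\<bar> \<partial>M)" using a y by (intro mult_nonneg_nonneg sum_nonneg) auto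
      ultimately have "\<gamma>\<^sup>2 * \<Omega> / 2 * (a / y * (\<Sum>e\<in>Basis. \<integral>\<omega>. \<bar>gram_dev k e \<omega>\<bar> \<partial>M)) \<le> 2 * K * P * (a / y * (d * (Cg * y powr \<beta>)))"
        by (rule mm)
      also have "\<dots> = (2 * K * a * d * Cg) * (x powr (2 * a - \<alpha>) * (y powr (- 2 * a) * y powr \<beta> * (1 / y)))"
        unfolding P_def by simp
      also have "y powr (- 2 * a) * y powr \<beta> * (1 / y) = y powr (- 2 * a + \<beta> + - 1)"
        unfolding inv by (simp only: powr_add)
      also have "x powr (2 * a - \<alpha>) * y powr (- 2 * a + \<beta> + - 1) = x powr (2 * a - \<beta>) * y powr (- 1 - (2 * a - \<beta>)) * x powr (- (\<alpha> - \<beta>))"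
        by (rule powr_collect[OF x y]) simp_all
      finally show ?thesis .
    qed
    have t2: "\<gamma>\<^sup>2 * \<Omega> / 2 * (\<alpha> / d / y * H k * (\<integral>\<omega>. \<bar>W k \<omega> - W n \<omega>\<bar> \<partial>M))
      \<le> (2 * K * (\<alpha> / d) * Cw) * (x powr (2 * a - \<alpha>) * y powr (- 1 - (2 * a - \<alpha>)) * x powr (- (\<alpha> / 2)))"
    proof -
      have "\<alpha> / d / y * H k * (\<integral>\<omega>. \<bar>W k \<omega> - W n \<omega>\<bar> \<partial>M) \<le> \<alpha> / d / y * y powr \<alpha> * (Cw * x powr (- \<alpha> / 2))"
        using \<alpha> d0 y H_pos[OF k1] H_bounds(2)[OF k1] Cw[OF n k] Cw0
        by (intro mult_mono mult_left_mono) (auto simp: x_def y_def \<alpha>_def less_imp_le)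
      moreover have "0 \<le> \<alpha> / d / y * H k * (\<integral>\<omega>. \<bar>W k \<omega> - W n \<omega>\<bar> \<partial>M)" using \<alpha> d0 y H_pos[OF k1] by simp
      ultimately have "\<gamma>\<^sup>2 * \<Omega> / 2 * (\<alpha> / d / y * H k * (\<integral>\<omega>. \<bar>W k \<omega> - W n \<omega>\<bar> \<partial>M)) \<le> 2 * K * P * (\<alpha> / d / y * y powr \<alpha> * (Cw * x powr (- \<alpha> / 2)))"
        by (rule mm)
      also have "\<dots> = (2 * K * (\<alpha> / d) * Cw) * ((x powr (2 * a - \<alpha>) * x powr (- \<alpha> / 2)) * (y powr (- 2 * a) * y powr \<alpha> * (1 / y)))"
        unfolding P_def by simp
      also have "y powr (- 2 * a) * y powr \<alpha> * (1 / y) = y powr (- 2 * a + \<alpha> + - 1)"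
        unfolding inv by (simp only: powr_add)
      also have "x powr (2 * a - \<alpha>) * x powr (- \<alpha> / 2) = x powr (2 * a - \<alpha> + - \<alpha> / 2)" by (simp only: powr_add)
      also have "x powr (2 * a - \<alpha> + - \<alpha> / 2) * y powr (- 2 * a + \<alpha> + - 1) = x powr (2 * a - \<alpha>) * y powr (- 1 - (2 * a - \<alpha>)) * x powr (- (\<alpha> / 2))"
        by (rule powr_collect[OF x y]) simp_all
      finally show ?thesis .
    qed
    have t3: "\<gamma>\<^sup>2 * \<Omega> / 2 * (a\<^sup>2 / y\<^sup>2 * (\<integral>\<omega>. (norm (walk X k \<omega>))\<^sup>2 \<partial>M))
      \<le> (2 * K * a\<^sup>2 * Cs) * (x powr 1 * y powr (- 1 - 1) * x powr (- (1 + \<alpha> - 2 * a)))"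
    proof -
      have "a\<^sup>2 / y\<^sup>2 * (\<integral>\<omega>. (norm (walk X k \<omega>))\<^sup>2 \<partial>M) \<le> a\<^sup>2 / y\<^sup>2 * (Cs * y powr (2 * a))"
        using Cs[OF k1] by (intro mult_left_mono) (auto simp: y_def)
      moreover have "0 \<le> a\<^sup>2 / y\<^sup>2 * (\<integral>\<omega>. (norm (walk X k \<omega>))\<^sup>2 \<partial>M)" by simp
      ultimately have "\<gamma>\<^sup>2 * \<Omega> / 2 * (a\<^sup>2 / y\<^sup>2 * (\<integral>\<omega>. (norm (walk X k \<omega>))\<^sup>2 \<partial>M)) \<le> 2 * K * P * (a\<^sup>2 / y\<^sup>2 * (Cs * y powr (2 * a)))"
        by (rule mm)
      also have "\<dots> = (2 * K * a\<^sup>2 * Cs) * (x powr (2 * a - \<alpha>) * (y powr (- 2 * a) * y powr (2 * a) * (1 / y\<^sup>2)))"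
        unfolding P_def by simp
      also have "y powr (- 2 * a) * y powr (2 * a) * (1 / y\<^sup>2) = y powr (- 2 * a + 2 * a + - 2)"
        unfolding inv by (simp only: powr_add)
      also have "x powr (2 * a - \<alpha>) * y powr (- 2 * a + 2 * a + - 2) = x powr 1 * y powr (- 1 - 1) * x powr (- (1 + \<alpha> - 2 * a))"
        by (rule powr_collect[OF x y]) simp_all
      finally show ?thesis .
    qed
    have t4: "\<gamma>\<^sup>2 * \<Omega> / 2 * (\<theta> * a\<^sup>2 / y\<^sup>2 * \<eta> * (\<integral>\<omega>. sigma_sq X n \<omega> \<partial>M))
      \<le> (4 * K * \<theta> * a\<^sup>2 * Cz) * (x powr (2 * a - \<alpha> + 1) * y powr (- 1 - (2 * a - \<alpha> + 1)) * x powr (- 1))"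
    proof -
      have ez: "0 \<le> (\<integral>\<omega>. sigma_sq X n \<omega> \<partial>M)" by (rule Bochner_Integration.integral_nonneg) (rule sigma_sq_nonneg)
      have c0: "0 \<le> \<theta> * a\<^sup>2 / y\<^sup>2" using theta_pos by simp
      have "\<theta> * a\<^sup>2 / y\<^sup>2 * \<eta> * (\<integral>\<omega>. sigma_sq X n \<omega> \<partial>M) \<le> \<theta> * a\<^sup>2 / y\<^sup>2 * (2 * (y powr \<alpha> * x powr (- \<alpha>))) * (Cz * x powr \<alpha>)"
        using c0 \<eta> \<eta>0 ez Cz[OF n] Cz0 by (intro mult_mono mult_left_mono mult_nonneg_nonneg) (auto simp: x_def)
      moreover have "0 \<le> \<theta> * a\<^sup>2 / y\<^sup>2 * \<eta> * (\<integral>\<omega>. sigma_sq X n \<omega> \<partial>M)" by (intro mult_nonneg_nonneg c0 \<eta>0 ez)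
      ultimately have "\<gamma>\<^sup>2 * \<Omega> / 2 * (\<theta> * a\<^sup>2 / y\<^sup>2 * \<eta> * (\<integral>\<omega>. sigma_sq X n \<omega> \<partial>M)) \<le> 2 * K * P * (\<theta> * a\<^sup>2 / y\<^sup>2 * (2 * (y powr \<alpha> * x powr (- \<alpha>))) * (Cz * x powr \<alpha>))"
        by (rule mm)
      also have "\<dots> = (4 * K * \<theta> * a\<^sup>2 * Cz) * ((x powr (2 * a - \<alpha>) * x powr (- \<alpha>) * x powr \<alpha>) * (y powr (- 2 * a) * y powr \<alpha> * (1 / y\<^sup>2)))"
        unfolding P_def by simp
      also have "y powr (- 2 * a) * y powr \<alpha> * (1 / y\<^sup>2) = y powr (- 2 * a + \<alpha> + - 2)"
        unfolding inv by (simp only: powr_add)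
      also have "x powr (2 * a - \<alpha>) * x powr (- \<alpha>) * x powr \<alpha> = x powr (2 * a - \<alpha> + - \<alpha> + \<alpha>)" by (simp only: powr_add)
      also have "x powr (2 * a - \<alpha> + - \<alpha> + \<alpha>) * y powr (- 2 * a + \<alpha> + - 2) = x powr (2 * a - \<alpha> + 1) * y powr (- 1 - (2 * a - \<alpha> + 1)) * x powr (- 1)"
        by (rule powr_collect[OF x y]) simp_all
      finally show ?thesis .
    qed
    have t5: "\<gamma> ^ 3 * \<Omega> * sqrt \<Omega> * \<alpha> / 3 / y * (\<integral>\<omega>. sigma_sq X k \<omega> \<partial>M)
      \<le> (8 * K * sqrt K * \<alpha> / 3 * Cz) * (x powr (3 * a - \<alpha>) * y powr (- 1 - (3 * a - \<alpha>)) * x powr (- (\<alpha> / 2)))"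
    proof -
      have ez: "0 \<le> (\<integral>\<omega>. sigma_sq X k \<omega> \<partial>M)" by (rule Bochner_Integration.integral_nonneg) (rule sigma_sq_nonneg)
      have "\<gamma> ^ 3 \<le> (2 * (x powr a * y powr (- a))) ^ 3" using \<gamma> \<gamma>0 by (rule power_mono)
      also have "\<dots> = 8 * (x powr (3 * a) * y powr (- 3 * a))"
      proof -
        have "(z powr u) ^ 3 = z powr (3 * u)" for z u :: real by (simp add: power3_eq_cube powr_add[symmetric])
        then show ?thesis by (simp add: power_mult_distrib)
      qed
      finally have g3: "\<gamma> ^ 3 \<le> 8 * (x powr (3 * a) * y powr (- 3 * a))" .
      have "\<gamma> ^ 3 * (\<Omega> * sqrt \<Omega> * \<alpha> / 3 / y * (\<integral>\<omega>. sigma_sq X k \<omega> \<partial>M))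
         \<le> 8 * (x powr (3 * a) * y powr (- 3 * a)) * (\<Omega> * sqrt \<Omega> * \<alpha> / 3 / y * (Cz * y powr \<alpha>))"
      proof (rule mult_mono[OF g3])
        show "\<Omega> * sqrt \<Omega> * \<alpha> / 3 / y * (\<integral>\<omega>. sigma_sq X k \<omega> \<partial>M) \<le> \<Omega> * sqrt \<Omega> * \<alpha> / 3 / y * (Cz * y powr \<alpha>)"
          using \<Omega>0 \<alpha> y Cz[OF k1] by (intro mult_left_mono) (auto simp: y_def)
        show "0 \<le> \<Omega> * sqrt \<Omega> * \<alpha> / 3 / y * (\<integral>\<omega>. sigma_sq X k \<omega> \<partial>M)" using \<Omega>0 \<alpha> y ez by simp
      qed simp
      also have "\<dots> = (8 * K * sqrt K * \<alpha> / 3 * Cz) * ((x powr (3 * a) * x powr (- \<alpha>) * x powr (- \<alpha> / 2)) * (y powr (- 3 * a) * y powr \<alpha> * (1 / y)))"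
        unfolding sq\<Omega> unfolding \<Omega>_def by simp
      also have "y powr (- 3 * a) * y powr \<alpha> * (1 / y) = y powr (- 3 * a + \<alpha> + - 1)"
        unfolding inv by (simp only: powr_add)
      also have "x powr (3 * a) * x powr (- \<alpha>) * x powr (- \<alpha> / 2) = x powr (3 * a + - \<alpha> + - \<alpha> / 2)" by (simp only: powr_add)
      also have "x powr (3 * a + - \<alpha> + - \<alpha> / 2) * y powr (- 3 * a + \<alpha> + - 1) = x powr (3 * a - \<alpha>) * y powr (- 1 - (3 * a - \<alpha>)) * x powr (- (\<alpha> / 2))"
        by (rule powr_collect[OF x y]) simp_all
      finally show ?thesis by simp
    qed
    have t6: "(\<gamma>\<^sup>2 * \<Omega> * \<eta> * C1 / y)\<^sup>2 / 4 * (\<integral>\<omega>. (sigma_sq X n \<omega>)\<^sup>2 \<partial>M)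
      \<le> (16 * K\<^sup>2 * C1\<^sup>2 * C2) * (x powr (4 * a - 2 * \<alpha> + 1) * y powr (- 1 - (4 * a - 2 * \<alpha> + 1)) * x powr (- 1))"
    proof -
      have ez: "0 \<le> (\<integral>\<omega>. (sigma_sq X n \<omega>)\<^sup>2 \<partial>M)" by (rule Bochner_Integration.integral_nonneg) simp
      have "\<gamma>\<^sup>2 * \<Omega> * \<eta> * C1 / y \<le> 4 * K * P * (2 * (y powr \<alpha> * x powr (- \<alpha>))) * C1 / y"
      proof (rule divide_right_mono[OF mult_right_mono[OF mult_mono[OF \<gamma>2 \<eta> _ \<eta>0] C10]])
        show "0 \<le> 4 * K * P" using K P0 by simp
      qed (use y in simp)
      moreover have "0 \<le> \<gamma>\<^sup>2 * \<Omega> * \<eta> * C1 / y" using \<Omega>0 \<eta>0 C10 y by simp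
      ultimately have "(\<gamma>\<^sup>2 * \<Omega> * \<eta> * C1 / y)\<^sup>2 \<le> (4 * K * P * (2 * (y powr \<alpha> * x powr (- \<alpha>))) * C1 / y)\<^sup>2"
        by (rule power_mono)
      then have "(\<gamma>\<^sup>2 * \<Omega> * \<eta> * C1 / y)\<^sup>2 / 4 * (\<integral>\<omega>. (sigma_sq X n \<omega>)\<^sup>2 \<partial>M) \<le> (4 * K * P * (2 * (y powr \<alpha> * x powr (- \<alpha>))) * C1 / y)\<^sup>2 / 4 * (C2 * x powr (2 * \<alpha>))"
        using ez C2[OF n] by (intro mult_mono divide_right_mono) (auto simp: x_def)
      also have "\<dots> = (16 * K\<^sup>2 * C1\<^sup>2 * C2) * (((x powr (2 * a - \<alpha>))\<^sup>2 * (x powr (- \<alpha>))\<^sup>2 * x powr (2 * \<alpha>)) * ((y powr (- 2 * a))\<^sup>2 * (y powr \<alpha>)\<^sup>2 * (1 / y\<^sup>2)))"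
        unfolding P_def by (simp add: power_mult_distrib power_divide)
      also have "(y powr (- 2 * a))\<^sup>2 * (y powr \<alpha>)\<^sup>2 * (1 / y\<^sup>2) = y powr (- 2 * a + - 2 * a + (\<alpha> + \<alpha>) + - 2)"
        unfolding inv by (simp only: powr_add power2_eq_square)
      also have "(x powr (2 * a - \<alpha>))\<^sup>2 * (x powr (- \<alpha>))\<^sup>2 * x powr (2 * \<alpha>) = x powr ((2 * a - \<alpha>) + (2 * a - \<alpha>) + (- \<alpha> + - \<alpha>) + 2 * \<alpha>)"
        by (simp only: powr_add power2_eq_square)
      also have "x powr ((2 * a - \<alpha>) + (2 * a - \<alpha>) + (- \<alpha> + - \<alpha>) + 2 * \<alpha>) * y powr (- 2 * a + - 2 * a + (\<alpha> + \<alpha>) + - 2)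
         = x powr (4 * a - 2 * \<alpha> + 1) * y powr (- 1 - (4 * a - 2 * \<alpha> + 1)) * x powr (- 1)"
        by (rule powr_collect[OF x y]) simp_all
      finally show ?thesis .
    qed
    have dist: "u * (v1 + v2 + v3 + v4) + v5 + v6 \<le> z1 + (z2 + (z3 + (z4 + (z5 + (z6 + 0)))))"
      if "u * v1 \<le> z1" "u * v2 \<le> z2" "u * v3 \<le> z3" "u * v4 \<le> z4" "v5 \<le> z5" "v6 \<le> z6" for u v1 v2 v3 v4 v5 v6 z1 z2 z3 z4 z5 z6 :: real
      using that by (simp add: distrib_left)
    show ?thesis
      using dist[OF t1 t2 t3 t4 t5 t6]
      unfolding expectation_err(2)[OF n k] T_def \<gamma>_def \<Omega>_def \<eta>_def C1_def x_def y_def a_def \<alpha>_def d_def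
      by (simp only: list.map sum_list.Cons sum_list.Nil prod.case of_nat_power)
  qed
  then show ?thesis using T unfolding \<alpha>_def by blast
qed

text \<open>The bound is uniform in N and in the weight, so N may tend to infinity and
  \<open>w\<close> may depend on n and on the past.\<close>

lemma tail_charfun_bound:
  assumes K: "0 \<le> K"
  shows "\<exists>\<epsilon>. \<epsilon> \<longlonglongrightarrow> 0 \<and> (\<forall>n\<ge>1. \<forall>w\<in>borel_measurable (F n). (\<forall>\<omega>. (norm (w \<omega>))\<^sup>2 \<le> K * real n powr (- (1 - r))) \<longrightarrow>
     (\<forall>N\<ge>n. norm ((\<integral>\<omega>. interp n w N \<omega> \<partial>M) - (\<integral>\<omega>. interp n w n \<omega> \<partial>M)) \<le> \<epsilon> n))"
proof -
  obtain T :: "(real \<times> real \<times> real) list" where T: "\<forall>(c, s, \<delta>)\<in>set T. 0 \<le> c \<and> 0 < s \<and> 0 < \<delta>"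
    and bd: "\<And>n k. 1 \<le> n \<Longrightarrow> n \<le> k \<Longrightarrow> (\<integral>\<omega>. err (K * real n powr (- (1 - r))) n k \<omega> \<partial>M)
       \<le> (\<Sum>(c, s, \<delta>)\<leftarrow>T. c * (real n powr s * real k powr (- 1 - s) * real n powr (- \<delta>)))"
    using err_bound[OF K] by blast
  define \<epsilon> where "\<epsilon> n = (\<Sum>(c, s, \<delta>)\<leftarrow>T. c * (2 powr (1 + s) / s) * real n powr (- \<delta>))" for n :: nat
  have "\<epsilon> \<longlonglongrightarrow> 0"
  proof -
    have "(\<lambda>n. \<Sum>(c, s, \<delta>)\<leftarrow>L. c * (2 powr (1 + s) / s) * real n powr (- \<delta>)) \<longlonglongrightarrow> 0"
      if "\<forall>(c, s, \<delta>)\<in>set L. 0 \<le> c \<and> 0 < s \<and> (0::real) < \<delta>" for L :: "(real \<times> real \<times> real) list"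
      using that
    proof (induction L)
      case (Cons t L)
      obtain c s \<delta> where t: "t = (c, s, \<delta>)" by (cases t)
      have "(\<lambda>n. real n powr (- \<delta>)) \<longlonglongrightarrow> 0"
        using Cons.prems t by (intro tendsto_neg_powr filterlim_real_sequentially) auto
      from tendsto_add[OF tendsto_mult_right_zero[OF this, of "c * (2 powr (1 + s) / s)"] Cons.IH] Cons.prems
      show ?case by (simp add: t)
    qed simp
    then show ?thesis unfolding \<epsilon>_def using T by blast
  qed
  moreover have "norm ((\<integral>\<omega>. interp n w N \<omega> \<partial>M) - (\<integral>\<omega>. interp n w n \<omega> \<partial>M)) \<le> \<epsilon> n"
    if n: "1 \<le> n" and N: "n \<le> N" and w: "w \<in> borel_measurable (F n)" "\<And>\<omega>. (norm (w \<omega>))\<^sup>2 \<le> K * real n powr (- (1 - r))" for n N w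
  proof -
    have "norm ((\<integral>\<omega>. interp n w N \<omega> \<partial>M) - (\<integral>\<omega>. interp n w n \<omega> \<partial>M))
       \<le> (\<Sum>k=n..<N. \<Sum>(c, s, \<delta>)\<leftarrow>T. c * (real n powr s * real k powr (- 1 - s) * real n powr (- \<delta>)))"
      using N
    proof (induction N rule: dec_induct)
      case (step k)
      have "norm ((\<integral>\<omega>. interp n w (Suc k) \<omega> \<partial>M) - (\<integral>\<omega>. interp n w k \<omega> \<partial>M)) \<le> (\<Sum>(c, s, \<delta>)\<leftarrow>T. c * (real n powr s * real k powr (- 1 - s) * real n powr (- \<delta>)))"
        using interp_step[OF n step(1) w] bd[OF n step(1)] by (rule order_trans)
      moreover have "norm ((\<integral>\<omega>. interp n w (Suc k) \<omega> \<partial>M) - (\<integral>\<omega>. interp n w n \<omega> \<partial>M))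
         \<le> norm ((\<integral>\<omega>. interp n w k \<omega> \<partial>M) - (\<integral>\<omega>. interp n w n \<omega> \<partial>M)) + norm ((\<integral>\<omega>. interp n w (Suc k) \<omega> \<partial>M) - (\<integral>\<omega>. interp n w k \<omega> \<partial>M))"
        using norm_triangle_ineq[of "(\<integral>\<omega>. interp n w k \<omega> \<partial>M) - (\<integral>\<omega>. interp n w n \<omega> \<partial>M)" "(\<integral>\<omega>. interp n w (Suc k) \<omega> \<partial>M) - (\<integral>\<omega>. interp n w k \<omega> \<partial>M)"] by simp
      ultimately show ?case using step by (simp add: sum.atLeastLessThan_Suc)
    qed simp
    also have "\<dots> \<le> \<epsilon> n"
      unfolding \<epsilon>_def using T
    proof (induction T)
      case (Cons t L)
      obtain c s \<delta> where t: "t = (c, s, \<delta>)" by (cases t)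
      have cs: "0 \<le> c" "0 < s" using Cons.prems t by auto
      have "(\<Sum>k=n..<N. c * (real n powr s * real k powr (- 1 - s) * real n powr (- \<delta>)))
         = c * real n powr (- \<delta>) * (\<Sum>k=n..<N. real n powr s * real k powr (- 1 - s))"
        by (simp add: sum_distrib_left mult_ac)
      also have "\<dots> \<le> c * real n powr (- \<delta>) * (2 powr (1 + s) / s)"
        using powr_tail_sum[OF cs(2) n N] cs by (intro mult_left_mono) auto
      finally have "(\<Sum>k=n..<N. c * (real n powr s * real k powr (- 1 - s) * real n powr (- \<delta>))) \<le> c * (2 powr (1 + s) / s) * real n powr (- \<delta>)"
        by (simp add: mult_ac)
      moreover have "(\<Sum>k=n..<N. \<Sum>(c, s, \<delta>)\<leftarrow>L. c * (real n powr s * real k powr (- 1 - s) * real n powr (- \<delta>)))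
          \<le> (\<Sum>(c, s, \<delta>)\<leftarrow>L. c * (2 powr (1 + s) / s) * real n powr (- \<delta>))"
        using Cons by simp
      ultimately show ?case by (simp only: t list.map sum_list.Cons prod.case sum.distrib add_mono)
    qed simp
    finally show ?thesis .
  qed
  ultimately show ?thesis by blast
qed

end

section \<open>The Mittag-Leffler limit\<close>

text \<open>The exponential series is integrated term by term, which is justified because the
  absolute moments form a Mittag-Leffler series at |t|, and that converges. The positive part agrees
  with the variable almost surely and is nonnegative everywhere.\<close>

lemma (in real_distribution) mittag_leffler_of_moments:
  assumes \<alpha>: "0 < \<alpha>" "\<alpha> \<le> 1" and pos: "AE x in M. 0 < x"
    and int: "\<And>m. integrable M (\<lambda>x. (max 0 x) ^ m)"
    and mom: "\<And>m. (\<integral>x. (max 0 x) ^ m \<partial>M) = fact m / Gamma (1 + real m * \<alpha>)"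
  shows "integrable M (\<lambda>x. exp (t * x))"
    and "(\<lambda>m. t ^ m / Gamma (1 + real m * \<alpha>)) sums (\<integral>x. exp (t * x) \<partial>M)"
proof -
  define f where "f m x = t ^ m / fact m * (max 0 x) ^ m" for m and x :: real
  have fi: "integrable M (f m)" for m unfolding f_def by (intro integrable_mult_right int)
  have fE: "(\<integral>x. f m x \<partial>M) = t ^ m / Gamma (1 + real m * \<alpha>)" for m
    unfolding f_def by (simp add: mom)
  have G: "0 < Gamma (1 + real m * \<alpha>)" for m using \<alpha> by (intro Gamma_real_pos add_pos_nonneg) auto
  have fN: "(\<integral>x. norm (f m x) \<partial>M) = \<bar>t\<bar> ^ m / Gamma (1 + real m * \<alpha>)" for m
  proof -
    have "norm (f m x) = \<bar>t\<bar> ^ m / fact m * (max 0 x) ^ m" for x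
      by (simp add: f_def abs_mult power_abs)
    then show ?thesis by (simp add: mom)
  qed
  have ser: "(\<lambda>m. (t * max 0 x) ^ m / fact m) sums exp (t * max 0 x)" "summable (\<lambda>m. norm ((t * max 0 x) ^ m / fact m))" for x
    using exp_converges[of "t * max 0 x"] summable_norm_exp[of "t * max 0 x"] by (simp_all add: divide_inverse mult.commute)
  have feq: "f m x = (t * max 0 x) ^ m / fact m" for m x by (simp add: f_def power_mult_distrib)
  have s1: "AE x in M. summable (\<lambda>m. norm (f m x))" unfolding feq by (intro AE_I2 ser(2))
  have s2: "summable (\<lambda>m. \<integral>x. norm (f m x) \<partial>M)"
    unfolding fN by (rule summable_mittag_leffler[OF \<alpha>])
  have suminf: "(\<Sum>m. f m x) = exp (t * max 0 x)" for x
    unfolding feq using ser(1) by (rule sums_unique[symmetric])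
  have i: "integrable M (\<lambda>x. exp (t * max 0 x))"
    using integrable_suminf[OF fi s1 s2] unfolding suminf .
  have s: "(\<lambda>m. t ^ m / Gamma (1 + real m * \<alpha>)) sums (\<integral>x. exp (t * max 0 x) \<partial>M)"
    using sums_integral[OF fi s1 s2] unfolding suminf fE .
  have ae: "AE x in M. exp (t * max 0 x) = exp (t * x)" using pos by eventually_elim simp
  show "integrable M (\<lambda>x. exp (t * x))"
    by (rule integrable_cong_AE_imp[OF i]) (use ae in \<open>auto elim: eventually_mono\<close>)
  have "(\<integral>x. exp (t * max 0 x) \<partial>M) = (\<integral>x. exp (t * x) \<partial>M)"
    by (rule integral_cong_AE[OF _ _ ae]) auto
  with s show "(\<lambda>m. t ^ m / Gamma (1 + real m * \<alpha>)) sums (\<integral>x. exp (t * x) \<partial>M)" by simp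
qed

context superdiffusive_merws
begin

definition Ts :: "nat \<Rightarrow> 'w \<Rightarrow> real" where "Ts n \<omega> = sigma_sq X n \<omega> / real n powr (1 - r)"

lemma Ts_M [measurable]: "Ts n \<in> borel_measurable M"
  unfolding Ts_def[abs_def] by measurable

lemma Ts_nonneg: "0 \<le> Ts n \<omega>"
  unfolding Ts_def using sigma_sq_nonneg by simp

lemma Ts_moment_tendsto: "(\<lambda>n. \<integral>\<omega>. (Ts n \<omega>) ^ m \<partial>M) \<longlonglongrightarrow> fact m / Gamma (1 + real m * (1 - r))"
  unfolding Ts_def by (rule scaled_moment_tendsto)

lemma integrable_Ts_pow: "integrable M (\<lambda>\<omega>. (Ts n \<omega>) ^ m)"
  unfolding Ts_def power_divide by (intro integrable_divide_zero integrable_sigma_sq_pow)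

lemma Ts_moment_bound: "\<exists>C>0. \<forall>n. (\<integral>\<omega>. (Ts n \<omega>) ^ m \<partial>M) \<le> C"
proof -
  have "Bseq (\<lambda>n. \<integral>\<omega>. (Ts n \<omega>) ^ m \<partial>M)"
    using Ts_moment_tendsto by (intro convergent_imp_Bseq convergentI)
  then obtain C where "0 < C" "\<And>n. \<bar>\<integral>\<omega>. (Ts n \<omega>) ^ m \<partial>M\<bar> \<le> C" unfolding Bseq_def by auto
  then show ?thesis by (meson abs_le_D1)
qed

lemma Ts_small_ball:
  assumes "1 \<le> n" "0 < \<epsilon>"
  shows "prob {\<omega>\<in>space M. Ts n \<omega> < \<epsilon>} \<le> Gamma (1 / 2) * sqrt \<epsilon>"
proof -
  have "0 < real n powr (1 - r)" using assms by simp
  then have "{\<omega>\<in>space M. Ts n \<omega> < \<epsilon>} = {\<omega>\<in>space M. sigma_sq X n \<omega> < \<epsilon> * real n powr (1 - r)}"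
    unfolding Ts_def by (simp add: pos_divide_less_eq)
  then show ?thesis using sigma_sq_small_ball[OF assms] by simp
qed

text \<open>Markov's inequality with the bounded first moments; the lower end -1 loses nothing, as
  \<open>Ts\<close> is nonnegative.\<close>

lemma Ts_tight: "tight (\<lambda>n. distr M borel (Ts n))"
  unfolding tight_def
proof (intro conjI allI impI)
  show "real_distribution (distr M borel (Ts n))" for n
    by (rule real_distribution_distr) measurable
  fix \<epsilon> :: real assume \<epsilon>: "0 < \<epsilon>"
  obtain C where C: "0 < C" "\<And>n. (\<integral>\<omega>. (Ts n \<omega>) ^ 1 \<partial>M) \<le> C" using Ts_moment_bound by blast
  define b where "b = 2 * C / \<epsilon>"
  have b: "0 < b" using C \<epsilon> by (simp add: b_def)
  have "1 - \<epsilon> < measure (distr M borel (Ts n)) {- 1<..b}" for n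
  proof -
    have "measure (distr M borel (Ts n)) {- 1<..b} = prob {\<omega>\<in>space M. Ts n \<omega> \<le> b}"
      using Ts_nonneg[of n] by (subst measure_distr) (auto intro!: arg_cong[where f=prob] simp: less_le_trans[of "- 1" "0::real"])
    moreover have "prob {\<omega>\<in>space M. Ts n \<omega> \<le> b} = 1 - prob {\<omega>\<in>space M. b < Ts n \<omega>}"
    proof -
      have "prob {\<omega>\<in>space M. \<not> b < Ts n \<omega>} = 1 - prob {\<omega>\<in>space M. b < Ts n \<omega>}"
        by (rule prob_neg) measurable
      then show ?thesis by (simp add: not_less)
    qed
    moreover have bC: "b * prob {\<omega>\<in>space M. b < Ts n \<omega>} \<le> C"
    proof -
      have "b * prob {\<omega>\<in>space M. b < Ts n \<omega>} = (\<integral>\<omega>. b * indicator {\<omega>\<in>space M. b < Ts n \<omega>} \<omega> \<partial>M)"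
        by simp
      also have "\<dots> \<le> (\<integral>\<omega>. (Ts n \<omega>) ^ 1 \<partial>M)"
      proof (rule integral_mono)
        show "integrable M (\<lambda>\<omega>. b * indicator {\<omega>\<in>space M. b < Ts n \<omega>} \<omega>)"
          by (intro integrable_mult_right) (simp add: emeasure_eq_measure)
        show "b * indicator {\<omega>\<in>space M. b < Ts n \<omega>} \<omega> \<le> (Ts n \<omega>) ^ 1" for \<omega>
          using Ts_nonneg[of n \<omega>] by (simp add: indicator_def)
      qed (rule integrable_Ts_pow)
      finally show ?thesis using C(2)[of n] by linarith
    qed
    moreover have "prob {\<omega>\<in>space M. b < Ts n \<omega>} < \<epsilon>"
    proof -
      have "C < b * \<epsilon>" using C \<epsilon> by (simp add: b_def)
      then have "b * prob {\<omega>\<in>space M. b < Ts n \<omega>} < b * \<epsilon>" using bC by (rule order_le_less_trans[rotated])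
      then show ?thesis using b by (simp only: mult_less_cancel_left_pos)
    qed
    ultimately show ?thesis by linarith
  qed
  then show "\<exists>a b. a < b \<and> (\<forall>n. 1 - \<epsilon> < measure (distr M borel (Ts n)) {a<..b})"
    using b by (intro exI[of _ "- 1"] exI[of _ b]) auto
qed

lemma Ts_weak_subsequence:
  obtains s \<mu> where "strict_mono (s :: nat \<Rightarrow> nat)" "real_distribution \<mu>"
    "\<And>f B. (\<And>x. isCont (f :: real \<Rightarrow> real) x) \<Longrightarrow> (\<And>x. \<bar>f x\<bar> \<le> B) \<Longrightarrow> (\<lambda>n. \<integral>\<omega>. f (Ts (s n) \<omega>) \<partial>M) \<longlonglongrightarrow> (\<integral>x. f x \<partial>\<mu>)"
proof -
  obtain s \<mu> where s: "strict_mono (s :: nat \<Rightarrow> nat)" and \<mu>: "real_distribution \<mu>"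
    and w: "weak_conv_m ((\<lambda>n. distr M borel (Ts n)) \<circ> id \<circ> s) \<mu>"
    using tight_imp_convergent_subsubsequence[OF Ts_tight, of id] by (auto simp: strict_mono_def)
  have rd: "real_distribution (distr M borel (Ts n))" for n
    by (rule real_distribution_distr) measurable
  have "(\<lambda>n. \<integral>\<omega>. f (Ts (s n) \<omega>) \<partial>M) \<longlonglongrightarrow> (\<integral>x. f x \<partial>\<mu>)"
    if c: "\<And>x. isCont f x" and b: "\<And>x. \<bar>f x\<bar> \<le> B" for f :: "real \<Rightarrow> real" and B
  proof -
    have [measurable]: "f \<in> borel_measurable borel"
      using c by (intro borel_measurable_continuous_onI continuous_at_imp_continuous_on) auto
    have "(\<lambda>n. integral\<^sup>L (((\<lambda>n. distr M borel (Ts n)) \<circ> id \<circ> s) n) f) \<longlonglongrightarrow> integral\<^sup>L \<mu> f"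
    proof (rule weak_conv_imp_integral_bdd_continuous_conv[OF _ \<mu> w])
      show "real_distribution (((\<lambda>n. distr M borel (Ts n)) \<circ> id \<circ> s) n)" for n using rd by simp
      show "isCont f x" for x by (rule c)
      show "norm (f x) \<le> B" for x using b by simp
    qed
    then show ?thesis by (simp add: integral_distr)
  qed
  then show thesis using that s \<mu> by blast
qed

text \<open>The function exp (- c x) is Lipschitz on the half-line, so Laplace transforms are
  controlled by L^1 distances: \<open>W\<close> is Cauchy in L^1, and \<open>Ts\<close> is
  \<open>W\<close> times a deterministic factor tending to 1. Convergence of the whole sequence
  follows before its limit is known.\<close>

lemma laplace_W_Ts_diff:
  assumes c: "0 \<le> c"
  shows "(\<lambda>n. (\<integral>\<omega>. exp (- (c * Ts n \<omega>)) \<partial>M) - (\<integral>\<omega>. exp (- (c * W n \<omega>)) \<partial>M)) \<longlonglongrightarrow> 0"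
    and "convergent (\<lambda>n. \<integral>\<omega>. exp (- (c * W n \<omega>)) \<partial>M)"
proof -
  have lip: "\<bar>exp (- (c * x)) - exp (- (c * y))\<bar> \<le> c * \<bar>x - y\<bar>" if "0 \<le> x" "0 \<le> y" for x y :: real
  proof -
    have *: "\<bar>exp (- u) - exp (- v)\<bar> \<le> \<bar>u - v\<bar>" if "0 \<le> u" "u \<le> v" for u v :: real
    proof -
      have e: "exp (- v) = exp (- u) * exp (- (v - u))" by (simp flip: exp_add)
      have e1: "exp (- u) \<le> 1" using that(1) by simp
      have e2: "1 - exp (- (v - u)) \<le> v - u" using exp_ge_add_one_self[of "- (v - u)"] by linarith
      have e3: "0 \<le> 1 - exp (- (v - u))" using that(2) by simp
      have "exp (- u) - exp (- v) = exp (- u) * (1 - exp (- (v - u)))" unfolding e by (simp only: right_diff_distrib mult_1_right)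
      moreover have "exp (- u) * (1 - exp (- (v - u))) \<le> 1 * (v - u)"
        by (rule mult_mono[OF e1 e2 _ e3]) simp
      moreover have "0 \<le> exp (- u) * (1 - exp (- (v - u)))" using e3 by (rule mult_nonneg_nonneg[rotated]) simp
      ultimately show ?thesis using that(2) by simp
    qed
    have "\<bar>exp (- (c * x)) - exp (- (c * y))\<bar> \<le> \<bar>c * x - c * y\<bar>"
    proof -
      have c0: "0 \<le> c * x" "0 \<le> c * y" using that c by simp_all
      show ?thesis
      proof (cases "c * x \<le> c * y")
        case True then show ?thesis using *[OF c0(1)] by blast
      next
        case False
        then have "\<bar>exp (- (c * y)) - exp (- (c * x))\<bar> \<le> \<bar>c * y - c * x\<bar>" using *[OF c0(2), of "c * x"] by linarith
        then show ?thesis by (simp only: abs_minus_commute)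
      qed
    qed
    also have "\<dots> = c * \<bar>x - y\<bar>" using c by (simp add: abs_mult flip: right_diff_distrib)
    finally show ?thesis .
  qed
  have W0: "0 \<le> W n \<omega>" if "1 \<le> n" for n \<omega>
    unfolding W_def using sigma_sq_nonneg H_pos[OF that] by (intro divide_nonneg_pos)
  have ie: "integrable M (\<lambda>\<omega>. exp (- (c * f \<omega>)))" if "f \<in> borel_measurable M" "\<And>\<omega>. 0 \<le> f \<omega>" for f
    by (rule integrable_const_bound[where B=1]) (use that c in auto)
  have iT: "integrable M (\<lambda>\<omega>. exp (- (c * Ts n \<omega>)))" for n by (rule ie) (auto simp: Ts_nonneg)
  have iW: "integrable M (\<lambda>\<omega>. exp (- (c * W n \<omega>)))" if "1 \<le> n" for n by (rule ie) (auto simp: W0[OF that])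
  define h where "h n = H n / real n powr (1 - r)" for n
  have h: "h \<longlonglongrightarrow> 1" unfolding h_def[abs_def] H_def using r_pos by (intro gquot_asymp) auto
  have Wi: "integrable M (W n)" for n unfolding W_def[abs_def] by (intro integrable_divide_zero integrable_sigma_sq)
  obtain C where C: "0 < C" "\<And>n. 1 \<le> n \<Longrightarrow> (\<integral>\<omega>. sigma_sq X n \<omega> \<partial>M) \<le> C * real n powr (1 - r)"
    using sigma_sq_mean_le by blast
  have WE: "(\<integral>\<omega>. W n \<omega> \<partial>M) \<le> 2 * C" if n: "1 \<le> n" for n
  proof -
    have "(\<integral>\<omega>. W n \<omega> \<partial>M) = (\<integral>\<omega>. sigma_sq X n \<omega> \<partial>M) / H n" unfolding W_def by simp
    also have "\<dots> \<le> (C * real n powr (1 - r)) / (real n powr (1 - r) / 2)"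
      using C n H_bounds(1)[OF n] by (intro frac_le) auto
    also have "\<dots> = 2 * C" using n by simp
    finally show ?thesis .
  qed
  have d1: "\<bar>(\<integral>\<omega>. exp (- (c * Ts n \<omega>)) \<partial>M) - (\<integral>\<omega>. exp (- (c * W n \<omega>)) \<partial>M)\<bar> \<le> c * 2 * C * \<bar>h n - 1\<bar>" if n: "1 \<le> n" for n
  proof -
    have "\<bar>\<integral>\<omega>. exp (- (c * Ts n \<omega>)) - exp (- (c * W n \<omega>)) \<partial>M\<bar> \<le> (\<integral>\<omega>. \<bar>exp (- (c * Ts n \<omega>)) - exp (- (c * W n \<omega>))\<bar> \<partial>M)"
      by (rule integral_abs_bound)
    also have "\<dots> \<le> (\<integral>\<omega>. c * \<bar>h n - 1\<bar> * W n \<omega> \<partial>M)"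
    proof (rule integral_mono)
      fix \<omega>
      have "Ts n \<omega> = h n * W n \<omega>" using H_pos[OF n] by (simp add: Ts_def h_def W_def)
      then have "Ts n \<omega> - W n \<omega> = (h n - 1) * W n \<omega>" by (simp only: left_diff_distrib mult_1_left)
      then have "\<bar>Ts n \<omega> - W n \<omega>\<bar> = \<bar>h n - 1\<bar> * W n \<omega>"
        using W0[OF n, of \<omega>] by (simp only: abs_mult abs_of_nonneg)
      then show "\<bar>exp (- (c * Ts n \<omega>)) - exp (- (c * W n \<omega>))\<bar> \<le> c * \<bar>h n - 1\<bar> * W n \<omega>"
        using lip[OF Ts_nonneg W0[OF n], of n \<omega> \<omega>] by (simp only: mult.assoc)
    qed (intro integrable_abs Bochner_Integration.integrable_diff integrable_mult_right iT iW[OF n] Wi)+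
    also have "\<dots> = c * \<bar>h n - 1\<bar> * (\<integral>\<omega>. W n \<omega> \<partial>M)" by simp
    also have "\<dots> \<le> c * \<bar>h n - 1\<bar> * (2 * C)" using WE[OF n] c by (intro mult_left_mono) auto
    finally show ?thesis using iT iW[OF n] by (simp add: mult_ac)
  qed
  show "(\<lambda>n. (\<integral>\<omega>. exp (- (c * Ts n \<omega>)) \<partial>M) - (\<integral>\<omega>. exp (- (c * W n \<omega>)) \<partial>M)) \<longlonglongrightarrow> 0"
  proof (rule Lim_null_comparison)
    show "\<forall>\<^sub>F n in sequentially. norm ((\<integral>\<omega>. exp (- (c * Ts n \<omega>)) \<partial>M) - (\<integral>\<omega>. exp (- (c * W n \<omega>)) \<partial>M)) \<le> c * 2 * C * \<bar>h n - 1\<bar>"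
      using eventually_ge_at_top[of 1] by eventually_elim (use d1 in simp)
    have "(\<lambda>n. c * 2 * C * \<bar>h n - 1\<bar>) \<longlonglongrightarrow> c * 2 * C * \<bar>1 - 1\<bar>" by (intro tendsto_intros h)
    then show "(\<lambda>n. c * 2 * C * \<bar>h n - 1\<bar>) \<longlonglongrightarrow> 0" by simp
  qed
  obtain Cw where Cw0: "0 \<le> Cw" and Cw: "\<And>n k. 1 \<le> n \<Longrightarrow> n \<le> k \<Longrightarrow> integrable M (\<lambda>\<omega>. W k \<omega> - W n \<omega>) \<and> (\<integral>\<omega>. \<bar>W k \<omega> - W n \<omega>\<bar> \<partial>M) \<le> Cw * real n powr (- (1 - r) / 2)"
    using W_cauchy by blast
  have d2: "\<bar>(\<integral>\<omega>. exp (- (c * W k \<omega>)) \<partial>M) - (\<integral>\<omega>. exp (- (c * W n \<omega>)) \<partial>M)\<bar> \<le> c * Cw * real n powr (- (1 - r) / 2)" if n: "1 \<le> n" and k: "n \<le> k" for n k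
  proof -
    have k1: "1 \<le> k" using n k by simp
    have "\<bar>\<integral>\<omega>. exp (- (c * W k \<omega>)) - exp (- (c * W n \<omega>)) \<partial>M\<bar> \<le> (\<integral>\<omega>. \<bar>exp (- (c * W k \<omega>)) - exp (- (c * W n \<omega>))\<bar> \<partial>M)"
      by (rule integral_abs_bound)
    also have "\<dots> \<le> (\<integral>\<omega>. c * \<bar>W k \<omega> - W n \<omega>\<bar> \<partial>M)"
    proof (rule integral_mono)
      show "integrable M (\<lambda>\<omega>. \<bar>exp (- (c * W k \<omega>)) - exp (- (c * W n \<omega>))\<bar>)"
        by (intro integrable_abs Bochner_Integration.integrable_diff iW n k1)
      show "integrable M (\<lambda>\<omega>. c * \<bar>W k \<omega> - W n \<omega>\<bar>)"
        using Cw[OF n k] by (intro integrable_mult_right integrable_abs) simp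
    qed (rule lip[OF W0[OF k1] W0[OF n]])
    also have "\<dots> \<le> c * (Cw * real n powr (- (1 - r) / 2))" using Cw[OF n k] c by (simp add: mult_left_mono)
    finally show ?thesis using iW[OF n] iW[OF k1] by (simp add: mult_ac)
  qed
  have "Cauchy (\<lambda>n. \<integral>\<omega>. exp (- (c * W n \<omega>)) \<partial>M)"
  proof (rule CauchyI')
    fix e :: real assume e: "0 < e"
    have "(\<lambda>n. real n powr (- (1 - r) / 2)) \<longlonglongrightarrow> 0"
      using r_pos by (intro tendsto_neg_powr filterlim_real_sequentially) auto
    from tendsto_mult_right_zero[OF this, of "c * Cw"]
    have "\<forall>\<^sub>F n in sequentially. c * Cw * real n powr (- (1 - r) / 2) < e"
      by (rule order_tendstoD(2)) (rule e)
    then obtain n0 where n0: "\<And>n. n \<ge> n0 \<Longrightarrow> c * Cw * real n powr (- (1 - r) / 2) < e"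
      unfolding eventually_sequentially by blast
    have "dist (\<integral>\<omega>. exp (- (c * W m \<omega>)) \<partial>M) (\<integral>\<omega>. exp (- (c * W n \<omega>)) \<partial>M) < e" if "max 1 n0 \<le> m" "m < n" for m n
      using d2[of m n] n0[of m] that by (simp add: dist_norm abs_minus_commute)
    then show "\<exists>M'. \<forall>m\<ge>M'. \<forall>n>m. dist (\<integral>\<omega>. exp (- (c * W m \<omega>)) \<partial>M) (\<integral>\<omega>. exp (- (c * W n \<omega>)) \<partial>M) < e" by blast
  qed
  then show "convergent (\<lambda>n. \<integral>\<omega>. exp (- (c * W n \<omega>)) \<partial>M)" by (simp add: Cauchy_convergent_iff)
qed

text \<open>A weak limit along a subsequence is identified by its moments. Since the Laplace
  transforms converge along the whole sequence, computing their limit along the subsequence is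
  enough.\<close>

theorem mittag_leffler_limit:
  obtains \<mu> where "real_distribution \<mu>" "AE x in \<mu>. 0 < x"
    "\<And>t. integrable \<mu> (\<lambda>x. exp (t * x))"
    "\<And>t. (\<lambda>m. t ^ m / Gamma (1 + real m * (1 - r))) sums (\<integral>x. exp (t * x) \<partial>\<mu>)"
    "\<And>c. 0 \<le> c \<Longrightarrow> (\<lambda>n. \<integral>\<omega>. exp (- (c * Ts n \<omega>)) \<partial>M) \<longlonglongrightarrow> (\<integral>x. exp (- (c * x)) \<partial>\<mu>)"
proof -
  obtain s \<mu> where s: "strict_mono (s :: nat \<Rightarrow> nat)" and \<mu>: "real_distribution \<mu>"
    and w: "\<And>f B. (\<And>x. isCont (f :: real \<Rightarrow> real) x) \<Longrightarrow> (\<And>x. \<bar>f x\<bar> \<le> B) \<Longrightarrow> (\<lambda>n. \<integral>\<omega>. f (Ts (s n) \<omega>) \<partial>M) \<longlonglongrightarrow> (\<integral>x. f x \<partial>\<mu>)"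
    using Ts_weak_subsequence by blast
  interpret R: real_distribution \<mu> by (rule \<mu>)
  have s_ge: "\<forall>\<^sub>F n in sequentially. 1 \<le> s n"
    using eventually_ge_at_top[of 1] by eventually_elim (use seq_suble[OF s] in \<open>meson order_trans\<close>)
  have pos: "AE x in \<mu>. 0 < x"
  proof -
    \<comment> \<open>A trapezoidal test function, 1 up to delta and 0 from 2 delta on, carries the
      small ball estimate to the limit; letting delta tend to 0 excludes mass on the nonpositive
      half-line.\<close>
    have le: "measure \<mu> {..0} \<le> Gamma (1 / 2) * sqrt (2 * \<delta>)" if \<delta>: "0 < \<delta>" for \<delta>
    proof -
      define f where "f x = max 0 (min 1 (2 - x / \<delta>))" for x :: real
      have fc: "isCont f x" for x
      proof -
        have "isCont (\<lambda>x. x * (1 / \<delta>)) x" by (intro continuous_intros)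
        then have "isCont (\<lambda>x. max 0 (min 1 (2 - x * (1 / \<delta>)))) x"
          by (intro continuous_max continuous_min continuous_diff continuous_const)
        then show ?thesis unfolding f_def[abs_def] by simp
      qed
      have fb: "\<bar>f x\<bar> \<le> 1" for x unfolding f_def by simp
      note w[OF fc fb]
      moreover have "\<forall>\<^sub>F n in sequentially. (\<integral>\<omega>. f (Ts (s n) \<omega>) \<partial>M) \<le> Gamma (1 / 2) * sqrt (2 * \<delta>)"
        using s_ge
      proof eventually_elim
        case (elim n)
        have [measurable]: "f \<in> borel_measurable borel" unfolding f_def by measurable
        have "(\<integral>\<omega>. f (Ts (s n) \<omega>) \<partial>M) \<le> (\<integral>\<omega>. indicator {\<omega>\<in>space M. Ts (s n) \<omega> < 2 * \<delta>} \<omega> \<partial>M)"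
        proof (rule integral_mono)
          show "integrable M (\<lambda>\<omega>. f (Ts (s n) \<omega>))"
            by (rule integrable_const_bound[where B=1]) (auto simp: f_def)
          show "integrable M (indicator {\<omega>\<in>space M. Ts (s n) \<omega> < 2 * \<delta>} :: 'w \<Rightarrow> real)"
            by (simp add: emeasure_eq_measure)
          fix \<omega> assume "\<omega> \<in> space M"
          then show "f (Ts (s n) \<omega>) \<le> indicator {\<omega>\<in>space M. Ts (s n) \<omega> < 2 * \<delta>} \<omega>"
            using \<delta> by (auto simp: f_def indicator_def field_simps)
        qed
        also have "\<dots> = prob {\<omega>\<in>space M. Ts (s n) \<omega> < 2 * \<delta>}" by simp
        also have "\<dots> \<le> Gamma (1 / 2) * sqrt (2 * \<delta>)" using \<delta> by (intro Ts_small_ball elim) auto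
        finally show ?case .
      qed
      ultimately have "(\<integral>x. f x \<partial>\<mu>) \<le> Gamma (1 / 2) * sqrt (2 * \<delta>)"
        by (rule tendsto_upperbound) simp
      moreover have "measure \<mu> {..0} \<le> (\<integral>x. f x \<partial>\<mu>)"
      proof -
        have [measurable]: "f \<in> borel_measurable borel" unfolding f_def by measurable
        have "(\<integral>x. indicator {..0} x \<partial>\<mu>) \<le> (\<integral>x. f x \<partial>\<mu>)"
        proof (rule integral_mono)
          show "integrable \<mu> f" by (rule R.integrable_const_bound[where B=1]) (auto simp: f_def)
          show "integrable \<mu> (indicator {..0} :: real \<Rightarrow> real)" by (simp add: R.emeasure_eq_measure)
          show "indicator {..0} x \<le> f x" for x using \<delta> by (auto simp: f_def indicator_def field_simps)
        qed
        then show ?thesis by simp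
      qed
      ultimately show ?thesis by linarith
    qed
    have "((\<lambda>\<delta>. Gamma (1 / 2) * sqrt (2 * \<delta>)) \<longlongrightarrow> Gamma (1 / 2) * sqrt (2 * 0)) (at_right 0)"
      by (intro tendsto_intros)
    then have "measure \<mu> {..0} \<le> Gamma (1 / 2) * sqrt (2 * 0)"
      by (rule tendsto_lowerbound) (auto simp: eventually_at_right_less intro!: eventually_mono[OF eventually_at_right_less] le)
    then have "measure \<mu> {..0} = 0" using measure_nonneg[of \<mu> "{..0}"] by simp
    then have "emeasure \<mu> {..0} = 0" by (simp add: R.emeasure_eq_measure)
    then show ?thesis by (intro AE_I[where N="{..0}"]) auto
  qed
  have moments: "integrable \<mu> (\<lambda>x. (max 0 x) ^ m)" "(\<integral>x. (max 0 x) ^ m \<partial>\<mu>) = fact m / Gamma (1 + real m * (1 - r))" for m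
  proof -
    let ?m = "fact m / Gamma (1 + real m * (1 - r)) :: real"
    \<comment> \<open>Weak convergence handles bounded functions, hence the truncation at i + 1. By
      z <= min z K + z^2 / K the loss is at most the moment of order 2 m divided by K = i + 1,
      uniformly in n, so the moments pass to the limit.\<close>
    define f where "f i x = min ((max 0 x) ^ m) (real (Suc i))" for i and x :: real
    have f0: "0 \<le> f i x" "f i x \<le> real (Suc i)" for i x by (simp_all add: f_def)
    have [measurable]: "f i \<in> borel_measurable borel" for i unfolding f_def by measurable
    have fi: "integrable \<mu> (f i)" for i
      by (rule R.integrable_const_bound[where B="real (Suc i)"]) (use f0 in \<open>auto simp del: of_nat_Suc\<close>)
    have fT: "integrable M (\<lambda>\<omega>. f i (Ts n \<omega>))" for i n
      by (rule integrable_const_bound[where B="real (Suc i)"]) (use f0 in \<open>auto simp del: of_nat_Suc\<close>)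
    have conv: "(\<lambda>n. \<integral>\<omega>. f i (Ts (s n) \<omega>) \<partial>M) \<longlonglongrightarrow> (\<integral>x. f i x \<partial>\<mu>)" for i
    proof -
      have fc: "isCont (f i) x" for x unfolding f_def[abs_def] by (intro continuous_intros)
      have fb: "\<bar>f i x\<bar> \<le> real (Suc i)" for x using f0[of i x] by (simp del: of_nat_Suc)
      show ?thesis by (rule w[OF fc fb])
    qed
    have mconv: "(\<lambda>n. \<integral>\<omega>. (Ts (s n) \<omega>) ^ m \<partial>M) \<longlonglongrightarrow> ?m"
      using LIMSEQ_subseq_LIMSEQ[OF Ts_moment_tendsto[of m] s] by (simp add: o_def)
    obtain C where C: "0 < C" "\<And>n. (\<integral>\<omega>. (Ts n \<omega>) ^ (2 * m) \<partial>M) \<le> C" using Ts_moment_bound by blast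
    have up: "(\<integral>x. f i x \<partial>\<mu>) \<le> ?m" for i
    proof (rule LIMSEQ_le[OF conv mconv])
      show "\<exists>N. \<forall>n\<ge>N. (\<integral>\<omega>. f i (Ts (s n) \<omega>) \<partial>M) \<le> (\<integral>\<omega>. (Ts (s n) \<omega>) ^ m \<partial>M)"
        using Ts_nonneg by (intro exI allI impI integral_mono fT integrable_Ts_pow) (auto simp: f_def max_def)
    qed
    have low: "?m - C / real (Suc i) \<le> (\<integral>x. f i x \<partial>\<mu>)" for i
    proof (rule LIMSEQ_le[OF tendsto_diff[OF mconv tendsto_const] conv])
      have "(\<integral>\<omega>. (Ts n \<omega>) ^ m \<partial>M) - C / real (Suc i) \<le> (\<integral>\<omega>. f i (Ts n \<omega>) \<partial>M)" for n
      proof -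
        have "(\<integral>\<omega>. (Ts n \<omega>) ^ m \<partial>M) \<le> (\<integral>\<omega>. f i (Ts n \<omega>) + (Ts n \<omega>) ^ (2 * m) / real (Suc i) \<partial>M)"
        proof (rule integral_mono)
          fix \<omega>
          define z where "z = (Ts n \<omega>) ^ m"
          have z0: "0 \<le> z" using Ts_nonneg by (simp add: z_def)
          have K: "0 < real (Suc i)" by simp
          have "z \<le> min z (real (Suc i)) + z\<^sup>2 / real (Suc i)"
          proof (cases "z \<le> real (Suc i)")
            case True then show ?thesis using K by simp
          next
            case False
            then have "z * real (Suc i) \<le> z * z" using z0 by (intro mult_left_mono) auto
            then have "z \<le> z\<^sup>2 / real (Suc i)" using K by (simp add: pos_le_divide_eq power2_eq_square)
            then show ?thesis using False K by linarith
          qed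
          moreover have "f i (Ts n \<omega>) = min z (real (Suc i))" using Ts_nonneg[of n \<omega>] by (simp add: f_def z_def)
          moreover have "(Ts n \<omega>) ^ (2 * m) = z\<^sup>2" by (simp add: z_def power_mult[symmetric] mult.commute)
          ultimately show "(Ts n \<omega>) ^ m \<le> f i (Ts n \<omega>) + (Ts n \<omega>) ^ (2 * m) / real (Suc i)" by (simp only: z_def[symmetric])
        qed (intro Bochner_Integration.integrable_add integrable_divide_zero fT integrable_Ts_pow)+
        also have "\<dots> = (\<integral>\<omega>. f i (Ts n \<omega>) \<partial>M) + (\<integral>\<omega>. (Ts n \<omega>) ^ (2 * m) \<partial>M) / real (Suc i)"
          using fT integrable_Ts_pow by (subst Bochner_Integration.integral_add) auto
        also have "(\<integral>\<omega>. (Ts n \<omega>) ^ (2 * m) \<partial>M) / real (Suc i) \<le> C / real (Suc i)" using C(2) by (intro divide_right_mono) auto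
        finally show ?thesis by linarith
      qed
      then show "\<exists>N. \<forall>n\<ge>N. (\<integral>\<omega>. (Ts (s n) \<omega>) ^ m \<partial>M) - C / real (Suc i) \<le> (\<integral>\<omega>. f i (Ts (s n) \<omega>) \<partial>M)" by blast
    qed
    have lim: "(\<lambda>i. \<integral>x. f i x \<partial>\<mu>) \<longlonglongrightarrow> ?m"
    proof (rule tendsto_sandwich)
      have "(\<lambda>i. C / real (Suc i)) \<longlonglongrightarrow> 0" by (rule LIMSEQ_Suc[OF lim_const_over_n])
      from tendsto_diff[OF tendsto_const this, of ?m] show "(\<lambda>i. ?m - C / real (Suc i)) \<longlonglongrightarrow> ?m" by simp
      show "\<forall>\<^sub>F i in sequentially. ?m - C / real (Suc i) \<le> (\<integral>x. f i x \<partial>\<mu>)" using low by (intro always_eventually allI)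
      show "\<forall>\<^sub>F i in sequentially. (\<integral>x. f i x \<partial>\<mu>) \<le> ?m" using up by (intro always_eventually allI)
    qed simp
    have "has_bochner_integral \<mu> (\<lambda>x. (max 0 x) ^ m) ?m"
    proof (rule has_bochner_integral_monotone_convergence[OF fi _ _ lim])
      show "AE x in \<mu>. mono (\<lambda>i. f i x)"
        by (intro AE_I2 monoI) (auto simp: f_def min_def)
      show "AE x in \<mu>. (\<lambda>i. f i x) \<longlonglongrightarrow> (max 0 x) ^ m"
      proof (rule AE_I2, rule tendsto_eventually)
        fix x :: real
        obtain k :: nat where k: "(max 0 x) ^ m \<le> real k" using real_arch_simple by blast
        show "\<forall>\<^sub>F i in sequentially. f i x = (max 0 x) ^ m"
          using eventually_ge_at_top[of k] by eventually_elim (use k in \<open>simp add: f_def\<close>)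
      qed
    qed measurable
    then show "integrable \<mu> (\<lambda>x. (max 0 x) ^ m)" "(\<integral>x. (max 0 x) ^ m \<partial>\<mu>) = ?m"
      by (auto simp: has_bochner_integral_iff)
  qed
  have lap: "(\<lambda>n. \<integral>\<omega>. exp (- (c * Ts n \<omega>)) \<partial>M) \<longlonglongrightarrow> (\<integral>x. exp (- (c * x)) \<partial>\<mu>)" if c: "0 \<le> c" for c
  proof -
    obtain l where l: "(\<lambda>n. \<integral>\<omega>. exp (- (c * W n \<omega>)) \<partial>M) \<longlonglongrightarrow> l"
      using laplace_W_Ts_diff(2)[OF c] by (auto simp: convergent_def)
    have full: "(\<lambda>n. \<integral>\<omega>. exp (- (c * Ts n \<omega>)) \<partial>M) \<longlonglongrightarrow> l"
      using tendsto_add[OF laplace_W_Ts_diff(1)[OF c] l] by simp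
    have "(\<lambda>n. \<integral>\<omega>. exp (- (c * max 0 (Ts (s n) \<omega>))) \<partial>M) \<longlonglongrightarrow> (\<integral>x. exp (- (c * max 0 x)) \<partial>\<mu>)"
    proof -
      define f where "f x = exp (- (c * max 0 x))" for x :: real
      have fc: "isCont f x" for x unfolding f_def[abs_def] by (intro continuous_intros)
      have fb: "\<bar>f x\<bar> \<le> 1" for x unfolding f_def using c by simp
      show ?thesis using w[OF fc fb] unfolding f_def .
    qed
    moreover have "max 0 (Ts n \<omega>) = Ts n \<omega>" for n \<omega> using Ts_nonneg[of n \<omega>] by simp
    moreover have "(\<integral>x. exp (- (c * max 0 x)) \<partial>\<mu>) = (\<integral>x. exp (- (c * x)) \<partial>\<mu>)"
    proof (rule integral_cong_AE)
      show "AE x in \<mu>. exp (- (c * max 0 x)) = exp (- (c * x))" using pos by eventually_elim simp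
    qed measurable
    ultimately have "(\<lambda>n. \<integral>\<omega>. exp (- (c * Ts (s n) \<omega>)) \<partial>M) \<longlonglongrightarrow> (\<integral>x. exp (- (c * x)) \<partial>\<mu>)" by simp
    moreover have "(\<lambda>n. \<integral>\<omega>. exp (- (c * Ts (s n) \<omega>)) \<partial>M) \<longlonglongrightarrow> l"
      using LIMSEQ_subseq_LIMSEQ[OF full s] by (simp add: o_def)
    ultimately have "l = (\<integral>x. exp (- (c * x)) \<partial>\<mu>)" by (rule LIMSEQ_unique[rotated])
    then show ?thesis using full by simp
  qed
  have al: "0 < 1 - r" "1 - r \<le> 1" using r_pos by simp_all
  note mg = R.mittag_leffler_of_moments[OF al pos moments]
  show thesis by (rule that[OF \<mu> pos mg lap])
qed

end

section \<open>Convergence in distribution\<close>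

lemma matrix_inv_scaleR_mat:
  assumes "s \<noteq> 0"
  shows "matrix_inv (s *\<^sub>R mat 1 :: real^'n^'n) = (1 / s) *\<^sub>R mat 1"
proof -
  let ?A = "s *\<^sub>R mat 1 :: real^'n^'n"
  have ex: "?A ** ((1 / s) *\<^sub>R mat 1) = mat 1 \<and> ((1 / s) *\<^sub>R mat 1) ** ?A = mat 1"
    using assms by (simp add: matrix_scalar_ac scalar_matrix_assoc[symmetric])
  have "?A ** matrix_inv ?A = mat 1"
    unfolding matrix_inv_def using someI[of "\<lambda>A'. ?A ** A' = mat 1 \<and> A' ** ?A = mat 1", OF ex] by blast
  then have "s *\<^sub>R matrix_inv ?A = mat 1" by (simp add: scalar_matrix_assoc[symmetric])
  then have "(1 / s) *\<^sub>R (s *\<^sub>R matrix_inv ?A) = (1 / s) *\<^sub>R mat 1" by simp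
  then show ?thesis using assms by simp
qed

lemma det_scaleR_mat: "det (s *\<^sub>R mat 1 :: real^'n^'n) = s ^ CARD('n)"
  by (subst det_diagonal) (simp_all add: mat_def)

lemma gaussian_measure_scaleR_mat:
  fixes s :: real
  assumes s: "0 < s"
  shows "gaussian_measure (0 :: real^'n) (s *\<^sub>R mat 1) = density lborel (\<lambda>x. ennreal (heat_kernel s x))"
proof -
  have "exp (- (x \<bullet> (((1 / s) *\<^sub>R mat 1) *v x)) / 2) / sqrt ((2 * pi) ^ CARD('n) * s ^ CARD('n)) = heat_kernel s x" for x :: "real^'n"
  proof -
    have "((1 / s) *\<^sub>R mat 1) *v x = (1 / s) *\<^sub>R x" by (simp add: scaleR_matrix_vector_assoc[symmetric])
    then have "x \<bullet> (((1 / s) *\<^sub>R mat 1) *v x) = (norm x)\<^sup>2 / s" by (simp add: power2_norm_eq_inner)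
    moreover have "(2 * pi) ^ CARD('n) * s ^ CARD('n) = (2 * pi * s) ^ DIM(real^'n)" by (simp add: power_mult_distrib)
    ultimately show ?thesis using s by (simp only: heat_kernel_def) (simp add: field_simps)
  qed
  then show ?thesis
    unfolding gaussian_measure_def using s by (simp add: matrix_inv_scaleR_mat det_scaleR_mat)
qed

lemma gaussian_borel_prob:
  assumes s: "0 < s" shows "borel_prob (gaussian_measure (0 :: real^'n) (s *\<^sub>R mat 1))"
proof (intro borel_prob.intro prob_spaceI borel_prob_axioms.intro)
  let ?G = "gaussian_measure (0 :: real^'n) (s *\<^sub>R mat 1)"
  show "sets ?G = sets borel" unfolding gaussian_measure_def by simp
  have "emeasure ?G (space ?G) = (\<integral>\<^sup>+x. ennreal (heat_kernel s x) \<partial>(lborel :: (real^'n) measure))"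
    unfolding gaussian_measure_scaleR_mat[OF s] by (simp add: emeasure_density cong: nn_integral_cong)
  also have "\<dots> = ennreal (\<integral>x. heat_kernel s x \<partial>(lborel :: (real^'n) measure))"
    by (rule nn_integral_eq_integral[OF heat_kernel_integrable(1)[OF s]]) (simp add: heat_kernel_nonneg s)
  finally show "emeasure ?G (space ?G) = 1" unfolding heat_kernel_integrable(2)[OF s] by simp
qed

lemma charfun_gaussian:
  assumes s: "0 < s"
  shows "charfun (gaussian_measure (0 :: real^'n) (s *\<^sub>R mat 1)) u = of_real (exp (- s * (norm u)\<^sup>2 / 2))"
proof -
  let ?c = "sqrt ((2 * pi * s) ^ DIM(real^'n))"
  have c: "0 < ?c" using s by simp
  have "charfun (gaussian_measure (0 :: real^'n) (s *\<^sub>R mat 1)) u = (\<integral>x. heat_kernel s x *\<^sub>R cis (u \<bullet> x) \<partial>lborel)"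
    unfolding charfun_def gaussian_measure_scaleR_mat[OF s]
    by (subst integral_density) (use heat_kernel_nonneg[OF s] in auto)
  also have "\<dots> = (\<integral>x. (1 / ?c) *\<^sub>R (exp (- (norm x)\<^sup>2 / (2 * s)) *\<^sub>R cis (u \<bullet> x)) \<partial>lborel)"
    unfolding heat_kernel_def by simp
  also have "\<dots> = (1 / ?c) *\<^sub>R of_real (?c * exp (- s * (norm u)\<^sup>2 / 2))"
    by (simp only: integral_scaleR_right gaussian_fourier(2)[OF s])
  also have "\<dots> = of_real (exp (- s * (norm u)\<^sup>2 / 2))"
    using c s by (simp add: scaleR_conv_of_real)
  finally show ?thesis .
qed

lemma (in prob_space) charfun_distr:
  fixes V :: "'a \<Rightarrow> 'c::euclidean_space"
  assumes [measurable]: "V \<in> borel_measurable M"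
  shows "charfun (distr M borel V) u = (\<integral>\<omega>. cis (u \<bullet> V \<omega>) \<partial>M)"
  unfolding charfun_def by (rule integral_distr) measurable

lemma (in prob_space) converges_in_distributionI:
  fixes V :: "nat \<Rightarrow> 'a \<Rightarrow> 'c::euclidean_space"
  assumes V [measurable]: "\<And>n. V n \<in> borel_measurable M" and \<mu>: "borel_prob \<mu>"
    and conv: "\<And>u. (\<lambda>n. \<integral>\<omega>. cis (u \<bullet> V n \<omega>) \<partial>M) \<longlonglongrightarrow> charfun \<mu> u"
  shows "converges_in_distribution M V \<mu>"
  unfolding converges_in_distribution_def
proof (intro allI impI)
  fix f :: "'c \<Rightarrow> real" assume f: "continuous_on UNIV f" "bounded (range f)"
  have [measurable]: "f \<in> borel_measurable borel" by (rule borel_measurable_continuous_onI[OF f(1)])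
  have bp: "borel_prob (distr M borel (V n))" for n
    by (intro borel_prob.intro borel_prob_axioms.intro prob_space_distr V) simp
  have cc: "(\<lambda>n. charfun (distr M borel (V n)) u) \<longlonglongrightarrow> charfun \<mu> u" for u
    unfolding charfun_distr[OF V] by (rule conv)
  have "(\<lambda>n. integral\<^sup>L (distr M borel (V n)) f) \<longlonglongrightarrow> integral\<^sup>L \<mu> f"
    by (rule levy_continuity_euclidean[OF bp \<mu> cc f])
  moreover have "integral\<^sup>L (distr M borel (V n)) f = (\<integral>\<omega>. f (V n \<omega>) \<partial>M)" for n
    by (rule integral_distr) measurable
  ultimately show "(\<lambda>n. \<integral>\<omega>. f (V n \<omega>) \<partial>M) \<longlonglongrightarrow> (\<integral>x. f x \<partial>\<mu>)" by simp
qed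

lemma norm_cis_diff_le: "norm (cis x - cis y) \<le> \<bar>x - y\<bar>"
proof -
  have "cmod (iexp (x - y) - (\<Sum>k\<le>0. (\<i> * (x - y)) ^ k / fact k)) \<le> \<bar>x - y\<bar> ^ Suc 0 / fact (Suc 0)"
    using iexp_approx1[of "x - y" 0] by simp
  then have 1: "norm (cis (x - y) - 1) \<le> \<bar>x - y\<bar>" by (simp add: cis_conv_exp)
  have "cis x - cis y = cis y * (cis (x - y) - 1)" by (simp add: right_diff_distrib cis_mult)
  then show ?thesis using 1 by (simp add: norm_mult)
qed

context superdiffusive_merws
begin

section \<open>From the tail estimate to the two limit theorems\<close>

context
  fixes L :: "'w \<Rightarrow> real^'d"
  assumes L [measurable]: "L \<in> borel_measurable M"
    and lim: "AE \<omega> in M. (\<lambda>n. walk X n \<omega> /\<^sub>R (real n powr (p - q))) \<longlonglongrightarrow> L \<omega>"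
begin

text \<open>Lets N tend to infinity in the uniform bound: \<open>B N\<close> tends to 0, which
  removes the Gaussian factor, and the tail converges because \<open>G N\<close> is asymptotic to
  N^(p - q). At N = n the tail is 0 and only the Gaussian factor is left.\<close>

lemma tail_gaussian:
  assumes n: "1 \<le> n" and w: "w \<in> borel_measurable (F n)"
    and bd: "\<And>N. n \<le> N \<Longrightarrow> norm ((\<integral>\<omega>. interp n w N \<omega> \<partial>M) - (\<integral>\<omega>. interp n w n \<omega> \<partial>M)) \<le> \<epsilon>"
  shows "norm ((\<integral>\<omega>. cis (w \<omega> \<bullet> (walk X n \<omega> - G n *\<^sub>R L \<omega>)) \<partial>M) - (\<integral>\<omega>. of_real (exp (- (\<theta> * (norm (w \<omega>))\<^sup>2 * sigma_sq X n \<omega> / 2))) \<partial>M)) \<le> \<epsilon>"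
proof -
  have wM [measurable]: "w \<in> borel_measurable M" by (rule F_measurable[OF w])
  have "(\<lambda>N. \<integral>\<omega>. interp n w N \<omega> \<partial>M) \<longlonglongrightarrow> (\<integral>\<omega>. cis (w \<omega> \<bullet> (walk X n \<omega> - G n *\<^sub>R L \<omega>)) \<partial>M)"
  proof (rule integral_dominated_convergence[where w="\<lambda>_. 1"])
    have ratio: "(\<lambda>N. real N powr (p - q) / G N) \<longlonglongrightarrow> 1"
    proof -
      have "(\<lambda>N. G N / real N powr (p - q)) \<longlonglongrightarrow> 1" unfolding G_def using a_bounds by (intro gquot_asymp) simp
      from tendsto_inverse[OF this] show ?thesis by (simp add: inverse_eq_divide)
    qed
    show "AE \<omega> in M. (\<lambda>N. interp n w N \<omega>) \<longlonglongrightarrow> cis (w \<omega> \<bullet> (walk X n \<omega> - G n *\<^sub>R L \<omega>))"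
      using lim
    proof eventually_elim
      case (elim \<omega>)
      have "(\<lambda>N. (G n * (real N powr (p - q) / G N)) *\<^sub>R (walk X N \<omega> /\<^sub>R (real N powr (p - q)))) \<longlonglongrightarrow> (G n * 1) *\<^sub>R L \<omega>"
        by (intro tendsto_scaleR tendsto_mult tendsto_const ratio elim)
      then have wl: "(\<lambda>N. (G n / G N) *\<^sub>R walk X N \<omega>) \<longlonglongrightarrow> G n *\<^sub>R L \<omega>"
      proof (rule Lim_transform_eventually[OF tendsto_eq_rhs])
        show "\<forall>\<^sub>F N in sequentially. (G n * (real N powr (p - q) / G N)) *\<^sub>R (walk X N \<omega> /\<^sub>R (real N powr (p - q))) = (G n / G N) *\<^sub>R walk X N \<omega>"
          using eventually_ge_at_top[of 1] by eventually_elim simp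
      qed simp
      have t: "(\<lambda>N. tail n w N \<omega>) \<longlonglongrightarrow> w \<omega> \<bullet> (walk X n \<omega> - G n *\<^sub>R L \<omega>)"
        unfolding tail_def by (intro tendsto_inner tendsto_diff tendsto_const wl)
      have c: "(\<lambda>N. cis (tail n w N \<omega>)) \<longlonglongrightarrow> cis (w \<omega> \<bullet> (walk X n \<omega> - G n *\<^sub>R L \<omega>))"
        by (rule isCont_tendsto_compose[OF _ t]) (auto simp: cis_conv_exp intro!: continuous_intros)
      have "(\<lambda>N. exp (- \<kappa> n w \<omega> * B N / 2)) \<longlonglongrightarrow> exp (- \<kappa> n w \<omega> * 0 / 2)"
        by (intro tendsto_exp tendsto_divide tendsto_mult tendsto_const B_tendsto_0) simp
      from tendsto_scaleR[OF this c] show ?case unfolding interp_def by simp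
    qed
    show "(\<lambda>\<omega>. cis (w \<omega> \<bullet> (walk X n \<omega> - G n *\<^sub>R L \<omega>))) \<in> borel_measurable M" by measurable
    show "interp n w N \<in> borel_measurable M" for N by measurable
    show "integrable M (\<lambda>_. 1 :: real)" by simp
    show "AE \<omega> in M. norm (interp n w N \<omega>) \<le> 1" for N
    proof (rule AE_I2)
      fix \<omega>
      \<comment> \<open>The domination is asked for N = 0 as well, where \<open>Gamma 0 = 0\<close>
        and division by zero make \<open>B 0\<close> equal to 0.\<close>
      have "0 \<le> B N" unfolding B_def H_def G_def gquot_def using r_pos
        by (cases "N = 0") (auto intro!: divide_nonneg_nonneg Gamma_real_nonneg simp: add_pos_nonneg)
      then have "0 \<le> \<kappa> n w \<omega> * B N" using kappa_nonneg[OF n] by (intro mult_nonneg_nonneg)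
      then show "norm (interp n w N \<omega>) \<le> 1" unfolding interp_def by simp
    qed
  qed
  then have "(\<lambda>N. norm ((\<integral>\<omega>. interp n w N \<omega> \<partial>M) - (\<integral>\<omega>. interp n w n \<omega> \<partial>M))) \<longlonglongrightarrow> norm ((\<integral>\<omega>. cis (w \<omega> \<bullet> (walk X n \<omega> - G n *\<^sub>R L \<omega>)) \<partial>M) - (\<integral>\<omega>. interp n w n \<omega> \<partial>M))"
    by (intro tendsto_norm tendsto_diff tendsto_const)
  then have "norm ((\<integral>\<omega>. cis (w \<omega> \<bullet> (walk X n \<omega> - G n *\<^sub>R L \<omega>)) \<partial>M) - (\<integral>\<omega>. interp n w n \<omega> \<partial>M)) \<le> \<epsilon>"
  proof (rule tendsto_upperbound)
    show "\<forall>\<^sub>F N in sequentially. norm ((\<integral>\<omega>. interp n w N \<omega> \<partial>M) - (\<integral>\<omega>. interp n w n \<omega> \<partial>M)) \<le> \<epsilon>"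
      using eventually_ge_at_top[of n] by eventually_elim (rule bd)
  qed simp
  moreover have "interp n w n \<omega> = of_real (exp (- (\<theta> * (norm (w \<omega>))\<^sup>2 * sigma_sq X n \<omega> / 2)))" for \<omega>
  proof -
    have "tail n w n \<omega> = 0" using G_pos[OF n] by (simp add: tail_def)
    moreover have "\<kappa> n w \<omega> * B n = \<theta> * (norm (w \<omega>))\<^sup>2 * sigma_sq X n \<omega>"
      using B_pos[OF n] by (simp add: \<kappa>_def)
    ultimately show ?thesis unfolding interp_def by (simp add: scaleR_conv_of_real)
  qed
  ultimately show ?thesis by (simp only:)
qed

text \<open>Replaces \<open>G n\<close> by n^(p - q). The two differ by at most 1, so the phase
  changes by at most |w| |L|, and |w| tends to 0 uniformly; the cap 2 provides domination with no
  moment of \<open>L\<close> at hand.\<close>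

lemma clt_core:
  assumes K: "0 \<le> K" and w: "\<And>n. 1 \<le> n \<Longrightarrow> w n \<in> borel_measurable (F n)"
    and wb: "\<And>n \<omega>. 1 \<le> n \<Longrightarrow> (norm (w n \<omega>))\<^sup>2 \<le> K * real n powr (- (1 - r))"
  shows "(\<lambda>n. (\<integral>\<omega>. cis (w n \<omega> \<bullet> (walk X n \<omega> - (real n powr (p - q)) *\<^sub>R L \<omega>)) \<partial>M)
     - of_real (\<integral>\<omega>. exp (- (\<theta> * (norm (w n \<omega>))\<^sup>2 * sigma_sq X n \<omega> / 2)) \<partial>M)) \<longlonglongrightarrow> 0"
proof -
  obtain \<epsilon> where \<epsilon>: "\<epsilon> \<longlonglongrightarrow> 0" and bd: "\<And>n w N. 1 \<le> n \<Longrightarrow> w \<in> borel_measurable (F n) \<Longrightarrow> (\<And>\<omega>. (norm (w \<omega>))\<^sup>2 \<le> K * real n powr (- (1 - r))) \<Longrightarrow> n \<le> N \<Longrightarrow>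
      norm ((\<integral>\<omega>. interp n w N \<omega> \<partial>M) - (\<integral>\<omega>. interp n w n \<omega> \<partial>M)) \<le> \<epsilon> n"
    using tail_charfun_bound[OF K] by blast
  define \<rho> where "\<rho> n = sqrt K * real n powr (- (1 - r) / 2)" for n :: nat
  have \<rho>: "\<rho> \<longlonglongrightarrow> 0"
  proof -
    have "(\<lambda>n. real n powr (- (1 - r) / 2)) \<longlonglongrightarrow> 0"
      using r_pos by (intro tendsto_neg_powr filterlim_real_sequentially) auto
    from tendsto_mult_right_zero[OF this, of "sqrt K"] show ?thesis unfolding \<rho>_def[abs_def] .
  qed
  have \<rho>0: "0 \<le> \<rho> n" for n unfolding \<rho>_def using K by simp
  have dom: "(\<lambda>n. \<integral>\<omega>. min 2 (\<rho> n * norm (L \<omega>)) \<partial>M) \<longlonglongrightarrow> (\<integral>\<omega>. 0 \<partial>M)"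
  proof (rule integral_dominated_convergence[where w="\<lambda>_. 2"])
    show "AE \<omega> in M. (\<lambda>n. min 2 (\<rho> n * norm (L \<omega>))) \<longlonglongrightarrow> 0"
    proof (rule AE_I2)
      fix \<omega>
      have "(\<lambda>n. min 2 (\<rho> n * norm (L \<omega>))) \<longlonglongrightarrow> min 2 (0 * norm (L \<omega>))"
        by (intro tendsto_min tendsto_const tendsto_mult \<rho>)
      then show "(\<lambda>n. min 2 (\<rho> n * norm (L \<omega>))) \<longlonglongrightarrow> 0" by simp
    qed
    show "AE \<omega> in M. norm (min 2 (\<rho> n * norm (L \<omega>))) \<le> 2" for n
      using \<rho>0[of n] by (intro AE_I2) (simp add: min_def)
  qed auto
  have main: "norm ((\<integral>\<omega>. cis (w n \<omega> \<bullet> (walk X n \<omega> - (real n powr (p - q)) *\<^sub>R L \<omega>)) \<partial>M)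
     - of_real (\<integral>\<omega>. exp (- (\<theta> * (norm (w n \<omega>))\<^sup>2 * sigma_sq X n \<omega> / 2)) \<partial>M)) \<le> (\<integral>\<omega>. min 2 (\<rho> n * norm (L \<omega>)) \<partial>M) + \<epsilon> n" if n: "1 \<le> n" for n
  proof -
    have wM [measurable]: "w n \<in> borel_measurable M" by (rule F_measurable[OF w[OF n]])
    let ?D = "\<lambda>\<omega>. cis (w n \<omega> \<bullet> (walk X n \<omega> - (real n powr (p - q)) *\<^sub>R L \<omega>))"
    let ?D' = "\<lambda>\<omega>. cis (w n \<omega> \<bullet> (walk X n \<omega> - G n *\<^sub>R L \<omega>))"
    have iD: "integrable M ?D" "integrable M ?D'" by (rule integrable_const_bound[where B=1]; simp)+
    have "norm ((\<integral>\<omega>. ?D \<omega> \<partial>M) - (\<integral>\<omega>. ?D' \<omega> \<partial>M)) = norm (\<integral>\<omega>. ?D \<omega> - ?D' \<omega> \<partial>M)"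
      using iD by simp
    also have "\<dots> \<le> (\<integral>\<omega>. norm (?D \<omega> - ?D' \<omega>) \<partial>M)" by (rule integral_norm_bound)
    also have "\<dots> \<le> (\<integral>\<omega>. min 2 (\<rho> n * norm (L \<omega>)) \<partial>M)"
    proof (rule integral_mono)
      show "integrable M (\<lambda>\<omega>. norm (?D \<omega> - ?D' \<omega>))" by (intro integrable_norm Bochner_Integration.integrable_diff iD)
      show "integrable M (\<lambda>\<omega>. min 2 (\<rho> n * norm (L \<omega>)))"
      proof (rule integrable_const_bound[where B=2])
        show "AE \<omega> in M. norm (min 2 (\<rho> n * norm (L \<omega>))) \<le> 2" using \<rho>0[of n] by (intro AE_I2) (simp add: min_def)
      qed measurable
      fix \<omega>
      have n2: "norm (?D \<omega> - ?D' \<omega>) \<le> 2" using norm_triangle_ineq4[of "?D \<omega>" "?D' \<omega>"] by simp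
      have "norm (?D \<omega> - ?D' \<omega>) \<le> \<bar>w n \<omega> \<bullet> (walk X n \<omega> - (real n powr (p - q)) *\<^sub>R L \<omega>) - w n \<omega> \<bullet> (walk X n \<omega> - G n *\<^sub>R L \<omega>)\<bar>"
        by (rule norm_cis_diff_le)
      also have "\<dots> = \<bar>(G n - real n powr (p - q)) * (w n \<omega> \<bullet> L \<omega>)\<bar>" by (simp add: inner_diff_right algebra_simps)
      also have "\<dots> = \<bar>real n powr (p - q) - G n\<bar> * \<bar>w n \<omega> \<bullet> L \<omega>\<bar>" by (simp only: abs_mult abs_minus_commute)
      also have "\<dots> \<le> 1 * (\<rho> n * norm (L \<omega>))"
      proof (rule mult_mono)
        show "\<bar>real n powr (p - q) - G n\<bar> \<le> 1" unfolding G_def using a_bounds by (intro powr_gquot_diff n) auto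
        have "norm (w n \<omega>) \<le> sqrt (K * real n powr (- (1 - r)))" using wb[OF n, of \<omega>] by (rule real_le_rsqrt)
        also have "\<dots> = \<rho> n" unfolding \<rho>_def by (simp add: real_sqrt_mult powr_half_sqrt[symmetric] powr_powr)
        finally have "norm (w n \<omega>) * norm (L \<omega>) \<le> \<rho> n * norm (L \<omega>)" by (rule mult_right_mono) simp
        then show "\<bar>w n \<omega> \<bullet> L \<omega>\<bar> \<le> \<rho> n * norm (L \<omega>)" using Cauchy_Schwarz_ineq2[of "w n \<omega>" "L \<omega>"] by linarith
      qed auto
      finally show "norm (?D \<omega> - ?D' \<omega>) \<le> min 2 (\<rho> n * norm (L \<omega>))" using n2 by simp
    qed
    finally have 1: "norm ((\<integral>\<omega>. ?D \<omega> \<partial>M) - (\<integral>\<omega>. ?D' \<omega> \<partial>M)) \<le> (\<integral>\<omega>. min 2 (\<rho> n * norm (L \<omega>)) \<partial>M)" .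
    have 2: "norm ((\<integral>\<omega>. ?D' \<omega> \<partial>M) - (\<integral>\<omega>. of_real (exp (- (\<theta> * (norm (w n \<omega>))\<^sup>2 * sigma_sq X n \<omega> / 2))) \<partial>M)) \<le> \<epsilon> n"
      by (rule tail_gaussian[OF n w[OF n]]) (rule bd[OF n w[OF n] wb[OF n]])
    have "norm ((\<integral>\<omega>. ?D \<omega> \<partial>M) - (\<integral>\<omega>. of_real (exp (- (\<theta> * (norm (w n \<omega>))\<^sup>2 * sigma_sq X n \<omega> / 2))) \<partial>M))
       \<le> (\<integral>\<omega>. min 2 (\<rho> n * norm (L \<omega>)) \<partial>M) + \<epsilon> n"
      using norm_diff_triangle_le[OF 1 2] .
    then show ?thesis by (simp only: integral_complex_of_real)
  qed
  show ?thesis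
  proof (rule Lim_null_comparison)
    show "\<forall>\<^sub>F n in sequentially. norm ((\<integral>\<omega>. cis (w n \<omega> \<bullet> (walk X n \<omega> - (real n powr (p - q)) *\<^sub>R L \<omega>)) \<partial>M)
     - of_real (\<integral>\<omega>. exp (- (\<theta> * (norm (w n \<omega>))\<^sup>2 * sigma_sq X n \<omega> / 2)) \<partial>M)) \<le> (\<integral>\<omega>. min 2 (\<rho> n * norm (L \<omega>)) \<partial>M) + \<epsilon> n"
      using eventually_ge_at_top[of 1] by eventually_elim (rule main)
    show "(\<lambda>n. (\<integral>\<omega>. min 2 (\<rho> n * norm (L \<omega>)) \<partial>M) + \<epsilon> n) \<longlonglongrightarrow> 0"
      using tendsto_add[OF dom \<epsilon>] by simp
  qed
qed

end

context
  fixes L :: "'w \<Rightarrow> real^'d"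
  assumes L [measurable]: "L \<in> borel_measurable M"
    and lim: "AE \<omega> in M. (\<lambda>n. walk X n \<omega> /\<^sub>R (real n powr (p - q))) \<longlonglongrightarrow> L \<omega>"
begin

definition dev :: "nat \<Rightarrow> 'w \<Rightarrow> real^'d" where
  "dev n \<omega> = walk X n \<omega> - (real n powr (p - q)) *\<^sub>R L \<omega>"

lemma dev_M [measurable]: "dev n \<in> borel_measurable M"
  unfolding dev_def[abs_def] by measurable

text \<open>The natural weight u / sqrt(sigma_n^2) is of order n^(-(1 - r) / 2) only where
  \<open>Ts\<close> stays away from 0. It is set to 0 where \<open>Ts\<close> is below delta, an
  event of probability O(sqrt delta), and delta tends to 0 after n tends to infinity.\<close>

lemma self_normalized_charfun:
  "(\<lambda>n. \<integral>\<omega>. cis (u \<bullet> (dev n \<omega> /\<^sub>R sqrt (sigma_sq X n \<omega>))) \<partial>M) \<longlonglongrightarrow> complex_of_real (exp (- \<theta> * (norm u)\<^sup>2 / 2))"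
proof -
  define c where "c = (exp (- \<theta> * (norm u)\<^sup>2 / 2) :: real)"
  have c: "0 \<le> c" "c \<le> 1" unfolding c_def using theta_pos by simp_all
  define f where "f n \<omega> = cis (u \<bullet> (dev n \<omega> /\<^sub>R sqrt (sigma_sq X n \<omega>)))" for n \<omega>
  have fM [measurable]: "f n \<in> borel_measurable M" for n unfolding f_def[abs_def] by measurable
  have fi: "integrable M (f n)" for n by (rule integrable_const_bound[where B=1]) (simp_all add: f_def)
  have close: "\<forall>\<^sub>F n in sequentially. norm ((\<integral>\<omega>. f n \<omega> \<partial>M) - of_real c) \<le> 3 * (Gamma (1 / 2) * sqrt \<delta>) + \<delta>" if \<delta>: "0 < \<delta>" for \<delta>
  proof -
    define w where "w n \<omega> = (if \<delta> \<le> Ts n \<omega> then (1 / sqrt (sigma_sq X n \<omega>)) *\<^sub>R u else 0)" for n \<omega>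
    define K where "K = (norm u)\<^sup>2 / \<delta>"
    have K: "0 \<le> K" using \<delta> by (simp add: K_def)
    have TsF: "Ts n \<in> borel_measurable (F n)" for n
      unfolding Ts_def[abs_def] using sigma_sq_F[OF order_refl, of n] by measurable
    have wF: "w n \<in> borel_measurable (F n)" for n
      unfolding w_def using sigma_sq_F[OF order_refl, of n] TsF[of n] by measurable
    have w_sq: "(norm (w n \<omega>))\<^sup>2 * sigma_sq X n \<omega> = (norm u)\<^sup>2" if n: "1 \<le> n" and T: "\<delta> \<le> Ts n \<omega>" for n \<omega>
    proof -
      have "0 < Ts n \<omega>" using T \<delta> by linarith
      then have "sigma_sq X n \<omega> \<noteq> 0" unfolding Ts_def by auto
      then have "0 < sigma_sq X n \<omega>" using sigma_sq_nonneg[of n \<omega>] by linarith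
      then show ?thesis using T by (simp add: w_def power_mult_distrib power_divide)
    qed
    have wb: "(norm (w n \<omega>))\<^sup>2 \<le> K * real n powr (- (1 - r))" if n: "1 \<le> n" for n \<omega>
    proof (cases "\<delta> \<le> Ts n \<omega>")
      case True
      have n0: "0 < real n powr (1 - r)" using n by simp
      have Z: "\<delta> * real n powr (1 - r) \<le> sigma_sq X n \<omega>"
        using True n0 unfolding Ts_def by (simp add: pos_le_divide_eq)
      have "(norm (w n \<omega>))\<^sup>2 * (\<delta> * real n powr (1 - r)) \<le> (norm (w n \<omega>))\<^sup>2 * sigma_sq X n \<omega>"
        using Z by (intro mult_left_mono) auto
      also have "\<dots> = (norm u)\<^sup>2" by (rule w_sq[OF n True])
      finally have "(norm (w n \<omega>))\<^sup>2 \<le> (norm u)\<^sup>2 / (\<delta> * real n powr (1 - r))"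
        using \<delta> n0 by (subst pos_le_divide_eq) auto
      also have "\<dots> = K * real n powr (- (1 - r))" unfolding K_def powr_minus_divide by simp
      finally show ?thesis .
    next
      case False then show ?thesis using K by (simp add: w_def)
    qed
    have core: "(\<lambda>n. (\<integral>\<omega>. cis (w n \<omega> \<bullet> dev n \<omega>) \<partial>M) - of_real (\<integral>\<omega>. exp (- (\<theta> * (norm (w n \<omega>))\<^sup>2 * sigma_sq X n \<omega> / 2)) \<partial>M)) \<longlonglongrightarrow> 0"
      unfolding dev_def by (rule clt_core[OF L lim K wF wb])
    from tendstoD[OF core \<delta>]
    have "\<forall>\<^sub>F n in sequentially. norm ((\<integral>\<omega>. cis (w n \<omega> \<bullet> dev n \<omega>) \<partial>M) - of_real (\<integral>\<omega>. exp (- (\<theta> * (norm (w n \<omega>))\<^sup>2 * sigma_sq X n \<omega> / 2)) \<partial>M)) < \<delta>"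
      by (simp only: dist_norm diff_zero)
    with eventually_ge_at_top[of 1] show ?thesis
    proof eventually_elim
      case (elim n)
      define S where "S = {\<omega>\<in>space M. Ts n \<omega> < \<delta>}"
      have [measurable]: "S \<in> events" unfolding S_def by measurable
      have PS: "prob S \<le> Gamma (1 / 2) * sqrt \<delta>" unfolding S_def by (rule Ts_small_ball[OF elim(1) \<delta>])
      have wM [measurable]: "w n \<in> borel_measurable M" by (rule F_measurable[OF wF])
      define g where "g \<omega> = cis (w n \<omega> \<bullet> dev n \<omega>)" for \<omega>
      define h where "h \<omega> = exp (- (\<theta> * (norm (w n \<omega>))\<^sup>2 * sigma_sq X n \<omega> / 2))" for \<omega>
      have [measurable]: "g \<in> borel_measurable M" unfolding g_def[abs_def] by measurable
      have gi: "integrable M g" by (rule integrable_const_bound[where B=1]) (simp_all add: g_def)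
      have h1: "0 \<le> h \<omega>" "h \<omega> \<le> 1" for \<omega>
      proof -
        have "0 \<le> \<theta> * (norm (w n \<omega>))\<^sup>2 * sigma_sq X n \<omega> / 2"
          using theta_pos sigma_sq_nonneg[of n \<omega>] by simp
        then show "0 \<le> h \<omega>" "h \<omega> \<le> 1" unfolding h_def by simp_all
      qed
      have hi: "integrable M h"
      proof (rule integrable_const_bound[where B=1])
        show "AE \<omega> in M. norm (h \<omega>) \<le> 1" using h1 by (intro AE_I2) simp
        show "h \<in> borel_measurable M" unfolding h_def[abs_def] by measurable
      qed
      have iS: "integrable M (\<lambda>\<omega>. k * indicator S \<omega> :: real)" for k by (intro integrable_mult_right) (simp add: emeasure_eq_measure)
      have a1: "norm ((\<integral>\<omega>. f n \<omega> \<partial>M) - (\<integral>\<omega>. g \<omega> \<partial>M)) \<le> 2 * prob S"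
      proof -
        have "norm ((\<integral>\<omega>. f n \<omega> \<partial>M) - (\<integral>\<omega>. g \<omega> \<partial>M)) = norm (\<integral>\<omega>. f n \<omega> - g \<omega> \<partial>M)" using fi gi by simp
        also have "\<dots> \<le> (\<integral>\<omega>. norm (f n \<omega> - g \<omega>) \<partial>M)" by (rule integral_norm_bound)
        also have "\<dots> \<le> (\<integral>\<omega>. 2 * indicator S \<omega> \<partial>M)"
        proof (rule integral_mono)
          fix \<omega> assume \<omega>: "\<omega> \<in> space M"
          show "norm (f n \<omega> - g \<omega>) \<le> 2 * indicator S \<omega>"
          proof (cases "\<delta> \<le> Ts n \<omega>")
            case True
            then have "f n \<omega> = g \<omega>" by (simp add: f_def g_def w_def inverse_eq_divide)
            then show ?thesis by simp
          next
            case False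
            then have "\<omega> \<in> S" using \<omega> by (simp add: S_def)
            then show ?thesis using norm_triangle_ineq4[of "f n \<omega>" "g \<omega>"] by (simp add: f_def g_def)
          qed
        qed (intro integrable_norm Bochner_Integration.integrable_diff fi gi iS)+
        finally show ?thesis by simp
      qed
      have a2: "norm (complex_of_real (\<integral>\<omega>. h \<omega> \<partial>M) - of_real c) \<le> prob S"
      proof -
        have "norm (complex_of_real (\<integral>\<omega>. h \<omega> \<partial>M) - of_real c) = \<bar>(\<integral>\<omega>. h \<omega> \<partial>M) - c\<bar>"
          by (simp only: of_real_diff[symmetric] norm_of_real)
        also have "(\<integral>\<omega>. h \<omega> \<partial>M) - c = (\<integral>\<omega>. h \<omega> - c \<partial>M)" using hi by (simp add: prob_space)
        also have "\<bar>\<integral>\<omega>. h \<omega> - c \<partial>M\<bar> \<le> (\<integral>\<omega>. \<bar>h \<omega> - c\<bar> \<partial>M)" by (rule integral_abs_bound)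
        also have "\<dots> \<le> (\<integral>\<omega>. 1 * indicator S \<omega> \<partial>M)"
        proof (rule integral_mono)
          fix \<omega> assume \<omega>: "\<omega> \<in> space M"
          show "\<bar>h \<omega> - c\<bar> \<le> 1 * indicator S \<omega>"
          proof (cases "\<delta> \<le> Ts n \<omega>")
            case True
            have "h \<omega> = c" unfolding h_def c_def mult.assoc w_sq[OF elim(1) True] by simp
            then show ?thesis by simp
          next
            case False
            then have "\<omega> \<in> S" using \<omega> by (simp add: S_def)
            moreover have "\<bar>h \<omega> - c\<bar> \<le> 1" using h1[of \<omega>] c by (simp only: abs_le_iff) linarith
            ultimately show ?thesis by simp
          qed
        next
          show "integrable M (\<lambda>\<omega>. \<bar>h \<omega> - c\<bar>)" using hi by (intro integrable_abs Bochner_Integration.integrable_diff) simp_all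
        qed (rule iS)
        finally show ?thesis by simp
      qed
      have a3: "norm ((\<integral>\<omega>. g \<omega> \<partial>M) - of_real (\<integral>\<omega>. h \<omega> \<partial>M)) \<le> \<delta>" using elim(2) unfolding g_def h_def by (rule less_imp_le)
      \<comment> \<open>Off \<open>S\<close> both replacements are exact. On \<open>S\<close> the
        first costs at most 2 and the second at most 1, whence the coefficient 3.\<close>
      have "norm ((\<integral>\<omega>. f n \<omega> \<partial>M) - of_real c) \<le> (2 * prob S + \<delta>) + prob S"
        by (rule norm_diff_triangle_le[OF norm_diff_triangle_le[OF a1 a3] a2])
      then show ?case using PS by linarith
    qed
  qed
  have "(\<lambda>n. \<integral>\<omega>. f n \<omega> \<partial>M) \<longlonglongrightarrow> of_real c"
  proof (rule tendstoI)
    fix e :: real assume e: "0 < e"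
    have "((\<lambda>\<delta>. 3 * (Gamma (1 / 2) * sqrt \<delta>) + \<delta>) \<longlongrightarrow> 3 * (Gamma (1 / 2) * sqrt 0) + 0) (at_right 0)"
      by (intro tendsto_intros)
    then have "\<forall>\<^sub>F \<delta> in at_right 0. 3 * (Gamma (1 / 2) * sqrt \<delta>) + \<delta> < e"
      by (rule order_tendstoD(2)) (use e in simp)
    with eventually_at_right_less[of 0] have "\<forall>\<^sub>F \<delta> in at_right 0. 0 < \<delta> \<and> 3 * (Gamma (1 / 2) * sqrt \<delta>) + \<delta> < e"
      by eventually_elim simp
    then obtain \<delta> where \<delta>: "0 < \<delta>" "3 * (Gamma (1 / 2) * sqrt \<delta>) + \<delta> < e"
      using eventually_happens'[OF trivial_limit_at_right_real] by blast
    from close[OF \<delta>(1)] show "\<forall>\<^sub>F n in sequentially. dist (\<integral>\<omega>. f n \<omega> \<partial>M) (of_real c) < e"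
      by eventually_elim (use \<delta>(2) in \<open>simp add: dist_norm\<close>)
  qed
  then show ?thesis unfolding f_def c_def .
qed

lemma self_normalized_clt:
  "converges_in_distribution M (\<lambda>n \<omega>. dev n \<omega> /\<^sub>R sqrt (sigma_sq X n \<omega>)) (gaussian_measure 0 (\<theta> *\<^sub>R mat 1))"
proof (rule converges_in_distributionI)
  show "(\<lambda>\<omega>. dev n \<omega> /\<^sub>R sqrt (sigma_sq X n \<omega>)) \<in> borel_measurable M" for n by measurable
  show "borel_prob (gaussian_measure (0 :: real^'d) (\<theta> *\<^sub>R mat 1))" by (rule gaussian_borel_prob[OF theta_pos])
  show "(\<lambda>n. \<integral>\<omega>. cis (u \<bullet> (dev n \<omega> /\<^sub>R sqrt (sigma_sq X n \<omega>))) \<partial>M) \<longlonglongrightarrow> charfun (gaussian_measure 0 (\<theta> *\<^sub>R mat 1)) u" for u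
    unfolding charfun_gaussian[OF theta_pos] by (rule self_normalized_charfun)
qed

text \<open>The weight is deterministic here, so the Gaussian side is the Laplace transform of
  \<open>Ts\<close> at theta |u|^2 / 2.\<close>

lemma deterministic_charfun:
  assumes lap: "\<And>c. 0 \<le> c \<Longrightarrow> (\<lambda>n. \<integral>\<omega>. exp (- (c * Ts n \<omega>)) \<partial>M) \<longlonglongrightarrow> (\<integral>x. exp (- (c * x)) \<partial>\<mu>)"
  shows "(\<lambda>n. \<integral>\<omega>. cis (u \<bullet> (dev n \<omega> /\<^sub>R sqrt (real n powr (1 - r)))) \<partial>M) \<longlonglongrightarrow> complex_of_real (\<integral>x. exp (- (\<theta> * (norm u)\<^sup>2 / 2 * x)) \<partial>\<mu>)"
proof -
  define w where "w n \<omega> = (1 / sqrt (real n powr (1 - r))) *\<^sub>R u" for n and \<omega> :: 'w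
  define K where "K = (norm u)\<^sup>2"
  have K: "0 \<le> K" by (simp add: K_def)
  have w2: "(norm (w n \<omega>))\<^sup>2 = K * real n powr (- (1 - r))" for n \<omega>
    unfolding w_def K_def powr_minus_divide by (simp add: power_divide)
  have core: "(\<lambda>n. (\<integral>\<omega>. cis (w n \<omega> \<bullet> dev n \<omega>) \<partial>M) - of_real (\<integral>\<omega>. exp (- (\<theta> * (norm (w n \<omega>))\<^sup>2 * sigma_sq X n \<omega> / 2)) \<partial>M)) \<longlonglongrightarrow> 0"
    unfolding dev_def
  proof (rule clt_core[OF L lim K])
    show "w n \<in> borel_measurable (F n)" for n unfolding w_def by simp
    show "(norm (w n \<omega>))\<^sup>2 \<le> K * real n powr (- (1 - r))" for n \<omega> by (simp only: w2)
  qed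
  have "\<theta> * (norm (w n \<omega>))\<^sup>2 * sigma_sq X n \<omega> / 2 = \<theta> * K / 2 * Ts n \<omega>" for n \<omega>
    unfolding w2 Ts_def powr_minus_divide by simp
  then have core': "(\<lambda>n. (\<integral>\<omega>. cis (w n \<omega> \<bullet> dev n \<omega>) \<partial>M) - of_real (\<integral>\<omega>. exp (- (\<theta> * K / 2 * Ts n \<omega>)) \<partial>M)) \<longlonglongrightarrow> 0"
    using core by (simp only:)
  have "(\<lambda>n. complex_of_real (\<integral>\<omega>. exp (- (\<theta> * K / 2 * Ts n \<omega>)) \<partial>M)) \<longlonglongrightarrow> of_real (\<integral>x. exp (- (\<theta> * K / 2 * x)) \<partial>\<mu>)"
    using theta_pos K by (intro tendsto_of_real lap) simp
  from tendsto_add[OF core' this]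
  have "(\<lambda>n. \<integral>\<omega>. cis (w n \<omega> \<bullet> dev n \<omega>) \<partial>M) \<longlonglongrightarrow> of_real (\<integral>x. exp (- (\<theta> * K / 2 * x)) \<partial>\<mu>)"
    by simp
  then show ?thesis unfolding w_def K_def by (simp add: inverse_eq_divide)
qed

text \<open>The pair is realised by the coordinates of the product of the Mittag-Leffler law and the
  Gaussian law. Given the first coordinate x, the vector sqrt(x) Z is Gaussian with variance theta x
  per direction, so integrating over x gives the Laplace transform found in
  \<open>deterministic_charfun\<close>.\<close>

lemma mittag_leffler_clt:
  "\<exists>(N :: (real \<times> (real^'d)) measure) \<Sigma>' Z.
     prob_space N \<and> prob_space.mittag_leffler_distributed N (1 - r) \<Sigma>' \<and>
     Z \<in> borel_measurable N \<and> distr N borel Z = gaussian_measure 0 (\<theta> *\<^sub>R mat 1) \<and>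
     prob_space.indep_set N (sigma_rv N borel \<Sigma>') (sigma_rv N borel Z) \<and>
     converges_in_distribution M (\<lambda>n \<omega>. dev n \<omega> /\<^sub>R sqrt (real n powr (1 - r)))
       (distr N borel (\<lambda>x. sqrt (\<Sigma>' x) *\<^sub>R Z x))"
proof -
  obtain \<mu> where \<mu>: "real_distribution \<mu>" and pos: "AE x in \<mu>. 0 < x"
    and mi: "\<And>t. integrable \<mu> (\<lambda>x. exp (t * x))"
    and ms: "\<And>t. (\<lambda>m. t ^ m / Gamma (1 + real m * (1 - r))) sums (\<integral>x. exp (t * x) \<partial>\<mu>)"
    and lap: "\<And>c. 0 \<le> c \<Longrightarrow> (\<lambda>n. \<integral>\<omega>. exp (- (c * Ts n \<omega>)) \<partial>M) \<longlonglongrightarrow> (\<integral>x. exp (- (c * x)) \<partial>\<mu>)"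
    by (rule mittag_leffler_limit) blast
  interpret R: real_distribution \<mu> by (rule \<mu>)
  define \<nu> where "\<nu> = gaussian_measure (0 :: real^'d) (\<theta> *\<^sub>R mat 1)"
  interpret V: borel_prob \<nu> unfolding \<nu>_def by (rule gaussian_borel_prob[OF theta_pos])
  interpret P: pair_prob_space \<mu> \<nu> ..
  define N where "N = \<mu> \<Otimes>\<^sub>M \<nu>"
  interpret NP: prob_space N unfolding N_def by (rule P.prob_space_axioms)
  have f1 [measurable]: "fst \<in> borel_measurable N"
    unfolding N_def using measurable_fst[of \<mu> \<nu>] by (simp cong: measurable_cong_sets)
  have s1 [measurable]: "snd \<in> borel_measurable N"
    unfolding N_def using measurable_snd[of \<mu> \<nu>] by (simp cong: measurable_cong_sets)
  have spN: "space N = UNIV" unfolding N_def space_pair_measure by simp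
  have rect: "NP.prob (A \<times> B) = measure \<mu> A * measure \<nu> B" if "A \<in> sets borel" "B \<in> sets borel" for A B
    unfolding N_def using that by (simp add: measure_def V.emeasure_pair_measure_Times enn2real_mult)
  have d1: "distr N borel fst = \<mu>"
  proof (rule measure_eqI)
    fix A assume "A \<in> sets (distr N borel fst)"
    then have A: "A \<in> sets borel" by simp
    then have "emeasure (distr N borel fst) A = emeasure N (A \<times> UNIV)"
      by (subst emeasure_distr[OF f1]) (auto simp: spN intro!: arg_cong[where f="emeasure N"])
    also have "\<dots> = emeasure \<mu> A * emeasure \<nu> UNIV" unfolding N_def using A by (intro V.emeasure_pair_measure_Times) auto
    finally show "emeasure (distr N borel fst) A = emeasure \<mu> A" using V.emeasure_space_1 by simp
  qed simp
  have d2: "distr N borel snd = \<nu>"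
  proof (rule measure_eqI)
    fix B assume "B \<in> sets (distr N borel snd)"
    then have B: "B \<in> sets borel" by simp
    then have "emeasure (distr N borel snd) B = emeasure N (UNIV \<times> B)"
      by (subst emeasure_distr[OF s1]) (auto simp: spN intro!: arg_cong[where f="emeasure N"])
    also have "\<dots> = emeasure \<mu> UNIV * emeasure \<nu> B" unfolding N_def using B by (intro V.emeasure_pair_measure_Times) auto
    finally show "emeasure (distr N borel snd) B = emeasure \<nu> B" using R.emeasure_space_1 by simp
  qed simp
  have ml: "NP.mittag_leffler_distributed (1 - r) fst"
    unfolding NP.mittag_leffler_distributed_def
  proof (intro conjI allI)
    have "AE x in distr N borel fst. 0 < x" unfolding d1 by (rule pos)
    then show "AE x in N. 0 < fst x" by (subst (asm) AE_distr_iff) auto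
    fix t :: real
    have "integrable (distr N borel fst) (\<lambda>x. exp (t * x))" unfolding d1 by (rule mi)
    then show "integrable N (\<lambda>x. exp (t * fst x))" by (subst (asm) integrable_distr_eq) auto
    have "(\<integral>x. exp (t * x) \<partial>distr N borel fst) = (\<integral>x. exp (t * fst x) \<partial>N)" by (rule integral_distr) auto
    then show "(\<lambda>n. t ^ n / Gamma (1 + real n * (1 - r))) sums NP.expectation (\<lambda>x. exp (t * fst x))"
      using ms[of t] unfolding d1 by simp
  qed (rule f1)
  have ind: "NP.indep_set (sigma_rv N borel fst) (sigma_rv N borel snd)"
  proof (rule NP.indep_setI)
    show "sigma_rv N borel fst \<subseteq> NP.events" by (rule sigma_rv_subset[OF f1])
    show "sigma_rv N borel snd \<subseteq> NP.events" by (rule sigma_rv_subset[OF s1])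
    fix a b assume "a \<in> sigma_rv N borel fst" "b \<in> sigma_rv N borel snd"
    then obtain A B where AB: "A \<in> sets borel" "B \<in> sets borel" and a: "a = fst -` A \<inter> space N" and b: "b = snd -` B \<inter> space N"
      by (auto simp: sigma_rv_eq)
    have "a = A \<times> UNIV" "b = UNIV \<times> B" "a \<inter> b = A \<times> B" unfolding a b spN by auto
    moreover have "measure \<mu> UNIV = 1" "measure \<nu> UNIV = 1" using R.prob_space V.prob_space by simp_all
    ultimately show "NP.prob (a \<inter> b) = NP.prob a * NP.prob b" using AB by (simp add: rect)
  qed
  have VM [measurable]: "(\<lambda>x. sqrt (fst x) *\<^sub>R snd x) \<in> borel_measurable N" by measurable
  have cf: "charfun (distr N borel (\<lambda>x. sqrt (fst x) *\<^sub>R snd x)) u = complex_of_real (\<integral>x. exp (- (\<theta> * (norm u)\<^sup>2 / 2 * x)) \<partial>\<mu>)" for u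
  proof -
    have "charfun (distr N borel (\<lambda>x. sqrt (fst x) *\<^sub>R snd x)) u = (\<integral>x. cis (u \<bullet> (sqrt (fst x) *\<^sub>R snd x)) \<partial>N)"
      by (rule NP.charfun_distr[OF VM])
    also have "\<dots> = (\<integral>x. \<integral>z. cis (u \<bullet> (sqrt x *\<^sub>R z)) \<partial>\<nu> \<partial>\<mu>)"
    proof -
      have "integrable N (\<lambda>x. cis (u \<bullet> (sqrt (fst x) *\<^sub>R snd x)))"
      proof (rule NP.integrable_const_bound[where B=1])
        show "(\<lambda>x. cis (u \<bullet> (sqrt (fst x) *\<^sub>R snd x))) \<in> borel_measurable N" by measurable
      qed simp
      from P.integral_fst'[OF this[unfolded N_def]] show ?thesis unfolding N_def by simp
    qed
    also have "\<dots> = (\<integral>x. complex_of_real (exp (- (\<theta> * (norm u)\<^sup>2 / 2 * x))) \<partial>\<mu>)"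
    proof (rule integral_cong_AE)
      show "AE x in \<mu>. (\<integral>z. cis (u \<bullet> (sqrt x *\<^sub>R z)) \<partial>\<nu>) = complex_of_real (exp (- (\<theta> * (norm u)\<^sup>2 / 2 * x)))"
        using pos
      proof eventually_elim
        case (elim x)
        have "(\<integral>z. cis (u \<bullet> (sqrt x *\<^sub>R z)) \<partial>\<nu>) = charfun \<nu> (sqrt x *\<^sub>R u)"
          unfolding charfun_def by simp
        also have "\<dots> = of_real (exp (- \<theta> * (norm (sqrt x *\<^sub>R u))\<^sup>2 / 2))" unfolding \<nu>_def by (rule charfun_gaussian[OF theta_pos])
        also have "(norm (sqrt x *\<^sub>R u))\<^sup>2 = x * (norm u)\<^sup>2" using elim by (simp add: power_mult_distrib)
        finally show ?case by (simp add: mult_ac)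
      qed
      show "(\<lambda>x. \<integral>z. cis (u \<bullet> (sqrt x *\<^sub>R z)) \<partial>\<nu>) \<in> borel_measurable \<mu>"
        by (rule V.borel_measurable_lebesgue_integral) measurable
    qed measurable
    finally show ?thesis by (simp only: integral_complex_of_real)
  qed
  have conv: "converges_in_distribution M (\<lambda>n \<omega>. dev n \<omega> /\<^sub>R sqrt (real n powr (1 - r))) (distr N borel (\<lambda>x. sqrt (fst x) *\<^sub>R snd x))"
  proof (rule converges_in_distributionI)
    show "(\<lambda>\<omega>. dev n \<omega> /\<^sub>R sqrt (real n powr (1 - r))) \<in> borel_measurable M" for n by measurable
    show "borel_prob (distr N borel (\<lambda>x. sqrt (fst x) *\<^sub>R snd x))"
      by (intro borel_prob.intro borel_prob_axioms.intro NP.prob_space_distr VM) simp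
    show "(\<lambda>n. \<integral>\<omega>. cis (u \<bullet> (dev n \<omega> /\<^sub>R sqrt (real n powr (1 - r)))) \<partial>M) \<longlonglongrightarrow> charfun (distr N borel (\<lambda>x. sqrt (fst x) *\<^sub>R snd x)) u" for u
      unfolding cf by (rule deterministic_charfun[OF lap])
  qed
  show ?thesis
    using NP.prob_space_axioms ml s1 d2[unfolded \<nu>_def] ind conv by blast
qed

end

end

theorem theorem3p8:
  fixes M :: "'w measure"
    and b :: "nat \<Rightarrow> 'd::finite"
    and p q r d \<theta>2 :: real
    and X :: "nat \<Rightarrow> 'w \<Rightarrow> real^'d"
    and U :: "nat \<Rightarrow> 'w \<Rightarrow> nat"
    and A :: "nat \<Rightarrow> 'w \<Rightarrow> real^'d^'d"
    and L :: "'w \<Rightarrow> real^'d"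
  assumes merws: "merws M b p q r X U A"
    and d: "d = real CARD('d)"
    and superdiffusive: "p > (2 * d + 1) / (4 * d) * (1 - r)"
    and nondegenerate: "q > 0 \<or> CARD('d) = 1"
    and \<theta>2: "\<theta>2 = (2 * d - 1) * (1 - r) / (d * (4 * d * p - (2 * d + 1) * (1 - r)))"
    and L_rv: "L \<in> borel_measurable M"
    and L_limit: "AE \<omega> in M. (\<lambda>n. walk X n \<omega> /\<^sub>R (real n powr (p - q))) \<longlonglongrightarrow> L \<omega>"
  shows "converges_in_distribution M
           (\<lambda>n \<omega>. (walk X n \<omega> - (real n powr (p - q)) *\<^sub>R L \<omega>) /\<^sub>R sqrt (sigma_sq X n \<omega>))
           (gaussian_measure 0 (\<theta>2 *\<^sub>R mat 1))
       \<and> (\<exists>(N :: (real \<times> (real^'d)) measure) \<Sigma>' Z.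
            prob_space N \<and>
            prob_space.mittag_leffler_distributed N (1 - r) \<Sigma>' \<and>
            Z \<in> borel_measurable N \<and>
            distr N borel Z = gaussian_measure 0 (\<theta>2 *\<^sub>R mat 1) \<and>
            prob_space.indep_set N (sigma_rv N borel \<Sigma>') (sigma_rv N borel Z) \<and>
            converges_in_distribution M
              (\<lambda>n \<omega>. (walk X n \<omega> - (real n powr (p - q)) *\<^sub>R L \<omega>) /\<^sub>R sqrt (real n powr (1 - r)))
              (distr N borel (\<lambda>x. sqrt (\<Sigma>' x) *\<^sub>R Z x)))"
proof -
  interpret merws M b p q r X U A by (rule merws)
  have d1: "1 \<le> d" using d_pos by (simp add: d)
  have al: "1 - r = (p - q) + 2 * d * q" unfolding d by (rule alpha_eq)
  have "(2 * d + 1) * (1 - r) < 4 * d * p"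
    using superdiffusive d1 by (simp add: pos_divide_less_eq mult.commute)
  \<comment> \<open>By this factorisation the condition on \<open>p\<close> becomes
    \<open>1 - r < 2 * (p - q)\<close>, and the factor \<open>2 * d - 1\<close> cancels in
    \<open>\<theta>2\<close>, leaving \<open>\<theta>\<close>.\<close>
  moreover have eq: "4 * d * p - (2 * d + 1) * (1 - r) = (2 * d - 1) * (2 * (p - q) - (1 - r))"
    unfolding al by (simp add: algebra_simps)
  ultimately have "0 < (2 * d - 1) * (2 * (p - q) - (1 - r))" by linarith
  then have "1 - r < 2 * (p - q)" using d1 by (simp add: zero_less_mult_iff)
  then interpret superdiffusive_merws M b p q r X U A
    using nondegenerate by unfold_locales auto
  have "\<theta>2 = \<theta>"
    unfolding \<theta>2 eq \<theta>_def d[symmetric] using d1 by simp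
  then show ?thesis
    using self_normalized_clt[OF L_rv L_limit] mittag_leffler_clt[OF L_rv L_limit]
    unfolding dev_def[OF L_rv L_limit] by simp
qed

end
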